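(* Let $d=2$, $b\in[-1,1]$, $\frac12<\beta<1$ and $s>1+\beta$, and let $\delta>0$ be a sufficiently small constant. There exist initial data $(u_0,\tau_0)\in H^s(\mathbb{R}^2)\cap\dot B^{-1}_{2,\infty}$ with $\mathrm{div}\,u_0=0$, $\tau_0$ symmetric and $\|(u_0,\tau_0)\|_{H^s}\le\delta$, and a constant $C>0$ independent of $a$, such that, denoting for $a\in[0,1]$ by $(u^a,\tau^a)\in C([0,\infty),H^s)$ the global strong solution of (OB$_a$) with initial data $(u_0,\tau_0)$ and $\tilde\tau^a=\mathrm{tr}\,\tau^a$, one has for all $a\in[0,1]$ $$\|\tilde\tau^a-\tilde\tau^0\|_{L^\infty([0,\infty),L^2)}\ge C\,a^{\frac1{2\beta}} .$$
   Context: The system (OB$_a$) (2D inviscid Oldroyd-B model with fractional stress tensor diffusion, damping coefficient $a$) on $[0,\infty)\times\mathbb{R}^2$ is $$\begin{cases}\partial_t u+u\cdot\nabla u+\nabla P=\mathrm{div}\,\tau,\quad \mathrm{div}\,u=0,\\ \partial_t\tau+u\cdot\nabla\tau+a\tau+Q(\nabla u,\tau)+(-\Delta)^\beta\tau=D(u),\\ u|_{t=0}=u_0,\quad \tau|_{t=0}=\tau_0,\end{cases}$$ with unknowns the velocity $u(t,x)\in\mathbb{R}^2$, the symmetric $2\times2$ tensor $\tau(t,x)$ and the scalar pressure $P$. Here $(\mathrm{div}\,\tau)^j=\sum_k\partial_k\tau^{jk}$, $(\nabla u)_{jk}=\partial_k u^j$, $D(u)=\frac{\nabla u+(\nabla u)^T}{2}$,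 $\Omega(u)=\frac{\nabla u-(\nabla u)^T}{2}$ and $$Q(\nabla u,\tau)=\tau\Omega(u)-\Omega(u)\tau-b\big(D(u)\tau+\tau D(u)\big),$$ where $b\in[-1,1]$ is a fixed parameter. $(-\Delta)^\beta$ is the Fourier multiplier with symbol $|\xi|^{2\beta}$. $(u^0,\tau^0)$ and $\tilde\tau^0$ refer to the solution with $a=0$. A strong solution is a pair $(u,\tau)\in C([0,\infty),H^s(\mathbb{R}^2))$ satisfying the system (for some pressure $P$) in the sense of distributions and attaining the initial data; for initial data with $\|(u_0,\tau_0)\|_{H^s}\le\delta$, $\delta$ sufficiently small (independently of $a\in[0,1]$), such a solution exists globally and is unique. $\|(u,\tau)\|_X^2=\|u\|_X^2+\|\tau\|_X^2$. The homogeneous Besov norm is $\|f\|_{\dot B^{\sigma}_{2,\infty}}=\sup_{j\in\mathbb{Z}}2^{j\sigma}\|\dot\Delta_j f\|_{L^2}$, where $\dot\Delta_j f=\mathscr{F}^{-1}(\varphi(2^{-j}\cdot)\mathscr{F}f)$ and $\varphi$ is a smooth radial function with values in $[0,1]$ supported in $\{\frac34\le|\xi|\le\frac83\}$ with $\sum_{j\in\mathbb{Z}}\varphi(2^{-j}\xi)=1$ for $\xi\ne0$. *)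

theory Defs
  imports "HOL-Analysis.Analysis" "HOL-Probability.Essential_Supremum"
begin

text \<open>
  Elements of function spaces are represented by functions rather than by classes modulo
  null sets; every notion below is invariant under modification on null sets in \<open>x\<close>.
\<close>

section \<open>Smooth functions, test functions and distributions\<close>

definition pderiv_dir :: "'a::euclidean_space \<Rightarrow> ('a \<Rightarrow> real) \<Rightarrow> 'a \<Rightarrow> real" where
  "pderiv_dir v f x = frechet_derivative f (at x) v"

primrec iter_pderiv :: "'a::euclidean_space list \<Rightarrow> ('a \<Rightarrow> real) \<Rightarrow> 'a \<Rightarrow> real" where
  "iter_pderiv [] f = f"
| "iter_pderiv (v # vs) f = pderiv_dir v (iter_pderiv vs f)"

definition smooth :: "('a::euclidean_space \<Rightarrow> real) \<Rightarrow> bool" where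
  "smooth f \<longleftrightarrow> (\<forall>vs\<in>lists Basis. \<forall>x. iter_pderiv vs f differentiable (at x))"

definition support :: "('a::topological_space \<Rightarrow> real) \<Rightarrow> 'a set" where
  "support f = closure {x. f x \<noteq> 0}"

definition test_fun :: "'a::euclidean_space set \<Rightarrow> ('a \<Rightarrow> real) \<Rightarrow> bool" where
  "test_fun W \<phi> \<longleftrightarrow> smooth \<phi> \<and> compact (support \<phi>) \<and> support \<phi> \<subseteq> W"

definition test_converges ::
    "'a::euclidean_space set \<Rightarrow> (nat \<Rightarrow> 'a \<Rightarrow> real) \<Rightarrow> ('a \<Rightarrow> real) \<Rightarrow> bool" where
  "test_converges W \<phi> \<psi> \<longleftrightarrow>
     (\<forall>n. test_fun W (\<phi> n)) \<and> test_fun W \<psi> \<and>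
     (\<exists>K. compact K \<and> K \<subseteq> W \<and> (\<forall>n. support (\<phi> n) \<subseteq> K)) \<and>
     (\<forall>vs\<in>lists Basis.
        uniform_limit UNIV (\<lambda>n. iter_pderiv vs (\<phi> n)) (iter_pderiv vs \<psi>) sequentially)"

definition distribution :: "'a::euclidean_space set \<Rightarrow> (('a \<Rightarrow> real) \<Rightarrow> real) \<Rightarrow> bool" where
  "distribution W T \<longleftrightarrow>
     (\<forall>\<phi> \<psi>. test_fun W \<phi> \<longrightarrow> test_fun W \<psi> \<longrightarrow> T (\<lambda>x. \<phi> x + \<psi> x) = T \<phi> + T \<psi>) \<and>
     (\<forall>c \<phi>. test_fun W \<phi> \<longrightarrow> T (\<lambda>x. c * \<phi> x) = c * T \<phi>) \<and>
     (\<forall>\<phi> \<psi>. test_converges W \<phi> \<psi> \<longrightarrow> (\<lambda>n. T (\<phi> n)) \<longlonglongrightarrow> T \<psi>)"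

definition distr_deriv ::
    "'a::euclidean_space \<Rightarrow> (('a \<Rightarrow> real) \<Rightarrow> real) \<Rightarrow> ('a \<Rightarrow> real) \<Rightarrow> real" where
  "distr_deriv v T \<phi> = - T (pderiv_dir v \<phi>)"


section \<open>The Fourier transform on \<open>L\<^sup>2\<close>\<close>

definition square_integrable :: "(real^2 \<Rightarrow> 'b::{banach, second_countable_topology}) \<Rightarrow> bool" where
  "square_integrable f \<longleftrightarrow>
     f \<in> borel_measurable lborel \<and> integrable lborel (\<lambda>x. (norm (f x))\<^sup>2)"

definition L2_norm :: "(real^2 \<Rightarrow> 'b::{banach, second_countable_topology}) \<Rightarrow> real" where
  "L2_norm f = sqrt (\<integral>x. (norm (f x))\<^sup>2 \<partial>lborel)"

definition fourier_integral :: "(real^2 \<Rightarrow> complex) \<Rightarrow> real^2 \<Rightarrow> complex" where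
  "fourier_integral f \<xi> = (\<integral>x. cis (- (x \<bullet> \<xi>)) * f x \<partial>lborel)"

text \<open>
  The Fourier--Plancherel transform: the \<open>L\<^sup>2\<close> limit of the absolutely convergent
  Fourier integrals of the truncations of \<open>f\<close> to balls. It is determined almost everywhere.
\<close>

definition is_fourier_L2 :: "(real^2 \<Rightarrow> complex) \<Rightarrow> (real^2 \<Rightarrow> complex) \<Rightarrow> bool" where
  "is_fourier_L2 f g \<longleftrightarrow> square_integrable g \<and>
     ((\<lambda>R. \<integral>\<^sup>+\<xi>. ennreal ((norm (fourier_integral (\<lambda>x. indicator (ball 0 R) x *\<^sub>R f x) \<xi> - g \<xi>))\<^sup>2)
        \<partial>lborel) \<longlongrightarrow> 0) at_top"

definition fourier :: "(real^2 \<Rightarrow> complex) \<Rightarrow> real^2 \<Rightarrow> complex" where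
  "fourier f = (SOME g. is_fourier_L2 f g)"

definition inv_fourier :: "(real^2 \<Rightarrow> complex) \<Rightarrow> real^2 \<Rightarrow> complex" where
  "inv_fourier g x = complex_of_real (1 / (2 * pi)\<^sup>2) * fourier g (- x)"

abbreviation fourier_real :: "(real^2 \<Rightarrow> real) \<Rightarrow> real^2 \<Rightarrow> complex" where
  "fourier_real f \<equiv> fourier (\<lambda>x. complex_of_real (f x))"

text \<open>
  The symbol is real and even, so for real \<open>f\<close> the inverse transform below is real almost
  everywhere and \<open>Re\<close> only changes the type. The function represents \<open>(-\<Delta>)\<^sup>\<beta> f\<close>
  when \<open>f\<close> belongs to \<open>H\<^sup>s\<close> with \<open>s \<ge> 2\<beta>\<close>; the standing assumptions \<open>s > 1 + \<beta>\<close>,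
  \<open>\<beta> < 1\<close> give \<open>s > 2\<beta>\<close>.
\<close>

definition frac_laplacian :: "real \<Rightarrow> (real^2 \<Rightarrow> real) \<Rightarrow> real^2 \<Rightarrow> real" where
  "frac_laplacian \<beta> f x =
     Re (inv_fourier (\<lambda>\<xi>. complex_of_real (norm \<xi> powr (2 * \<beta>)) * fourier_real f \<xi>) x)"


section \<open>Sobolev and Besov spaces\<close>

definition Hs_weighted :: "real \<Rightarrow> (real^2 \<Rightarrow> real) \<Rightarrow> real^2 \<Rightarrow> complex" where
  "Hs_weighted s f \<xi> = complex_of_real ((1 + (norm \<xi>)\<^sup>2) powr (s / 2)) * fourier_real f \<xi>"

text \<open>Only exponents \<open>s \<ge> 0\<close> are meant, for which \<open>H\<^sup>s\<close> consists of \<open>L\<^sup>2\<close> functions.\<close>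

definition in_Hs :: "real \<Rightarrow> (real^2 \<Rightarrow> real) \<Rightarrow> bool" where
  "in_Hs s f \<longleftrightarrow> square_integrable f \<and> square_integrable (Hs_weighted s f)"

text \<open>Normalised so that the \<open>H\<^sup>0\<close> norm is the \<open>L\<^sup>2\<close> norm.\<close>

definition Hs_norm :: "real \<Rightarrow> (real^2 \<Rightarrow> real) \<Rightarrow> real" where
  "Hs_norm s f = L2_norm (Hs_weighted s f) / (2 * pi)"

definition littlewood_paley :: "(real^2 \<Rightarrow> real) \<Rightarrow> bool" where
  "littlewood_paley \<phi> \<longleftrightarrow> smooth \<phi> \<and>
     (\<forall>\<xi> \<eta>. norm \<xi> = norm \<eta> \<longrightarrow> \<phi> \<xi> = \<phi> \<eta>) \<and>
     (\<forall>\<xi>. 0 \<le> \<phi> \<xi> \<and> \<phi> \<xi> \<le> 1) \<and>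
     support \<phi> \<subseteq> {\<xi>. 3/4 \<le> norm \<xi> \<and> norm \<xi> \<le> 8/3} \<and>
     (\<forall>\<xi>. \<xi> \<noteq> 0 \<longrightarrow> ((\<lambda>j::int. \<phi> ((2 powr (- real_of_int j)) *\<^sub>R \<xi>)) has_sum 1) UNIV)"

definition dyadic_block ::
    "(real^2 \<Rightarrow> real) \<Rightarrow> int \<Rightarrow> (real^2 \<Rightarrow> real) \<Rightarrow> real^2 \<Rightarrow> complex" where
  "dyadic_block \<phi> j f =
     inv_fourier (\<lambda>\<xi>. complex_of_real (\<phi> ((2 powr (- real_of_int j)) *\<^sub>R \<xi>)) * fourier_real f \<xi>)"

text \<open>Third index infinity, integrability index 2; meant for \<open>f\<close> in \<open>L\<^sup>2\<close>.\<close>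

definition besov_norm :: "(real^2 \<Rightarrow> real) \<Rightarrow> real \<Rightarrow> (real^2 \<Rightarrow> real) \<Rightarrow> ereal" where
  "besov_norm \<phi> \<sigma> f =
     (SUP j::int. ereal (2 powr (real_of_int j * \<sigma>) * L2_norm (dyadic_block \<phi> j f)))"

definition pair_in_Hs :: "real \<Rightarrow> (real^2 \<Rightarrow> real^2) \<Rightarrow> (real^2 \<Rightarrow> real^2^2) \<Rightarrow> bool" where
  "pair_in_Hs s u \<tau> \<longleftrightarrow>
     (\<forall>j. in_Hs s (\<lambda>x. u x $ j)) \<and> (\<forall>j k. in_Hs s (\<lambda>x. \<tau> x $ j $ k))"

definition pair_Hs_norm :: "real \<Rightarrow> (real^2 \<Rightarrow> real^2) \<Rightarrow> (real^2 \<Rightarrow> real^2^2) \<Rightarrow> real" where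
  "pair_Hs_norm s u \<tau> =
     sqrt ((\<Sum>j\<in>UNIV. (Hs_norm s (\<lambda>x. u x $ j))\<^sup>2) +
           (\<Sum>j\<in>UNIV. \<Sum>k\<in>UNIV. (Hs_norm s (\<lambda>x. \<tau> x $ j $ k))\<^sup>2))"

definition pair_in_besov ::
    "(real^2 \<Rightarrow> real) \<Rightarrow> real \<Rightarrow> (real^2 \<Rightarrow> real^2) \<Rightarrow> (real^2 \<Rightarrow> real^2^2) \<Rightarrow> bool" where
  "pair_in_besov \<phi> \<sigma> u \<tau> \<longleftrightarrow>
     (\<forall>j. besov_norm \<phi> \<sigma> (\<lambda>x. u x $ j) < \<infinity>) \<and>
     (\<forall>j k. besov_norm \<phi> \<sigma> (\<lambda>x. \<tau> x $ j $ k) < \<infinity>)"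

text \<open>The pair is an element of \<open>C([0,\<infinity>), H\<^sup>s)\<close>; values at negative times are irrelevant.\<close>

definition continuous_in_Hs ::
    "real \<Rightarrow> (real \<Rightarrow> real^2 \<Rightarrow> real^2) \<Rightarrow> (real \<Rightarrow> real^2 \<Rightarrow> real^2^2) \<Rightarrow> bool" where
  "continuous_in_Hs s u \<tau> \<longleftrightarrow>
     (\<forall>t\<ge>0. pair_in_Hs s (u t) (\<tau> t) \<and>
        ((\<lambda>t'. pair_Hs_norm s (\<lambda>x. u t' x - u t x) (\<lambda>x. \<tau> t' x - \<tau> t x)) \<longlongrightarrow> 0)
          (at t within {0..}))"


section \<open>The Oldroyd-B system with fractional stress diffusion\<close>

text \<open>
  The distributional derivative of an \<open>H\<^sup>1\<close> function, as an \<open>L\<^sup>2\<close> function. It is needed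
  as a function because it enters the products in the nonlinear terms.
\<close>

definition weak_deriv :: "2 \<Rightarrow> (real^2 \<Rightarrow> real) \<Rightarrow> real^2 \<Rightarrow> real" where
  "weak_deriv k f = (SOME g. square_integrable g \<and>
     (\<forall>\<phi>. test_fun UNIV \<phi> \<longrightarrow>
        (\<integral>x. f x * pderiv_dir (axis k 1) \<phi> x \<partial>lborel) = - (\<integral>x. g x * \<phi> x \<partial>lborel)))"

definition grad :: "(real^2 \<Rightarrow> real^2) \<Rightarrow> real^2 \<Rightarrow> real^2^2" where
  "grad u x = (\<chi> j k. weak_deriv k (\<lambda>y. u y $ j) x)"

definition sym_part :: "real^2^2 \<Rightarrow> real^2^2" where
  "sym_part G = (1/2) *\<^sub>R (G + transpose G)"

definition skew_part :: "real^2^2 \<Rightarrow> real^2^2" where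
  "skew_part G = (1/2) *\<^sub>R (G - transpose G)"

definition Q_term :: "real \<Rightarrow> real^2^2 \<Rightarrow> real^2^2 \<Rightarrow> real^2^2" where
  "Q_term b G T = T ** skew_part G - skew_part G ** T
     - b *\<^sub>R (sym_part G ** T + T ** sym_part G)"

definition transport :: "(real^2 \<Rightarrow> real^2) \<Rightarrow> (real^2 \<Rightarrow> real) \<Rightarrow> real^2 \<Rightarrow> real" where
  "transport u f x = (\<Sum>k\<in>UNIV. u x $ k * weak_deriv k f x)"

definition spacetime :: "(real \<times> (real^2)) set" where
  "spacetime = {0<..} \<times> UNIV"

text \<open>
  The distribution on \<open>(0,\<infinity>) \<times> \<real>\<^sup>2\<close> given by a curve of functions of \<open>x\<close>. The integral is
  iterated because a curve in \<open>C([0,\<infinity>), H\<^sup>s)\<close> only determines \<open>f t\<close> modulo null sets for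
  each \<open>t\<close>, so that joint measurability of chosen representatives is not available.
\<close>

definition distr_of :: "(real \<Rightarrow> real^2 \<Rightarrow> real) \<Rightarrow> (real \<times> (real^2) \<Rightarrow> real) \<Rightarrow> real" where
  "distr_of f \<phi> = (LINT t:{0..}|lborel. (\<integral>x. f t x * \<phi> (t, x) \<partial>lborel))"

abbreviation distr_dt ::
    "((real \<times> (real^2) \<Rightarrow> real) \<Rightarrow> real) \<Rightarrow> (real \<times> (real^2) \<Rightarrow> real) \<Rightarrow> real" where
  "distr_dt \<equiv> distr_deriv (1, 0)"

abbreviation distr_dx ::
    "2 \<Rightarrow> ((real \<times> (real^2) \<Rightarrow> real) \<Rightarrow> real) \<Rightarrow> (real \<times> (real^2) \<Rightarrow> real) \<Rightarrow> real" where
  "distr_dx k \<equiv> distr_deriv (0, axis k 1)"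

definition momentum_equation ::
    "(real \<Rightarrow> real^2 \<Rightarrow> real^2) \<Rightarrow> (real \<Rightarrow> real^2 \<Rightarrow> real^2^2) \<Rightarrow>
     ((real \<times> (real^2) \<Rightarrow> real) \<Rightarrow> real) \<Rightarrow> bool" where
  "momentum_equation u \<tau> P \<longleftrightarrow>
     (\<forall>\<phi>. test_fun spacetime \<phi> \<longrightarrow> (\<forall>j.
        distr_dt (distr_of (\<lambda>t x. u t x $ j)) \<phi>
        + distr_of (\<lambda>t. transport (u t) (\<lambda>x. u t x $ j)) \<phi>
        + distr_dx j P \<phi>
        = (\<Sum>k\<in>UNIV. distr_dx k (distr_of (\<lambda>t x. \<tau> t x $ j $ k)) \<phi>)))"

definition incompressible :: "(real \<Rightarrow> real^2 \<Rightarrow> real^2) \<Rightarrow> bool" where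
  "incompressible u \<longleftrightarrow>
     (\<forall>\<phi>. test_fun spacetime \<phi> \<longrightarrow>
        (\<Sum>k\<in>UNIV. distr_dx k (distr_of (\<lambda>t x. u t x $ k)) \<phi>) = 0)"

definition stress_equation ::
    "real \<Rightarrow> real \<Rightarrow> real \<Rightarrow> (real \<Rightarrow> real^2 \<Rightarrow> real^2) \<Rightarrow> (real \<Rightarrow> real^2 \<Rightarrow> real^2^2) \<Rightarrow> bool" where
  "stress_equation b \<beta> a u \<tau> \<longleftrightarrow>
     (\<forall>\<phi>. test_fun spacetime \<phi> \<longrightarrow> (\<forall>j k.
        distr_dt (distr_of (\<lambda>t x. \<tau> t x $ j $ k)) \<phi>
        + distr_of (\<lambda>t. transport (u t) (\<lambda>x. \<tau> t x $ j $ k)) \<phi>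
        + a * distr_of (\<lambda>t x. \<tau> t x $ j $ k) \<phi>
        + distr_of (\<lambda>t x. Q_term b (grad (u t) x) (\<tau> t x) $ j $ k) \<phi>
        + distr_of (\<lambda>t. frac_laplacian \<beta> (\<lambda>x. \<tau> t x $ j $ k)) \<phi>
        = distr_of (\<lambda>t x. sym_part (grad (u t) x) $ j $ k) \<phi>))"

definition symmetric_tensor :: "(real^2 \<Rightarrow> real^2^2) \<Rightarrow> bool" where
  "symmetric_tensor T \<longleftrightarrow> (AE x in lborel. transpose (T x) = T x)"

definition divergence_free :: "(real^2 \<Rightarrow> real^2) \<Rightarrow> bool" where
  "divergence_free v \<longleftrightarrow>
     (\<forall>\<phi>. test_fun UNIV \<phi> \<longrightarrow>
        (\<Sum>k\<in>UNIV. distr_deriv (axis k 1) (\<lambda>\<psi>. \<integral>x. v x $ k * \<psi> x \<partial>lborel) \<phi>) = 0)"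

text \<open>
  The pressure is an arbitrary distribution on \<open>(0,\<infinity>) \<times> \<real>\<^sup>2\<close>.
\<close>

definition strong_solution ::
    "real \<Rightarrow> real \<Rightarrow> real \<Rightarrow> real \<Rightarrow> (real^2 \<Rightarrow> real^2) \<Rightarrow> (real^2 \<Rightarrow> real^2^2) \<Rightarrow>
     (real \<Rightarrow> real^2 \<Rightarrow> real^2) \<Rightarrow> (real \<Rightarrow> real^2 \<Rightarrow> real^2^2) \<Rightarrow> bool" where
  "strong_solution b \<beta> s a u0 \<tau>0 u \<tau> \<longleftrightarrow>
     continuous_in_Hs s u \<tau> \<and>
     (\<forall>t\<ge>0. symmetric_tensor (\<tau> t)) \<and>
     (\<exists>P. distribution spacetime P \<and> momentum_equation u \<tau> P) \<and>
     incompressible u \<and>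
     stress_equation b \<beta> a u \<tau> \<and>
     (AE x in lborel. u 0 x = u0 x) \<and> (AE x in lborel. \<tau> 0 x = \<tau>0 x)"

text \<open>
  \<open>esssup\<close> is \<open>top\<close> on non-measurable functions; here \<open>t \<mapsto> L2_norm (f t)\<close> is continuous on
  \<open>[0,\<infinity>)\<close> for \<open>f\<close> in \<open>C([0,\<infinity>), H\<^sup>s)\<close>.
\<close>

definition Linf_L2_norm :: "(real \<Rightarrow> real^2 \<Rightarrow> real) \<Rightarrow> ereal" where
  "Linf_L2_norm f = esssup (restrict_space lborel {0..}) (\<lambda>t. ereal (L2_norm (f t)))"

end

theory Submission
  imports Defs "HOL-Probability.Characteristic_Functions"
begin

text \<open>
  The lower bound is realised by isotropic stresses. If the velocity vanishes and the stress is
  \<open>\<sigma> I\<close>, then \<open>div \<tau>\<close> is the gradient of \<open>\<sigma>\<close> and is absorbed by the pressure, all nonlinear terms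
  vanish, and the system reduces to \<open>\<sigma>\<^sub>t + a \<sigma> + (-\<Delta>)\<^sup>\<beta> \<sigma> = 0\<close>. For data with Fourier transform
  \<open>\<epsilon> 1\<^bsub>|\<xi>| \<le> 1\<^esub>\<close> the solution has transform \<open>\<epsilon> e\<^bsup>-(a + |\<xi>|^2\<beta>) t\<^esup>\<close> on the disc. At times
  \<open>t \<in> [1/a, 2/a]\<close> and frequencies \<open>|\<xi>| \<le> a\<^bsup>1/(2\<beta>)\<^esup>\<close> it differs from the solution with \<open>a = 0\<close> by at
  least \<open>\<epsilon> e\<^bsup>-2\<^esup> (1 - e\<^bsup>-1\<^esup>)\<close>, and the square root of the area of this disc is a multiple of
  \<open>a\<^bsup>1/(2\<beta>)\<^esup>\<close> (\<open>norm_cl_sg_ge\<close>).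

  Since the bound is claimed for every strong solution with these data, uniqueness is the main
  work. It is proved for the comparison of an arbitrary strong solution \<open>(u, \<tau>)\<close> with the explicit
  one (\<open>unique\<close>). A distributional solution is first turned into a differentiable curve in the
  Hilbert space of square integrable functions (\<open>stress_ode\<close>, \<open>velocity_ode\<close>): the pressure
  disappears by testing with rotated gradients, which determines the velocity equation because a
  field without divergence and curl is zero. With \<open>y = \<tau> - \<sigma> I\<close> the energy
  \<open>1/2 \<parallel>y\<parallel>\<^sup>2 + 1/2 \<parallel>u\<parallel>\<^sup>2 + b \<langle>\<sigma> u, u\<rangle>\<close> satisfies a Gronwall inequality. The weight \<open>1 + 2 b \<sigma>\<close> on the
  velocity is chosen so that the terms \<open>\<langle>y, (1 + 2 b \<sigma>) \<nabla> u\<rangle>\<close>, which lose a derivative of \<open>u\<close>, cancel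
  (\<open>energy_identity\<close>). The quadratic term \<open>\<langle>y, Q(\<nabla> u, y)\<rangle>\<close> is absorbed by the dissipation, since
  \<open>\<beta> > 1/2\<close> makes the product of two functions in \<open>H\<^sup>\<beta>\<close> square integrable (\<open>product_estimate\<close>).

  The Fourier transform, its Plancherel theorem, multipliers and weak derivatives are developed on
  the Hilbert space of classes of square integrable functions modulo null sets.
\<close>

section \<open>The Hilbert space of square integrable functions\<close>

abbreviation SI :: "(real^2 => complex) => bool" where
 "SI \<equiv> square_integrable"

lemma SI_measurable: "SI f ==> f \<in> borel_measurable lborel"
 by (simp add: square_integrable_def)

lemma SI_integrable: "SI f ==> integrable lborel (%x. (norm (f x))\<^sup>2)"
 by (simp add: square_integrable_def)

lemma SI_I_bound:
 assumes "f \<in> borel_measurable lborel" "integrable lborel g" "AE x in lborel. (norm (f x))\<^sup>2 <= g x"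
 shows "SI f"
 unfolding square_integrable_def
proof
 show "integrable lborel (%x. (norm (f x))\<^sup>2)"
  by (rule Bochner_Integration.integrable_bound[OF assms(2)]) (use assms in auto)
qed fact

lemma SI_bound:
 assumes "f \<in> borel_measurable lborel" "SI g" "AE x in lborel. norm (f x) <= C * norm (g x)"
 shows "SI f"
proof (rule SI_I_bound[OF assms(1)])
 show "integrable lborel (%x. C\<^sup>2 * (norm (g x))\<^sup>2)"
  using SI_integrable[OF assms(2)] by simp
 show "AE x in lborel. (norm (f x))\<^sup>2 <= C\<^sup>2 * (norm (g x))\<^sup>2"
  using assms(3) by eventually_elim (metis norm_ge_zero power_mono power_mult_distrib)
qed

lemma SI_cong_AE:
 assumes "f \<in> borel_measurable lborel" "SI g" "AE x in lborel. f x = g x"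
 shows "SI f"
 by (rule SI_bound[OF assms(1,2), of 1]) (use assms(3) in auto)

lemma borel_measurable_cnj [measurable (raw)]:
 "f \<in> borel_measurable M ==> (%x. cnj (f x)) \<in> borel_measurable M"
 by (rule borel_measurable_continuous_on[of cnj]) (auto intro: continuous_intros)

lemma SI_zero [simp]: "SI (%x. 0)"
 by (simp add: square_integrable_def)

lemma SI_add:
 assumes "SI f" "SI g" shows "SI (%x. f x + g x)"
proof (rule SI_I_bound)
 show "(%x. f x + g x) \<in> borel_measurable lborel"
  using assms[THEN SI_measurable] by measurable
 show "integrable lborel (%x. 2 * (norm (f x))\<^sup>2 + 2 * (norm (g x))\<^sup>2)"
  using assms[THEN SI_integrable] by simp
 have "(norm (a + b))\<^sup>2 <= 2 * (norm a)\<^sup>2 + 2 * (norm b)\<^sup>2" for a b :: complex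
 proof -
  have "(norm (a + b))\<^sup>2 <= (norm a + norm b)\<^sup>2"
   by (intro power_mono norm_triangle_ineq) auto
  also have "\<dots> <= 2 * (norm a)\<^sup>2 + 2 * (norm b)\<^sup>2"
   using sum_squares_bound[of "norm a" "norm b"] by (simp add: power2_sum)
  finally show ?thesis .
 qed
 then show "AE x in lborel. (norm (f x + g x))\<^sup>2 <= 2 * (norm (f x))\<^sup>2 + 2 * (norm (g x))\<^sup>2"
  by simp
qed

lemma SI_cmult: "SI f ==> SI (%x. c * f x)"
 by (rule SI_bound[of _ f "norm c"]) (auto simp: norm_mult dest: SI_measurable)

lemma SI_scaleR: "SI f ==> SI (%x. c *\<^sub>R f x)"
 using SI_cmult[of f "complex_of_real c"] by (simp add: scaleR_conv_of_real)

lemma SI_uminus: "SI f ==> SI (%x. - f x)"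
 using SI_cmult[of f "-1"] by simp

lemma SI_diff: "SI f ==> SI g ==> SI (%x. f x - g x)"
 using SI_add[of f "%x. - g x"] SI_uminus[of g] by simp

lemma SI_cnj: "SI f ==> SI (%x. cnj (f x))"
 by (rule SI_bound[of _ f 1]) (auto dest: SI_measurable intro: borel_measurable_cnj)

lemma SI_Re: "SI f ==> SI (%x. complex_of_real (Re (f x)))"
 by (rule SI_bound[of _ f 1]) (auto dest: SI_measurable simp: abs_Re_le_cmod)

lemma SI_sum: "(!!i. i \<in> I ==> SI (f i)) ==> SI (%x. \<Sum>i\<in>I. f i x)"
 by (induction I rule: infinite_finite_induct) (auto intro: SI_add)

lemma SI_prod_integrable:
 assumes "SI f" "SI g" shows "integrable lborel (%x. f x * g x)"
proof (rule Bochner_Integration.integrable_bound)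
 show "integrable lborel (%x. (norm (f x))\<^sup>2 + (norm (g x))\<^sup>2)"
  using assms[THEN SI_integrable] by simp
 show "(%x. f x * g x) \<in> borel_measurable lborel"
  using assms[THEN SI_measurable] by measurable
 have "norm (a * b) <= norm ((norm a)\<^sup>2 + (norm b)\<^sup>2)" for a b :: complex
 proof -
  have "0 <= norm a * norm b" "2 * norm a * norm b <= (norm a)\<^sup>2 + (norm b)\<^sup>2"
   using sum_squares_bound[of "norm a" "norm b"] by auto
  then have "norm a * norm b <= (norm a)\<^sup>2 + (norm b)\<^sup>2" by linarith
  then show ?thesis by (simp add: norm_mult)
 qed
 then show "AE x in lborel. norm (f x * g x) <= norm ((norm (f x))\<^sup>2 + (norm (g x))\<^sup>2)"
  by simp
qed

text \<open>Square integrable functions modulo null sets, as a real Hilbert space. The inner product is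
  the real part of the usual one; for real valued functions nothing is lost.\<close>

quotient_type l2 = "real^2 => complex" / partial:
 "%f g. SI f \<and> SI g \<and> (AE x in lborel. f x = g x)"
 morphisms rep abs_l2
proof (rule part_equivpI)
 show "\<exists>f. SI f \<and> SI f \<and> (AE x in lborel. f x = f x)"
  by (rule exI[of _ "%_. 0"]) auto
 show "symp (%f g. SI f \<and> SI g \<and> (AE x in lborel. f x = g x))"
  by (rule sympI) (auto elim: eventually_mono)
 show "transp (%f g. SI f \<and> SI g \<and> (AE x in lborel. f x = g x))"
 proof (rule transpI, elim conjE, intro conjI)
  fix f g h :: "real^2 => complex"
  assume "AE x in lborel. f x = g x" "AE x in lborel. g x = h x"
  then show "AE x in lborel. f x = h x" by eventually_elim simp
 qed
qed

definition cl :: "(real^2 => complex) => l2" where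
 "cl f = (if SI f then abs_l2 f else abs_l2 (%_. 0))"

lemma SI_rep: "SI (rep x)"
 using Quotient_rep_reflp[OF Quotient_l2, of x] by auto

lemma cl_rep [simp]: "cl (rep x) = x"
 unfolding cl_def using SI_rep Quotient_abs_rep[OF Quotient_l2, of x] by simp

lemma cl_eq_iff: "SI f ==> SI g ==> cl f = cl g \<longleftrightarrow> (AE x in lborel. f x = g x)"
 unfolding cl_def using Quotient_rel_abs[OF Quotient_l2, of f g] Quotient_rel[OF Quotient_l2, of f g]
 by auto

lemma rep_cl: "SI f ==> AE x in lborel. rep (cl f) x = f x"
 using cl_eq_iff[of "rep (cl f)" f] SI_rep by simp

lemma cl_cong_AE: "SI f ==> SI g ==> AE x in lborel. f x = g x ==> cl f = cl g"
 by (simp add: cl_eq_iff)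

instantiation l2 :: real_inner
begin

lift_definition zero_l2 :: l2 is "%_. 0" by auto

lift_definition plus_l2 :: "l2 => l2 => l2" is "%f g x. f x + g x"
proof (elim conjE, intro conjI SI_add)
 fix f1 f2 g1 g2 :: "real^2 => complex"
 assume "AE x in lborel. f1 x = f2 x" "AE x in lborel. g1 x = g2 x"
 then show "AE x in lborel. f1 x + g1 x = f2 x + g2 x" by eventually_elim simp
qed

lift_definition minus_l2 :: "l2 => l2 => l2" is "%f g x. f x - g x"
proof (elim conjE, intro conjI SI_diff)
 fix f1 f2 g1 g2 :: "real^2 => complex"
 assume "AE x in lborel. f1 x = f2 x" "AE x in lborel. g1 x = g2 x"
 then show "AE x in lborel. f1 x - g1 x = f2 x - g2 x" by eventually_elim simp
qed

lift_definition uminus_l2 :: "l2 => l2" is "%f x. - f x"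
 by (auto intro!: SI_uminus)

lift_definition scaleR_l2 :: "real => l2 => l2" is "%c f x. c *\<^sub>R f x"
 by (intro conjI SI_scaleR) (auto elim: eventually_mono)

lift_definition inner_l2 :: "l2 => l2 => real" is "%f g. Re (LBINT x. f x * cnj (g x))"
proof (elim conjE)
 fix f1 f2 g1 g2 :: "real^2 => complex"
 assume *: "AE x in lborel. f1 x = f2 x" "AE x in lborel. g1 x = g2 x"
  and SI: "SI f1" "SI f2" "SI g1" "SI g2"
 note [measurable] = SI[THEN SI_measurable]
 show "Re (LBINT x. f1 x * cnj (g1 x)) = Re (LBINT x. f2 x * cnj (g2 x))"
  by (rule arg_cong[of _ _ Re], rule integral_cong_AE) (use * in \<open>auto elim: eventually_elim2\<close>)
qed

definition norm_l2 :: "l2 => real" where "norm_l2 x = sqrt (inner x x)"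
definition dist_l2 :: "l2 => l2 => real" where "dist_l2 x y = norm (x - y)"
definition sgn_l2 :: "l2 => l2" where "sgn_l2 x = inverse (norm x) *\<^sub>R x"
definition uniformity_l2 :: "(l2 \<times> l2) filter" where
 "uniformity_l2 = (INF e\<in>{0<..}. principal {(x, y). dist x y < e})"
definition open_l2 :: "l2 set => bool" where
 "open_l2 U = (\<forall>x\<in>U. \<forall>\<^sub>F (x', y) in uniformity. x' = x \<longrightarrow> y \<in> U)"

instance
proof
 fix a b c :: l2 and r s :: real
 show "a + b + c = a + (b + c)" by transfer (auto intro!: SI_add simp: add.assoc)
 show "a + b = b + a" by transfer (auto intro!: SI_add simp: add.commute)
 show "0 + a = a" by transfer auto
 show "- a + a = 0" by transfer auto
 show "a - b = a + - b" by transfer (auto intro!: SI_add SI_uminus SI_diff)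
 show "r *\<^sub>R (a + b) = r *\<^sub>R a + r *\<^sub>R b"
  by transfer (auto intro!: SI_add SI_scaleR[of "%x. _ x + _ x"] SI_scaleR simp: scaleR_add_right)
 show "(r + s) *\<^sub>R a = r *\<^sub>R a + s *\<^sub>R a"
  by transfer (auto intro!: SI_add SI_scaleR simp: scaleR_add_left)
 show "r *\<^sub>R s *\<^sub>R a = (r * s) *\<^sub>R a" by transfer (auto intro!: SI_scaleR)
 show "1 *\<^sub>R a = a" by transfer auto
 show "inner a b = inner b a"
 proof (transfer, elim conjE)
  fix f g :: "real^2 => complex"
  have "(LBINT x. g x * cnj (f x)) = (LBINT x. cnj (f x * cnj (g x)))"
   by (simp add: mult.commute)
  then show "Re (LBINT x. f x * cnj (g x)) = Re (LBINT x. g x * cnj (f x))"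
   by (simp del: complex_cnj_mult)
 qed
 show "inner (a + b) c = inner a c + inner b c"
 proof (transfer, elim conjE)
  fix f g h :: "real^2 => complex" assume "SI f" "SI g" "SI h"
  then show "Re (LBINT x. (f x + g x) * cnj (h x)) =
   Re (LBINT x. f x * cnj (h x)) + Re (LBINT x. g x * cnj (h x))"
   using SI_prod_integrable[OF \<open>SI f\<close> SI_cnj[OF \<open>SI h\<close>]] SI_prod_integrable[OF \<open>SI g\<close> SI_cnj[OF \<open>SI h\<close>]]
   by (simp add: distrib_right)
 qed
 show "inner (r *\<^sub>R a) b = r * inner a b"
  by transfer (simp add: scaleR_conv_of_real mult.assoc)
 have sq: "Re (LBINT x. f x * cnj (f x)) = (LBINT x. (norm (f x))\<^sup>2)" for f :: "real^2 => complex"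
  by (simp add: del: of_real_power flip: complex_norm_square)
 show "0 <= inner a a"
  by transfer (simp add: sq)
 show "(inner a a = 0) = (a = 0)"
 proof (transfer, elim conjE)
  fix f :: "real^2 => complex" assume "SI f"
  have "(Re (LBINT x. f x * cnj (f x)) = 0) = (AE x in lborel. (norm (f x))\<^sup>2 = 0)"
   unfolding sq by (rule integral_nonneg_eq_0_iff_AE[OF SI_integrable[OF \<open>SI f\<close>]]) simp
  then show "(Re (LBINT x. f x * cnj (f x)) = 0) = (SI f \<and> SI (%_. 0) \<and> (AE x in lborel. f x = 0))"
   using \<open>SI f\<close> by simp
 qed
qed (rule dist_l2_def sgn_l2_def uniformity_l2_def open_l2_def norm_l2_def)+

end

lemma cl_zero [simp]: "cl (%_. 0) = 0"
 by (simp add: cl_def zero_l2.abs_eq)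

lemma cl_add: "SI f ==> SI g ==> cl (%x. f x + g x) = cl f + cl g"
 by (simp add: cl_def plus_l2.abs_eq SI_add)

lemma cl_diff: "SI f ==> SI g ==> cl (%x. f x - g x) = cl f - cl g"
 by (simp add: cl_def minus_l2.abs_eq SI_diff)

lemma cl_uminus: "SI f ==> cl (%x. - f x) = - cl f"
 by (simp add: cl_def uminus_l2.abs_eq SI_uminus)

lemma cl_scaleR: "SI f ==> cl (%x. c *\<^sub>R f x) = c *\<^sub>R cl f"
 by (simp add: cl_def scaleR_l2.abs_eq SI_scaleR)

lemma cl_sum: "(!!i. i \<in> I ==> SI (f i)) ==> cl (%x. \<Sum>i\<in>I. f i x) = (\<Sum>i\<in>I. cl (f i))"
 by (induction I rule: infinite_finite_induct) (auto simp: cl_add SI_sum)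

lemma inner_cl: "SI f ==> SI g ==> inner (cl f) (cl g) = Re (LBINT x. f x * cnj (g x))"
 by (simp add: cl_def inner_l2.abs_eq)

lemma norm_cl_sq: "SI f ==> (norm (cl f))\<^sup>2 = (LBINT x. (norm (f x))\<^sup>2)"
 by (simp add: power2_norm_eq_inner inner_cl del: of_real_power flip: complex_norm_square)

lemma norm_cl: "SI f ==> norm (cl f) = L2_norm f"
 unfolding L2_norm_def by (simp flip: norm_cl_sq)

lemma norm_cl_nn: "SI f ==> ennreal ((norm (cl f))\<^sup>2) = (\<integral>\<^sup>+x. ennreal ((norm (f x))\<^sup>2) \<partial>lborel)"
 by (simp add: norm_cl_sq nn_integral_eq_integral[OF SI_integrable])

lemma inner_rep: "inner x y = Re (LBINT t. rep x t * cnj (rep y t))"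
 using inner_cl[OF SI_rep SI_rep, of x y] by simp

lemma rep_diff: "AE t in lborel. rep (x - y) t = rep x t - rep y t"
 using rep_cl[OF SI_diff[OF SI_rep[of x] SI_rep[of y]]] by (simp add: cl_diff SI_rep)

lemma rep_zero: "AE t in lborel. rep 0 t = 0"
 using rep_cl[OF SI_zero] by simp

lemma norm_cl_le:
 assumes "SI f" "SI g" "AE x in lborel. norm (f x) <= C * norm (g x)" "C >= 0"
 shows "norm (cl f) <= C * norm (cl g)"
proof -
 have "(norm (cl f))\<^sup>2 <= (LBINT x. C\<^sup>2 * (norm (g x))\<^sup>2)"
  unfolding norm_cl_sq[OF assms(1)]
 proof (rule integral_mono_AE)
  show "AE x in lborel. (norm (f x))\<^sup>2 <= C\<^sup>2 * (norm (g x))\<^sup>2"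
   using assms(3) by eventually_elim (metis norm_ge_zero power_mono power_mult_distrib)
 qed (use assms(1,2)[THEN SI_integrable] in auto)
 also have "\<dots> = (C * norm (cl g))\<^sup>2"
  by (simp add: norm_cl_sq[OF assms(2)] power_mult_distrib)
 finally show ?thesis
  using assms(4) by (auto intro: power2_le_imp_le)
qed

lemma SI_nn_bound:
 assumes [measurable]: "f \<in> borel_measurable lborel"
  and "(\<integral>\<^sup>+x. ennreal ((norm (f x))\<^sup>2) \<partial>lborel) <= ennreal (C\<^sup>2)" and "C >= 0"
 shows "SI f" "norm (cl f) <= C"
proof -
 show SI: "SI f"
  unfolding square_integrable_def using assms
  by (auto intro!: integrableI_bounded simp: le_less_trans[OF _ ennreal_less_top])
 have "ennreal ((norm (cl f))\<^sup>2) <= ennreal (C\<^sup>2)"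
  using assms(2) norm_cl_nn[OF SI] by simp
 then show "norm (cl f) <= C" using assms(3) by (auto intro: power2_le_imp_le)
qed

text \<open>Fatou's lemma in \<open>L\<^sup>2\<close>: a sequence of functions that is close to \<open>x\<close> in norm and
  converges pointwise has a limit that is equally close.\<close>

lemma L2_Fatou:
 assumes f: "!!n::nat. SI (f n)" and [measurable]: "g \<in> borel_measurable lborel"
  and lim: "AE x in lborel. (%n. f n x) \<longlonglongrightarrow> g x"
  and le: "eventually (%n. norm (cl (f n)) <= C) sequentially" and C: "C >= 0"
 shows "norm (cl g) <= C \<and> SI g"
proof -
 have [measurable]: "f n \<in> borel_measurable borel" for n
  using SI_measurable[OF f[of n]] by simp
 have "(\<integral>\<^sup>+x. ennreal ((norm (g x))\<^sup>2) \<partial>lborel) =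
    (\<integral>\<^sup>+x. liminf (%n. ennreal ((norm (f n x))\<^sup>2)) \<partial>lborel)"
 proof (rule nn_integral_cong_AE)
  show "AE x in lborel. ennreal ((norm (g x))\<^sup>2) = liminf (%n. ennreal ((norm (f n x))\<^sup>2))"
   using lim
  proof eventually_elim
   case (elim x)
   then have "(%n. ennreal ((norm (f n x))\<^sup>2)) \<longlonglongrightarrow> ennreal ((norm (g x))\<^sup>2)"
    by (intro tendsto_intros)
   then show ?case by (metis lim_imp_Liminf sequentially_bot)
  qed
 qed
 also have "\<dots> <= liminf (%n. \<integral>\<^sup>+x. ennreal ((norm (f n x))\<^sup>2) \<partial>lborel)"
  by (rule nn_integral_liminf) simp
 also have "\<dots> <= ennreal (C\<^sup>2)"
 proof -
  have "eventually (%n. (\<integral>\<^sup>+x. ennreal ((norm (f n x))\<^sup>2) \<partial>lborel) <= ennreal (C\<^sup>2)) sequentially"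
   using le by eventually_elim (simp flip: norm_cl_nn[OF f] add: power_mono)
  then have "liminf (%n. \<integral>\<^sup>+x. ennreal ((norm (f n x))\<^sup>2) \<partial>lborel) <= limsup (%n. \<integral>\<^sup>+x. ennreal ((norm (f n x))\<^sup>2) \<partial>lborel)"
    "limsup (%n. \<integral>\<^sup>+x. ennreal ((norm (f n x))\<^sup>2) \<partial>lborel) <= ennreal (C\<^sup>2)"
   by (auto intro: Liminf_le_Limsup Limsup_bounded)
  then show ?thesis by order
 qed
 finally have *: "(\<integral>\<^sup>+x. ennreal ((norm (g x))\<^sup>2) \<partial>lborel) <= ennreal (C\<^sup>2)" .
 show "norm (cl g) <= C \<and> SI g"
  using SI_nn_bound[OF _ * C] by simp
qed

lemma L2_limit_pointwise:
 assumes f: "!!n::nat. SI (f n)" and [measurable]: "g \<in> borel_measurable lborel"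
  and lim: "AE t in lborel. (%n. f n t) \<longlonglongrightarrow> g t" and x: "(%n. cl (f n)) \<longlonglongrightarrow> x"
 shows "SI g" "cl g = x"
proof -
 have d: "norm (cl (%t. g t - rep x t)) <= e \<and> SI (%t. g t - rep x t)" if "e > 0" for e
 proof (rule L2_Fatou[of "%n t. f n t - rep x t" _ e])
  show "SI (%t. f n t - rep x t)" for n by (intro SI_diff f SI_rep)
  show "AE t in lborel. (%n. f n t - rep x t) \<longlonglongrightarrow> g t - rep x t"
   using lim by eventually_elim (intro tendsto_intros)
  have "\<forall>\<^sub>F n in sequentially. dist (cl (f n)) x < e"
   using x \<open>e > 0\<close> by (rule tendstoD)
  then show "\<forall>\<^sub>F n in sequentially. norm (cl (%t. f n t - rep x t)) <= e"
   by eventually_elim (simp add: cl_diff f SI_rep dist_norm)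
 qed (use that SI_rep[THEN SI_measurable] in auto)
 have "SI (%t. g t - rep x t)" using d[of 1] by simp
 then show g: "SI g" using SI_add[OF _ SI_rep[of x]] by fastforce
 have "norm (cl (%t. g t - rep x t)) <= 0"
  by (rule field_le_epsilon) (use d in auto)
 then show "cl g = x" by (simp add: cl_diff[OF g SI_rep])
qed

text \<open>Riesz--Fischer: a subsequence with summable increments converges almost everywhere.\<close>

instance l2 :: banach
proof
 fix X :: "nat => l2" assume X: "Cauchy X"
 have "\<exists>r. strict_mono r \<and> (\<forall>n. dist (X (r n)) (X (r (Suc n))) < (1/2)^n)"
 proof -
  have "\<exists>N. \<forall>m\<ge>N. \<forall>n\<ge>N. dist (X m) (X n) < (1/2)^k" for k
   using X by (auto simp: Cauchy_def)
  then obtain N where N: "!!k m n. m >= N k ==> n >= N k ==> dist (X m) (X n) < (1/2)^k" by metis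
  define r where "r = rec_nat (N 0) (%k p. max (Suc p) (N (Suc k)))"
  have rS: "r (Suc k) = max (Suc (r k)) (N (Suc k))" for k by (simp add: r_def)
  have ge: "r k >= N k" for k by (cases k) (auto simp: rS, simp add: r_def)
  have lt: "r k < r (Suc k)" for k by (simp add: rS)
  have "strict_mono r" using lt by (rule strict_monoI_Suc)
  moreover have "dist (X (r n)) (X (r (Suc n))) < (1/2)^n" for n
   using ge[of n] lt[of n] by (intro N) auto
  ultimately show ?thesis by blast
 qed
 then obtain r where r: "strict_mono r" and d: "!!n. dist (X (r n)) (X (r (Suc n))) < (1/2)^n" by blast
 define f where "f n = rep (X (r n))" for n
 have fSI: "SI (f n)" and clf: "cl (f n) = X (r n)" for n by (auto simp: f_def SI_rep)
 have [measurable]: "f n \<in> borel_measurable borel" for n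
  using SI_measurable[OF fSI[of n]] by simp
 define S where "S N x = (\<Sum>n<N. complex_of_real (norm (f (Suc n) x - f n x)))" for N x
 have SI1: "SI (%x. complex_of_real (norm (f (Suc n) x - f n x)))" for n
  by (rule SI_bound[OF _ SI_diff[OF fSI[of "Suc n"] fSI[of n]], of _ 1]) auto
 have SIS: "SI (S N)" for N unfolding S_def by (intro SI_sum SI1)
 have nS: "norm (cl (S N)) <= 2" for N
 proof -
  have "norm (cl (S N)) <= (\<Sum>n<N. norm (cl (%x. complex_of_real (norm (f (Suc n) x - f n x)))))"
   unfolding S_def by (subst cl_sum) (auto intro: SI1 norm_sum)
  also have "\<dots> <= (\<Sum>n<N. (1/2)^n)"
  proof (rule sum_mono)
   fix n
   have "norm (cl (%x. complex_of_real (norm (f (Suc n) x - f n x)))) <= 1 * norm (cl (%x. f (Suc n) x - f n x))"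
    by (rule norm_cl_le) (auto intro: SI1 SI_diff fSI)
   also have "\<dots> = dist (X (r n)) (X (r (Suc n)))"
    by (simp add: cl_diff fSI clf dist_norm norm_minus_commute)
   finally show "norm (cl (%x. complex_of_real (norm (f (Suc n) x - f n x)))) <= (1/2)^n"
    using d[of n] by simp
  qed
  also have "\<dots> <= (\<Sum>n. (1/2::real)^n)" by (rule sum_le_suminf) auto
  also have "\<dots> = 2" using suminf_geometric[of "1/2::real"] by simp
  finally show ?thesis .
 qed
 have "(\<integral>\<^sup>+x. (SUP N. ennreal ((norm (S N x))\<^sup>2)) \<partial>lborel) = (SUP N. \<integral>\<^sup>+x. ennreal ((norm (S N x))\<^sup>2) \<partial>lborel)"
 proof (rule nn_integral_monotone_convergence_SUP)
  have nn: "norm (S N x) = (\<Sum>n<N. norm (f (Suc n) x - f n x))" for N x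
   unfolding S_def by (simp flip: of_real_sum add: sum_nonneg)
  have "norm (S m x) <= norm (S n x)" if "m <= n" for m n x
   unfolding nn using that by (intro sum_mono2) auto
  then show "incseq (%N x. ennreal ((norm (S N x))\<^sup>2))"
   by (auto simp: incseq_def le_fun_def intro!: ennreal_leI power_mono)
  show "(%x. ennreal ((norm (S N x))\<^sup>2)) \<in> borel_measurable lborel" for N
   unfolding S_def by measurable
 qed
 also have "\<dots> <= ennreal (2\<^sup>2)"
 proof (rule SUP_least)
  fix N show "(\<integral>\<^sup>+x. ennreal ((norm (S N x))\<^sup>2) \<partial>lborel) <= ennreal (2\<^sup>2)"
   unfolding norm_cl_nn[OF SIS, symmetric] by (intro ennreal_leI power_mono nS) auto
 qed
 finally have "(\<integral>\<^sup>+x. (SUP N. ennreal ((norm (S N x))\<^sup>2)) \<partial>lborel) < \<infinity>"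
  by (rule le_less_trans) simp
 then have "AE x in lborel. (SUP N. ennreal ((norm (S N x))\<^sup>2)) ~= \<infinity>"
  by (intro nn_integral_PInf_AE) (auto simp: S_def)
 then have conv: "AE x in lborel. convergent (%n. f n x)"
 proof eventually_elim
  case (elim x)
  define s where "s = enn2real (SUP N. ennreal ((norm (S N x))\<^sup>2))"
  have le: "(norm (S N x))\<^sup>2 <= s" for N
  proof -
   have "ennreal ((norm (S N x))\<^sup>2) <= (SUP N. ennreal ((norm (S N x))\<^sup>2))" by (rule SUP_upper) simp
   also have "\<dots> = ennreal s" unfolding s_def using elim by (intro ennreal_enn2real[symmetric]) (simp only: less_top infinity_ennreal_def)
   finally show ?thesis unfolding s_def by (subst (asm) ennreal_le_iff) auto
  qed
  have "summable (%n. norm (f (Suc n) x - f n x))"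
  proof (rule bounded_imp_summable)
   fix N
   have "norm (S (Suc N) x) <= sqrt s" using le[of "Suc N"] by (rule real_le_rsqrt)
   moreover have "norm (S (Suc N) x) = (\<Sum>n\<le>N. norm (f (Suc n) x - f n x))"
    unfolding S_def by (simp flip: of_real_sum add: sum_nonneg lessThan_Suc_atMost)
   ultimately show "(\<Sum>n\<le>N. norm (f (Suc n) x - f n x)) <= sqrt s" by simp
  qed auto
  then have "summable (%n. f (Suc n) x - f n x)" by (rule summable_norm_cancel)
  then have "convergent (%N. \<Sum>n<N. f (Suc n) x - f n x)" by (simp add: summable_iff_convergent)
  then have "convergent (%N. f N x - f 0 x)" by (simp add: sum_lessThan_telescope[of "%n. f n x"])
  then show ?case by (simp add: convergent_diff_const_right_iff)
 qed
 define g where "g x = lim (%n. f n x)" for x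
 have gm [measurable]: "g \<in> borel_measurable borel"
  unfolding g_def by measurable
 have lim: "AE x in lborel. (%n. f n x) \<longlonglongrightarrow> g x"
  using conv by eventually_elim (simp add: g_def convergent_LIMSEQ_iff)
 have dn: "norm (cl (%x. g x - f n x)) <= e \<and> SI (%x. g x - f n x)"
  if "e > 0" "!!m. m >= n ==> dist (X (r m)) (X (r n)) <= e" for n e
 proof (rule L2_Fatou[of "%m x. f m x - f n x" _ e])
  show "AE x in lborel. (%m. f m x - f n x) \<longlonglongrightarrow> g x - f n x"
   using lim by eventually_elim (intro tendsto_intros)
  show "\<forall>\<^sub>F m in sequentially. norm (cl (%x. f m x - f n x)) <= e"
   using eventually_ge_at_top[of n]
   by eventually_elim (use that(2) in \<open>simp add: cl_diff fSI clf dist_norm\<close>)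
 qed (use that in \<open>auto intro: SI_diff fSI\<close>)
 have Xr: "Cauchy (%n. X (r n))"
  using Cauchy_subseq_Cauchy[OF X r] by (simp add: o_def)
 obtain n0 where "!!m. m >= n0 ==> dist (X (r m)) (X (r n0)) < 1"
  using Xr unfolding Cauchy_def by (metis order_refl zero_less_one)
 then have "SI (%x. g x - f n0 x)" using dn[of 1 n0] by force
 then have g: "SI g" using SI_add[OF _ fSI[of n0]] by fastforce
 have "(%n. X (r n)) \<longlonglongrightarrow> cl g"
 proof (rule metric_LIMSEQ_I)
  fix e :: real assume "e > 0"
  then obtain M where M: "!!m n. m >= M ==> n >= M ==> dist (X (r m)) (X (r n)) < e / 2"
   using Xr unfolding Cauchy_def by (metis half_gt_zero)
  show "\<exists>M. \<forall>n\<ge>M. dist (X (r n)) (cl g) < e"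
  proof (intro exI allI impI)
   fix n assume n: "n >= M"
   have "norm (cl (%x. g x - f n x)) <= e / 2"
    using dn[of "e/2" n] M n \<open>e > 0\<close> by (force intro: less_imp_le)
   then show "dist (X (r n)) (cl g) < e"
    using \<open>e > 0\<close> by (simp add: cl_diff[OF g fSI] clf dist_norm norm_minus_commute)
  qed
 qed
 then show "convergent X"
  using Cauchy_converges_subseq[OF X r] by (auto simp: convergent_def o_def)
qed

section \<open>Plancherel's theorem\<close>

lemma nn_integral_affine:
 fixes f :: "'a::euclidean_space => ennreal"
 assumes [measurable]: "f \<in> borel_measurable borel" and c: "c ~= 0"
 shows "(\<integral>\<^sup>+x. f x \<partial>lborel) = ennreal (\<bar>c\<bar> ^ DIM('a)) * (\<integral>\<^sup>+x. f (t + c *\<^sub>R x) \<partial>lborel)"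
 by (subst lborel_affine[OF c, of t])
   (simp add: nn_integral_density nn_integral_distr nn_integral_cmult)

lemma integrable_affine:
 fixes f :: "'a::euclidean_space => 'b::{banach, second_countable_topology}"
 assumes f: "integrable lborel f" and c: "c ~= 0"
 shows "integrable lborel (%x. f (t + c *\<^sub>R x))"
 using f f[THEN borel_measurable_integrable] c unfolding integrable_iff_bounded
 by (subst (asm) nn_integral_affine[where c=c and t=t]) (auto simp: ennreal_mult_less_top)

lemma integrable_affine_iff:
 fixes f :: "'a::euclidean_space => 'b::{banach, second_countable_topology}"
 assumes c: "c ~= 0"
 shows "integrable lborel (%x. f (t + c *\<^sub>R x)) \<longleftrightarrow> integrable lborel f"
 using integrable_affine[of f c t] integrable_affine[of "%x. f (t + c *\<^sub>R x)" "1/c" "(-1/c) *\<^sub>R t"] c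
 by (auto simp: algebra_simps)

lemma integral_affine:
 fixes f :: "'a::euclidean_space => 'b::{banach, second_countable_topology}"
 assumes c: "c ~= 0"
 shows "(LBINT x. f x) = (\<bar>c\<bar> ^ DIM('a)) *\<^sub>R (LBINT x. f (t + c *\<^sub>R x))"
proof (cases "integrable lborel f")
 case True
 then have [measurable]: "f \<in> borel_measurable borel" by auto
 show ?thesis
  by (subst lborel_affine[OF c, of t])
    (simp add: integral_density integral_distr)
next
 case False
 then show ?thesis
  using integrable_affine_iff[OF c, of f t] by (simp add: not_integrable_integral_eq)
qed

lemma integral_translate:
 fixes f :: "'a::euclidean_space => 'b::{banach, second_countable_topology}"
 shows "(LBINT x. f (x + t)) = (LBINT x. f x)"
 using integral_affine[of 1 f t] by (simp add: add.commute)

lemma integral_reflect: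
 fixes f :: "'a::euclidean_space => 'b::{banach, second_countable_topology}"
 shows "(LBINT x. f (t - x)) = (LBINT x. f x)"
 using integral_affine[of "-1" f t] by simp

lemma integrable_translate:
 fixes f :: "'a::euclidean_space => 'b::{banach, second_countable_topology}"
 shows "integrable lborel f ==> integrable lborel (%x. f (x + t))"
 using integrable_affine[of f 1 t] by (simp add: add.commute)

lemma integrable_reflect:
 fixes f :: "'a::euclidean_space => 'b::{banach, second_countable_topology}"
 shows "integrable lborel f ==> integrable lborel (%x. f (t - x))"
 using integrable_affine[of f "-1" t] by simp

lemma AE_affine:
 fixes P :: "'a::euclidean_space => bool"
 assumes "AE x in lborel. P x" "c ~= 0"
 shows "AE x in lborel. P (t + c *\<^sub>R x)"
proof -
 from assms(1) obtain N where N: "N \<in> null_sets lborel" "{x \<in> space lborel. \<not> P x} \<subseteq> N"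
  by (auto simp: eventually_ae_filter)
 have [measurable]: "N \<in> sets borel" using N by auto
 have "(\<integral>\<^sup>+x. indicator N x \<partial>lborel) = (0::ennreal)"
  using N by (simp add: null_sets_def)
 then have "(\<integral>\<^sup>+x. indicator N (t + c *\<^sub>R x) \<partial>lborel) = (0::ennreal)"
  by (subst (asm) nn_integral_affine[of _ c t]) (use assms(2) in auto)
 then have "AE x in lborel. indicator N (t + c *\<^sub>R x) = (0::ennreal)"
  by (subst (asm) nn_integral_0_iff_AE) auto
 then show ?thesis
  by eventually_elim (use N(2) in \<open>auto simp: indicator_def split: if_splits\<close>)
qed

lemma SI_affine:
 assumes "SI f" "c ~= 0" shows "SI (%x. f (t + c *\<^sub>R x))"
 unfolding square_integrable_def
proof
 have [measurable]: "f \<in> borel_measurable borel" using SI_measurable[OF assms(1)] by simp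
 show "(%x. f (t + c *\<^sub>R x)) \<in> borel_measurable lborel" by measurable
 show "integrable lborel (%x. (norm (f (t + c *\<^sub>R x)))\<^sup>2)"
  by (rule integrable_affine[OF SI_integrable[OF assms(1)] assms(2)])
qed

lemma SI_translate: "SI f ==> SI (%x. f (x + t))"
 using SI_affine[of f 1 t] by (simp add: add.commute)

lemma SI_reflect: "SI f ==> SI (%x. f (- x))"
 using SI_affine[of f "-1" 0] by simp

subsection \<open>Continuity of translations\<close>

lemma indicator_open_translate:
 fixes U :: "'a::euclidean_space set"
 assumes U: "open U" "emeasure lborel U < \<infinity>" and y: "y \<longlonglongrightarrow> 0"
 shows "(%n. \<integral>x. norm (indicator U (x + y n) - indicator U x :: real) \<partial>lborel) \<longlonglongrightarrow> 0"
proof -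
 have [measurable]: "U \<in> sets borel" using U by auto
 have iU: "integrable lborel (indicator U :: 'a => real)" using U by (simp add: integrable_indicator_iff)
 define m where "m n x = (indicator U (x + y n) * indicator U x :: real)" for n x
 have m: "integrable lborel (m n)" for n
  by (rule Bochner_Integration.integrable_bound[OF iU]) (auto simp: m_def[abs_def] indicator_def)
 have "(%n. \<integral>x. m n x \<partial>lborel) \<longlonglongrightarrow> (LBINT x. indicator U x)"
 proof (rule integral_dominated_convergence[where w="indicator U"])
  show "AE x in lborel. (%n. m n x) \<longlonglongrightarrow> indicator U x"
  proof (rule AE_I2)
   fix x
   show "(%n. m n x) \<longlonglongrightarrow> indicator U x"
   proof (cases "x \<in> U")
    case True
    have "(%n. x + y n) \<longlonglongrightarrow> x" using tendsto_add[OF tendsto_const y, of x] by simp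
    then have "eventually (%n. x + y n \<in> U) sequentially"
     using U(1) True by (rule topological_tendstoD)
    then show ?thesis
     by (intro tendsto_eventually) (auto elim!: eventually_mono simp: m_def True)
   qed (simp add: m_def)
  qed
 qed (use iU in \<open>auto simp: m_def indicator_def\<close>)
 then have "(%n. 2 * (LBINT x. indicator U x) - 2 * (LBINT x. m n x)) \<longlonglongrightarrow>
   2 * (LBINT x. indicator U x) - 2 * (\<integral>x. indicator U x \<partial>(lborel::'a measure)) "
  by (intro tendsto_intros)
 moreover have "(LBINT x. norm (indicator U (x + y n) - indicator U x :: real)) =
   2 * (LBINT x. indicator U x) - 2 * (LBINT x. m n x)" for n
 proof -
  have "(LBINT x. norm (indicator U (x + y n) - indicator U x :: real)) =
    (LBINT x. indicator U (x + y n) + indicator U x - 2 * m n x)"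
   by (rule Bochner_Integration.integral_cong) (auto simp: m_def indicator_def)
  also have "\<dots> = (LBINT x. indicator U (x + y n)) + (LBINT x. indicator U x) - 2 * (LBINT x. m n x)"
   using iU m[of n] integrable_translate[OF iU, of "y n"] by simp
  also have "(LBINT x. indicator U (x + y n)) = (\<integral>x. indicator U x \<partial>lborel :: real)"
   by (rule integral_translate[of "indicator U"])
  finally show ?thesis by simp
 qed
 ultimately show ?thesis by simp
qed

lemma L1_translate_diff:
 fixes f g :: "'a::euclidean_space => 'b::{banach, second_countable_topology}"
 assumes f: "integrable lborel f" and g: "integrable lborel g"
 shows "(LBINT x. norm (f (x + y) - f x)) \<le>
   (LBINT x. norm (g (x + y) - g x)) + 2 * (LBINT x. norm (f x - g x))"
proof -
 note ft = integrable_translate[OF f, of y] and gt = integrable_translate[OF g, of y]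
 have "(LBINT x. norm (f (x + y) - f x)) \<le>
   (LBINT x. norm (g (x + y) - g x) + norm (f (x + y) - g (x + y)) + norm (f x - g x))"
 proof (rule integral_mono)
  fix x
  have "f (x + y) - f x = (g (x + y) - g x) + (f (x + y) - g (x + y)) - (f x - g x)" by simp
  then show "norm (f (x + y) - f x) <= norm (g (x + y) - g x) + norm (f (x + y) - g (x + y)) + norm (f x - g x)"
   using norm_triangle_ineq4[of "(g (x + y) - g x) + (f (x + y) - g (x + y))" "f x - g x"]
    norm_triangle_ineq[of "g (x + y) - g x" "f (x + y) - g (x + y)"]
   by (simp only: \<open>f (x + y) - f x = _\<close>)
 qed (use f g ft gt in auto)
 also have "\<dots> = (LBINT x. norm (g (x + y) - g x)) + (LBINT x. norm (f (x + y) - g (x + y))) + (LBINT x. norm (f x - g x))"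
  using f g ft gt by simp
 also have "(LBINT x. norm (f (x + y) - g (x + y))) = (LBINT x. norm (f x - g x))"
  by (rule integral_translate[of "%x. norm (f x - g x)"])
 finally show ?thesis by simp
qed

lemma translate_continuous_L1:
 fixes f :: "'a::euclidean_space => complex"
 assumes f: "integrable lborel f" and y: "y \<longlonglongrightarrow> 0"
 shows "(%n. \<integral>x. norm (f (x + y n) - f x) \<partial>lborel) \<longlonglongrightarrow> 0"
 using f
proof (induction f rule: integrable_induct)
 case (base A c)
 then have [measurable]: "A \<in> sets borel" by simp
 have iA: "integrable lborel (indicator A :: 'a => real)" using base by (simp add: integrable_indicator_iff)
 have "(%n. \<integral>x. norm (indicator A (x + y n) - indicator A x :: real) \<partial>lborel) \<longlonglongrightarrow> 0"
 proof (rule LIMSEQ_I)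
  fix e :: real assume e: "e > 0"
  then obtain U where U: "open U" "A \<subseteq> U" "emeasure lborel (U - A) < e / 4"
   using outer_regular_lborel[of A "e/4"] by auto
  have [measurable]: "U \<in> sets borel" using U by simp
  have "emeasure lborel U = emeasure lborel A + emeasure lborel (U - A)"
   using U by (subst plus_emeasure) (auto simp: Un_absorb1)
  then have fU: "emeasure lborel U < \<infinity>"
   using less_trans[OF U(3) ennreal_less_top] base by simp
  have iU: "integrable lborel (indicator U :: 'a => real)" using fU by (simp add: integrable_indicator_iff)
  have d: "(LBINT x. norm (indicator A x - indicator U x :: real)) <= e / 4"
  proof -
   have "(LBINT x. norm (indicator A x - indicator U x :: real)) = (LBINT x. indicator (U - A) x)"
    using U by (intro Bochner_Integration.integral_cong) (auto simp: indicator_def)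
   also have "\<dots> = measure lborel (U - A)" by simp
   also have "\<dots> <= e / 4" using U(3) e unfolding measure_def
    by (intro enn2real_leI) auto
   finally show ?thesis .
  qed
  from LIMSEQ_D[OF indicator_open_translate[OF U(1) fU y], of "e/2"] e
  obtain N where N: "!!n. n >= N ==> (LBINT x. norm (indicator U (x + y n) - indicator U x :: real)) < e / 2"
   by auto
  show "\<exists>N. \<forall>n\<ge>N. norm ((LBINT x. norm (indicator A (x + y n) - indicator A x :: real)) - 0) < e"
  proof (intro exI allI impI)
   fix n assume "n >= N"
   moreover have "0 <= (LBINT x. norm (indicator A (x + y n) - indicator A x :: real))" by simp
   ultimately show "norm ((LBINT x. norm (indicator A (x + y n) - indicator A x :: real)) - 0) < e"
    using N[of n] L1_translate_diff[OF iA iU, of "y n"] d by simp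
  qed
 qed
 then have "(%n. (LBINT x. norm (indicator A (x + y n) - indicator A x :: real)) * norm c) \<longlonglongrightarrow> 0 * norm c"
  by (intro tendsto_intros)
 moreover have "(LBINT x. norm (indicator A (x + y n) *\<^sub>R c - indicator A x *\<^sub>R c))
   = (LBINT x. norm (indicator A (x + y n) - indicator A x :: real)) * norm c" for n
  by (simp flip: scaleR_diff_left)
 ultimately show ?case by simp
next
 case (add f g)
 show ?case
 proof (rule tendsto_sandwich[OF _ _ tendsto_const])
  show "(%n. (LBINT x. norm (f (x + y n) - f x)) + (LBINT x. norm (g (x + y n) - g x))) \<longlonglongrightarrow> 0"
   using tendsto_add[OF add.IH] by simp
  show "\<forall>\<^sub>F n in sequentially. (LBINT x. norm (f (x + y n) + g (x + y n) - (f x + g x)))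
   <= (LBINT x. norm (f (x + y n) - f x)) + (LBINT x. norm (g (x + y n) - g x))"
  proof (intro always_eventually allI)
   fix n
   note ft = integrable_translate[OF add.hyps(1), of "y n"] integrable_translate[OF add.hyps(2), of "y n"]
   have "(LBINT x. norm (f (x + y n) + g (x + y n) - (f x + g x))) \<le>
     (LBINT x. norm (f (x + y n) - f x) + norm (g (x + y n) - g x))"
    by (rule integral_mono) (use add.hyps ft in \<open>auto simp: add_diff_add intro: norm_triangle_ineq\<close>)
   also have "\<dots> = (LBINT x. norm (f (x + y n) - f x)) + (LBINT x. norm (g (x + y n) - g x))"
    using add.hyps ft by simp
   finally show "(LBINT x. norm (f (x + y n) + g (x + y n) - (f x + g x)))
    <= (LBINT x. norm (f (x + y n) - f x)) + (LBINT x. norm (g (x + y n) - g x))" .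
  qed
 qed simp
next
 case (lim f s)
 have conv: "(%i. \<integral>x. norm (f x - s i x) \<partial>lborel) \<longlonglongrightarrow> (\<integral>x. 0 \<partial>(lborel::'a measure))"
 proof (rule integral_dominated_convergence[where w="%x. 3 * norm (f x)"])
  show "AE x in lborel. (%i. norm (f x - s i x)) \<longlonglongrightarrow> 0"
   using lim.hyps(2) by (intro AE_I2) (auto intro!: tendsto_norm_zero tendsto_eq_intros)
  show "AE x in lborel. norm (norm (f x - s i x)) <= 3 * norm (f x)" for i
  proof (rule AE_I2)
   fix x :: 'a
   have "norm (s i x) <= 2 * norm (f x)" using lim.hyps(3) by simp
   then show "norm (norm (f x - s i x)) <= 3 * norm (f x)"
    using norm_triangle_ineq4[of "f x" "s i x"] by simp
  qed
 qed (use lim.hyps in auto)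
 show ?case
 proof (rule LIMSEQ_I)
  fix e :: real assume e: "e > 0"
  have "0 < e / 4" "0 < e / 2" using e by auto
  from conv have "(%i. \<integral>x. norm (f x - s i x) \<partial>lborel) \<longlonglongrightarrow> 0" by simp
  from order_tendstoD(2)[OF this \<open>0 < e / 4\<close>] obtain i where i: "(LBINT x. norm (f x - s i x)) < e / 4"
   by (auto simp only: eventually_sequentially)
  from order_tendstoD(2)[OF lim.IH[of i] \<open>0 < e / 2\<close>]
  obtain N where N: "!!n. n >= N ==> (LBINT x. norm (s i (x + y n) - s i x)) < e / 2"
   unfolding eventually_sequentially by blast
  show "\<exists>N. \<forall>n\<ge>N. norm ((LBINT x. norm (f (x + y n) - f x)) - 0) < e"
  proof (intro exI allI impI)
   fix n assume "n >= N"
   moreover have "0 <= (LBINT x. norm (f (x + y n) - f x))" by simp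
   ultimately show "norm ((LBINT x. norm (f (x + y n) - f x)) - 0) < e"
    using N[of n] L1_translate_diff[OF lim.hyps(4) lim.hyps(1)[of i], of "y n"] i
    unfolding real_norm_def by linarith
  qed
 qed
qed

text \<open>The map \<open>a \<mapsto> |a| a\<close> carries continuity of translations from \<open>L\<^sup>1\<close> to \<open>L\<^sup>2\<close>.\<close>

lemma norm_diff_square_le:
 fixes a b :: "'a::real_inner"
 shows "(norm (a - b))\<^sup>2 <= 2 * norm (norm a *\<^sub>R a - norm b *\<^sub>R b)"
proof (cases "a = b")
 case False
 have id: "inner (norm a *\<^sub>R a - norm b *\<^sub>R b) (a - b) =
   (norm a + norm b) / 2 * (norm (a - b))\<^sup>2 + (norm a - norm b)\<^sup>2 * (norm a + norm b) / 2"
 proof -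
  have n: "(norm (a - b))\<^sup>2 = (norm a)\<^sup>2 + (norm b)\<^sup>2 - 2 * inner a b"
   by (simp add: power2_norm_eq_inner inner_diff_left inner_diff_right inner_commute)
  show ?thesis unfolding n
   by (simp add: inner_diff_left inner_diff_right inner_commute[of b a] power2_norm_eq_inner[symmetric])
     (simp add: field_simps power2_eq_square)
 qed
 have "(norm (a - b)) * (norm (a - b))\<^sup>2 <= (norm a + norm b) * (norm (a - b))\<^sup>2"
  by (intro mult_right_mono norm_triangle_ineq4) auto
 also have "\<dots> <= 2 * inner (norm a *\<^sub>R a - norm b *\<^sub>R b) (a - b)"
  unfolding id by (simp add: field_simps)
 also have "\<dots> <= 2 * (norm (norm a *\<^sub>R a - norm b *\<^sub>R b) * norm (a - b))"
  by (intro mult_left_mono norm_cauchy_schwarz) auto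
 finally have "norm (a - b) * (norm (a - b))\<^sup>2 <= norm (a - b) * (2 * norm (norm a *\<^sub>R a - norm b *\<^sub>R b))"
  by (simp add: algebra_simps)
 then show ?thesis using False by (subst (asm) mult_le_cancel_left_pos) auto
qed auto

lemma translate_continuous_L2:
 assumes f: "SI f" and y: "y \<longlonglongrightarrow> 0"
 shows "(%n. cl (%x. f (x + y n))) \<longlonglongrightarrow> cl f"
proof -
 have [measurable]: "f \<in> borel_measurable borel" using SI_measurable[OF f] by simp
 define g where "g x = norm (f x) *\<^sub>R f x" for x
 have g: "integrable lborel g"
  unfolding g_def
  by (rule Bochner_Integration.integrable_bound[OF SI_integrable[OF f]]) (auto simp: power2_eq_square)
 have ft: "SI (%x. f (x + y n))" for n by (rule SI_translate[OF f])
 have le: "(norm (cl (%x. f (x + y n)) - cl f))\<^sup>2 <= 2 * (LBINT x. norm (g (x + y n) - g x))" for n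
 proof -
  have "(norm (cl (%x. f (x + y n)) - cl f))\<^sup>2 = (LBINT x. (norm (f (x + y n) - f x))\<^sup>2)"
   by (simp add: norm_cl_sq SI_diff ft f flip: cl_diff)
  also have "\<dots> <= (LBINT x. 2 * norm (g (x + y n) - g x))"
   by (rule integral_mono)
    (use SI_integrable[OF SI_diff[OF ft[of n] f]] g integrable_translate[OF g, of "y n"] norm_diff_square_le in \<open>auto simp: g_def[symmetric], auto simp: g_def\<close>)
  finally show ?thesis by simp
 qed
 have "(%n. (norm (cl (%x. f (x + y n)) - cl f))\<^sup>2) \<longlonglongrightarrow> 0"
 proof (rule tendsto_sandwich[OF _ _ tendsto_const])
  show "(%n. 2 * (LBINT x. norm (g (x + y n) - g x))) \<longlonglongrightarrow> 0"
   using tendsto_mult[OF tendsto_const translate_continuous_L1[OF g y], of 2] by simp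
 qed (use le in auto)
 then have "(%n. sqrt ((norm (cl (%x. f (x + y n)) - cl f))\<^sup>2)) \<longlonglongrightarrow> sqrt 0"
  by (rule tendsto_real_sqrt)
 then have "(%n. norm (cl (%x. f (x + y n)) - cl f)) \<longlonglongrightarrow> 0" by simp
 then show ?thesis by (rule LIM_zero_cancel[OF tendsto_norm_zero_cancel])
qed

subsection \<open>Absolutely convergent Fourier integrals\<close>

abbreviation fi :: "(real^2 => complex) => real^2 => complex" where
 "fi \<equiv> fourier_integral"

lemma borel_measurable_cis [measurable (raw)]:
 "f \<in> borel_measurable M ==> (%x. cis (f x)) \<in> borel_measurable M"
 by (rule borel_measurable_continuous_on[of cis]) (auto intro: continuous_intros)

lemma fi_integrable:
 assumes "integrable lborel f" shows "integrable lborel (%x. cis (- (x \<bullet> xi)) * f x)"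
 by (rule Bochner_Integration.integrable_bound[OF assms]) (use assms in \<open>auto simp: norm_mult\<close>)

lemma fi_norm_le: "norm (fi f xi) <= (LBINT x. norm (f x))"
 unfolding fourier_integral_def
 using integral_norm_bound[of lborel "%x. cis (- (x \<bullet> xi)) * f x"] by (simp add: norm_mult)

lemma fi_measurable [measurable]:
 assumes "integrable lborel f" shows "fi f \<in> borel_measurable borel"
proof -
 have [measurable]: "f \<in> borel_measurable borel" using assms by auto
 show ?thesis unfolding fourier_integral_def[abs_def]
  by (rule lborel.borel_measurable_lebesgue_integral) simp
qed

lemma fi_diff: "integrable lborel f ==> integrable lborel g ==> fi (%x. f x - g x) xi = fi f xi - fi g xi"
 unfolding fourier_integral_def
 by (simp add: right_diff_distrib fi_integrable)

lemma fi_add: "integrable lborel f ==> integrable lborel g ==> fi (%x. f x + g x) xi = fi f xi + fi g xi"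
 unfolding fourier_integral_def
 by (simp add: distrib_left fi_integrable)

lemma fi_continuous:
 assumes f: "integrable lborel f" and y: "y \<longlonglongrightarrow> xi"
 shows "(%n. fi f (y n)) \<longlonglongrightarrow> fi f xi"
 unfolding fourier_integral_def
proof (rule integral_dominated_convergence[where w="%x. norm (f x)"])
 show "AE x in lborel. (%n. cis (- (x \<bullet> y n)) * f x) \<longlonglongrightarrow> cis (- (x \<bullet> xi)) * f x"
  by (intro AE_I2 tendsto_intros y)
qed (use f in \<open>auto simp: norm_mult\<close>)

lemma multiplication_formula:
 assumes f: "integrable lborel f" and g: "integrable lborel g"
 shows "(LBINT xi. fi f xi * g xi) = (LBINT x. f x * fi g x)"
proof -
 have [measurable]: "f \<in> borel_measurable borel" "g \<in> borel_measurable borel" using f g by auto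
 have *: "integrable (lborel \<Otimes>\<^sub>M lborel) (%(xi, x). cis (- (x \<bullet> xi)) * f x * g xi)"
 proof (rule lborel_pair.Fubini_integrable)
  show "integrable lborel (%xi. \<integral>x. norm (case (xi, x) of (xi, x) => cis (- (x \<bullet> xi)) * f x * g xi) \<partial>lborel)"
   using g by (simp add: norm_mult)
  show "AE xi in lborel. integrable lborel (%x. case (xi, x) of (xi, x) => cis (- (x \<bullet> xi)) * f x * g xi)"
   using fi_integrable[OF f] by auto
 qed measurable
 have "(LBINT xi. fi f xi * g xi) = (LBINT xi. (LBINT x. cis (- (x \<bullet> xi)) * f x * g xi))"
  unfolding fourier_integral_def by simp
 also have "\<dots> = (LBINT x. (LBINT xi. cis (- (x \<bullet> xi)) * f x * g xi))"
  using lborel_pair.Fubini_integral[OF *] by simp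
 also have "\<dots> = (LBINT x. f x * fi g x)"
 proof (rule Bochner_Integration.integral_cong[OF refl])
  fix x
  have "(LBINT xi. cis (- (x \<bullet> xi)) * f x * g xi) = (LBINT xi. f x * (cis (- (xi \<bullet> x)) * g xi))"
   by (simp add: inner_commute mult_ac)
  also have "\<dots> = f x * fi g x" unfolding fourier_integral_def by simp
  finally show "(LBINT xi. cis (- (x \<bullet> xi)) * f x * g xi) = f x * fi g x" .
 qed
 finally show ?thesis .
qed

lemma fi_cnj: "fi (%x. cnj (f x)) xi = cnj (fi f (- xi))"
 unfolding fourier_integral_def Bochner_Integration.integral_cnj[symmetric]
 by (rule Bochner_Integration.integral_cong) (auto simp: cis_cnj)

lemma fi_translate: "fi (%x. f (x + y)) xi = cis (y \<bullet> xi) * fi f xi"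
proof -
 have "fi (%x. f (x + y)) xi = (LBINT x. (%x. cis (y \<bullet> xi) * (cis (- (x \<bullet> xi)) * f x)) (x + y))"
  unfolding fourier_integral_def
  by (rule Bochner_Integration.integral_cong)
    (auto simp: inner_add_left cis_mult mult.assoc[symmetric])
 also have "\<dots> = cis (y \<bullet> xi) * fi f xi"
  unfolding integral_translate[of "%x. cis (y \<bullet> xi) * (cis (- (x \<bullet> xi)) * f x)"] fourier_integral_def by simp
 finally show ?thesis .
qed

lemma fi_modulate: "fi (%x. cis (x \<bullet> zeta) * f x) xi = fi f (xi - zeta)"
 unfolding fourier_integral_def
 by (rule Bochner_Integration.integral_cong)
   (auto simp: cis_mult mult.assoc[symmetric] inner_diff_right)

subsection \<open>Gaussians\<close>

lemma lborel_prod_integral: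
 fixes f :: "'a::euclidean_space => real => 'b::{real_normed_field,banach,second_countable_topology}"
 assumes f: "!!b. b \<in> Basis ==> integrable lborel (f b)"
 shows "integrable lborel (%x. \<Prod>b\<in>Basis. f b (x \<bullet> b))"
  and "(LBINT x. (\<Prod>b\<in>Basis. f b (x \<bullet> b))) = (\<Prod>b\<in>Basis. \<integral>t. f b t \<partial>lborel)"
proof -
 interpret product_sigma_finite "%_::'a. lborel :: real measure" ..
 have [measurable]: "b \<in> Basis ==> f b \<in> borel_measurable borel" for b using f[of b] by auto
 have eq: "(\<Prod>b\<in>Basis. f b ((\<Sum>c\<in>Basis. g c *\<^sub>R c) \<bullet> b)) = (\<Prod>b\<in>Basis. f b (g b))" for g :: "'a => real"
  by (rule prod.cong) (auto simp: inner_sum_left inner_Basis if_distrib cong: if_cong)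
 show "integrable lborel (%x. \<Prod>b\<in>Basis. f b (x \<bullet> b))"
  by (subst lborel_eq, subst integrable_distr_eq) (auto simp: eq intro!: product_integrable_prod f)
 show "(LBINT x. (\<Prod>b\<in>Basis. f b (x \<bullet> b))) = (\<Prod>b\<in>Basis. \<integral>t. f b t \<partial>lborel)"
  by (subst lborel_eq, subst integral_distr) (auto simp: eq intro!: product_integral_prod f)
qed

lemma gaussian_1d:
 fixes z e :: real assumes e: "e > 0"
 shows "integrable lborel (%t. cis (- (t * z)) * complex_of_real (exp (- (e\<^sup>2 * t\<^sup>2) / 2)))"
  and "(LBINT t. cis (- (t * z)) * complex_of_real (exp (- (e\<^sup>2 * t\<^sup>2) / 2)))
   = complex_of_real (sqrt (2 * pi) / e * exp (- z\<^sup>2 / (2 * e\<^sup>2)))"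
proof -
 define h where "h x = complex_of_real (std_normal_density x) * cis (x * (- z / e))" for x
 have "char std_normal_distribution (- z / e) = (LBINT x. std_normal_density x *\<^sub>R iexp (- z / e * x))"
  unfolding char_def by (rule integral_density) auto
 also have "\<dots> = (LBINT x. h x)"
  by (rule Bochner_Integration.integral_cong) (auto simp: h_def scaleR_conv_of_real cis_conv_exp mult_ac)
 finally have h: "(LBINT x. h x) = complex_of_real (exp (- (z\<^sup>2 / (2 * e\<^sup>2))))"
  by (simp add: char_std_normal_distribution power_divide mult.commute)
 have ih: "integrable lborel h"
  by (rule Bochner_Integration.integrable_bound[OF integrable_normal_density[of 1 0]])
    (auto simp: h_def[abs_def] norm_mult)
 have heq: "h (0 + e * t) = complex_of_real (1 / sqrt (2 * pi)) * (cis (- (t * z)) * complex_of_real (exp (- (e\<^sup>2 * t\<^sup>2) / 2)))" for t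
  using e by (simp add: h_def std_normal_density_def power_mult_distrib mult_ac)
 have "integrable lborel (%t. h (0 + e * t))"
  by (rule lborel_integrable_real_affine[OF ih]) (use e in auto)
 then have "integrable lborel (%t. complex_of_real (sqrt (2 * pi)) * h (0 + e * t))" by simp
 also have "(%t. complex_of_real (sqrt (2 * pi)) * h (0 + e * t)) =
   (%t. cis (- (t * z)) * complex_of_real (exp (- (e\<^sup>2 * t\<^sup>2) / 2)))"
  unfolding heq by (simp add: fun_eq_iff flip: of_real_mult)
 finally show "integrable lborel (%t. cis (- (t * z)) * complex_of_real (exp (- (e\<^sup>2 * t\<^sup>2) / 2)))" .
 have "complex_of_real (exp (- (z\<^sup>2 / (2 * e\<^sup>2)))) = e *\<^sub>R (LBINT t. h (0 + e * t))"
  using lborel_integral_real_affine[of e h 0] e by (simp add: h)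
 also have "\<dots> = complex_of_real (e / sqrt (2 * pi)) * (LBINT t. cis (- (t * z)) * complex_of_real (exp (- (e\<^sup>2 * t\<^sup>2) / 2)))"
  unfolding heq integral_mult_right_zero by (simp add: scaleR_conv_of_real)
 finally have "complex_of_real (sqrt (2 * pi) / e) * complex_of_real (exp (- (z\<^sup>2 / (2 * e\<^sup>2)))) =
   complex_of_real (sqrt (2 * pi) / e * (e / sqrt (2 * pi))) * (LBINT t. cis (- (t * z)) * complex_of_real (exp (- (e\<^sup>2 * t\<^sup>2) / 2)))"
  by (simp only: of_real_mult mult.assoc)
 moreover have "sqrt (2 * pi) / e * (e / sqrt (2 * pi)) = 1" using e by simp
 ultimately show "(LBINT t. cis (- (t * z)) * complex_of_real (exp (- (e\<^sup>2 * t\<^sup>2) / 2)))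
   = complex_of_real (sqrt (2 * pi) / e * exp (- z\<^sup>2 / (2 * e\<^sup>2)))"
  by simp
qed

definition gauss :: "real => real^2 => real" where
 "gauss e x = exp (- (e\<^sup>2 * (norm x)\<^sup>2) / 2)"

lemma norm_sq_Basis: "(norm x)\<^sup>2 = (\<Sum>b\<in>Basis. (x \<bullet> b)\<^sup>2)" for x :: "'a::euclidean_space"
 unfolding power2_norm_eq_inner by (subst euclidean_inner) (simp add: power2_eq_square)

lemma gauss_fourier:
 fixes z :: "real^2" assumes e: "e > 0"
 shows "integrable lborel (%x. complex_of_real (gauss e x))"
  and "fi (%x. complex_of_real (gauss e x)) z = complex_of_real (2 * pi / e\<^sup>2 * gauss (1/e) z)"
proof -
 define f where "f z b t = cis (- (t * (z \<bullet> b))) * complex_of_real (exp (- (e\<^sup>2 * t\<^sup>2) / 2))" for z b :: "real^2" and t :: real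
 have eq: "(\<Prod>b\<in>Basis. f z b (x \<bullet> b)) = cis (- (x \<bullet> z)) * complex_of_real (gauss e x)" for x z :: "real^2"
 proof -
  have "(\<Prod>b\<in>Basis. f z b (x \<bullet> b)) = (\<Prod>b\<in>Basis. cis (- ((x \<bullet> b) * (z \<bullet> b)))) * complex_of_real (\<Prod>b\<in>Basis. exp (- (e\<^sup>2 * (x \<bullet> b)\<^sup>2) / 2))"
   unfolding f_def prod.distrib of_real_prod by simp
  also have "(\<Prod>b\<in>Basis. cis (- ((x \<bullet> b) * (z \<bullet> b)))) = cis (\<Sum>b\<in>Basis. - ((x \<bullet> b) * (z \<bullet> b)))"
   by (simp add: cis_conv_exp sum_distrib_left exp_sum)
  also have "(\<Sum>b\<in>Basis. - ((x \<bullet> b) * (z \<bullet> b))) = - (x \<bullet> z)"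
   by (subst euclidean_inner[of x z]) (simp add: sum_negf)
  also have "(\<Prod>b\<in>Basis. exp (- (e\<^sup>2 * (x \<bullet> b)\<^sup>2) / 2)) = gauss e x"
  proof -
   have "(\<Sum>b\<in>(Basis::(real^2) set). - (e\<^sup>2 * (x \<bullet> b)\<^sup>2) / 2) = - (e\<^sup>2 * (\<Sum>b\<in>(Basis::(real^2) set). (x \<bullet> b)\<^sup>2)) / 2"
    unfolding sum_divide_distrib[symmetric] sum_negf sum_distrib_left ..
   then show ?thesis
    unfolding gauss_def norm_sq_Basis[of x] by (simp only: exp_sum[symmetric] finite_Basis)
  qed
  finally show ?thesis .
 qed
 have if1: "integrable lborel (f z b)" for z b unfolding f_def[abs_def] by (rule gaussian_1d(1)[OF e])
 have int1: "(LBINT t. f z b t) = complex_of_real (sqrt (2 * pi) / e * exp (- (z \<bullet> b)\<^sup>2 / (2 * e\<^sup>2)))" for z b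
  unfolding f_def by (rule gaussian_1d(2)[OF e])
 show "integrable lborel (%x. complex_of_real (gauss e x))"
  using lborel_prod_integral(1)[of "f 0", OF if1] unfolding eq by simp
 have "fi (%x. complex_of_real (gauss e x)) z = (\<Prod>b\<in>Basis. complex_of_real (sqrt (2 * pi) / e * exp (- (z \<bullet> b)\<^sup>2 / (2 * e\<^sup>2))))"
  unfolding fourier_integral_def eq[symmetric] int1[symmetric]
  by (rule lborel_prod_integral(2)[OF if1])
 also have "\<dots> = complex_of_real ((sqrt (2 * pi) / e) ^ 2 * (\<Prod>b\<in>(Basis::(real^2) set). exp (- (z \<bullet> b)\<^sup>2 / (2 * e\<^sup>2))))"
  unfolding of_real_prod[symmetric] prod.distrib prod_constant by simp
 also have "(\<Prod>b\<in>(Basis::(real^2) set). exp (- (z \<bullet> b)\<^sup>2 / (2 * e\<^sup>2))) = gauss (1/e) z"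
 proof -
  have "(\<Sum>b\<in>(Basis::(real^2) set). - (z \<bullet> b)\<^sup>2 / (2 * e\<^sup>2)) = - ((1/e)\<^sup>2 * (\<Sum>b\<in>(Basis::(real^2) set). (z \<bullet> b)\<^sup>2)) / 2"
   unfolding sum_divide_distrib[symmetric] sum_negf by (simp add: power_divide)
  then show ?thesis
   unfolding gauss_def norm_sq_Basis[of z] by (simp flip: exp_sum)
 qed
 also have "(sqrt (2 * pi) / e) ^ 2 = 2 * pi / e\<^sup>2" by (simp add: power_divide)
 finally show "fi (%x. complex_of_real (gauss e x)) z = complex_of_real (2 * pi / e\<^sup>2 * gauss (1/e) z)" .
qed

lemma gauss_integral: "e > 0 ==> (LBINT x. gauss e x) = 2 * pi / e\<^sup>2"
proof -
 assume "e > 0"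
 then have "complex_of_real (LBINT x. gauss e x) = complex_of_real (2 * pi / e\<^sup>2 * gauss (1/e) 0)"
  using gauss_fourier(2)[of e 0] unfolding fourier_integral_def by (simp del: of_real_mult of_real_divide)
 then have "(LBINT x. gauss e x) = 2 * pi / e\<^sup>2 * gauss (1/e) 0" by (simp only: of_real_eq_iff)
 moreover have "gauss (1/e) 0 = 1" by (simp add: gauss_def)
 ultimately show ?thesis by simp
qed

lemma gauss_scale:
 assumes "e > 0" shows "gauss (1 / e) (e *\<^sub>R w) = gauss 1 w"
proof -
 have "(1 / e)\<^sup>2 * (norm (e *\<^sub>R w))\<^sup>2 = (norm w)\<^sup>2"
  unfolding power_mult_distrib[symmetric] using assms by simp
 then show ?thesis by (simp only: gauss_def one_power2 mult_1)
qed

subsection \<open>Plancherel's theorem for integrable functions\<close>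

lemma autocorrelation:
 assumes f: "integrable lborel f" and SI: "SI f"
 defines "c \<equiv> %z. \<integral>x. f x * cnj (f (x - z)) \<partial>lborel"
 shows "integrable lborel c" and "fi c xi = complex_of_real ((norm (fi f xi))\<^sup>2)"
proof -
 have [measurable]: "f \<in> borel_measurable borel" using f by auto
 have *: "integrable (lborel \<Otimes>\<^sub>M lborel) (%(x, z). f x * cnj (f (x - z)))"
 proof (rule lborel_pair.Fubini_integrable)
  have "(LBINT z. norm (f x * cnj (f (x - z)))) = norm (f x) * (LBINT z. norm (f z))" for x
   using integral_reflect[of "%z. norm (f z)" x] by (simp add: norm_mult)
  then show "integrable lborel (%x. \<integral>z. norm (case (x, z) of (x, z) => f x * cnj (f (x - z))) \<partial>lborel)"
   using f by simp
  show "AE x in lborel. integrable lborel (%z. case (x, z) of (x, z) => f x * cnj (f (x - z)))"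
   using integrable_reflect[OF f] by auto
 qed measurable
 have *: "integrable (lborel \<Otimes>\<^sub>M lborel) (%(z, x). f x * cnj (f (x - z)))"
  using lborel_pair.integrable_product_swap[OF *] by (simp add: case_prod_beta)
 show "integrable lborel c"
  using lborel_pair.integrable_fst'[OF *] unfolding c_def by simp
 have **: "integrable (lborel \<Otimes>\<^sub>M lborel) (%(z, x). cis (- (z \<bullet> xi)) * (f x * cnj (f (x - z))))"
  by (rule Bochner_Integration.integrable_bound[OF *]) (auto simp: norm_mult)
 have "fi c xi = (LBINT z. (LBINT x. cis (- (z \<bullet> xi)) * (f x * cnj (f (x - z)))))"
  unfolding fourier_integral_def c_def by simp
 also have "\<dots> = (LBINT x. (LBINT z. cis (- (z \<bullet> xi)) * (f x * cnj (f (x - z)))))"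
  using lborel_pair.Fubini_integral[OF **] by simp
 also have "\<dots> = (LBINT x. cis (- (x \<bullet> xi)) * f x * cnj (fi f xi))"
 proof (rule Bochner_Integration.integral_cong[OF refl])
  fix x
  have "(LBINT z. cis (- (z \<bullet> xi)) * (f x * cnj (f (x - z)))) =
    (LBINT z. (%y. cis (- (x \<bullet> xi)) * f x * cnj (cis (- (y \<bullet> xi)) * f y)) (x - z))"
   by (rule Bochner_Integration.integral_cong)
     (auto simp: cis_cnj cis_mult inner_diff_left mult.assoc[symmetric] mult.commute[of "f _"])
  also have "\<dots> = cis (- (x \<bullet> xi)) * f x * cnj (fi f xi)"
   unfolding integral_reflect[of "%y. cis (- (x \<bullet> xi)) * f x * cnj (cis (- (y \<bullet> xi)) * f y)"]
    fourier_integral_def Bochner_Integration.integral_cnj[symmetric] by simp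
  finally show "(LBINT z. cis (- (z \<bullet> xi)) * (f x * cnj (f (x - z)))) = cis (- (x \<bullet> xi)) * f x * cnj (fi f xi)" .
 qed
 also have "\<dots> = fi f xi * cnj (fi f xi)"
  unfolding fourier_integral_def by simp
 also have "\<dots> = complex_of_real ((norm (fi f xi))\<^sup>2)" by (rule complex_norm_square[symmetric])
 finally show "fi c xi = complex_of_real ((norm (fi f xi))\<^sup>2)" .
qed

text \<open>The transform of the autocorrelation is \<open>|f^|\<^sup>2\<close>. Integrating it against Gaussians that spread out gives
  the value of the autocorrelation at \<open>0\<close>, which is continuous because translations are.\<close>

lemma Plancherel_L1:
 assumes f: "integrable lborel f" and SI: "SI f"
 shows "SI (fi f)" and "norm (cl (fi f)) = 2 * pi * norm (cl f)"
proof -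
 have [measurable]: "f \<in> borel_measurable borel" using f by auto
 define c where "c z = (LBINT x. f x * cnj (f (x - z)))" for z
 have c: "integrable lborel c" "!!xi. fi c xi = complex_of_real ((norm (fi f xi))\<^sup>2)"
  using autocorrelation[OF f SI] unfolding c_def[abs_def] by auto
 have [measurable]: "c \<in> borel_measurable borel" using c by auto
 have ft: "SI (%x. f (x - z))" for z using SI_translate[OF SI, of "- z"] by simp
 have Rec: "Re (c z) = inner (cl f) (cl (%x. f (x - z)))" for z
  unfolding c_def by (simp add: inner_cl SI ft)
 have nt: "norm (cl (%x. f (x - z))) = norm (cl f)" for z
 proof -
  have "(norm (cl (%x. f (x - z))))\<^sup>2 = (norm (cl f))\<^sup>2"
   using integral_translate[of "%x. (norm (f x))\<^sup>2" "- z"] by (simp add: norm_cl_sq ft SI)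
  then show ?thesis by simp
 qed
 have cb: "\<bar>Re (c z)\<bar> <= (norm (cl f))\<^sup>2" for z
  unfolding Rec using Cauchy_Schwarz_ineq2[of "cl f" "cl (%x. f (x - z))"] by (simp add: nt power2_eq_square)
 have c0: "(%n. Re (c (y n))) \<longlonglongrightarrow> (norm (cl f))\<^sup>2" if "y \<longlonglongrightarrow> 0" for y
 proof -
  have "(%n. cl (%x. f (x - y n))) \<longlonglongrightarrow> cl f"
   using translate_continuous_L2[OF SI, of "%n. - y n"] tendsto_minus[OF that] by simp
  then have "(%n. inner (cl f) (cl (%x. f (x - y n)))) \<longlonglongrightarrow> inner (cl f) (cl f)"
   by (intro tendsto_intros)
  then show ?thesis unfolding Rec power2_norm_eq_inner .
 qed
 define e where "e n = 1 / real (Suc n)" for n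
 have e: "e n > 0" "e \<longlonglongrightarrow> 0" for n
  unfolding e_def using LIMSEQ_inverse_real_of_nat by (auto simp: divide_inverse)
 have ig: "integrable lborel (gauss 1)" using gauss_fourier(1)[of 1] by (simp add: complex_of_real_integrable_eq)
 have gm [measurable]: "gauss k \<in> borel_measurable borel" for k unfolding gauss_def[abs_def] by measurable
 have gn: "gauss k x >= 0" for k x by (simp add: gauss_def)
 have int: "integrable lborel (%xi. (norm (fi f xi))\<^sup>2 * gauss (e n) xi) \<and>
   (LBINT xi. (norm (fi f xi))\<^sup>2 * gauss (e n) xi) = 2 * pi * (LBINT w. Re (c (e n *\<^sub>R w)) * gauss 1 w)" for n
 proof
  note g = gauss_fourier[OF e(1)[of n]]
  let ?M = "(LBINT x. norm (f x))"
  show "integrable lborel (%xi. (norm (fi f xi))\<^sup>2 * gauss (e n) xi)"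
  proof (rule Bochner_Integration.integrable_bound)
   show "integrable lborel (%xi. complex_of_real (?M\<^sup>2) * complex_of_real (gauss (e n) xi))" using g(1) by simp
   show "AE xi in lborel. norm ((norm (fi f xi))\<^sup>2 * gauss (e n) xi) <= norm (complex_of_real (?M\<^sup>2) * complex_of_real (gauss (e n) xi))"
    by (intro AE_I2) (auto simp: norm_mult gn norm_power intro!: mult_right_mono power_mono fi_norm_le)
  qed (use f in measurable)
  have "complex_of_real (LBINT xi. (norm (fi f xi))\<^sup>2 * gauss (e n) xi) = (LBINT xi. fi c xi * complex_of_real (gauss (e n) xi))"
   by (simp add: c(2) flip: integral_complex_of_real)
  also have "\<dots> = (LBINT z. c z * fi (%x. complex_of_real (gauss (e n) x)) z)"
   by (rule multiplication_formula[OF c(1) g(1)])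
  also have "\<dots> = (LBINT z. c z * complex_of_real (2 * pi / (e n)\<^sup>2 * gauss (1 / e n) z))"
   by (simp add: g(2))
  also have "\<dots> = ((e n)\<^sup>2) *\<^sub>R (LBINT w. c (0 + e n *\<^sub>R w) * complex_of_real (2 * pi / (e n)\<^sup>2 * gauss (1 / e n) (0 + e n *\<^sub>R w)))"
   by (subst integral_affine[of "e n" _ 0]) (use e(1)[of n] in auto)
  also have "\<dots> = (LBINT w. c (e n *\<^sub>R w) * complex_of_real (gauss 1 w) * complex_of_real (2 * pi))"
   unfolding integral_scaleR_right[symmetric] using e(1)[of n]
   by (intro Bochner_Integration.integral_cong refl) (simp add: gauss_scale scaleR_conv_of_real[of "(e n)\<^sup>2"])
  also have "\<dots> = complex_of_real (2 * pi) * (LBINT w. c (e n *\<^sub>R w) * complex_of_real (gauss 1 w))"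
   by simp
  finally have "(LBINT xi. (norm (fi f xi))\<^sup>2 * gauss (e n) xi) = Re (complex_of_real (2 * pi) * (LBINT w. c (e n *\<^sub>R w) * complex_of_real (gauss 1 w)))"
   by (metis Re_complex_of_real)
  also have "\<dots> = 2 * pi * Re (LBINT w. c (e n *\<^sub>R w) * complex_of_real (gauss 1 w))" by simp
  also have "Re (LBINT w. c (e n *\<^sub>R w) * complex_of_real (gauss 1 w)) = (LBINT w. Re (c (e n *\<^sub>R w) * complex_of_real (gauss 1 w)))"
  proof (rule integral_Re[symmetric])
   show "integrable lborel (%w. c (e n *\<^sub>R w) * complex_of_real (gauss 1 w))"
   proof (rule Bochner_Integration.integrable_bound)
    show "integrable lborel (%w. c (0 + e n *\<^sub>R w))" by (rule integrable_affine[OF c(1)]) (use e(1)[of n] in auto)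
    show "AE x in lborel. norm (c (e n *\<^sub>R x) * complex_of_real (gauss 1 x)) <= norm (c (0 + e n *\<^sub>R x))"
     by (intro AE_I2) (auto simp: norm_mult gn gauss_def intro!: mult_left_le)
   qed measurable
  qed
  finally show "(LBINT xi. (norm (fi f xi))\<^sup>2 * gauss (e n) xi) = 2 * pi * (LBINT w. Re (c (e n *\<^sub>R w)) * gauss 1 w)"
   by simp
 qed
 have lim: "(%n. \<integral>xi. (norm (fi f xi))\<^sup>2 * gauss (e n) xi \<partial>lborel) \<longlonglongrightarrow> (2 * pi * norm (cl f))\<^sup>2"
 proof -
  have "(%n. \<integral>w. Re (c (e n *\<^sub>R w)) * gauss 1 w \<partial>lborel) \<longlonglongrightarrow> (LBINT w. (norm (cl f))\<^sup>2 * gauss 1 w)"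
  proof (rule integral_dominated_convergence[where w="%w. (norm (cl f))\<^sup>2 * gauss 1 w"])
   show "AE w in lborel. (%n. Re (c (e n *\<^sub>R w)) * gauss 1 w) \<longlonglongrightarrow> (norm (cl f))\<^sup>2 * gauss 1 w"
   proof (intro AE_I2 tendsto_mult tendsto_const c0)
    fix w :: "real^2" show "(%n. e n *\<^sub>R w) \<longlonglongrightarrow> 0"
     using tendsto_scaleR[OF e(2) tendsto_const, of w] by simp
   qed
   show "AE w in lborel. norm (Re (c (e n *\<^sub>R w)) * gauss 1 w) <= (norm (cl f))\<^sup>2 * gauss 1 w" for n
    by (intro AE_I2) (auto simp: abs_mult gn intro!: mult_right_mono cb)
  qed (use ig in auto)
  then have "(%n. 2 * pi * (LBINT w. Re (c (e n *\<^sub>R w)) * gauss 1 w)) \<longlonglongrightarrow> 2 * pi * ((norm (cl f))\<^sup>2 * (2 * pi))"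
   using gauss_integral[of 1] by (intro tendsto_intros) simp
  then show ?thesis using int by (simp add: power2_eq_square algebra_simps)
 qed
 have "has_bochner_integral lborel (%xi. (norm (fi f xi))\<^sup>2) ((2 * pi * norm (cl f))\<^sup>2)"
 proof (rule has_bochner_integral_monotone_convergence[OF _ _ _ lim])
  show "!!n. integrable lborel (%xi. (norm (fi f xi))\<^sup>2 * gauss (e n) xi)" using int by blast
  show "AE xi in lborel. mono (%n. (norm (fi f xi))\<^sup>2 * gauss (e n) xi)"
  proof (intro AE_I2 monoI mult_left_mono)
   fix xi :: "real^2" and m n :: nat assume "m <= n"
   then have "e n <= e m" "0 <= e n" by (auto simp: e_def field_simps)
   then have "(e n)\<^sup>2 * (norm xi)\<^sup>2 <= (e m)\<^sup>2 * (norm xi)\<^sup>2" by (intro mult_right_mono power_mono) auto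
   then show "gauss (e m) xi <= gauss (e n) xi" by (simp add: gauss_def)
  qed auto
  show "AE xi in lborel. (%n. (norm (fi f xi))\<^sup>2 * gauss (e n) xi) \<longlonglongrightarrow> (norm (fi f xi))\<^sup>2"
  proof (intro AE_I2)
   fix xi :: "real^2"
   have "(%n. (norm (fi f xi))\<^sup>2 * gauss (e n) xi) \<longlonglongrightarrow> (norm (fi f xi))\<^sup>2 * exp (- (0\<^sup>2 * (norm xi)\<^sup>2) / 2)"
    unfolding gauss_def by (intro tendsto_intros e(2)) auto
   then show "(%n. (norm (fi f xi))\<^sup>2 * gauss (e n) xi) \<longlonglongrightarrow> (norm (fi f xi))\<^sup>2" by simp
  qed
 qed (use f in measurable)
 then have i: "integrable lborel (%xi. (norm (fi f xi))\<^sup>2)" "(LBINT xi. (norm (fi f xi))\<^sup>2) = (2 * pi * norm (cl f))\<^sup>2"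
  by (auto simp: has_bochner_integral_iff)
 show S: "SI (fi f)" unfolding square_integrable_def using i f by simp
 have "(norm (cl (fi f)))\<^sup>2 = (2 * pi * norm (cl f))\<^sup>2" by (simp only: norm_cl_sq[OF S] i(2))
 then show "norm (cl (fi f)) = 2 * pi * norm (cl f)"
  by (rule power2_eq_imp_eq) auto
qed

subsection \<open>The Fourier transform on the Hilbert space\<close>

abbreviation trunc :: "real => (real^2 => complex) => real^2 => complex" where
 "trunc R f \<equiv> %x. indicator (ball 0 R) x *\<^sub>R f x"

lemma ball_borel [measurable]: "ball (c::'a::metric_space) r \<in> sets borel"
 by simp

lemma emeasure_lborel_ball_finite [simp]: "emeasure lborel (ball (0::'a::euclidean_space) R) < \<infinity>"
 by (rule emeasure_bounded_finite) auto

lemma integrable_indicator_bounded: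
 fixes S :: "'a::euclidean_space set"
 shows "S \<in> sets borel ==> bounded S ==> integrable lborel (indicator S :: 'a => real)"
 using emeasure_bounded_finite[of S] by (simp add: integrable_indicator_iff)

lemma SI_trunc: "SI f ==> SI (trunc R f)"
 by (rule SI_bound[of _ f 1]) (auto dest: SI_measurable simp: indicator_def)

lemma SI_integrable_bounded_support:
 assumes f: "SI f" and S: "bounded S" "S \<in> sets borel" and 0: "!!x. x \<notin> S ==> f x = 0"
 shows "integrable lborel f"
proof (rule Bochner_Integration.integrable_bound)
 show "integrable lborel (%x. indicator S x + (norm (f x))\<^sup>2)"
  using SI_integrable[OF f] integrable_indicator_bounded[OF S(2,1)] by simp
 have "norm (f x) <= indicator S x + (norm (f x))\<^sup>2" for x
 proof (cases "x \<in> S")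
  case True
  have "0 <= (norm (f x) - 1)\<^sup>2" by simp
  then have "2 * norm (f x) <= 1 + (norm (f x))\<^sup>2" by (simp add: power2_diff)
  with True show ?thesis using norm_ge_zero[of "f x"] by (simp only: indicator_simps)
 qed (simp add: 0)
 then show "AE x in lborel. norm (f x) <= norm (indicator S x + (norm (f x))\<^sup>2)"
  by (simp add: abs_of_nonneg)
qed (use SI_measurable[OF f] in auto)

lemma trunc_integrable: "SI f ==> integrable lborel (trunc R f)"
 by (rule SI_integrable_bounded_support[of _ "ball 0 R"]) (auto simp: SI_trunc)

lemma eventually_norm_less_at_top: "eventually (%R. norm (x::'a::real_normed_vector) < R) at_top"
 by (rule eventually_gt_at_top)

lemma trunc_tendsto:
 assumes f: "SI f" shows "((%R. cl (trunc R f)) \<longlongrightarrow> cl f) at_top"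
proof -
 have [measurable]: "f \<in> borel_measurable borel" using SI_measurable[OF f] by simp
 have "((%R. \<integral>x. (norm (trunc R f x - f x))\<^sup>2 \<partial>lborel) \<longlongrightarrow> (\<integral>x. 0 \<partial>(lborel::(real^2) measure))) at_top"
 proof (rule integral_dominated_convergence_at_top[where w="%x. (norm (f x))\<^sup>2"])
  show "AE x in lborel. ((%R. (norm (trunc R f x - f x))\<^sup>2) \<longlongrightarrow> 0) at_top"
  proof (rule AE_I2, rule tendsto_eventually)
   fix x show "eventually (%R. (norm (trunc R f x - f x))\<^sup>2 = 0) at_top"
    using eventually_norm_less_at_top[of x] by eventually_elim auto
  qed
  show "\<forall>\<^sub>F R in at_top. AE x in lborel. norm ((norm (trunc R f x - f x))\<^sup>2) <= (norm (f x))\<^sup>2"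
   by (intro always_eventually allI AE_I2) (auto simp: indicator_def)
  show "(%x. (norm (trunc R f x - f x))\<^sup>2) \<in> borel_measurable lborel" for R
   using borel_measurable_integrable[OF SI_integrable[OF SI_diff[OF SI_trunc[OF f, of R] f]]] .
 qed (use SI_integrable[OF f] in auto)
 then have "((%R. (norm (cl (trunc R f) - cl f))\<^sup>2) \<longlongrightarrow> 0) at_top"
  by (simp add: norm_cl_sq SI_diff SI_trunc f flip: cl_diff)
 then have "((%R. sqrt ((norm (cl (trunc R f) - cl f))\<^sup>2)) \<longlongrightarrow> sqrt 0) at_top"
  by (rule tendsto_real_sqrt)
 then show ?thesis
  by (simp add: tendsto_norm_zero_iff LIM_zero_iff)
qed

lemma norm_fi_diff:
 assumes "SI f" "SI g" "integrable lborel f" "integrable lborel g"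
 shows "norm (cl (fi f) - cl (fi g)) = 2 * pi * norm (cl f - cl g)"
proof -
 have "cl (fi f) - cl (fi g) = cl (fi (%x. f x - g x))"
  unfolding fi_diff[OF assms(3,4), abs_def] by (simp add: cl_diff Plancherel_L1 assms)
 then show ?thesis
  using Plancherel_L1(2)[of "%x. f x - g x"] assms by (simp add: cl_diff SI_diff)
qed

lemma is_fourier_L2_iff:
 assumes f: "SI f"
 shows "is_fourier_L2 f g \<longleftrightarrow> SI g \<and> ((%R. cl (fi (trunc R f))) \<longlongrightarrow> cl g) at_top"
proof (cases "SI g")
 case True
 have S: "SI (fi (trunc R f))" for R by (intro Plancherel_L1 trunc_integrable SI_trunc f)
 have "(\<integral>\<^sup>+xi. ennreal ((norm (fi (trunc R f) xi - g xi))\<^sup>2) \<partial>lborel) = ennreal ((norm (cl (fi (trunc R f)) - cl g))\<^sup>2)" for R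
  using norm_cl_nn[OF SI_diff[OF S True]] by (simp add: cl_diff[OF S True])
 then have "is_fourier_L2 f g \<longleftrightarrow> ((%R. ennreal ((norm (cl (fi (trunc R f)) - cl g))\<^sup>2)) \<longlongrightarrow> ennreal 0) at_top"
  unfolding is_fourier_L2_def using True by simp
 also have "\<dots> \<longleftrightarrow> ((%R. (norm (cl (fi (trunc R f)) - cl g))\<^sup>2) \<longlongrightarrow> 0) at_top"
  by (rule tendsto_ennreal_iff) auto
 also have "\<dots> \<longleftrightarrow> ((%R. norm (cl (fi (trunc R f)) - cl g)) \<longlongrightarrow> 0) at_top"
 proof
  assume "((%R. (norm (cl (fi (trunc R f)) - cl g))\<^sup>2) \<longlongrightarrow> 0) at_top"
  from tendsto_real_sqrt[OF this] show "((%R. norm (cl (fi (trunc R f)) - cl g)) \<longlongrightarrow> 0) at_top" by simp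
 next
  assume "((%R. norm (cl (fi (trunc R f)) - cl g)) \<longlongrightarrow> 0) at_top"
  from tendsto_power[OF this, of 2] show "((%R. (norm (cl (fi (trunc R f)) - cl g))\<^sup>2) \<longlongrightarrow> 0) at_top" by simp
 qed
 also have "\<dots> \<longleftrightarrow> ((%R. cl (fi (trunc R f))) \<longlongrightarrow> cl g) at_top"
  by (simp add: tendsto_norm_zero_iff LIM_zero_iff)
 finally show ?thesis using True by simp
qed (simp add: is_fourier_L2_def)

lemma fourier_ex:
 assumes f: "SI f" shows "\<exists>g. is_fourier_L2 f g"
proof -
 define X where "X R = cl (fi (trunc R f))" for R
 have d: "norm (X R - X R') = 2 * pi * norm (cl (trunc R f) - cl (trunc R' f))" for R R'
  unfolding X_def by (intro norm_fi_diff SI_trunc trunc_integrable f)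
 have T: "(%n. cl (trunc (real n) f)) \<longlonglongrightarrow> cl f"
  using filterlim_compose[OF trunc_tendsto[OF f] filterlim_real_sequentially] .
 have "Cauchy (%n. X (real n))"
 proof (rule metric_CauchyI)
  fix e :: real assume "e > 0"
  then have "0 < e / (2 * pi)" by simp
  from metric_CauchyD[OF LIMSEQ_imp_Cauchy[OF T] this]
  obtain M where "!!m n. m >= M ==> n >= M ==> dist (cl (trunc (real m) f)) (cl (trunc (real n) f)) < e / (2 * pi)"
   by blast
  then show "\<exists>M. \<forall>m\<ge>M. \<forall>n\<ge>M. dist (X (real m)) (X (real n)) < e"
   by (intro exI[of _ M]) (auto simp: dist_norm d field_simps)
 qed
 then obtain x where x: "(%n. X (real n)) \<longlonglongrightarrow> x" by (auto simp: Cauchy_convergent_iff convergent_def)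
 have dx: "norm (X R - x) = 2 * pi * norm (cl (trunc R f) - cl f)" for R
 proof (rule LIMSEQ_unique)
  show "(%n. norm (X R - X (real n))) \<longlonglongrightarrow> norm (X R - x)" by (intro tendsto_intros x)
  show "(%n. norm (X R - X (real n))) \<longlonglongrightarrow> 2 * pi * norm (cl (trunc R f) - cl f)"
   unfolding d by (intro tendsto_intros T)
 qed
 have "((%R. 2 * pi * norm (cl (trunc R f) - cl f)) \<longlongrightarrow> 2 * pi * norm (cl f - cl f)) at_top"
  by (intro tendsto_intros trunc_tendsto f)
 then have "((%R. norm (X R - x)) \<longlongrightarrow> 0) at_top" unfolding dx by simp
 then have "(X \<longlongrightarrow> x) at_top" by (simp add: tendsto_norm_zero_iff LIM_zero_iff)
 then show ?thesis
  by (intro exI[of _ "rep x"]) (simp add: is_fourier_L2_iff[OF f] SI_rep X_def[abs_def])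
qed

lemma fourier_is: "SI f ==> is_fourier_L2 f (fourier f)"
 unfolding fourier_def by (rule someI_ex[OF fourier_ex])

lemma SI_fourier: "SI f ==> SI (fourier f)"
 using fourier_is is_fourier_L2_iff by blast

lemma fourier_lim: "SI f ==> ((%R. cl (fi (trunc R f))) \<longlongrightarrow> cl (fourier f)) at_top"
 using fourier_is is_fourier_L2_iff by blast

lemma fourier_cong_AE:
 assumes "SI f" "SI g" "AE x in lborel. f x = g x"
 shows "fourier f = fourier g"
proof -
 have [measurable]: "f \<in> borel_measurable borel" "g \<in> borel_measurable borel"
  using assms(1,2)[THEN SI_measurable] by auto
 have "fi (trunc R f) xi = fi (trunc R g) xi" for R xi
  unfolding fourier_integral_def
  by (rule integral_cong_AE) (use assms(3) in \<open>auto elim: eventually_mono\<close>)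
 then show ?thesis unfolding fourier_def is_fourier_L2_def by presburger
qed

definition FT :: "l2 => l2" where "FT x = cl (fourier (rep x))"

lemma FT_cl: "SI f ==> FT (cl f) = cl (fourier f)"
 unfolding FT_def by (subst fourier_cong_AE[of _ f]) (auto simp: SI_rep rep_cl)

lemma FT_lim: "SI f ==> ((%R. cl (fi (trunc R f))) \<longlongrightarrow> FT (cl f)) at_top"
 using fourier_lim by (simp add: FT_cl)

lemma FT_integrable:
 assumes f: "SI f" "integrable lborel f" shows "FT (cl f) = cl (fi f)"
proof (rule L2_limit_pointwise(2)[symmetric])
 show "SI (fi (trunc (real n) f))" for n by (intro Plancherel_L1 trunc_integrable SI_trunc f)
 show "(%n. cl (fi (trunc (real n) f))) \<longlonglongrightarrow> FT (cl f)"
  using filterlim_compose[OF FT_lim[OF f(1)] filterlim_real_sequentially] .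
 show "AE xi in lborel. (%n. fi (trunc (real n) f) xi) \<longlonglongrightarrow> fi f xi"
  unfolding fourier_integral_def
 proof (intro AE_I2 integral_dominated_convergence[where w="%x. norm (f x)"])
  fix xi x :: "real^2"
  have "eventually (%n. norm x < real n) sequentially"
   using filterlim_real_sequentially eventually_norm_less_at_top by (auto simp: filterlim_iff)
  then show "(%n. cis (- (x \<bullet> xi)) * trunc (real n) f x) \<longlonglongrightarrow> cis (- (x \<bullet> xi)) * f x"
   by (intro tendsto_eventually) (auto elim: eventually_mono)
 qed (use f in \<open>auto simp: norm_mult indicator_def\<close>)
qed (use f in measurable)

lemma norm_FT: "norm (FT x) = 2 * pi * norm x"
proof -
 let ?f = "rep x"
 have "((%R. norm (cl (fi (trunc R ?f)))) \<longlongrightarrow> norm (FT x)) at_top"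
  using tendsto_norm[OF FT_lim[OF SI_rep[of x]]] by simp
 moreover have "((%R. 2 * pi * norm (cl (trunc R ?f))) \<longlongrightarrow> 2 * pi * norm x) at_top"
  using tendsto_mult[OF tendsto_const tendsto_norm[OF trunc_tendsto[OF SI_rep[of x]]], of "2 * pi"] by simp
 ultimately show ?thesis
  by (auto intro!: tendsto_unique[of at_top] simp: Plancherel_L1 SI_trunc trunc_integrable SI_rep)
qed

lemma FT_add: "FT (x + y) = FT x + FT y"
proof (rule tendsto_unique)
 let ?f = "rep x" and ?g = "rep y"
 have S: "SI (%t. ?f t + ?g t)" by (intro SI_add SI_rep)
 have "cl (%t. ?f t + ?g t) = x + y" by (simp add: cl_add SI_rep)
 then show "((%R. cl (fi (trunc R (%t. ?f t + ?g t)))) \<longlongrightarrow> FT (x + y)) at_top"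
  using FT_lim[OF S] by simp
 have "cl (fi (trunc R (%t. ?f t + ?g t))) = cl (fi (trunc R ?f)) + cl (fi (trunc R ?g))" for R
 proof -
  have "fi (trunc R (%t. ?f t + ?g t)) = (%xi. fi (trunc R ?f) xi + fi (trunc R ?g) xi)"
   unfolding scaleR_add_right by (rule ext, rule fi_add) (auto intro: trunc_integrable SI_rep)
  then show ?thesis by (simp add: cl_add Plancherel_L1 SI_trunc trunc_integrable SI_rep)
 qed
 then show "((%R. cl (fi (trunc R (%t. ?f t + ?g t)))) \<longlongrightarrow> FT x + FT y) at_top"
  using tendsto_add[OF FT_lim[OF SI_rep[of x]] FT_lim[OF SI_rep[of y]]] by simp
qed simp

lemma FT_scaleR: "FT (c *\<^sub>R x) = c *\<^sub>R FT x"
proof (rule tendsto_unique)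
 let ?f = "rep x"
 have S: "SI (%t. c *\<^sub>R ?f t)" by (intro SI_scaleR SI_rep)
 have "cl (%t. c *\<^sub>R ?f t) = c *\<^sub>R x" by (simp add: cl_scaleR SI_rep)
 then show "((%R. cl (fi (trunc R (%t. c *\<^sub>R ?f t)))) \<longlongrightarrow> FT (c *\<^sub>R x)) at_top"
  using FT_lim[OF S] by simp
 have "cl (fi (trunc R (%t. c *\<^sub>R ?f t))) = c *\<^sub>R cl (fi (trunc R ?f))" for R
 proof -
  have "fi (trunc R (%t. c *\<^sub>R ?f t)) = (%xi. c *\<^sub>R fi (trunc R ?f) xi)"
   unfolding fourier_integral_def scaleR_conv_of_real[of c] integral_mult_right_zero[symmetric]
   by (intro ext Bochner_Integration.integral_cong refl) (simp add: mult_ac scaleR_conv_of_real)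
  then show ?thesis by (simp add: cl_scaleR Plancherel_L1 SI_trunc trunc_integrable SI_rep)
 qed
 then show "((%R. cl (fi (trunc R (%t. c *\<^sub>R ?f t)))) \<longlongrightarrow> c *\<^sub>R FT x) at_top"
  using tendsto_scaleR[OF tendsto_const FT_lim[OF SI_rep[of x]]] by simp
qed simp

lemma bounded_linear_FT: "bounded_linear FT"
 by (rule bounded_linear_intro[of _ "2 * pi"]) (auto simp: FT_add FT_scaleR norm_FT)

lemmas FT_diff = linear_diff[OF bounded_linear.linear[OF bounded_linear_FT]]
lemmas FT_zero [simp] = linear_0[OF bounded_linear.linear[OF bounded_linear_FT]]
lemmas FT_sum = linear_sum[OF bounded_linear.linear[OF bounded_linear_FT]]

lemma inner_FT: "inner (FT x) (FT y) = (2 * pi)\<^sup>2 * inner x y"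
 unfolding dot_norm FT_add[symmetric] norm_FT by (simp add: power_mult_distrib field_simps)

definition refl :: "l2 => l2" where "refl x = cl (%t. rep x (- t))"

lemma refl_cl: "SI f ==> refl (cl f) = cl (%t. f (- t))"
 unfolding refl_def
 by (rule cl_cong_AE) (use AE_affine[OF rep_cl, of f "-1" 0] in \<open>auto simp: SI_reflect SI_rep\<close>)

lemma inner_refl: "inner (refl x) (refl y) = inner x y"
 unfolding refl_def using integral_reflect[of "%t. rep x t * cnj (rep y t)" 0]
 unfolding inner_rep[of x y] by (subst inner_cl) (simp_all add: SI_reflect SI_rep)

lemma norm_refl: "norm (refl x) = norm x"
 by (simp add: norm_eq_sqrt_inner inner_refl)

lemma bounded_linear_refl: "bounded_linear refl"
proof (rule bounded_linear_intro[of _ 1])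
 show "refl (x + y) = refl x + refl y" for x y
  using refl_cl[OF SI_add[OF SI_rep[of x] SI_rep[of y]]]
  by (simp add: cl_add SI_rep SI_reflect refl_def)
 show "refl (c *\<^sub>R x) = c *\<^sub>R refl x" for c x
  using refl_cl[OF SI_scaleR[OF SI_rep[of x]]] by (simp add: cl_scaleR SI_rep SI_reflect refl_def)
qed (simp add: norm_refl)

lemma FT_adjoint: "inner (FT x) y = inner x (refl (FT y))"
proof (rule LIMSEQ_unique)
 define f where "f n = trunc (real n) (rep x)" for n
 define g where "g n = trunc (real n) (rep y)" for n
 have SI: "SI (f n)" "integrable lborel (f n)" "SI (g n)" "integrable lborel (g n)" for n
  unfolding f_def g_def by (auto intro!: SI_trunc trunc_integrable SI_rep)
 have fx: "(%n. cl (f n)) \<longlonglongrightarrow> x" "(%n. cl (g n)) \<longlonglongrightarrow> y"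
  unfolding f_def g_def using filterlim_compose[OF trunc_tendsto[OF SI_rep] filterlim_real_sequentially] by simp_all
 note L = bounded_linear.tendsto[OF bounded_linear_FT] bounded_linear.tendsto[OF bounded_linear_refl]
 show "(%n. inner (FT (cl (f n))) (cl (g n))) \<longlonglongrightarrow> inner (FT x) y"
  by (intro tendsto_intros L fx)
 have "inner (FT (cl (f n))) (cl (g n)) = inner (cl (f n)) (refl (FT (cl (g n))))" for n
 proof -
  have "(LBINT xi. fi (f n) xi * cnj (g n xi)) = (LBINT x. f n x * fi (%x. cnj (g n x)) x)"
   by (rule multiplication_formula) (use SI in auto)
  then show ?thesis
   by (simp add: FT_integrable SI refl_cl Plancherel_L1 inner_cl SI_reflect fi_cnj)
 qed
 then show "(%n. inner (FT (cl (f n))) (cl (g n))) \<longlonglongrightarrow> inner x (refl (FT y))"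
  by (simp, intro tendsto_intros L fx)
qed

definition IFT :: "l2 => l2" where "IFT x = (1 / (2 * pi)\<^sup>2) *\<^sub>R refl (FT x)"

lemma IFT_FT [simp]: "IFT (FT x) = x"
proof (rule vector_eq_ldot[THEN iffD1, rule_format])
 fix y show "inner y (IFT (FT x)) = inner y x"
  unfolding IFT_def using FT_adjoint[of y "FT x"] by (simp add: inner_FT field_simps)
qed

lemma norm_IFT: "norm (IFT x) = norm x / (2 * pi)"
 unfolding IFT_def by (simp add: norm_refl norm_FT power2_eq_square)

lemma bounded_linear_IFT: "bounded_linear IFT"
 unfolding IFT_def[abs_def]
 by (intro bounded_linear_compose[OF bounded_linear_scaleR_right]
    bounded_linear_compose[OF bounded_linear_refl] bounded_linear_FT)

lemmas IFT_diff = linear_diff[OF bounded_linear.linear[OF bounded_linear_IFT]]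
lemmas IFT_zero [simp] = linear_0[OF bounded_linear.linear[OF bounded_linear_IFT]]

lemma FT_IFT [simp]: "FT (IFT x) = x"
proof -
 have "IFT (FT (IFT x) - x) = 0" by (simp add: IFT_diff)
 then have "norm (FT (IFT x) - x) = 0" using norm_IFT[of "FT (IFT x) - x"] by simp
 then show ?thesis by simp
qed

lemma inner_via_FT: "inner x y = inner (FT x) (FT y) / (2 * pi)\<^sup>2"
 by (simp add: inner_FT)

lemma FT_eq_iff [simp]: "FT x = FT y \<longleftrightarrow> x = y"
 by (metis IFT_FT)

lemma cl_inv_fourier:
 assumes "SI f" shows "SI (inv_fourier f)" "cl (inv_fourier f) = IFT (cl f)"
proof -
 have eq: "inv_fourier f = (%x. (1 / (2 * pi)\<^sup>2) *\<^sub>R fourier f (- x))"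
  by (simp add: inv_fourier_def fun_eq_iff scaleR_conv_of_real)
 have S: "SI (%x. fourier f (- x))" by (intro SI_reflect SI_fourier assms)
 show "SI (inv_fourier f)" unfolding eq by (intro SI_scaleR S)
 show "cl (inv_fourier f) = IFT (cl f)"
  unfolding eq cl_scaleR[OF S] IFT_def by (simp add: FT_cl assms refl_cl SI_fourier)
qed

lemma IFT_integrable:
 assumes "SI p" "integrable lborel p"
 shows "IFT (cl p) = cl (%x. (1 / (2 * pi)\<^sup>2) *\<^sub>R fi p (- x))" "SI (%x. (1 / (2 * pi)\<^sup>2) *\<^sub>R fi p (- x))"
 using assms unfolding IFT_def
 by (simp_all add: FT_integrable refl_cl Plancherel_L1 cl_scaleR SI_reflect SI_scaleR)

subsection \<open>Multipliers, translations and modulations\<close>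

text \<open>Multiplication by a function, on elements whose product with it is square integrable.\<close>

definition mul :: "(real^2 => complex) => l2 => l2" where
 "mul m x = cl (%xi. m xi * rep x xi)"

definition mdom :: "(real^2 => complex) => l2 => bool" where
 "mdom m x \<longleftrightarrow> SI (%xi. m xi * rep x xi)"

lemma mdom_cl:
 assumes "m \<in> borel_measurable borel" "SI f"
 shows "mdom m (cl f) \<longleftrightarrow> SI (%xi. m xi * f xi)"
proof -
 have [measurable]: "f \<in> borel_measurable borel" "rep (cl f) \<in> borel_measurable borel"
  using SI_measurable[OF assms(2)] SI_measurable[OF SI_rep] by auto
 note [measurable] = assms(1)
 have ae: "AE xi in lborel. m xi * rep (cl f) xi = m xi * f xi" "AE xi in lborel. m xi * f xi = m xi * rep (cl f) xi"
  using rep_cl[OF assms(2)] by (eventually_elim, simp)+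
 show ?thesis unfolding mdom_def
  using SI_cong_AE[OF _ _ ae(1)] SI_cong_AE[OF _ _ ae(2)] by auto
qed

lemma mul_cl:
 assumes "m \<in> borel_measurable borel" "SI f" "SI (%xi. m xi * f xi)"
 shows "mul m (cl f) = cl (%xi. m xi * f xi)"
 unfolding mul_def
proof (rule cl_cong_AE[OF _ assms(3)])
 show "SI (%xi. m xi * rep (cl f) xi)" using mdom_cl[OF assms(1,2)] assms(3) by (simp add: mdom_def)
 show "AE xi in lborel. m xi * rep (cl f) xi = m xi * f xi" using rep_cl[OF assms(2)] by eventually_elim simp
qed

lemma rep_mul: "mdom m x ==> AE xi in lborel. rep (mul m x) xi = m xi * rep x xi"
 unfolding mul_def mdom_def by (rule rep_cl)

lemma mdom_bounded:
 assumes "m \<in> borel_measurable borel" "!!xi. norm (m xi) <= C"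
 shows "mdom m x"
 unfolding mdom_def
 by (rule SI_bound[OF _ SI_rep[of x], of _ C])
   (use assms SI_measurable[OF SI_rep] in \<open>auto simp: norm_mult intro!: mult_right_mono\<close>)

lemma norm_mul_le:
 assumes "m \<in> borel_measurable borel" "!!xi. norm (m xi) <= C"
 shows "norm (mul m x) <= C * norm x"
proof -
 have "norm (cl (%xi. m xi * rep x xi)) <= C * norm (cl (rep x))"
  using mdom_bounded[OF assms, of x] assms(2) order_trans[OF norm_ge_zero assms(2)]
  by (intro norm_cl_le) (auto simp: mdom_def SI_rep norm_mult intro!: mult_right_mono)
 then show ?thesis by (simp add: mul_def)
qed

lemma mul_add:
 assumes "m \<in> borel_measurable borel" "mdom m x" "mdom m y"
 shows "mdom m (x + y)" "mul m (x + y) = mul m x + mul m y"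
proof -
 have S: "SI (%xi. m xi * (rep x xi + rep y xi))"
  using SI_add[OF assms(2,3)[unfolded mdom_def]] by (simp add: distrib_left)
 have xy: "x + y = cl (%xi. rep x xi + rep y xi)" by (simp add: cl_add SI_rep)
 show "mdom m (x + y)" unfolding xy
  using mdom_cl[OF assms(1) SI_add[OF SI_rep SI_rep]] S by blast
 have "mul m (x + y) = cl (%xi. m xi * rep x xi + m xi * rep y xi)"
  unfolding xy mul_cl[OF assms(1) SI_add[OF SI_rep SI_rep] S] distrib_left ..
 then show "mul m (x + y) = mul m x + mul m y"
  using assms(2,3) by (simp add: mul_def cl_add mdom_def)
qed

lemma mul_scaleR:
 assumes "m \<in> borel_measurable borel" "mdom m x"
 shows "mdom m (c *\<^sub>R x)" "mul m (c *\<^sub>R x) = c *\<^sub>R mul m x"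
proof -
 have S: "SI (%xi. m xi * (c *\<^sub>R rep x xi))"
  using SI_scaleR[OF assms(2)[unfolded mdom_def], of c] by (simp add: scaleR_conv_of_real mult.left_commute)
 have cx: "c *\<^sub>R x = cl (%xi. c *\<^sub>R rep x xi)" by (simp add: cl_scaleR SI_rep)
 show "mdom m (c *\<^sub>R x)" unfolding cx
  using mdom_cl[OF assms(1) SI_scaleR[OF SI_rep]] S by blast
 have "mul m (c *\<^sub>R x) = cl (%xi. c *\<^sub>R (m xi * rep x xi))"
  unfolding cx mul_cl[OF assms(1) SI_scaleR[OF SI_rep] S] by (simp add: scaleR_conv_of_real mult.left_commute)
 then show "mul m (c *\<^sub>R x) = c *\<^sub>R mul m x"
  using assms(2) by (simp add: mul_def cl_scaleR mdom_def)
qed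

lemma mul_diff:
 assumes "m \<in> borel_measurable borel" "mdom m x" "mdom m y"
 shows "mdom m (x - y)" "mul m (x - y) = mul m x - mul m y"
 using mul_add[OF assms(1,2) mul_scaleR(1)[OF assms(1,3), of "-1"]] mul_scaleR(2)[OF assms(1,3), of "-1"] by auto

lemma mul_zero: "m \<in> borel_measurable borel ==> mdom m 0" "m \<in> borel_measurable borel ==> mul m 0 = 0"
 using mdom_cl[of m "%_. 0"] mul_cl[of m "%_. 0"] by auto

lemma bounded_linear_mul:
 assumes "m \<in> borel_measurable borel" "!!xi. norm (m xi) <= C"
 shows "bounded_linear (mul m)"
 by (rule bounded_linear_intro[of _ C])
   (use assms norm_mul_le[OF assms] in \<open>auto simp: mul_add mul_scaleR mdom_bounded[OF assms] mult.commute\<close>)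

lemma inner_mul:
 assumes "mdom m x" "mdom (%xi. cnj (m xi)) y"
 shows "inner (mul m x) y = inner x (mul (%xi. cnj (m xi)) y)"
proof -
 have "inner (mul m x) (cl (rep y)) = inner (cl (rep x)) (mul (%xi. cnj (m xi)) y)"
  using assms unfolding mul_def mdom_def
  by (subst (1 2) inner_cl) (auto simp: SI_rep mult.left_commute mult.assoc)
 then show ?thesis by simp
qed

definition transl :: "real^2 => l2 => l2" where "transl y x = cl (%t. rep x (t + y))"

lemma transl_cl: "SI f ==> transl y (cl f) = cl (%t. f (t + y))"
 unfolding transl_def
 by (rule cl_cong_AE) (use AE_affine[OF rep_cl, of f 1 y] in \<open>auto simp: SI_translate SI_rep add.commute\<close>)

lemma inner_transl: "inner (transl y x) (transl y z) = inner x z"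
 unfolding transl_def using integral_translate[of "%t. rep x t * cnj (rep z t)" y]
 unfolding inner_rep[of x z] by (subst inner_cl) (simp_all add: SI_translate SI_rep)

lemma bounded_linear_transl: "bounded_linear (transl y)"
proof (rule bounded_linear_intro[of _ 1])
 show "transl y (x + z) = transl y x + transl y z" for x z
  using transl_cl[OF SI_add[OF SI_rep[of x] SI_rep[of z]]]
  by (simp add: cl_add SI_rep SI_translate transl_def)
 show "transl y (c *\<^sub>R x) = c *\<^sub>R transl y x" for c x
  using transl_cl[OF SI_scaleR[OF SI_rep[of x]]] by (simp add: cl_scaleR SI_rep SI_translate transl_def)
qed (simp add: norm_eq_sqrt_inner inner_transl)

lemma l2_ext_integrable:
 assumes "bounded_linear A" "bounded_linear B"
  and "!!f. SI f ==> integrable lborel f ==> A (cl f) = B (cl f)"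
 shows "A x = B x"
proof (rule tendsto_unique)
 have l: "((%R. cl (trunc R (rep x))) \<longlongrightarrow> x) at_top" using trunc_tendsto[OF SI_rep[of x]] by simp
 show "((%R. A (cl (trunc R (rep x)))) \<longlongrightarrow> A x) at_top"
  by (rule bounded_linear.tendsto[OF assms(1) l])
 show "((%R. A (cl (trunc R (rep x)))) \<longlongrightarrow> B x) at_top"
  using bounded_linear.tendsto[OF assms(2) l] assms(3)[OF SI_trunc[OF SI_rep] trunc_integrable[OF SI_rep]] by simp
qed simp

lemma FT_transl: "FT (transl y x) = mul (%xi. cis (y \<bullet> xi)) (FT x)"
proof (rule l2_ext_integrable[where A="%x. FT (transl y x)" and B="%x. mul (%xi. cis (y \<bullet> xi)) (FT x)"])
 show "bounded_linear (%x. FT (transl y x))"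
  by (rule bounded_linear_compose[OF bounded_linear_FT bounded_linear_transl])
 show "bounded_linear (%x. mul (%xi. cis (y \<bullet> xi)) (FT x))"
  by (rule bounded_linear_compose[OF bounded_linear_mul bounded_linear_FT]) auto
 fix f assume f: "SI f" "integrable lborel f"
 then have S: "SI (%xi. cis (y \<bullet> xi) * fi f xi)"
  using Plancherel_L1(1)[OF integrable_translate[OF f(2), of y] SI_translate[OF f(1)]] by (simp add: fi_translate[abs_def])
 show "FT (transl y (cl f)) = mul (%xi. cis (y \<bullet> xi)) (FT (cl f))"
  using f S by (simp add: transl_cl FT_integrable SI_translate integrable_translate fi_translate[abs_def] mul_cl Plancherel_L1)
qed

section \<open>Smooth functions and test functions\<close>

text \<open>Smoothness is a greatest fixed point: it holds on any class of differentiable functions that is closed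
  under partial derivatives.\<close>

lemma smooth_coinduct:
 assumes "S f" and "!!f x. S f ==> f differentiable (at x)"
  and "!!f v. S f ==> v \<in> Basis ==> S (pderiv_dir v f)"
 shows "smooth f"
proof -
 have "vs \<in> lists Basis ==> S (iter_pderiv vs f)" for vs
  by (induction vs) (auto intro: assms)
 then show ?thesis unfolding smooth_def using assms(2) by blast
qed

lemma iter_pderiv_append: "iter_pderiv (vs @ [v]) f = iter_pderiv vs (pderiv_dir v f)"
 by (induction vs) auto

lemma smooth_pderiv: "smooth f ==> v \<in> Basis ==> smooth (pderiv_dir v f)"
 unfolding smooth_def
proof (intro ballI allI)
 fix vs :: "'a list" and x :: 'a
 assume *: "\<forall>vs\<in>lists Basis. \<forall>x. iter_pderiv vs f differentiable (at x)" "v \<in> Basis" "vs \<in> lists Basis"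
 then have "vs @ [v] \<in> lists Basis" by auto
 then have "iter_pderiv (vs @ [v]) f differentiable (at x)" using * by blast
 then show "iter_pderiv vs (pderiv_dir v f) differentiable (at x)" by (simp only: iter_pderiv_append)
qed

lemma smooth_differentiable: "smooth f ==> f differentiable (at x)"
 unfolding smooth_def by (drule bspec[of _ _ "[]"]) auto

lemma smooth_has_derivative: "smooth f ==> (f has_derivative frechet_derivative f (at x)) (at x)"
 using smooth_differentiable frechet_derivative_works by blast

lemma pderiv_dir_eq: "(f has_derivative f') (at x) ==> pderiv_dir v f x = f' v"
 unfolding pderiv_dir_def by (metis frechet_derivative_at)

lemma smooth_continuous: "smooth f ==> continuous_on UNIV f"
 using smooth_differentiable[of f] differentiable_imp_continuous_within[of f _ UNIV]
 unfolding continuous_on_eq_continuous_within by blast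

lemma smooth_measurable: "smooth f ==> f \<in> borel_measurable borel"
 by (intro borel_measurable_continuous_onI smooth_continuous)

lemma frechet_derivative_Basis:
 assumes "smooth f"
 shows "frechet_derivative f (at x) w = (\<Sum>b\<in>Basis. (w \<bullet> b) * pderiv_dir b f x)"
proof -
 have lin: "linear (frechet_derivative f (at x))"
  using linear_frechet_derivative[OF smooth_differentiable[OF assms]] .
 have "frechet_derivative f (at x) w = frechet_derivative f (at x) (\<Sum>b\<in>Basis. (w \<bullet> b) *\<^sub>R b)"
  by (simp add: euclidean_representation)
 also have "\<dots> = (\<Sum>b\<in>Basis. (w \<bullet> b) * pderiv_dir b f x)"
  by (simp add: linear_sum[OF lin] linear_scale[OF lin] pderiv_dir_def)
 finally show ?thesis .
qed

lemma pderiv_dir_zero [simp]: "pderiv_dir v (%_. 0) = (%_. 0)"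
 using pderiv_dir_eq[OF has_derivative_const] by (auto simp: fun_eq_iff)

lemma smooth_zero: "smooth (%_. 0)"
 by (rule smooth_coinduct[where S="%f. f = (%_. 0)"]) auto

lemma pderiv_dir_mult:
 assumes "smooth f" "smooth g"
 shows "pderiv_dir v (%x. f x * g x) = (%x. f x * pderiv_dir v g x + pderiv_dir v f x * g x)"
 using pderiv_dir_eq[OF has_derivative_mult[OF smooth_has_derivative[OF assms(1)] smooth_has_derivative[OF assms(2)]]]
 by (auto simp: fun_eq_iff pderiv_dir_def)

lemma pderiv_dir_add:
 assumes "smooth f" "smooth g"
 shows "pderiv_dir v (%x. f x + g x) = (%x. pderiv_dir v f x + pderiv_dir v g x)"
 using pderiv_dir_eq[OF has_derivative_add[OF smooth_has_derivative[OF assms(1)] smooth_has_derivative[OF assms(2)]]]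
 by (auto simp: fun_eq_iff pderiv_dir_def)

lemma smooth_add:
 assumes "smooth f" "smooth g" shows "smooth (%x. f x + g x)"
proof (rule smooth_coinduct[where S="%h. \<exists>f g. smooth f \<and> smooth g \<and> h = (%x. f x + g x)"])
 show "\<exists>f' g'. smooth f' \<and> smooth g' \<and> (%x. f x + g x) = (%x. f' x + g' x)"
  using assms by blast
next
 fix h :: "'a => real" and x v
 assume "\<exists>f g. smooth f \<and> smooth g \<and> h = (%x. f x + g x)"
 then obtain f g where fg: "smooth f" "smooth g" "h = (%x. f x + g x)" by blast
 show "h differentiable (at x)"
  unfolding fg(3) by (intro differentiable_add smooth_differentiable fg)
 show "\<exists>f g. smooth f \<and> smooth g \<and> pderiv_dir v h = (%x. f x + g x)" if "v \<in> Basis"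
  unfolding fg(3) pderiv_dir_add[OF fg(1,2)] using smooth_pderiv that fg by blast
qed

inductive sum_of_products :: "('a::euclidean_space => real) => bool" where
 "smooth f ==> smooth g ==> sum_of_products (%x. f x * g x)"
| "sum_of_products f ==> sum_of_products g ==> sum_of_products (%x. f x + g x)"

lemma sum_of_products_pderiv:
 "sum_of_products f ==> (\<forall>x. f differentiable (at x)) \<and> (v \<in> Basis \<longrightarrow> sum_of_products (pderiv_dir v f))"
proof (induction rule: sum_of_products.induct)
 case (1 f g)
 have "v \<in> Basis ==> sum_of_products (%x. f x * pderiv_dir v g x + pderiv_dir v f x * g x)"
  by (rule sum_of_products.intros(2)[OF sum_of_products.intros(1) sum_of_products.intros(1)])
    (use 1 in \<open>auto intro: smooth_pderiv\<close>)
 then show ?case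
  unfolding pderiv_dir_mult[OF 1] using 1 by (simp add: differentiable_mult smooth_differentiable)
next
 case (2 f g)
 have "pderiv_dir v (%x. f x + g x) = (%x. pderiv_dir v f x + pderiv_dir v g x)"
 proof
  fix x
  have "(f has_derivative frechet_derivative f (at x)) (at x)" "(g has_derivative frechet_derivative g (at x)) (at x)"
   using 2 frechet_derivative_works by blast+
  from pderiv_dir_eq[OF has_derivative_add[OF this], of v]
  show "pderiv_dir v (%x. f x + g x) x = pderiv_dir v f x + pderiv_dir v g x"
   by (simp add: pderiv_dir_def)
 qed
 with 2 show ?case by (auto intro: sum_of_products.intros differentiable_add)
qed

lemma smooth_mult:
 assumes "smooth f" "smooth g" shows "smooth (%x. f x * g x)"
proof (rule smooth_coinduct[where S=sum_of_products])
 show "sum_of_products (%x. f x * g x)" using assms by (rule sum_of_products.intros)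
qed (use sum_of_products_pderiv in blast)+

inductive affine_sum :: "'b::euclidean_space => ('a::euclidean_space => 'b) => ('a => real) => bool"
 for c and A where
 "smooth f ==> affine_sum c A (%x. k * f (c + A x))"
| "affine_sum c A f ==> affine_sum c A g ==> affine_sum c A (%x. f x + g x)"

lemma affine_sum_zero: "affine_sum c A (%_. 0)"
 using affine_sum.intros(1)[OF smooth_zero, of c A 0] by simp

lemma affine_sum_sum: "(!!i. i \<in> I ==> affine_sum c A (f i)) ==> affine_sum c A (%x. \<Sum>i\<in>I. f i x)"
 by (induction I rule: infinite_finite_induct) (auto intro: affine_sum.intros affine_sum_zero)

lemma has_derivative_affine_comp:
 assumes "smooth f" "bounded_linear A"
 shows "((%x. f (c + A x)) has_derivative (%h. frechet_derivative f (at (c + A x)) (A h))) (at x)"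
proof -
 have "((%x. c + A x) has_derivative A) (at x)"
  using has_derivative_add[OF has_derivative_const bounded_linear_imp_has_derivative[OF assms(2)], of c "at x"] by simp
 from has_derivative_compose[OF this smooth_has_derivative[OF assms(1)]] show ?thesis .
qed

lemma pderiv_dir_affine:
 assumes "smooth f" "bounded_linear A"
 shows "pderiv_dir v (%x. f (c + A x)) x = (\<Sum>b\<in>Basis. (A v \<bullet> b) * pderiv_dir b f (c + A x))"
 using pderiv_dir_eq[OF has_derivative_affine_comp[OF assms]] frechet_derivative_Basis[OF assms(1)] by simp

lemma pderiv_dir_cmult:
 fixes f :: "'a::euclidean_space => real"
 assumes "f differentiable (at x)" shows "pderiv_dir v (%x. k * f x) x = k * pderiv_dir v f x"
proof -
 have "((%x. k * f x) has_derivative (%h. k * frechet_derivative f (at x) h)) (at x)"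
  by (intro has_derivative_mult_right) (use assms frechet_derivative_works in blast)
 from pderiv_dir_eq[OF this] show ?thesis by (simp add: pderiv_dir_def)
qed

lemma affine_sum_pderiv:
 assumes A: "bounded_linear A"
 shows "affine_sum c A f ==> (\<forall>x. f differentiable (at x)) \<and> (v \<in> Basis \<longrightarrow> affine_sum c A (pderiv_dir v f))"
proof (induction rule: affine_sum.induct)
 case (1 f k)
 have d: "(%x. f (c + A x)) differentiable (at x)" for x
  using has_derivative_affine_comp[OF 1 A] by (auto simp: differentiable_def)
 have "pderiv_dir v (%x. k * f (c + A x)) = (%x. \<Sum>b\<in>Basis. (k * (A v \<bullet> b)) * pderiv_dir b f (c + A x))"
  by (simp add: fun_eq_iff pderiv_dir_cmult[OF d] pderiv_dir_affine[OF 1 A] sum_distrib_left mult.assoc)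
 moreover have "affine_sum c A (%x. \<Sum>b\<in>Basis. (k * (A v \<bullet> b)) * pderiv_dir b f (c + A x))"
  by (intro affine_sum_sum affine_sum.intros smooth_pderiv 1)
 ultimately show ?case using d by (auto intro: differentiable_mult)
next
 case (2 f g)
 have "pderiv_dir v (%x. f x + g x) = (%x. pderiv_dir v f x + pderiv_dir v g x)"
 proof
  fix x
  have "(f has_derivative frechet_derivative f (at x)) (at x)" "(g has_derivative frechet_derivative g (at x)) (at x)"
   using 2 frechet_derivative_works by blast+
  from pderiv_dir_eq[OF has_derivative_add[OF this], of v]
  show "pderiv_dir v (%x. f x + g x) x = pderiv_dir v f x + pderiv_dir v g x"
   by (simp add: pderiv_dir_def)
 qed
 with 2 show ?case by (auto intro: affine_sum.intros differentiable_add)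
qed

lemma smooth_affine:
 assumes "smooth f" "bounded_linear A" shows "smooth (%x. f (c + A x))"
proof (rule smooth_coinduct[where S="affine_sum c A"])
 show "affine_sum c A (%x. f (c + A x))" using affine_sum.intros(1)[OF assms(1), of c A 1] by simp
qed (use affine_sum_pderiv[OF assms(2)] in blast)+

lemma smooth_const: "smooth (%_. k)"
proof (rule smooth_coinduct[where S="%f. \<exists>k. f = (%_. k)"])
 show "\<exists>k. pderiv_dir v f = (%_. k)" if c: "\<exists>k. f = (%_. k)" for f :: "'a => real" and v
 proof -
  obtain k where f: "f = (%_. k)" using c by blast
  have "pderiv_dir v f x = 0" for x unfolding f using pderiv_dir_eq[OF has_derivative_const] .
  then show ?thesis by (intro exI[of _ 0]) (simp add: fun_eq_iff)
 qed
qed auto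

lemma smooth_cmult: "smooth f ==> smooth (%x. k * f x)"
 by (rule smooth_mult[OF smooth_const])

subsection \<open>Test functions\<close>

lemma not_support: "x \<notin> support f ==> f x = 0"
 unfolding support_def using closure_subset[of "{x. f x ~= 0}"] by auto

lemma support_subset_closed: "closed S ==> (!!x. x \<notin> S ==> f x = 0) ==> support f \<subseteq> S"
 unfolding support_def by (rule closure_minimal) auto

lemma support_mult: "support (%x. f x * g x) \<subseteq> support f"
proof (rule support_subset_closed)
 show "closed (support f)" by (simp add: support_def)
qed (simp add: not_support)

lemma support_pderiv: "support (pderiv_dir v f) \<subseteq> support f"
proof (rule support_subset_closed)
 show "closed (support f)" by (simp add: support_def)
 fix x assume x: "x \<notin> support f"
 have "open (- support f)" by (simp add: support_def open_Compl)
 have "(f has_derivative (%_. 0)) (at x)"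
  by (rule has_derivative_transform_within_open[of "%_. 0" _ _ _ "- support f"])
    (use x \<open>open (- support f)\<close> in \<open>auto simp: not_support\<close>)
 then show "pderiv_dir v f x = 0" by (rule pderiv_dir_eq)
qed

lemma compact_support_mono:
 assumes "compact (support f)" "support g \<subseteq> support f" shows "compact (support g)"
 using assms closed_Int_compact[of "support g" "support f"] by (simp add: Int_absorb2 support_def)

lemma test_fun_smooth: "test_fun W \<phi> ==> smooth \<phi>" by (simp add: test_fun_def)

lemma test_fun_pderiv: "test_fun W \<phi> ==> v \<in> Basis ==> test_fun W (pderiv_dir v \<phi>)"
 unfolding test_fun_def using support_pderiv[of v \<phi>]
 by (auto intro: smooth_pderiv compact_support_mono)

lemma test_fun_mult:
 assumes "test_fun W \<phi>" "smooth g" shows "test_fun W (%x. \<phi> x * g x)"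
 using assms support_mult[of \<phi> g] unfolding test_fun_def
 by (auto intro: smooth_mult compact_support_mono)

lemma test_fun_bounded_support:
 assumes "test_fun W (\<phi> :: 'a::euclidean_space => real)"
 obtains R where "R > 0" "!!x. norm x >= R ==> \<phi> x = 0"
proof -
 have "bounded (support \<phi>)" using assms by (auto simp: test_fun_def intro: compact_imp_bounded)
 then obtain R where R: "R > 0" "!!x. x \<in> support \<phi> ==> norm x < R"
  using bounded_pos_less by metis
 show thesis by (rule that[OF R(1)]) (use R(2) not_support in force)
qed

lemma test_fun_bounded:
 assumes "test_fun W (\<phi> :: 'a::euclidean_space => real)"
 obtains M where "M > 0" "!!x. \<bar>\<phi> x\<bar> <= M"
proof -
 have "compact (\<phi> ` support \<phi>)"
  using assms smooth_continuous[of \<phi>] by (auto simp: test_fun_def intro!: compact_continuous_image elim: continuous_on_subset)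
 then obtain M where M: "M > 0" "!!x. x \<in> support \<phi> ==> \<bar>\<phi> x\<bar> <= M"
  using compact_imp_bounded bounded_pos by (metis image_eqI real_norm_def)
 show thesis
  by (rule that[OF M(1)]) (use M not_support[of _ \<phi>] in \<open>force\<close>)
qed

lemma test_fun_integrable:
 assumes "test_fun W (\<phi> :: 'a::euclidean_space => real)" shows "integrable lborel \<phi>"
proof -
 obtain R where R: "R > 0" "!!x. norm x >= R ==> \<phi> x = 0" by (rule test_fun_bounded_support[OF assms]) blast
 obtain M where M: "M > 0" "!!x. \<bar>\<phi> x\<bar> <= M" by (rule test_fun_bounded[OF assms]) blast
 show ?thesis
 proof (rule Bochner_Integration.integrable_bound)
  show "integrable lborel (%x. M * indicator (ball 0 R) x)"
   by (intro integrable_mult_right integrable_indicator_bounded) auto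
  show "\<phi> \<in> borel_measurable lborel" using assms by (auto simp: test_fun_def dest: smooth_measurable)
  show "AE x in lborel. norm (\<phi> x) <= norm (M * indicator (ball 0 R) x)"
   using M R by (auto simp: indicator_def not_less)
 qed
qed

lemma line_derivative:
 assumes "smooth \<phi>"
 shows "((%t. \<phi> (x + t *\<^sub>R v)) has_real_derivative pderiv_dir v \<phi> (x + t *\<^sub>R v)) (at t)"
proof -
 have "((%t. \<phi> (x + t *\<^sub>R v)) has_derivative (%h. frechet_derivative \<phi> (at (x + t *\<^sub>R v)) (h *\<^sub>R v))) (at t)"
  by (rule has_derivative_affine_comp[OF assms]) (rule bounded_linear_scaleR_left)
 moreover have "(%h. frechet_derivative \<phi> (at (x + t *\<^sub>R v)) (h *\<^sub>R v)) = (*) (pderiv_dir v \<phi> (x + t *\<^sub>R v))"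
  by (auto simp: fun_eq_iff pderiv_dir_def linear_scale[OF linear_frechet_derivative[OF smooth_differentiable[OF assms]]])
 ultimately show ?thesis
  unfolding has_field_derivative_def by simp
qed

lemma test_fun_difference_quotient:
 fixes \<phi> :: "'a::euclidean_space => real"
 assumes \<phi>: "test_fun W \<phi>" and v: "v \<in> Basis"
 obtains C where "C >= 0" and "!!h x. h ~= 0 ==> \<bar>h\<bar> <= 1 ==> \<bar>(\<phi> (x + h *\<^sub>R v) - \<phi> x) / h\<bar> <= C * indicator (ball 0 C) x"
  and "!!x. \<bar>pderiv_dir v \<phi> x\<bar> <= C * indicator (ball 0 C) x"
proof -
 obtain R where R: "R > 0" "!!x. norm x >= R ==> \<phi> x = 0" by (rule test_fun_bounded_support[OF \<phi>]) blast
 obtain R' where R': "R' > 0" "!!x. norm x >= R' ==> pderiv_dir v \<phi> x = 0"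
  by (rule test_fun_bounded_support[OF test_fun_pderiv[OF \<phi> v]]) blast
 obtain M where M: "M > 0" "!!x. \<bar>pderiv_dir v \<phi> x\<bar> <= M" by (rule test_fun_bounded[OF test_fun_pderiv[OF \<phi> v]]) blast
 define C where "C = max M (max (R + 1) R')"
 have C: "C >= M" "C >= R + 1" "C >= R'" "C > 0" unfolding C_def using R by auto
 show thesis
 proof (rule that[of C])
  show "\<bar>pderiv_dir v \<phi> x\<bar> <= C * indicator (ball 0 C) x" for x
   using M(2)[of x] R'(2)[of x] C by (auto simp: indicator_def)
  fix h x assume h: "h ~= (0::real)" "\<bar>h\<bar> <= 1"
  show "\<bar>(\<phi> (x + h *\<^sub>R v) - \<phi> x) / h\<bar> <= C * indicator (ball 0 C) x"
  proof (cases "norm x < C")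
   case True
   have "norm (\<phi> (x + h *\<^sub>R v) - \<phi> (x + 0 *\<^sub>R v)) <= M * norm (h - 0)"
   proof (rule field_differentiable_bound[where S=UNIV and f'="%t. pderiv_dir v \<phi> (x + t *\<^sub>R v)"])
    show "((%t. \<phi> (x + t *\<^sub>R v)) has_field_derivative pderiv_dir v \<phi> (x + z *\<^sub>R v)) (at z within UNIV)" for z
     using line_derivative[OF test_fun_smooth[OF \<phi>]] by simp
   qed (use M in auto)
   then have "\<bar>(\<phi> (x + h *\<^sub>R v) - \<phi> x) / h\<bar> <= M"
    using h by (simp add: divide_le_eq)
   then show ?thesis using True C by (simp add: indicator_def)
  next
   case False
   have "norm (h *\<^sub>R v) <= 1" using h v by simp
   moreover have "norm x <= norm (x + h *\<^sub>R v) + norm (h *\<^sub>R v)"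
    using norm_triangle_ineq4[of "x + h *\<^sub>R v" "h *\<^sub>R v"] by simp
   ultimately have "\<phi> (x + h *\<^sub>R v) = 0" "\<phi> x = 0" using False C by (auto intro!: R)
   then show ?thesis using C by simp
  qed
 qed (use C in auto)
qed

definition hseq :: "nat => real" where "hseq n = 1 / real (Suc n)"

lemma hseq: "hseq n ~= 0" "\<bar>hseq n\<bar> <= 1" "hseq \<longlonglongrightarrow> 0" "filterlim hseq (at 0) sequentially"
proof -
 show "hseq \<longlonglongrightarrow> 0" unfolding hseq_def using LIMSEQ_inverse_real_of_nat by (simp add: divide_inverse)
 then show "filterlim hseq (at 0) sequentially" by (auto simp: filterlim_at hseq_def)
qed (auto simp: hseq_def)

lemma difference_quotient_tendsto:
 assumes "smooth \<phi>"
 shows "(%n. (\<phi> (x + hseq n *\<^sub>R v) - \<phi> x) / hseq n) \<longlonglongrightarrow> pderiv_dir v \<phi> x"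
proof -
 have "((%h. (\<phi> (x + h *\<^sub>R v) - \<phi> x) / h) \<longlongrightarrow> pderiv_dir v \<phi> x) (at 0)"
  using line_derivative[OF assms, of x v 0] by (simp add: has_field_derivative_iff)
 then show ?thesis using hseq(4) by (rule filterlim_compose)
qed

section \<open>Derivatives in the Hilbert space\<close>

subsection \<open>Real elements\<close>

abbreviation cr :: "('a => real) => 'a => complex" where
 "cr f \<equiv> %x. complex_of_real (f x)"

abbreviation Lr :: "(real^2 => real) => l2" where
 "Lr f \<equiv> cl (cr f)"

lemma square_integrable_real: "square_integrable (f :: real^2 => real) \<longleftrightarrow> SI (cr f)"
proof
 assume "SI (cr f)"
 then have "(%x. Re (complex_of_real (f x))) \<in> borel_measurable lborel"
  by (intro borel_measurable_continuous_on[of Re] continuous_intros SI_measurable)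
 then show "square_integrable f" using SI_integrable[OF \<open>SI (cr f)\<close>] by (simp add: square_integrable_def)
next
 assume "square_integrable f"
 then have "f \<in> borel_measurable lborel" by (simp add: square_integrable_def)
 then have "cr f \<in> borel_measurable lborel"
  by (intro borel_measurable_continuous_on[of complex_of_real] continuous_intros)
 then show "SI (cr f)" using \<open>square_integrable f\<close> by (simp add: square_integrable_def)
qed

lemma L2_norm_real: "SI (cr f) ==> L2_norm f = norm (Lr f)"
 unfolding norm_cl L2_norm_def by simp

lemma inner_Lr: "SI (cr f) ==> SI (cr g) ==> inner (Lr f) (Lr g) = (LBINT x. f x * g x)"
 by (simp add: inner_cl flip: of_real_mult)

definition RE :: "l2 => l2" where "RE x = cl (%t. complex_of_real (Re (rep x t)))"

lemma RE_cl: "SI f ==> RE (cl f) = cl (%t. complex_of_real (Re (f t)))"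
 unfolding RE_def
 by (rule cl_cong_AE) (auto simp: SI_Re SI_rep elim: eventually_mono[OF rep_cl])

lemma RE_Lr [simp]: "SI (cr f) ==> RE (Lr f) = Lr f"
 by (simp add: RE_cl)

lemma bounded_linear_RE: "bounded_linear RE"
proof (rule bounded_linear_intro[of _ 1])
 show "RE (x + y) = RE x + RE y" for x y
  using RE_cl[OF SI_add[OF SI_rep[of x] SI_rep[of y]]]
  by (simp add: cl_add SI_rep SI_Re RE_def)
 show "RE (c *\<^sub>R x) = c *\<^sub>R RE x" for c x
 proof -
  have "RE (c *\<^sub>R x) = RE (cl (%t. c *\<^sub>R rep x t))" by (simp add: cl_scaleR SI_rep)
  also have "\<dots> = cl (%t. c *\<^sub>R complex_of_real (Re (rep x t)))"
   by (subst RE_cl[OF SI_scaleR[OF SI_rep]]) (simp add: scaleR_conv_of_real)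
  also have "\<dots> = c *\<^sub>R RE x" unfolding RE_def by (rule cl_scaleR[OF SI_Re[OF SI_rep]])
  finally show ?thesis .
 qed
 show "norm (RE x) <= norm x * 1" for x
  using norm_cl_le[OF SI_Re[OF SI_rep[of x]] SI_rep[of x], of 1] by (simp add: RE_def abs_Re_le_cmod)
qed

lemma inner_cl_Re: "SI f ==> SI g ==> inner (cl f) (cl g) = (LBINT x. Re (f x * cnj (g x)))"
 unfolding inner_cl by (rule integral_Re[symmetric]) (intro SI_prod_integrable SI_cnj)

lemma inner_RE: "inner (RE x) y = inner x (RE y)"
proof -
 have "inner (RE x) (cl (rep y)) = inner (cl (rep x)) (RE y)"
  unfolding RE_def inner_cl_Re[OF SI_Re[OF SI_rep] SI_rep] inner_cl_Re[OF SI_rep SI_Re[OF SI_rep]] by simp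
 then show ?thesis by simp
qed

lemma RE_transl: "RE (transl y x) = transl y (RE x)"
proof -
 have "RE (transl y (cl (rep x))) = transl y (RE (cl (rep x)))"
  by (simp only: RE_cl[OF SI_rep] transl_cl[OF SI_rep] transl_cl[OF SI_Re[OF SI_rep]] RE_cl[OF SI_translate[OF SI_rep]])
 then show ?thesis by simp
qed

lemma real_element:
 assumes "RE x = x" obtains f where "SI (cr f)" "x = Lr f"
proof
 show "SI (cr (%t. Re (rep x t)))" by (rule SI_Re[OF SI_rep])
 show "x = Lr (%t. Re (rep x t))" using assms by (simp add: RE_def)
qed

subsection \<open>Difference quotients\<close>

definition dsym :: "2 => real^2 => complex" where "dsym k xi = \<i> * complex_of_real (xi $ k)"

lemma dsym_measurable [measurable]: "dsym k \<in> borel_measurable borel"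
 unfolding dsym_def[abs_def] by (intro borel_measurable_continuous_onI continuous_intros)

text \<open>A derivative is defined by its Fourier multiplier, and is equivalently a limit of difference quotients
  (\<open>isD_iff_dq\<close>); the second form gives Leibniz' rule and compatibility with test functions.\<close>

definition isD :: "2 => l2 => l2 => bool" where
 "isD k x y \<longleftrightarrow> mdom (dsym k) (FT x) \<and> FT y = mul (dsym k) (FT x)"

definition dq :: "2 => nat => l2 => l2" where
 "dq k n x = (1 / hseq n) *\<^sub>R (transl (hseq n *\<^sub>R axis k 1) x - x)"

lemma isD_unique: "isD k x y ==> isD k x z ==> y = z"
 unfolding isD_def by (metis FT_eq_iff)

lemma isD_diff: "isD k x y ==> isD k x' y' ==> isD k (x - x') (y - y')"
 by (simp add: isD_def FT_diff mul_diff)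

lemma isD_zero: "isD k 0 0"
 by (simp add: isD_def mul_zero)

lemma isD_rep: "isD k x y ==> AE xi in lborel. rep (FT y) xi = dsym k xi * rep (FT x) xi"
 unfolding isD_def using rep_mul by simp

lemma isD_ibp:
 assumes "isD k x x'" "isD k y y'" shows "inner x' y = - inner x y'"
proof -
 have "mdom (dsym k) (FT x)" "mdom (dsym k) (FT y)" using assms by (auto simp: isD_def)
 moreover have c: "(%xi. cnj (dsym k xi)) = (%xi. - dsym k xi)" by (auto simp: dsym_def)
 moreover have m: "mul (%xi. - dsym k xi) z = - mul (dsym k) z" if "mdom (dsym k) z" for z
  using that by (simp add: mul_def mdom_def cl_uminus)
 moreover have "mdom (%xi. - dsym k xi) (FT y)"
  using \<open>mdom (dsym k) (FT y)\<close> SI_uminus unfolding mdom_def by fastforce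
 ultimately have "inner (mul (dsym k) (FT x)) (FT y) = inner (FT x) (- mul (dsym k) (FT y))"
  using inner_mul[of "dsym k" "FT x" "FT y"] by simp
 then show ?thesis using assms unfolding inner_via_FT[of x'] inner_via_FT[of x] isD_def by simp
qed

lemma cis_difference_quotient:
 fixes a :: real
 shows "norm ((cis (h * a) - 1) / complex_of_real h) <= \<bar>a\<bar>"
  and "(%n. (cis (hseq n * a) - 1) / complex_of_real (hseq n)) \<longlonglongrightarrow> \<i> * complex_of_real a"
proof -
 have n: "norm (cis b - 1) <= \<bar>b\<bar>" for b
  using iexp_approx1[of b 0] by (simp add: cis_conv_exp)
 show "norm ((cis (h * a) - 1) / complex_of_real h) <= \<bar>a\<bar>"
  using n[of "h * a"] by (cases "h = 0") (auto simp: norm_divide divide_le_eq abs_mult mult.commute)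
 have m: "norm (cis b - (1 + \<i> * complex_of_real b)) <= b\<^sup>2 / 2" for b
  using iexp_approx1[of b 1] by (simp add: cis_conv_exp power2_eq_square numeral_2_eq_2)
 show "(%n. (cis (hseq n * a) - 1) / complex_of_real (hseq n)) \<longlonglongrightarrow> \<i> * complex_of_real a"
 proof (rule LIM_zero_cancel, rule Lim_null_comparison)
  show "\<forall>\<^sub>F n in sequentially. norm ((cis (hseq n * a) - 1) / complex_of_real (hseq n) - \<i> * complex_of_real a) <= \<bar>hseq n\<bar> * a\<^sup>2 / 2"
  proof (intro always_eventually allI)
   fix n
   let ?h = "hseq n"
   have h: "?h ~= 0" by (rule hseq)
   have "norm ((cis (?h * a) - 1) / complex_of_real ?h - \<i> * complex_of_real a) =
     norm ((cis (?h * a) - (1 + \<i> * complex_of_real (?h * a))) / complex_of_real ?h)"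
    using h by (simp add: field_simps)
   also have "\<dots> <= ((?h * a)\<^sup>2 / 2) / \<bar>?h\<bar>"
    unfolding norm_divide norm_of_real by (intro divide_right_mono m) auto
   also have "(?h * a)\<^sup>2 = \<bar>?h\<bar> * (\<bar>?h\<bar> * a\<^sup>2)"
    by (simp add: power_mult_distrib power2_eq_square[of ?h])
   also have "\<bar>?h\<bar> * (\<bar>?h\<bar> * a\<^sup>2) / 2 / \<bar>?h\<bar> = \<bar>?h\<bar> * a\<^sup>2 / 2"
    using h by (simp add: field_simps)
   finally show "norm ((cis (?h * a) - 1) / complex_of_real ?h - \<i> * complex_of_real a) <= \<bar>?h\<bar> * a\<^sup>2 / 2" .
  qed
  have "(%n. \<bar>hseq n\<bar> * a\<^sup>2 / 2) \<longlonglongrightarrow> \<bar>0\<bar> * a\<^sup>2 / 2" by (intro tendsto_intros hseq) simp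
  then show "(%n. \<bar>hseq n\<bar> * a\<^sup>2 / 2) \<longlonglongrightarrow> 0" by simp
 qed
qed

lemma FT_dq:
 "FT (dq k n x) = cl (%xi. (cis (hseq n * xi $ k) - 1) / complex_of_real (hseq n) * rep (FT x) xi)"
 "SI (%xi. (cis (hseq n * xi $ k) - 1) / complex_of_real (hseq n) * rep (FT x) xi)"
proof -
 have m: "(%xi. cis (hseq n * xi $ k)) \<in> borel_measurable borel"
  by (intro borel_measurable_continuous_onI continuous_intros)
 have d: "SI (%xi. cis (hseq n * xi $ k) * rep (FT x) xi)"
  using mdom_bounded[OF m, of 1] by (simp add: mdom_def)
 then have d': "SI (%xi. cis (hseq n * xi $ k) * rep (FT x) xi - rep (FT x) xi)"
  by (intro SI_diff SI_rep)
 have eq: "(cis (hseq n * xi $ k) - 1) / complex_of_real (hseq n) * rep (FT x) xi =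
   (1 / hseq n) *\<^sub>R (cis (hseq n * xi $ k) * rep (FT x) xi - rep (FT x) xi)" for xi
  by (simp add: scaleR_conv_of_real field_simps)
 show "SI (%xi. (cis (hseq n * xi $ k) - 1) / complex_of_real (hseq n) * rep (FT x) xi)"
  unfolding eq by (rule SI_scaleR[OF d'])
 have "FT (dq k n x) = (1 / hseq n) *\<^sub>R (mul (%xi. cis (hseq n * xi $ k)) (FT x) - FT x)"
  by (simp add: dq_def FT_scaleR FT_diff FT_transl inner_axis' del: scaleR_right_diff_distrib)
 also have "\<dots> = cl (%xi. (1 / hseq n) *\<^sub>R (cis (hseq n * xi $ k) * rep (FT x) xi - rep (FT x) xi))"
  by (simp only: cl_scaleR[OF d'] cl_diff[OF d SI_rep] mul_def cl_rep)
 finally show "FT (dq k n x) = cl (%xi. (cis (hseq n * xi $ k) - 1) / complex_of_real (hseq n) * rep (FT x) xi)"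
  unfolding eq .
qed

lemma L2_dominated:
 assumes f: "!!n::nat. SI (f n)" and g: "SI g" and w: "SI w"
  and lim: "AE x in lborel. (%n. f n x) \<longlonglongrightarrow> g x"
  and bnd: "!!n. AE x in lborel. norm (f n x) <= norm (w x)"
 shows "(%n. cl (f n)) \<longlonglongrightarrow> cl g"
proof -
 have S: "SI (%x. f n x - g x)" for n by (intro SI_diff f g)
 have "(%n. \<integral>x. (norm (f n x - g x))\<^sup>2 \<partial>lborel) \<longlonglongrightarrow> (\<integral>x. 0 \<partial>(lborel::(real^2) measure))"
 proof (rule integral_dominated_convergence[where w="%x. 2 * (norm (w x))\<^sup>2 + 2 * (norm (g x))\<^sup>2"])
  show "AE x in lborel. (%n. (norm (f n x - g x))\<^sup>2) \<longlonglongrightarrow> 0"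
   using lim by eventually_elim (auto intro!: tendsto_eq_intros)
  show "AE x in lborel. norm ((norm (f n x - g x))\<^sup>2) <= 2 * (norm (w x))\<^sup>2 + 2 * (norm (g x))\<^sup>2" for n
   using bnd[of n]
  proof eventually_elim
   case (elim x)
   have "norm (f n x - g x) <= norm (w x) + norm (g x)"
    using norm_triangle_ineq4[of "f n x" "g x"] elim by linarith
   then have "(norm (f n x - g x))\<^sup>2 <= (norm (w x) + norm (g x))\<^sup>2" by (intro power_mono) auto
   also have "\<dots> <= 2 * (norm (w x))\<^sup>2 + 2 * (norm (g x))\<^sup>2"
    using sum_squares_bound[of "norm (w x)" "norm (g x)"] by (simp add: power2_sum)
   finally show ?case by simp
  qed
  show "(%x. (norm (f n x - g x))\<^sup>2) \<in> borel_measurable lborel" for n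
   using borel_measurable_integrable[OF SI_integrable[OF S[of n]]] .
 qed (use SI_integrable[OF g] SI_integrable[OF w] in auto)
 then have "(%n. (norm (cl (f n) - cl g))\<^sup>2) \<longlonglongrightarrow> 0"
  by (simp add: norm_cl_sq S f g flip: cl_diff)
 from tendsto_real_sqrt[OF this] have "(%n. norm (cl (f n) - cl g)) \<longlonglongrightarrow> 0" by simp
 then show ?thesis by (rule LIM_zero_cancel[OF tendsto_norm_zero_cancel])
qed

lemma isD_iff_dq: "isD k x y \<longleftrightarrow> (%n. dq k n x) \<longlonglongrightarrow> y"
proof -
 define f where "f n xi = (cis (hseq n * xi $ k) - 1) / complex_of_real (hseq n) * rep (FT x) xi" for n xi
 have f: "SI (f n)" "FT (dq k n x) = cl (f n)" for n
  using FT_dq[where k=k and n=n and x=x] unfolding f_def[abs_def] by auto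
 have lim: "AE xi in lborel. (%n. f n xi) \<longlonglongrightarrow> dsym k xi * rep (FT x) xi"
  unfolding f_def dsym_def by (intro AE_I2 tendsto_mult tendsto_const cis_difference_quotient(2))
 have meas: "(%xi. dsym k xi * rep (FT x) xi) \<in> borel_measurable lborel"
  using SI_measurable[OF SI_rep[of "FT x"]] by simp
 show ?thesis
 proof
  assume D: "isD k x y"
  then have S: "SI (%xi. dsym k xi * rep (FT x) xi)" and y: "FT y = cl (%xi. dsym k xi * rep (FT x) xi)"
   by (auto simp: isD_def mdom_def mul_def)
  have "(%n. cl (f n)) \<longlonglongrightarrow> FT y"
   unfolding y
  proof (rule L2_dominated[OF f(1) S S lim])
   show "AE xi in lborel. norm (f n xi) <= norm (dsym k xi * rep (FT x) xi)" for n
   proof (rule AE_I2)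
    fix xi
    have "norm (f n xi) = norm ((cis (hseq n * xi $ k) - 1) / complex_of_real (hseq n)) * norm (rep (FT x) xi)"
     by (simp only: f_def norm_mult)
    also have "\<dots> <= \<bar>xi $ k\<bar> * norm (rep (FT x) xi)"
     by (rule mult_right_mono[OF cis_difference_quotient(1)]) simp
    finally show "norm (f n xi) <= norm (dsym k xi * rep (FT x) xi)"
     by (simp add: dsym_def norm_mult)
   qed
  qed
  then have "(%n. IFT (FT (dq k n x))) \<longlonglongrightarrow> IFT (FT y)"
   unfolding f(2)[symmetric] by (rule bounded_linear.tendsto[OF bounded_linear_IFT])
  then show "(%n. dq k n x) \<longlonglongrightarrow> y" by simp
 next
  assume "(%n. dq k n x) \<longlonglongrightarrow> y"
  then have "(%n. cl (f n)) \<longlonglongrightarrow> FT y"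
   unfolding f(2)[symmetric] by (rule bounded_linear.tendsto[OF bounded_linear_FT])
  from L2_limit_pointwise[OF f(1) meas lim this] show "isD k x y"
   by (simp add: isD_def mdom_def mul_def)
 qed
qed

lemma RE_dq: "RE (dq k n x) = dq k n (RE x)"
 unfolding dq_def using bounded_linear.linear[OF bounded_linear_RE]
 by (simp add: linear_diff linear_scale RE_transl)

lemma isD_RE: "isD k x y ==> isD k (RE x) (RE y)"
 unfolding isD_iff_dq RE_dq[symmetric] by (rule bounded_linear.tendsto[OF bounded_linear_RE])

lemma isD_real: "isD k x y ==> RE x = x ==> RE y = y"
 using isD_RE[of k x y] isD_unique by metis

lemma dq_Lr:
 assumes "SI (cr f)"
 shows "dq k n (Lr f) = Lr (%x. (f (x + hseq n *\<^sub>R axis k 1) - f x) / hseq n)"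
  "SI (cr (%x. (f (x + hseq n *\<^sub>R axis k 1) - f x) / hseq n))"
proof -
 note t = SI_translate[OF assms, of "hseq n *\<^sub>R axis k 1"]
 have eq: "cr (%x. (f (x + hseq n *\<^sub>R axis k 1) - f x) / hseq n) =
   (%x. (1 / hseq n) *\<^sub>R (cr f (x + hseq n *\<^sub>R axis k 1) - cr f x))"
  by (simp add: fun_eq_iff scaleR_conv_of_real)
 show "SI (cr (%x. (f (x + hseq n *\<^sub>R axis k 1) - f x) / hseq n))"
  unfolding eq by (intro SI_scaleR SI_diff t assms)
 show "dq k n (Lr f) = Lr (%x. (f (x + hseq n *\<^sub>R axis k 1) - f x) / hseq n)"
  unfolding eq dq_def transl_cl[OF assms] cl_scaleR[OF SI_diff[OF t assms]] cl_diff[OF t assms] ..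
qed

subsection \<open>Products\<close>

text \<open>Leibniz' rule for bounded functions: the difference quotient of a product is
  \<open>f(x+h) (g(x+h) - g(x)) / h + g(x) (f(x+h) - f(x)) / h\<close>, and translates of a bounded
  function act continuously on \<open>L\<^sup>2\<close>.\<close>

lemma SI_bounded_mult:
 assumes "SI g" "f \<in> borel_measurable borel" "!!x. norm (f x) <= (C::real)"
 shows "SI (%x. f x * g x)"
 by (rule SI_bound[OF _ assms(1), of _ C]) (use assms SI_measurable[OF assms(1)] in \<open>auto simp: norm_mult intro!: mult_right_mono\<close>)

lemma continuous_translates_mult:
 assumes f: "continuous_on UNIV f" "!!x. norm (f x) <= C" and g: "SI g"
  and gn: "!!n. SI (gn n)" and lim: "(%n. cl (gn n)) \<longlonglongrightarrow> cl g" and y: "y \<longlonglongrightarrow> (0::real^2)"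
 shows "(%n. cl (%x. f (x + y n) * gn n x)) \<longlonglongrightarrow> cl (%x. f x * g x)"
proof -
 have fm [measurable]: "f \<in> borel_measurable borel" using f(1) by (rule borel_measurable_continuous_onI)
 have S: "SI (%x. f (x + y n) * h x)" if "SI h" for h n
  by (rule SI_bounded_mult[OF that _ f(2)]) measurable
 have S0: "SI (%x. f x * g x)" by (rule SI_bounded_mult[OF g _ f(2)]) measurable
 have 1: "(%n. cl (%x. f (x + y n) * g x)) \<longlonglongrightarrow> cl (%x. f x * g x)"
 proof (rule L2_dominated[OF S[OF g] S0, where w="%x. complex_of_real C * g x"])
  show "SI (%x. complex_of_real C * g x)" by (rule SI_cmult[OF g])
  show "AE x in lborel. (%n. f (x + y n) * g x) \<longlonglongrightarrow> f x * g x"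
  proof (intro AE_I2 tendsto_mult tendsto_const)
   fix x
   have "(%n. x + y n) \<longlonglongrightarrow> x" using tendsto_add[OF tendsto_const y, of x] by simp
   then show "(%n. f (x + y n)) \<longlonglongrightarrow> f x"
    using f(1) by (auto intro: isCont_tendsto_compose[of x f] simp: continuous_on_eq_continuous_at)
  qed
  show "AE x in lborel. norm (f (x + y n) * g x) <= norm (complex_of_real C * g x)" for n
   using f(2) order_trans[OF norm_ge_zero f(2)] by (intro AE_I2) (auto simp: norm_mult intro!: mult_right_mono)
 qed
 have C: "C >= 0" using order_trans[OF norm_ge_zero f(2)] .
 have 2: "(%n. cl (%x. f (x + y n) * gn n x) - cl (%x. f (x + y n) * g x)) \<longlonglongrightarrow> 0"
 proof (rule Lim_null_comparison)
  show "\<forall>\<^sub>F n in sequentially. norm (cl (%x. f (x + y n) * gn n x) - cl (%x. f (x + y n) * g x)) <= C * norm (cl (gn n) - cl g)"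
  proof (intro always_eventually allI)
   fix n
   have "norm (cl (%x. f (x + y n) * (gn n x - g x))) <= C * norm (cl (%x. gn n x - g x))"
    by (rule norm_cl_le) (use S[OF SI_diff[OF gn g]] SI_diff[OF gn g] f(2) C in \<open>auto simp: norm_mult intro!: mult_right_mono\<close>)
   then show "norm (cl (%x. f (x + y n) * gn n x) - cl (%x. f (x + y n) * g x)) <= C * norm (cl (gn n) - cl g)"
    by (simp add: cl_diff S gn g right_diff_distrib)
  qed
  have "(%n. C * norm (cl (gn n) - cl g)) \<longlonglongrightarrow> C * norm (cl g - cl g)" by (intro tendsto_intros lim)
  then show "(%n. C * norm (cl (gn n) - cl g)) \<longlonglongrightarrow> 0" by simp
 qed
 from tendsto_add[OF 2 1] show ?thesis by simp
qed

subsection \<open>Multiplication by bounded continuous functions\<close>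

type_synonym bcf = "(real^2) \<Rightarrow>\<^sub>C real"

definition mb :: "bcf => l2 => l2" where "mb B x = mul (cr (apply_bcontfun B)) x"

lemma bcf_measurable [measurable]: "apply_bcontfun (B::bcf) \<in> borel_measurable borel"
 by (rule borel_measurable_continuous_onI) simp

lemma cr_bcf_measurable [measurable]: "cr (apply_bcontfun (B::bcf)) \<in> borel_measurable borel"
 by measurable

lemma norm_bcf: "norm (cr (apply_bcontfun (B::bcf)) x) <= norm B"
 using norm_bounded[of B x] by simp

lemma mb_mdom: "mdom (cr (apply_bcontfun (B::bcf))) x"
 by (rule mdom_bounded[OF cr_bcf_measurable norm_bcf])

lemma SI_bcf_mult: "SI f ==> SI (%x. complex_of_real (apply_bcontfun (B::bcf) x) * f x)"
 using SI_bounded_mult[OF _ cr_bcf_measurable norm_bcf] .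

lemma mb_cl: "SI f ==> mb B (cl f) = cl (%x. complex_of_real (apply_bcontfun B x) * f x)"
 unfolding mb_def by (rule mul_cl[OF cr_bcf_measurable _ SI_bcf_mult])

lemma mb_Lr:
 assumes "SI (cr g)"
 shows "SI (cr (%x. apply_bcontfun B x * g x))" "mb B (Lr g) = Lr (%x. apply_bcontfun B x * g x)"
 using mb_cl[OF assms, of B] SI_bcf_mult[OF assms, of B] by simp_all

lemma bounded_bilinear_mb: "bounded_bilinear mb"
proof
 fix A B :: bcf and x y :: l2 and r :: real
 show "mb (A + B) x = mb A x + mb B x"
 proof -
  have "mb (A + B) (cl (rep x)) = mb A (cl (rep x)) + mb B (cl (rep x))"
   by (simp only: mb_cl[OF SI_rep] cl_add[OF SI_bcf_mult[OF SI_rep] SI_bcf_mult[OF SI_rep], symmetric])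
     (simp add: distrib_right)
  then show ?thesis by simp
 qed
 show "mb (r *\<^sub>R B) x = r *\<^sub>R mb B x"
 proof -
  have "mb (r *\<^sub>R B) (cl (rep x)) = r *\<^sub>R mb B (cl (rep x))"
   by (simp only: mb_cl[OF SI_rep] cl_scaleR[OF SI_bcf_mult[OF SI_rep], symmetric])
     (simp add: scaleR_conv_of_real mult.assoc)
  then show ?thesis by simp
 qed
 show "mb B (x + y) = mb B x + mb B y" "mb B (r *\<^sub>R x) = r *\<^sub>R mb B x"
  unfolding mb_def by (intro mul_add(2) mul_scaleR(2) cr_bcf_measurable mb_mdom)+
 show "\<exists>K. \<forall>B x. norm (mb B x) <= norm B * norm x * K"
  unfolding mb_def using norm_mul_le[OF cr_bcf_measurable norm_bcf] by (intro exI[of _ 1]) auto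
qed

lemma norm_mb: "norm (mb B x) <= norm B * norm x"
 unfolding mb_def by (rule norm_mul_le[OF cr_bcf_measurable norm_bcf])

interpretation mb: bounded_bilinear mb by (rule bounded_bilinear_mb)

lemma inner_mb: "inner (mb B x) y = inner x (mb B y)"
 using inner_mul[OF mb_mdom, of B y x] mb_mdom[of B y] unfolding mb_def by simp

lemma mb_commute: "mb A (mb B x) = mb B (mb A x)"
proof -
 have "mb A (mb B (cl (rep x))) = mb B (mb A (cl (rep x)))"
  by (simp only: mb_cl[OF SI_rep] mb_cl[OF SI_bcf_mult[OF SI_rep]]) (simp add: mult_ac)
 then show ?thesis by simp
qed

lemma RE_mb: "RE (mb A x) = mb A (RE x)"
proof -
 have "RE (mb A (cl (rep x))) = mb A (RE (cl (rep x)))"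
  by (simp only: mb_cl[OF SI_rep] RE_cl[OF SI_rep] RE_cl[OF SI_bcf_mult[OF SI_rep]] mb_cl[OF SI_Re[OF SI_rep]]) simp
 then show ?thesis by simp
qed

lemma mb_swap:
 assumes "SI (cr (apply_bcontfun A))" "SI (cr (apply_bcontfun B))"
 shows "mb A (Lr (apply_bcontfun B)) = mb B (Lr (apply_bcontfun A))"
 using assms by (simp add: mb_cl mult.commute)

lemma isD_mult:
 fixes A B :: bcf
 assumes A: "SI (cr (apply_bcontfun A))" "isD k (Lr (apply_bcontfun A)) a'"
  and B: "SI (cr (apply_bcontfun B))" "isD k (Lr (apply_bcontfun B)) b'"
 shows "isD k (mb A (Lr (apply_bcontfun B))) (mb A b' + mb B a')"
proof -
 define h where "h n = hseq n *\<^sub>R axis k (1::real)" for n :: nat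
 have h0: "h \<longlonglongrightarrow> (0::real^2)" unfolding h_def using tendsto_scaleR[OF hseq(3) tendsto_const, of "axis k (1::real)"] by simp
 define qa where "qa n = cr (%x. (apply_bcontfun A (x + h n) - apply_bcontfun A x) / hseq n)" for n
 define qb where "qb n = cr (%x. (apply_bcontfun B (x + h n) - apply_bcontfun B x) / hseq n)" for n
 note qa = dq_Lr[OF A(1), where k=k, folded h_def, folded qa_def] and qb = dq_Lr[OF B(1), where k=k, folded h_def, folded qb_def]
 have la: "(%n. cl (qa n)) \<longlonglongrightarrow> cl (rep a')" and lb: "(%n. cl (qb n)) \<longlonglongrightarrow> cl (rep b')"
  using A(2) B(2) unfolding isD_iff_dq by (simp_all add: qa qb)
 have S1: "SI (%x. cr (apply_bcontfun A) (x + h n) * qb n x)" for n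
  by (rule SI_bounded_mult[OF qb(2) _ norm_bcf]) measurable
 have S2: "SI (%x. cr (apply_bcontfun B) (x + 0) * qa n x)" for n
  by (rule SI_bounded_mult[OF qa(2) _ norm_bcf]) measurable
 have "(%n. cl (%x. cr (apply_bcontfun A) (x + h n) * qb n x)) \<longlonglongrightarrow> cl (%x. cr (apply_bcontfun A) x * rep b' x)"
  by (rule continuous_translates_mult[OF _ norm_bcf SI_rep qb(2) lb h0]) (intro continuous_intros continuous_on_apply_bcontfun)
 moreover have "(%n. cl (%x. cr (apply_bcontfun B) (x + 0) * qa n x)) \<longlonglongrightarrow> cl (%x. cr (apply_bcontfun B) x * rep a' x)"
  by (rule continuous_translates_mult[OF _ norm_bcf SI_rep qa(2) la, where y="%_. 0"]) (intro continuous_intros continuous_on_apply_bcontfun tendsto_const)+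
 ultimately have "(%n. cl (%x. cr (apply_bcontfun A) (x + h n) * qb n x) + cl (%x. cr (apply_bcontfun B) (x + 0) * qa n x))
   \<longlonglongrightarrow> mb A b' + mb B a'"
  unfolding mb_def mul_def by (rule tendsto_add)
 moreover have "cl (%x. cr (apply_bcontfun A) (x + h n) * qb n x) + cl (%x. cr (apply_bcontfun B) (x + 0) * qa n x)
   = dq k n (mb A (Lr (apply_bcontfun B)))" for n
  unfolding mb_Lr(2)[OF B(1)] dq_Lr(1)[OF mb_Lr(1)[OF B(1)]] cl_add[OF S1 S2, symmetric]
  by (rule arg_cong[of _ _ cl], auto simp: fun_eq_iff qa_def qb_def h_def field_simps simp flip: of_real_mult of_real_add of_real_diff of_real_divide)
    (simp add: mult.commute flip: add_divide_distrib)
 ultimately show ?thesis unfolding isD_iff_dq by simp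
qed

section \<open>Sobolev spaces\<close>

definition wt :: "real => real^2 => complex" where
 "wt s xi = complex_of_real ((1 + (norm xi)\<^sup>2) powr (s / 2))"

abbreviation inHs :: "real => l2 => bool" where "inHs s x \<equiv> mdom (wt s) (FT x)"

definition Hsn :: "real => l2 => real" where "Hsn s x = norm (mul (wt s) (FT x))"

lemma one_plus_norm_ge: "1 <= 1 + (norm (xi::'a::real_normed_vector))\<^sup>2" "0 < 1 + (norm xi)\<^sup>2"
 by (auto simp: add_pos_nonneg)

lemma wt_measurable [measurable]: "wt s \<in> borel_measurable borel"
 unfolding wt_def[abs_def]
 by (intro borel_measurable_continuous_onI continuous_intros) (use one_plus_norm_ge(2) less_imp_neq in fastforce)

lemma norm_wt: "norm (wt s xi) = (1 + (norm xi)\<^sup>2) powr (s / 2)"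
 by (simp add: wt_def)

lemma wt_mult: "wt s xi * wt r xi = wt (s + r) xi"
 by (simp add: wt_def add_divide_distrib powr_add)

lemma wt_0: "wt 0 xi = 1"
 using one_plus_norm_ge(2)[of xi] by (simp add: wt_def)

lemma wt_mono: "s <= r ==> norm (wt s xi) <= norm (wt r xi)"
 unfolding norm_wt by (rule powr_mono) (auto simp: one_plus_norm_ge)

lemma mdom_dominated:
 assumes "m \<in> borel_measurable borel" "mdom m' x" "!!xi. norm (m xi) <= C * norm (m' xi)" "C >= 0"
 shows "mdom m x" "norm (mul m x) <= C * norm (mul m' x)"
proof -
 have le: "AE xi in lborel. norm (m xi * rep x xi) <= C * norm (m' xi * rep x xi)"
  using assms(3) by (intro AE_I2) (simp add: norm_mult mult_right_mono flip: mult.assoc)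
 have "(%xi. m xi * rep x xi) \<in> borel_measurable lborel"
  using assms(1) SI_measurable[OF SI_rep[of x]] by simp
 then show d: "mdom m x"
  unfolding mdom_def by (rule SI_bound[OF _ _ le]) (use assms(2) in \<open>simp add: mdom_def\<close>)
 show "norm (mul m x) <= C * norm (mul m' x)"
  unfolding mul_def using d assms(2) le assms(4) by (intro norm_cl_le) (auto simp: mdom_def)
qed

lemma inHs_mono:
 assumes "inHs r x" "s <= r" shows "inHs s x" "Hsn s x <= Hsn r x"
 using mdom_dominated[OF wt_measurable assms(1), of s 1] wt_mono[OF assms(2)] unfolding Hsn_def by auto

lemma inHs_diff: "inHs s x ==> inHs s y ==> inHs s (x - y)"
 by (simp add: FT_diff mul_diff)

lemma inHs_0 [simp]: "inHs 0 x"
 by (rule mdom_bounded[of _ 1]) (auto simp: wt_0)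

lemma Hsn_0: "Hsn 0 x = 2 * pi * norm x"
 unfolding Hsn_def mul_def wt_0 by (simp add: norm_FT)

lemma integrable_wt_1d:
 assumes "r > 1" shows "integrable lborel (%t::real. (1 + t\<^sup>2) powr (- r / 2))"
proof -
 have hi: "((%x. x powr (- r)) has_integral - (1 powr (- r + 1)) / (- r + 1)) {1..}"
  by (rule has_integral_powr_to_inf) (use assms in auto)
 have "(%x. x powr (- r)) absolutely_integrable_on {1..}"
  by (rule nonnegative_absolutely_integrable_1) (use hi in \<open>auto simp: integrable_on_def\<close>)
 then have "integrable lebesgue (%x. indicator {1..} x *\<^sub>R (x powr (- r)))"
  by (simp add: set_integrable_def)
 then have i: "integrable lborel (%x::real. indicator {1..} x *\<^sub>R (x powr (- r)))"
  by (subst (asm) integrable_completion) auto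
 have i': "integrable lborel (%x::real. indicator {1..} (0 + (-1) * x) *\<^sub>R ((0 + (-1) * x) powr (- r)))"
  by (rule lborel_integrable_real_affine[OF i]) simp
 have i0: "integrable lborel (indicator {-1..1} :: real => real)" by (intro integrable_indicator_bounded) auto
 show ?thesis
 proof (rule Bochner_Integration.integrable_bound)
  show "integrable lborel (%x::real. indicator {-1..1} x + indicator {1..} x *\<^sub>R (x powr (- r)) + indicator {1..} (0 + (-1) * x) *\<^sub>R ((0 + (-1) * x) powr (- r)))"
   by (intro Bochner_Integration.integrable_add i i' i0)
  show "(%t::real. (1 + t\<^sup>2) powr (- r / 2)) \<in> borel_measurable lborel" by measurable
  have le1: "(1 + t\<^sup>2) powr (- r / 2) <= 1" for t :: real
   using powr_mono2'[of "-r/2" 1 "1 + t\<^sup>2"] assms by simp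
  have le2: "(1 + t\<^sup>2) powr (- r / 2) <= \<bar>t\<bar> powr (- r)" if "\<bar>t\<bar> >= 1" for t :: real
  proof -
   have "(1 + t\<^sup>2) powr (- r / 2) <= (t\<^sup>2) powr (- r / 2)"
    using powr_mono2'[of "-r/2" "t\<^sup>2" "1 + t\<^sup>2"] assms that by (cases "t = 0") auto
   also have "(t\<^sup>2) powr (- r / 2) = \<bar>t\<bar> powr (- r)"
   proof -
    have e: "t\<^sup>2 = \<bar>t\<bar> powr 2" using that by (cases "t = 0") (auto simp: powr_numeral)
    show ?thesis unfolding e powr_powr by simp
   qed
   finally show ?thesis .
  qed
  show "AE x in lborel. norm ((1 + x\<^sup>2) powr (- r / 2)) <= norm (indicator {-1..1} x + indicator {1..} x *\<^sub>R (x powr (- r)) + indicator {1..} (0 + (-1) * x) *\<^sub>R ((0 + (-1) * x) powr (- r)))"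
  proof (rule AE_I2)
   fix x :: real
   show "norm ((1 + x\<^sup>2) powr (- r / 2)) <= norm (indicator {-1..1} x + indicator {1..} x *\<^sub>R (x powr (- r)) + indicator {1..} (0 + (-1) * x) *\<^sub>R ((0 + (-1) * x) powr (- r)))"
    using le1[of x] le2[of x] by (cases "x >= 1"; cases "x <= -1") (auto simp: indicator_def)
  qed
 qed
qed

lemma integrable_wt:
 assumes "s > 1" shows "integrable lborel (%xi::real^2. (1 + (norm xi)\<^sup>2) powr (- s))"
proof (rule Bochner_Integration.integrable_bound)
 show "integrable lborel (%xi::real^2. \<Prod>b\<in>Basis. (1 + (xi \<bullet> b)\<^sup>2) powr (- s / 2))"
  by (rule lborel_prod_integral(1)) (rule integrable_wt_1d[OF assms])
 show "AE xi in lborel. norm ((1 + (norm (xi::real^2))\<^sup>2) powr (- s)) <= norm (\<Prod>b\<in>Basis. (1 + (xi \<bullet> b)\<^sup>2) powr (- s / 2))"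
 proof (rule AE_I2)
  fix xi :: "real^2"
  have "(1 + (norm xi)\<^sup>2) powr (- s) = (\<Prod>b\<in>(Basis::(real^2) set). (1 + (norm xi)\<^sup>2) powr (- s / 2))"
   using one_plus_norm_ge(2)[of xi] by (simp add: prod_constant power2_eq_square flip: powr_add)
  also have "\<dots> <= (\<Prod>b\<in>Basis. (1 + (xi \<bullet> b)\<^sup>2) powr (- s / 2))"
  proof (rule prod_mono)
   fix b :: "real^2" assume b: "b \<in> Basis"
   have "\<bar>xi \<bullet> b\<bar> <= norm xi" using Basis_le_norm[OF b] .
   then have "(xi \<bullet> b)\<^sup>2 <= (norm xi)\<^sup>2" by (metis abs_le_square_iff abs_norm_cancel)
   moreover have "0 < 1 + (xi \<bullet> b)\<^sup>2" by (simp add: add_pos_nonneg)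
   ultimately show "0 <= (1 + (norm xi)\<^sup>2) powr (- s / 2) \<and> (1 + (norm xi)\<^sup>2) powr (- s / 2) <= (1 + (xi \<bullet> b)\<^sup>2) powr (- s / 2)"
    using powr_mono2'[of "-s/2" "1 + (xi \<bullet> b)\<^sup>2" "1 + (norm xi)\<^sup>2"] assms by auto
  qed
  finally show "norm ((1 + (norm xi)\<^sup>2) powr (- s)) <= norm (\<Prod>b\<in>Basis. (1 + (xi \<bullet> b)\<^sup>2) powr (- s / 2))"
   by simp
 qed
 show "(%xi::real^2. (1 + (norm xi)\<^sup>2) powr (- s)) \<in> borel_measurable lborel" by measurable
qed

lemma SI_wt_neg: "s > 1 ==> SI (wt (- s))"
 unfolding square_integrable_def using integrable_wt[of s]
 by (simp add: norm_wt powr_powr power2_eq_square flip: powr_add)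

definition wtc :: "real => real" where "wtc s = norm (cl (wt (- s)))"

lemma norm_integral_le_norms:
 assumes "SI f" "SI g"
 shows "(LBINT x. norm (f x * g x)) <= norm (cl f) * norm (cl g)"
proof -
 have S: "SI (cr (%x. norm (h x)))" "norm (Lr (%x. norm (h x))) = norm (cl h)" if h: "SI h" for h
 proof -
  show 1: "SI (cr (%x. norm (h x)))"
   by (rule SI_bound[OF _ h, of _ 1]) (use SI_measurable[OF h] in auto)
  have "(norm (Lr (%x. norm (h x))))\<^sup>2 = (norm (cl h))\<^sup>2" by (simp add: norm_cl_sq h 1)
  then show "norm (Lr (%x. norm (h x))) = norm (cl h)" by simp
 qed
 have "(LBINT x. norm (f x * g x)) = inner (Lr (%x. norm (f x))) (Lr (%x. norm (g x)))"
  by (simp add: inner_Lr S assms norm_mult)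
 also have "\<dots> <= norm (cl f) * norm (cl g)"
  using norm_cauchy_schwarz[of "Lr (%x. norm (f x))" "Lr (%x. norm (g x))"] by (simp add: S assms)
 finally show ?thesis .
qed

lemma FT_L1:
 assumes s: "s > 1" and x: "inHs s x"
 shows "integrable lborel (rep (FT x))" "(LBINT xi. norm (rep (FT x) xi)) <= wtc s * Hsn s x"
proof -
 have S: "SI (%xi. wt s xi * rep (FT x) xi)" using x by (simp add: mdom_def)
 have eq: "rep (FT x) xi = wt (- s) xi * (wt s xi * rep (FT x) xi)" for xi
  by (simp add: wt_mult wt_0 flip: mult.assoc)
 show "integrable lborel (rep (FT x))"
  using SI_prod_integrable[OF SI_wt_neg[OF s] S] by (simp flip: eq)
 show "(LBINT xi. norm (rep (FT x) xi)) <= wtc s * Hsn s x"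
  using norm_integral_le_norms[OF SI_wt_neg[OF s] S] unfolding wtc_def Hsn_def mul_def by (simp flip: eq)
qed

text \<open>The continuous representative, obtained from the absolutely convergent inversion integral.\<close>

definition ibc :: "(real^2 => complex) => bcf" where
 "ibc p = Bcontfun (%x. Re (fi p (- x)) / (2 * pi)\<^sup>2)"

lemma ibc_apply:
 assumes "integrable lborel p" shows "apply_bcontfun (ibc p) x = Re (fi p (- x)) / (2 * pi)\<^sup>2"
proof -
 have "(%x. Re (fi p (- x)) / (2 * pi)\<^sup>2) \<in> bcontfun"
 proof (rule bcontfun_normI)
  have "isCont (fi p) xi" for xi
   unfolding continuous_at_sequentially using fi_continuous[OF assms] by (auto simp: o_def)
  then have "continuous_on UNIV (fi p)" by (simp add: continuous_at_imp_continuous_on)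
  then have "continuous_on UNIV (%x. fi p (- x))"
   by (rule continuous_on_compose2[of UNIV _ UNIV "%x. - x"]) (auto intro: continuous_on_minus continuous_on_id)
  then show "continuous_on UNIV (%x. Re (fi p (- x)) / (2 * pi)\<^sup>2)" by (intro continuous_intros) auto
  show "norm (Re (fi p (- x)) / (2 * pi)\<^sup>2) <= (LBINT x. norm (p x)) / (2 * pi)\<^sup>2" for x
   using order_trans[OF abs_Re_le_cmod fi_norm_le[of p "- x"]] by (simp add: divide_right_mono)
 qed
 then show ?thesis unfolding ibc_def by (simp add: Bcontfun_inverse)
qed

lemma norm_ibc_le:
 assumes "integrable lborel p" shows "norm (ibc p) <= (LBINT x. norm (p x)) / (2 * pi)\<^sup>2"
proof (rule norm_bound)
 show "norm (apply_bcontfun (ibc p) x) <= (LBINT x. norm (p x)) / (2 * pi)\<^sup>2" for x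
  using order_trans[OF abs_Re_le_cmod fi_norm_le[of p "- x"]] by (simp add: ibc_apply[OF assms] divide_right_mono)
qed

lemma ibc_diff:
 assumes "integrable lborel p" "integrable lborel q" shows "ibc (%xi. p xi - q xi) = ibc p - ibc q"
 using assms by (intro bcontfun_eqI) (simp add: ibc_apply fi_diff diff_divide_distrib)

lemma ibc_scaleR:
 assumes "integrable lborel p" shows "ibc (%xi. c *\<^sub>R p xi) = c *\<^sub>R ibc p"
proof (rule bcontfun_eqI)
 fix x
 have "fi (%xi. c *\<^sub>R p xi) y = c *\<^sub>R fi p y" for y
  unfolding fourier_integral_def by (simp add: scaleR_conv_of_real mult.left_commute[of _ "complex_of_real c"])
 then show "apply_bcontfun (ibc (%xi. c *\<^sub>R p xi)) x = apply_bcontfun (c *\<^sub>R ibc p) x"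
  using assms by (simp add: ibc_apply)
qed

lemma ibc_cong_AE:
 assumes "integrable lborel p" "integrable lborel q" "AE x in lborel. p x = q x" shows "ibc p = ibc q"
proof -
 have "fi p xi = fi q xi" for xi
  unfolding fourier_integral_def by (rule integral_cong_AE) (use assms in \<open>auto elim: eventually_mono\<close>)
 then show ?thesis unfolding ibc_def by simp
qed

lemma Lr_ibc:
 assumes "SI p" "integrable lborel p"
 shows "Lr (apply_bcontfun (ibc p)) = RE (IFT (cl p))" "SI (cr (apply_bcontfun (ibc p)))"
proof -
 note I = IFT_integrable[OF assms]
 have eq: "cr (apply_bcontfun (ibc p)) = (%t. complex_of_real (Re ((1 / (2 * pi)\<^sup>2) *\<^sub>R fi p (- t))))"
  by (simp add: ibc_apply[OF assms(2)] fun_eq_iff)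
 show "Lr (apply_bcontfun (ibc p)) = RE (IFT (cl p))" unfolding eq I(1) RE_cl[OF I(2)] ..
 show "SI (cr (apply_bcontfun (ibc p)))" unfolding eq by (rule SI_Re[OF I(2)])
qed

definition bc :: "l2 => bcf" where "bc x = ibc (rep (FT x))"

lemma bc_real:
 assumes "s > 1" "inHs s x" "RE x = x"
 shows "Lr (apply_bcontfun (bc x)) = x" "SI (cr (apply_bcontfun (bc x)))"
 using Lr_ibc[OF SI_rep FT_L1(1)[OF assms(1,2)]] assms(3) by (simp_all add: bc_def)

lemma norm_bc_le:
 assumes "s > 1" "inHs s x" shows "norm (bc x) <= wtc s / (2 * pi)\<^sup>2 * Hsn s x"
 unfolding bc_def using norm_ibc_le[OF FT_L1(1)[OF assms]] FT_L1(2)[OF assms]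
 by (smt (verit) divide_right_mono times_divide_eq_left zero_le_power2)

lemma bc_diff:
 assumes "s > 1" "inHs s x" "inHs s y" shows "bc (x - y) = bc x - bc y"
 unfolding bc_def
proof (subst ibc_diff[symmetric])
 note i = FT_L1(1)[OF assms(1,2)] FT_L1(1)[OF assms(1,3)]
 show "ibc (rep (FT (x - y))) = ibc (%xi. rep (FT x) xi - rep (FT y) xi)"
  by (rule ibc_cong_AE) (use i FT_L1(1)[OF assms(1) inHs_diff[OF assms(2,3)]] rep_diff in \<open>auto simp: FT_diff\<close>)
qed (use FT_L1(1)[OF assms(1,2)] FT_L1(1)[OF assms(1,3)] in auto)

subsection \<open>Multipliers on Sobolev spaces\<close>

definition mop :: "(real^2 => complex) => l2 => l2" where "mop m x = IFT (mul m (FT x))"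

abbreviation Dk :: "2 => l2 => l2" where "Dk k \<equiv> mop (dsym k)"

definition fsym :: "real => real^2 => complex" where
 "fsym \<beta> xi = complex_of_real (norm xi powr (2 * \<beta>))"

lemma fsym_measurable [measurable]: "fsym \<beta> \<in> borel_measurable borel"
 unfolding fsym_def[abs_def] by measurable

lemma norm_component_le_wt: "norm (dsym k xi) <= norm (wt 1 xi)"
proof -
 have "norm (dsym k xi) <= norm xi" by (simp add: dsym_def norm_mult component_le_norm_cart)
 also have "\<dots> <= sqrt (1 + (norm xi)\<^sup>2)" by (rule real_le_rsqrt) simp
 finally show ?thesis using one_plus_norm_ge(2)[of xi] by (simp add: norm_wt powr_half_sqrt)
qed

lemma norm_powr_le_wt: "\<beta> >= 0 ==> norm xi powr \<beta> <= norm (wt \<beta> xi)"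
proof -
 assume b: "\<beta> >= 0"
 have "norm xi powr \<beta> <= (sqrt (1 + (norm xi)\<^sup>2)) powr \<beta>"
  by (rule powr_mono2[OF b]) (auto intro: real_le_rsqrt)
 also have "\<dots> = norm (wt \<beta> xi)"
  using one_plus_norm_ge(2)[of xi] by (simp add: norm_wt powr_half_sqrt[symmetric] powr_powr)
 finally show ?thesis .
qed

lemma mop_Hs:
 assumes m: "m \<in> borel_measurable borel" "!!xi. norm (m xi) <= norm (wt s xi)" and x: "inHs s x"
 shows "mdom m (FT x)" "norm (mop m x) <= Hsn s x"
proof -
 note d = mdom_dominated[OF m(1) x, of 1]
 show "mdom m (FT x)" using d m(2) by simp
 have "norm (mop m x) = norm (mul m (FT x)) / (2 * pi)" unfolding mop_def by (rule norm_IFT)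
 also have "\<dots> <= norm (mul m (FT x)) / 1"
  by (rule divide_left_mono) (use pi_gt3 in auto)
 also have "\<dots> <= Hsn s x" using d m(2) unfolding Hsn_def by simp
 finally show "norm (mop m x) <= Hsn s x" .
qed

lemma mop_diff:
 assumes m: "m \<in> borel_measurable borel" "!!xi. norm (m xi) <= norm (wt s xi)" and x: "inHs s x" "inHs s y"
 shows "mop m (x - y) = mop m x - mop m y"
 using mop_Hs(1)[OF m x(1)] mop_Hs(1)[OF m x(2)] unfolding mop_def by (simp add: FT_diff mul_diff m(1) IFT_diff)

lemma dsym_le_wt: "s >= 1 ==> norm (dsym k xi) <= norm (wt s xi)"
 using order_trans[OF norm_component_le_wt wt_mono] .

lemma fsym_le_wt: "0 <= \<beta> ==> 2 * \<beta> <= s ==> norm (fsym \<beta> xi) <= norm (wt s xi)"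
 using order_trans[OF norm_powr_le_wt[of "2 * \<beta>"] wt_mono] by (simp add: fsym_def)

lemma isD_Dk: "s >= 1 ==> inHs s x ==> isD k x (Dk k x)"
 unfolding isD_def using mop_Hs(1)[OF dsym_measurable dsym_le_wt, of s x k] by (simp add: mop_def)

section \<open>Weak derivatives of square integrable functions\<close>

subsection \<open>Band-limited functions\<close>

definition band_limited :: "(real^2 => complex) => bool" where
 "band_limited p \<longleftrightarrow> integrable lborel p \<and> (\<exists>N>0. \<forall>xi. norm xi >= N \<longrightarrow> p xi = 0)"

definition wave :: "(real^2 => complex) => real^2 => real" where
 "wave p x = Re (fi p (- x))"

lemma band_limited_mult:
 assumes p: "band_limited p" and m: "continuous_on UNIV m"
 shows "band_limited (%xi. m xi * p xi)"
proof -
 obtain N where N: "N > 0" "!!xi. norm xi >= N ==> p xi = 0" and i: "integrable lborel p"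
  using p by (auto simp: band_limited_def)
 have "compact (m ` cball 0 N)" using m by (intro compact_continuous_image) (auto elim: continuous_on_subset)
 from compact_imp_bounded[OF this] obtain C where "\<forall>y\<in>m ` cball 0 N. norm y <= C"
  unfolding bounded_iff by blast
 then have C: "!!xi. norm xi <= N ==> norm (m xi) <= C" by simp
 have "integrable lborel (%xi. m xi * p xi)"
 proof (rule Bochner_Integration.integrable_bound)
  show "integrable lborel (%xi. complex_of_real C * p xi)" using i by simp
  show "(%xi. m xi * p xi) \<in> borel_measurable lborel"
   using borel_measurable_continuous_onI[OF m] i by simp
  have "norm (m xi * p xi) <= norm (complex_of_real C * p xi)" for xi
  proof (cases "norm xi <= N")
   case True
   then show ?thesis using C[OF True] order_trans[OF norm_ge_zero C[OF True]] by (auto simp: norm_mult intro!: mult_right_mono)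
  qed (simp add: N)
  then show "AE xi in lborel. norm (m xi * p xi) <= norm (complex_of_real C * p xi)" by simp
 qed
 then show ?thesis using N by (auto simp: band_limited_def)
qed

lemma wave_has_derivative:
 assumes p: "band_limited p"
 shows "(wave p has_derivative (%h. wave (%xi. \<i> * complex_of_real (h \<bullet> xi) * p xi) x)) (at x)"
proof -
 obtain N where N: "N > 0" "!!xi. norm xi >= N ==> p xi = 0" and i: "integrable lborel p"
  using p by (auto simp: band_limited_def)
 let ?I = "\<integral>xi. norm (p xi) \<partial>lborel"
 define q where "q h xi = \<i> * complex_of_real (h \<bullet> xi) * p xi" for h xi
 have qi: "integrable lborel (q h)" for h
 proof -
  have "continuous_on UNIV (%xi::real^2. \<i> * complex_of_real (h \<bullet> xi))" by (intro continuous_intros)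
  from band_limited_mult[OF p this] show ?thesis unfolding q_def[abs_def] band_limited_def by simp
 qed
 have qn: "norm (q h xi) <= norm h * N * norm (p xi)" for h xi
 proof (cases "norm xi <= N")
  case True
  have "\<bar>h \<bullet> xi\<bar> <= norm h * N"
   using Cauchy_Schwarz_ineq2[of h xi] mult_left_mono[OF True, of "norm h"] by simp
  then show ?thesis by (auto simp: q_def norm_mult intro!: mult_right_mono)
 qed (simp add: q_def N)
 show ?thesis
  unfolding q_def[symmetric]
 proof (rule has_derivativeI_sandwich[of 1])
  show "bounded_linear (%h. wave (q h) x)"
  proof (rule bounded_linear_intro[of _ "N * ?I"])
   fix h k :: "real^2" and r :: real
   have "q (h + k) = (%xi. q h xi + q k xi)" by (auto simp: q_def fun_eq_iff inner_add_left algebra_simps)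
   then show "wave (q (h + k)) x = wave (q h) x + wave (q k) x"
    by (simp add: wave_def fi_add qi)
   have "q (r *\<^sub>R h) = (%xi. complex_of_real r * q h xi)" by (auto simp: q_def fun_eq_iff)
   moreover have "fi (%xi. complex_of_real r * q h xi) y = complex_of_real r * fi (q h) y" for y
    unfolding fourier_integral_def by (simp add: mult.left_commute[of _ "complex_of_real r"])
   ultimately show "wave (q (r *\<^sub>R h)) x = r *\<^sub>R wave (q h) x"
    by (simp add: wave_def)
   have "norm (wave (q h) x) <= (LBINT xi. norm (q h xi))"
    unfolding wave_def using order_trans[OF abs_Re_le_cmod fi_norm_le] by simp
   also have "\<dots> <= (LBINT xi. norm h * N * norm (p xi))"
    by (rule integral_mono) (use qi i qn in auto)
   finally show "norm (wave (q h) x) <= norm h * (N * ?I)" by (simp add: mult_ac)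
  qed
  show "((%y. N\<^sup>2 / 2 * ?I * norm (y - x)) \<longlongrightarrow> 0) (at x)"
   by (auto intro!: tendsto_eq_intros)
  fix y assume "y ~= x"
  define h where "h = y - x"
  have h0: "norm h > 0" using \<open>y ~= x\<close> by (simp add: h_def)
  have m: "norm (cis b - (1 + \<i> * complex_of_real b)) <= b\<^sup>2 / 2" for b
   using iexp_approx1[of b 1] by (simp add: cis_conv_exp power2_eq_square numeral_2_eq_2)
  define g where "g xi = cis (- (xi \<bullet> - y)) * p xi - cis (- (xi \<bullet> - x)) * p xi - cis (- (xi \<bullet> - x)) * q h xi" for xi
  have gi: "integrable lborel g"
   unfolding g_def[abs_def] by (intro Bochner_Integration.integrable_diff fi_integrable i qi)
  have gn: "norm (g xi) <= (norm h)\<^sup>2 * N\<^sup>2 / 2 * norm (p xi)" for xi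
  proof (cases "norm xi <= N")
   case True
   have "g xi = cis (xi \<bullet> x) * (cis (h \<bullet> xi) - (1 + \<i> * complex_of_real (h \<bullet> xi))) * p xi"
    by (simp add: g_def q_def h_def algebra_simps cis_mult inner_diff_left inner_commute[of xi])
   then have "norm (g xi) = norm (cis (h \<bullet> xi) - (1 + \<i> * complex_of_real (h \<bullet> xi))) * norm (p xi)"
    by (simp add: norm_mult)
   also have "\<dots> <= ((h \<bullet> xi)\<^sup>2 / 2) * norm (p xi)" by (intro mult_right_mono m) auto
   also have "\<dots> <= ((norm h * N)\<^sup>2 / 2) * norm (p xi)"
   proof (intro mult_right_mono divide_right_mono)
    have "\<bar>h \<bullet> xi\<bar> <= norm h * N"
     using Cauchy_Schwarz_ineq2[of h xi] mult_left_mono[OF True, of "norm h"] by simp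
    then show "(h \<bullet> xi)\<^sup>2 <= (norm h * N)\<^sup>2" by (metis abs_ge_zero power2_abs power_mono)
   qed auto
   finally show ?thesis by (simp add: power_mult_distrib)
  qed (simp add: g_def q_def N)
  have "wave p y - wave p x - wave (q h) x = Re (fi p (- y) - fi p (- x) - fi (q h) (- x))"
   by (simp add: wave_def)
  also have "fi p (- y) - fi p (- x) - fi (q h) (- x) = (LBINT xi. g xi)"
   unfolding fourier_integral_def g_def
   by (simp only: Bochner_Integration.integral_diff[symmetric] fi_integrable i qi Bochner_Integration.integrable_diff)
  finally have "norm (wave p y - wave p x - wave (q h) x) <= norm (LBINT xi. g xi)"
   using abs_Re_le_cmod by simp
  also have "\<dots> <= (LBINT xi. norm (g xi))" by (rule integral_norm_bound)
  also have "\<dots> <= (LBINT xi. (norm h)\<^sup>2 * N\<^sup>2 / 2 * norm (p xi))"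
   by (rule integral_mono) (use gi i gn in auto)
  also have "\<dots> = (N\<^sup>2 / 2 * ?I * norm h) * norm h" by (simp add: power2_eq_square)
  finally show "norm (wave p y - wave p x - wave (q (y - x)) x) / norm (y - x) <= N\<^sup>2 / 2 * ?I * norm (y - x)"
   using h0 by (simp add: h_def[symmetric] divide_le_eq)
 qed auto
qed

lemma pderiv_wave: "band_limited p ==> pderiv_dir v (wave p) = wave (%xi. \<i> * complex_of_real (v \<bullet> xi) * p xi)"
 by (rule ext) (rule pderiv_dir_eq[OF wave_has_derivative])

lemma smooth_wave: "band_limited p ==> smooth (wave p)"
proof (rule smooth_coinduct[where S="%f. \<exists>p. band_limited p \<and> f = wave p"])
 fix f :: "real^2 => real" and v x
 assume "\<exists>p. band_limited p \<and> f = wave p"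
 then obtain p where p: "band_limited p" "f = wave p" by blast
 show "f differentiable (at x)" using wave_has_derivative[OF p(1)] p(2) by (auto simp: differentiable_def)
 show "\<exists>p. band_limited p \<and> pderiv_dir v f = wave p"
  unfolding p(2) pderiv_wave[OF p(1)]
  by (intro exI[of _ "%xi. \<i> * complex_of_real (v \<bullet> xi) * p xi"] conjI refl band_limited_mult p) (intro continuous_intros)
qed auto

lemma ibc_band_limited:
 assumes "band_limited p"
 shows "apply_bcontfun (ibc p) = (%x. 1 / (2 * pi)\<^sup>2 * wave p x)"
  "smooth (apply_bcontfun (ibc p))"
  "pderiv_dir (axis k 1) (apply_bcontfun (ibc p)) = apply_bcontfun (ibc (%xi. dsym k xi * p xi))"
  "band_limited (%xi. dsym k xi * p xi)"
proof -
 have i: "integrable lborel p" using assms by (simp add: band_limited_def)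
 show eq: "apply_bcontfun (ibc p) = (%x. 1 / (2 * pi)\<^sup>2 * wave p x)"
  by (simp add: fun_eq_iff ibc_apply[OF i] wave_def)
 show "smooth (apply_bcontfun (ibc p))" unfolding eq by (rule smooth_cmult[OF smooth_wave[OF assms]])
 show b: "band_limited (%xi. dsym k xi * p xi)"
  by (rule band_limited_mult[OF assms]) (auto simp: dsym_def[abs_def] intro!: continuous_intros)
 then have i': "integrable lborel (%xi. dsym k xi * p xi)" by (simp add: band_limited_def)
 show "pderiv_dir (axis k 1) (apply_bcontfun (ibc p)) = apply_bcontfun (ibc (%xi. dsym k xi * p xi))"
 proof
  fix x
  have "pderiv_dir (axis k 1) (%x. 1 / (2 * pi)\<^sup>2 * wave p x) x = 1 / (2 * pi)\<^sup>2 * pderiv_dir (axis k 1) (wave p) x"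
   by (rule pderiv_dir_cmult[OF smooth_differentiable[OF smooth_wave[OF assms]]])
  also have "\<dots> = 1 / (2 * pi)\<^sup>2 * wave (%xi. dsym k xi * p xi) x"
   unfolding pderiv_wave[OF assms] dsym_def by (simp only: inner_axis' real_inner_1_left)
  finally show "pderiv_dir (axis k 1) (apply_bcontfun (ibc p)) x = apply_bcontfun (ibc (%xi. dsym k xi * p xi)) x"
   unfolding eq ibc_apply[OF i'] wave_def by simp
 qed
qed

lemma Lr_ibc_band_limited:
 assumes "SI p" "band_limited p"
 shows "SI (cr (apply_bcontfun (ibc p)))" "Lr (apply_bcontfun (ibc p)) = RE (IFT (cl p))"
 using Lr_ibc[of p] assms by (auto simp: band_limited_def)

lemma SI_band_limited_mult:
 assumes "SI p" "band_limited p" "continuous_on UNIV m"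
 shows "SI (%xi. m xi * p xi)"
proof -
 obtain N where N: "N > 0" "!!xi. norm xi >= N ==> p xi = 0"
  using assms by (auto simp: band_limited_def)
 have "compact (m ` cball 0 N)" using assms by (intro compact_continuous_image) (auto elim: continuous_on_subset)
 from compact_imp_bounded[OF this] obtain C where "\<forall>y\<in>m ` cball 0 N. norm y <= C"
  unfolding bounded_iff by blast
 then have C: "!!xi. norm xi <= N ==> norm (m xi) <= C" by simp
 have "norm (m xi * p xi) <= C * norm (p xi)" for xi
  using C[of xi] N(2)[of xi] by (cases "norm xi <= N") (auto simp: norm_mult intro!: mult_right_mono)
 moreover have "(%xi. m xi * p xi) \<in> borel_measurable lborel"
  using borel_measurable_continuous_onI[OF assms(3)] SI_measurable[OF assms(1)] by simp
 ultimately show ?thesis using SI_bound[OF _ assms(1)] by blast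
qed

lemma band_limited_trunc: "SI f ==> band_limited (trunc (real (Suc N)) f)"
 unfolding band_limited_def
 by (intro conjI trunc_integrable exI[of _ "real (Suc N)"]) (auto simp: indicator_def)

lemma trunc_zero_AE:
 assumes "SI f" "!!N. cl (trunc (real (Suc N)) f) = 0" shows "cl f = 0"
proof -
 have "filterlim (%n. real (Suc n)) at_top sequentially"
  using filterlim_compose[OF filterlim_real_sequentially filterlim_Suc] .
 from filterlim_compose[OF trunc_tendsto[OF assms(1)] this] show ?thesis
  using assms(2) by (simp add: LIMSEQ_const_iff)
qed

subsection \<open>Test functions in the Hilbert space\<close>

lemma test_fun_SI:
 assumes "test_fun W (\<phi> :: real^2 => real)" shows "SI (cr \<phi>)"
proof -
 obtain R where R: "R > 0" "!!x. norm x >= R ==> \<phi> x = 0" by (rule test_fun_bounded_support[OF assms]) blast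
 obtain M where M: "M > 0" "!!x. \<bar>\<phi> x\<bar> <= M" by (rule test_fun_bounded[OF assms]) blast
 have m: "cr \<phi> \<in> borel_measurable lborel" using smooth_measurable[OF test_fun_smooth[OF assms]] by simp
 show ?thesis
 proof (rule SI_I_bound[OF m])
  show "integrable lborel (%x. M\<^sup>2 * indicator (ball 0 R) x :: real)"
   by (intro integrable_mult_right integrable_indicator_bounded) auto
  show "AE x in lborel. (norm (cr \<phi> x))\<^sup>2 <= M\<^sup>2 * indicator (ball 0 R) x"
   using M R by (intro AE_I2) (auto simp: indicator_def not_less abs_le_square_iff[symmetric] intro: order_trans)
 qed
qed

lemma axis_Basis [simp]: "axis k (1::real) \<in> (Basis :: (real^2) set)"
 by (simp add: axis_in_Basis_iff)

lemma SI_indicator_ball: "SI (%x. complex_of_real (C * indicator (ball 0 R) x))"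
proof (rule SI_I_bound)
 show "integrable lborel (%x. C\<^sup>2 * indicator (ball 0 R) x :: real)"
  by (intro integrable_mult_right integrable_indicator_bounded) auto
qed (auto simp: indicator_def)

lemma isD_test_fun:
 assumes \<phi>: "test_fun W (\<phi> :: real^2 => real)"
 shows "isD k (Lr \<phi>) (Lr (pderiv_dir (axis k 1) \<phi>))"
proof -
 obtain C where C: "!!h x. h ~= 0 ==> \<bar>h\<bar> <= 1 ==> \<bar>(\<phi> (x + h *\<^sub>R axis k 1) - \<phi> x) / h\<bar> <= C * indicator (ball 0 C) x"
  using test_fun_difference_quotient[OF \<phi> axis_Basis] by metis
 show ?thesis
  unfolding isD_iff_dq dq_Lr(1)[OF test_fun_SI[OF \<phi>]]
 proof (rule L2_dominated[OF dq_Lr(2)[OF test_fun_SI[OF \<phi>]] test_fun_SI[OF test_fun_pderiv[OF \<phi> axis_Basis]] SI_indicator_ball[of C C]])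
  show "AE x in lborel. (%n. complex_of_real ((\<phi> (x + hseq n *\<^sub>R axis k 1) - \<phi> x) / hseq n)) \<longlonglongrightarrow> cr (pderiv_dir (axis k 1) \<phi>) x"
   by (intro AE_I2 tendsto_of_real difference_quotient_tendsto test_fun_smooth[OF \<phi>])
  show "AE x in lborel. norm (complex_of_real ((\<phi> (x + hseq n *\<^sub>R axis k 1) - \<phi> x) / hseq n)) <= norm (complex_of_real (C * indicator (ball 0 C) x))" for n
  proof (rule AE_I2)
   fix x
   show "norm (complex_of_real ((\<phi> (x + hseq n *\<^sub>R axis k 1) - \<phi> x) / hseq n)) <= norm (complex_of_real (C * indicator (ball 0 C) x))"
    unfolding norm_of_real using C[OF hseq(1)[of n] hseq(2)[of n], of x] by linarith
  qed
 qed
qed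

text \<open>A bump function, needed to turn smooth functions into test functions.\<close>

locale cutoff =
 fixes \<theta> :: "real^2 => real"
 assumes smooth_\<theta>: "smooth \<theta>" and compact_\<theta>: "compact (support \<theta>)" and \<theta>0: "\<theta> 0 = 1"
  and \<theta>_nonneg: "!!x. \<theta> x >= 0"
begin

lemma test_\<theta>: "test_fun UNIV \<theta>"
 by (simp add: test_fun_def smooth_\<theta> compact_\<theta>)

definition cut :: "nat => (real^2 => real) => real^2 => real" where
 "cut n g x = \<theta> (0 + hseq n *\<^sub>R x) * g x"

lemma smooth_scaled: "smooth (%x. \<theta> (0 + hseq n *\<^sub>R x))"
 by (rule smooth_affine[OF smooth_\<theta> bounded_linear_scaleR_right])

lemma test_fun_scaled: "test_fun UNIV (%x. \<theta> (0 + hseq n *\<^sub>R x))"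
proof -
 obtain R where R: "R > 0" "!!x. norm x >= R ==> \<theta> x = 0" by (rule test_fun_bounded_support[OF test_\<theta>]) blast
 have "support (%x. \<theta> (0 + hseq n *\<^sub>R x)) \<subseteq> cball 0 (R / \<bar>hseq n\<bar>)"
 proof (rule support_subset_closed)
  fix x :: "real^2" assume "x \<notin> cball 0 (R / \<bar>hseq n\<bar>)"
  then have "norm (hseq n *\<^sub>R x) >= R" using hseq(1)[of n] by (simp add: not_le divide_less_eq mult.commute)
  then show "\<theta> (0 + hseq n *\<^sub>R x) = 0" using R by simp
 qed simp
 then have "compact (support (%x. \<theta> (0 + hseq n *\<^sub>R x)))"
  by (metis compact_Int_closed compact_cball inf.absorb_iff2 closed_closure support_def)
 then show ?thesis using smooth_scaled[of n] by (simp add: test_fun_def)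
qed

lemma test_fun_cut: "smooth g ==> test_fun UNIV (cut n g)"
 unfolding cut_def[abs_def] by (rule test_fun_mult[OF test_fun_scaled])

lemma hseq_scale_tendsto: "(%n. \<theta>' (0 + hseq n *\<^sub>R x)) \<longlonglongrightarrow> \<theta>' 0" if "smooth \<theta>'" for \<theta>' :: "real^2 => real"
proof -
 have "(%n. 0 + hseq n *\<^sub>R x) \<longlonglongrightarrow> 0" using tendsto_scaleR[OF hseq(3) tendsto_const, of x] by simp
 moreover have "isCont \<theta>' 0" using smooth_continuous[OF that] by (simp add: continuous_on_eq_continuous_at)
 ultimately show ?thesis by (rule isCont_tendsto_compose[rotated])
qed

lemma cut_tendsto:
 assumes g: "smooth g" "SI (cr g)" shows "(%n. Lr (cut n g)) \<longlonglongrightarrow> Lr g"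
proof -
 obtain M where M: "M > 0" "!!x. \<bar>\<theta> x\<bar> <= M" by (rule test_fun_bounded[OF test_\<theta>]) blast
 show ?thesis
 proof (rule L2_dominated[OF test_fun_SI[OF test_fun_cut[OF g(1)]] g(2) SI_cmult[OF g(2), of M]])
  show "AE x in lborel. (%n. complex_of_real (cut n g x)) \<longlonglongrightarrow> complex_of_real (g x)"
   using hseq_scale_tendsto[OF smooth_\<theta>] \<theta>0 by (intro AE_I2 tendsto_of_real) (auto simp: cut_def intro!: tendsto_eq_intros)
  show "AE x in lborel. norm (complex_of_real (cut n g x)) <= norm (complex_of_real M * complex_of_real (g x))" for n
   using M by (intro AE_I2) (auto simp: cut_def norm_mult abs_mult intro!: mult_right_mono)
 qed
qed

lemma pderiv_cut:
 assumes "smooth g"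
 shows "pderiv_dir v (cut n g) x = \<theta> (0 + hseq n *\<^sub>R x) * pderiv_dir v g x
   + (\<Sum>b\<in>Basis. (hseq n *\<^sub>R v \<bullet> b) * pderiv_dir b \<theta> (0 + hseq n *\<^sub>R x)) * g x"
 unfolding cut_def[abs_def] pderiv_dir_mult[OF smooth_scaled assms]
 by (simp only: pderiv_dir_affine[OF smooth_\<theta> bounded_linear_scaleR_right])

lemma cut_deriv_tendsto:
 assumes g: "smooth g" "SI (cr g)" "SI (cr (pderiv_dir (axis k 1) g))"
 shows "(%n. Lr (pderiv_dir (axis k 1) (cut n g))) \<longlonglongrightarrow> Lr (pderiv_dir (axis k 1) g)"
proof -
 let ?v = "axis k 1 :: real^2"
 obtain M where M: "M > 0" "!!x. \<bar>\<theta> x\<bar> <= M" by (rule test_fun_bounded[OF test_\<theta>]) blast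
 obtain M' where M': "M' > 0" "!!x. \<bar>pderiv_dir ?v \<theta> x\<bar> <= M'"
  by (rule test_fun_bounded[OF test_fun_pderiv[OF test_\<theta> axis_Basis]]) blast
 have eq: "pderiv_dir ?v (cut n g) x = \<theta> (0 + hseq n *\<^sub>R x) * pderiv_dir ?v g x
   + hseq n * pderiv_dir ?v \<theta> (0 + hseq n *\<^sub>R x) * g x" for n x
 proof -
  have "(\<Sum>b\<in>Basis. (hseq n *\<^sub>R ?v \<bullet> b) * pderiv_dir b \<theta> (0 + hseq n *\<^sub>R x)) =
    (\<Sum>b\<in>Basis. if b = ?v then hseq n * pderiv_dir ?v \<theta> (0 + hseq n *\<^sub>R x) else 0)"
   by (rule sum.cong) (auto simp: inner_Basis)
  also have "\<dots> = hseq n * pderiv_dir ?v \<theta> (0 + hseq n *\<^sub>R x)" by (subst sum.delta) auto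
  finally show ?thesis unfolding pderiv_cut[OF g(1)] by simp
 qed
 define w where "w x = complex_of_real (M * \<bar>pderiv_dir ?v g x\<bar> + M' * \<bar>g x\<bar>)" for x
 have w: "SI w"
 proof -
  have a: "SI (%x. complex_of_real C * complex_of_real \<bar>h x\<bar>)" if "SI (cr h)" for h C
   by (rule SI_bound[OF _ that, of _ "\<bar>C\<bar>"]) (use SI_measurable[OF that] square_integrable_real[of h] that in \<open>auto simp: norm_mult square_integrable_def\<close>)
  show ?thesis unfolding w_def[abs_def] of_real_add of_real_mult by (intro SI_add a g)
 qed
 show ?thesis
 proof (rule L2_dominated[OF test_fun_SI[OF test_fun_pderiv[OF test_fun_cut[OF g(1)] axis_Basis]] g(3) w])
  show "AE x in lborel. (%n. complex_of_real (pderiv_dir ?v (cut n g) x)) \<longlonglongrightarrow> complex_of_real (pderiv_dir ?v g x)"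
  proof (intro AE_I2 tendsto_of_real)
   fix x
   have "(%n. \<theta> (0 + hseq n *\<^sub>R x) * pderiv_dir ?v g x + hseq n * pderiv_dir ?v \<theta> (0 + hseq n *\<^sub>R x) * g x) \<longlonglongrightarrow>
     \<theta> 0 * pderiv_dir ?v g x + 0 * pderiv_dir ?v \<theta> 0 * g x"
    by (intro tendsto_intros hseq hseq_scale_tendsto smooth_\<theta> smooth_pderiv axis_Basis)
   then show "(%n. pderiv_dir ?v (cut n g) x) \<longlonglongrightarrow> pderiv_dir ?v g x" unfolding eq by (simp add: \<theta>0)
  qed
  show "AE x in lborel. norm (complex_of_real (pderiv_dir ?v (cut n g) x)) <= norm (w x)" for n
  proof (rule AE_I2)
   fix x
   have "\<bar>pderiv_dir ?v (cut n g) x\<bar> <= \<bar>\<theta> (0 + hseq n *\<^sub>R x)\<bar> * \<bar>pderiv_dir ?v g x\<bar> + \<bar>hseq n\<bar> * \<bar>pderiv_dir ?v \<theta> (0 + hseq n *\<^sub>R x)\<bar> * \<bar>g x\<bar>"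
    unfolding eq by (rule order_trans[OF abs_triangle_ineq]) (simp add: abs_mult)
   also have "\<dots> <= M * \<bar>pderiv_dir ?v g x\<bar> + 1 * M' * \<bar>g x\<bar>"
    by (intro add_mono mult_mono M M' hseq) (use M M' in auto)
   finally show "norm (complex_of_real (pderiv_dir ?v (cut n g) x)) <= norm (w x)"
    unfolding w_def norm_of_real by linarith
  qed
 qed
qed

text \<open>Testing against cut-off band-limited functions amounts to testing on the Fourier side.\<close>

lemma test_fun_total:
 assumes real: "RE x = x" and 0: "!!\<phi>. test_fun UNIV \<phi> ==> inner x (Lr \<phi>) = 0"
 shows "x = 0"
proof -
 let ?f = "rep (FT x)"
 have "cl (trunc (real (Suc N)) ?f) = 0" for N
 proof -
  define p where "p = trunc (real (Suc N)) ?f"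
  have S: "SI p" "band_limited p" unfolding p_def by (rule SI_trunc[OF SI_rep], rule band_limited_trunc[OF SI_rep])
  note L = Lr_ibc_band_limited[OF S]
  have "(%n. inner x (Lr (cut n (apply_bcontfun (ibc p))))) \<longlonglongrightarrow> inner x (Lr (apply_bcontfun (ibc p)))"
   by (intro tendsto_intros cut_tendsto ibc_band_limited S L)
  moreover have "inner x (Lr (cut n (apply_bcontfun (ibc p)))) = 0" for n
   by (intro 0 test_fun_cut ibc_band_limited S)
  ultimately have "inner x (Lr (apply_bcontfun (ibc p))) = 0" by (simp add: LIMSEQ_const_iff)
  then have "inner x (IFT (cl p)) = 0" unfolding L(2) by (simp add: real flip: inner_RE)
  then have "inner (FT x) (cl p) = 0" unfolding inner_via_FT[of x] by simp
  also have "inner (FT x) (cl p) = inner (cl ?f) (cl p)" by simp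
  also have "\<dots> = inner (cl p) (cl p)"
   unfolding inner_cl[OF SI_rep S(1)] inner_cl[OF S(1) S(1)]
   by (intro arg_cong[of _ _ Re] Bochner_Integration.integral_cong refl) (auto simp: p_def indicator_def)
  finally show ?thesis unfolding p_def by simp
 qed
 from trunc_zero_AE[OF SI_rep this] have "FT x = 0" by simp
 then show ?thesis using FT_eq_iff[of x 0] by simp
qed

text \<open>The Fourier side of an identity between distributional derivatives of two different functions,
  neither of which needs to be differentiable by itself.\<close>

lemma test_fun_curl:
 assumes real: "RE x = x" "RE y = y"
  and eq: "!!\<phi>. test_fun UNIV \<phi> ==> inner x (Lr (pderiv_dir (axis k 1) \<phi>)) = inner y (Lr (pderiv_dir (axis l 1) \<phi>))"
 shows "AE xi in lborel. dsym k xi * rep (FT x) xi = dsym l xi * rep (FT y) xi"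
proof -
 define e where "e xi = dsym k xi * rep (FT x) xi - dsym l xi * rep (FT y) xi" for xi
 have [measurable]: "rep z \<in> borel_measurable borel" for z using SI_measurable[OF SI_rep] by simp
 have em: "e \<in> borel_measurable borel" unfolding e_def[abs_def] by measurable
 have "AE xi in lborel. trunc (real (Suc N)) e xi = 0" for N
 proof -
  define p where "p = trunc (real (Suc N)) e"
  have cd: "continuous_on UNIV (dsym j)" for j by (auto simp: dsym_def[abs_def] intro!: continuous_intros)
  have tr: "trunc R e = (%xi. dsym k xi * trunc R (rep (FT x)) xi - dsym l xi * trunc R (rep (FT y)) xi)" for R
   by (auto simp: e_def fun_eq_iff scaleR_conv_of_real algebra_simps)
  have pS: "SI p" unfolding p_def tr by (intro SI_diff SI_band_limited_mult SI_trunc SI_rep band_limited_trunc cd)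
  have pb: "band_limited p" unfolding band_limited_def
  proof
   show "integrable lborel p"
    by (rule SI_integrable_bounded_support[OF pS, of "ball 0 (real (Suc N))"]) (auto simp: p_def)
   show "\<exists>N>0. \<forall>xi. N <= norm xi \<longrightarrow> p xi = 0"
    by (intro exI[of _ "real (Suc N)"]) (auto simp: p_def indicator_def)
  qed
  define q where "q xi = (- 1) * p xi" for xi
  have S: "SI q" "band_limited q" unfolding q_def[abs_def]
   by (intro SI_cmult pS band_limited_mult pb continuous_intros)+
  note L = Lr_ibc_band_limited[OF S] and b = ibc_band_limited[OF S(2)]
  have Sd: "SI (%xi. dsym j xi * q xi)" for j by (rule SI_band_limited_mult[OF S cd])
  note Ld = Lr_ibc_band_limited[OF Sd b(4)]
  have lim: "(%n. inner z (Lr (pderiv_dir (axis j 1) (cut n (apply_bcontfun (ibc q)))))) \<longlonglongrightarrow>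
    inner z (Lr (pderiv_dir (axis j 1) (apply_bcontfun (ibc q))))" for z j
   by (intro tendsto_intros cut_deriv_tendsto b L) (simp add: b(3) Ld)
  have "inner x (Lr (pderiv_dir (axis k 1) (apply_bcontfun (ibc q)))) = inner y (Lr (pderiv_dir (axis l 1) (apply_bcontfun (ibc q))))"
   using LIMSEQ_unique[OF lim[of x k]] lim[of y l] eq[OF test_fun_cut[OF b(2)]] by simp
  then have "inner (FT x) (cl (%xi. dsym k xi * q xi)) = inner (FT y) (cl (%xi. dsym l xi * q xi))"
   unfolding b(3) Ld(2) inner_RE[symmetric] real unfolding inner_via_FT[of x] inner_via_FT[of y] by simp
  then have "inner (cl (rep (FT x))) (cl (%xi. dsym k xi * q xi)) - inner (cl (rep (FT y))) (cl (%xi. dsym l xi * q xi)) = 0"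
   by simp
  also have "inner (cl (rep (FT x))) (cl (%xi. dsym k xi * q xi)) - inner (cl (rep (FT y))) (cl (%xi. dsym l xi * q xi))
   = Re (LBINT xi. rep (FT x) xi * cnj (dsym k xi * q xi) - rep (FT y) xi * cnj (dsym l xi * q xi))"
   unfolding inner_cl[OF SI_rep Sd]
   by (subst Bochner_Integration.integral_diff) (simp_all only: minus_complex.simps SI_prod_integrable[OF SI_rep SI_cnj[OF Sd]])
  also have "\<dots> = Re (LBINT xi. p xi * cnj (p xi))"
   by (intro arg_cong[of _ _ Re] Bochner_Integration.integral_cong refl)
     (auto simp: q_def p_def e_def dsym_def indicator_def algebra_simps)
  also have "\<dots> = inner (cl p) (cl p)" by (simp add: inner_cl pS)
  finally have "cl p = cl (%_. 0)" by simp
  then show ?thesis using cl_eq_iff[OF pS SI_zero] unfolding p_def by simp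
 qed
 then have "AE xi in lborel. \<forall>N. trunc (real (Suc N)) e xi = 0" unfolding AE_all_countable by blast
 then show ?thesis
 proof eventually_elim
  case (elim xi)
  obtain N :: nat where "norm xi < real N" using reals_Archimedean2 by blast
  then have "xi \<in> ball 0 (real (Suc N))" by simp
  then show ?case using elim[rule_format, of N] by (simp add: e_def)
 qed
qed

lemma weak_deriv_isD:
 assumes f: "SI (cr f)" and D: "isD k (Lr f) y"
 shows "SI (cr (weak_deriv k f))" "Lr (weak_deriv k f) = y"
proof -
 define P where "P g \<longleftrightarrow> square_integrable g \<and>
   (\<forall>\<phi>. test_fun UNIV \<phi> \<longrightarrow>
    (LBINT x. f x * pderiv_dir (axis k 1) \<phi> x) = - (LBINT x. g x * \<phi> x))" for g :: "real^2 => real"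
 have y: "RE y = y" using isD_real[OF D] f by simp
 have P_iff: "P g \<longleftrightarrow> SI (cr g) \<and> (\<forall>\<phi>. test_fun UNIV \<phi> \<longrightarrow> inner y (Lr \<phi>) = inner (Lr g) (Lr \<phi>))" for g
 proof -
  have "(LBINT x. f x * pderiv_dir (axis k 1) \<phi> x) = - inner y (Lr \<phi>)" if "test_fun UNIV \<phi>" for \<phi>
   using isD_ibp[OF D isD_test_fun[OF that]] inner_Lr[OF f test_fun_SI[OF test_fun_pderiv[OF that axis_Basis]]] by simp
  then show ?thesis unfolding P_def square_integrable_real by (auto simp: inner_Lr test_fun_SI)
 qed
 obtain g0 where "SI (cr g0)" "y = Lr g0" using real_element[OF y] by blast
 then have "P g0" by (simp add: P_iff)
 moreover have "weak_deriv k f = (SOME g. P g)" unfolding weak_deriv_def P_def ..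
 ultimately have "P (weak_deriv k f)" by (metis someI)
 then have w: "SI (cr (weak_deriv k f))" "!!\<phi>. test_fun UNIV \<phi> ==> inner (y - Lr (weak_deriv k f)) (Lr \<phi>) = 0"
  by (auto simp: P_iff inner_diff_left)
 show "SI (cr (weak_deriv k f))" by (rule w)
 have "RE (y - Lr (weak_deriv k f)) = y - Lr (weak_deriv k f)"
  using linear_diff[OF bounded_linear.linear[OF bounded_linear_RE]] y w(1) by simp
 from test_fun_total[OF this w(2)] show "Lr (weak_deriv k f) = y" by simp
qed

end

lemma frac_laplacian_mop:
 assumes f: "SI (cr f)" and d: "mdom (fsym \<beta>) (FT (Lr f))"
 shows "SI (cr (frac_laplacian \<beta> f))" "Lr (frac_laplacian \<beta> f) = RE (mop (fsym \<beta>) (Lr f))"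
proof -
 have S: "SI (%xi. fsym \<beta> xi * fourier (cr f) xi)"
  using d by (simp add: FT_cl f mdom_cl SI_fourier)
 have eq: "cr (frac_laplacian \<beta> f) = (%x. complex_of_real (Re (inv_fourier (%xi. fsym \<beta> xi * fourier (cr f) xi) x)))"
  by (simp add: frac_laplacian_def[abs_def] fsym_def)
 note I = cl_inv_fourier[OF S]
 show "SI (cr (frac_laplacian \<beta> f))" unfolding eq by (rule SI_Re[OF I(1)])
 show "Lr (frac_laplacian \<beta> f) = RE (mop (fsym \<beta>) (Lr f))"
  unfolding eq RE_cl[OF I(1), symmetric] I(2) mop_def by (simp add: FT_cl f mul_cl SI_fourier S)
qed

lemma in_Hs_iff: "in_Hs s f \<longleftrightarrow> SI (cr f) \<and> inHs s (Lr f)"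
proof -
 have "inHs s (Lr f) \<longleftrightarrow> SI (Hs_weighted s f)" if "SI (cr f)"
  unfolding Hs_weighted_def[abs_def] by (simp add: FT_cl that mdom_cl SI_fourier wt_def)
 then show ?thesis unfolding in_Hs_def square_integrable_real by blast
qed

lemma Hs_norm_eq: "in_Hs s f ==> Hs_norm s f = Hsn s (Lr f) / (2 * pi)"
proof -
 assume f: "in_Hs s f"
 then have S: "SI (cr f)" "SI (Hs_weighted s f)" by (auto simp: in_Hs_def square_integrable_real)
 have w: "Hs_weighted s f = (%xi. wt s xi * fourier (cr f) xi)" by (simp add: Hs_weighted_def[abs_def] wt_def)
 show ?thesis
  unfolding Hs_norm_def Hsn_def norm_cl[OF S(2), symmetric]
  using S by (simp add: FT_cl mul_cl SI_fourier w)
qed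

section \<open>A product estimate in fractional Sobolev spaces\<close>

lemma FT_modulate_cmult: "FT (mul (%x. c * cis (x \<bullet> zeta)) x) = mul (%_. c) (transl (- zeta) (FT x))"
proof (rule l2_ext_integrable[where A="%x. FT (mul (%x. c * cis (x \<bullet> zeta)) x)" and B="%x. mul (%_. c) (transl (- zeta) (FT x))"])
 show "bounded_linear (%x. mul (%_. c) (transl (- zeta) (FT x)))"
  by (rule bounded_linear_compose[OF bounded_linear_mul[of _ "norm c"] bounded_linear_compose[OF bounded_linear_transl bounded_linear_FT]]) auto
 show "bounded_linear (%x. FT (mul (%x. c * cis (x \<bullet> zeta)) x))"
  by (rule bounded_linear_compose[OF bounded_linear_FT bounded_linear_mul[of _ "norm c"]]) (auto simp: norm_mult)
 fix f assume f: "SI f" "integrable lborel f"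
 then have S0: "SI (%x. cis (x \<bullet> zeta) * f x)" and I0: "integrable lborel (%x. cis (x \<bullet> zeta) * f x)"
  using SI_bound[of "%x. cis (x \<bullet> zeta) * f x" f 1] fi_integrable[OF f(2), of "- zeta"] SI_measurable[OF f(1)] by (auto simp: norm_mult)
 have eq: "(%x. c * cis (x \<bullet> zeta) * f x) = (%x. c * (cis (x \<bullet> zeta) * f x))" by (simp add: mult.assoc)
 have S: "SI (%x. c * cis (x \<bullet> zeta) * f x)" and I: "integrable lborel (%x. c * cis (x \<bullet> zeta) * f x)"
  unfolding eq using SI_cmult[OF S0] I0 by auto
 have fc: "fi (%x. c * cis (x \<bullet> zeta) * f x) = (%xi. c * fi f (xi - zeta))"
  unfolding eq fi_modulate[symmetric] by (simp add: fourier_integral_def mult.left_commute[of _ c] fun_eq_iff)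
 have S1: "SI (%xi. fi f (xi - zeta))" using SI_translate[OF Plancherel_L1(1)[OF f(2,1)], of "- zeta"] by simp
 show "FT (mul (%x. c * cis (x \<bullet> zeta)) (cl f)) = mul (%_. c) (transl (- zeta) (FT (cl f)))"
  using f S I S1 by (simp add: mul_cl FT_integrable fc transl_cl Plancherel_L1 SI_cmult)
qed

text \<open>The inner product with a function given by an absolutely convergent inversion integral is
  controlled by a trilinear convolution form on the Fourier side.\<close>

lemma inner_product_convolution:
 assumes i: "integrable lborel (rep (FT x))" and x: "RE x = x" "Lr (apply_bcontfun B) = x" "SI (cr (apply_bcontfun B))"
 shows "\<bar>inner (mb B y) z\<bar> <= 1 / (2 * pi) ^ 4 *
   (LBINT zeta. norm (rep (FT x) zeta) * (LBINT xi. norm (rep (FT y) (xi - zeta)) * norm (rep (FT z) xi)))"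
proof -
 let ?p = "rep (FT x)" and ?y = "rep y" and ?z = "rep z"
 let ?Y = "rep (FT y)" and ?Z = "rep (FT z)"
 have [measurable]: "rep w \<in> borel_measurable borel" for w using SI_measurable[OF SI_rep] by simp
 note I = IFT_integrable[OF SI_rep i]
 define b where "b t = (1 / (2 * pi)\<^sup>2) *\<^sub>R fi ?p (- t)" for t
 have b: "SI b" "cl b = x" using I unfolding b_def[abs_def] by auto
 have bB: "AE t in lborel. b t = cr (apply_bcontfun B) t"
  using cl_eq_iff[OF b(1) x(3)] b(2) x(2) by simp
 define h where "h t = ?y t * cnj (?z t)" for t
 have h: "integrable lborel h" unfolding h_def by (intro SI_prod_integrable SI_rep SI_cnj)
 then have [measurable]: "h \<in> borel_measurable borel" by auto
 define J where "J zeta = (LBINT t. ?p zeta * cis (t \<bullet> zeta) * h t)" for zeta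
 have prod: "integrable (lborel \<Otimes>\<^sub>M lborel) (%(t, zeta). ?p zeta * cis (t \<bullet> zeta) * h t)"
 proof (rule lborel_pair.Fubini_integrable)
  show "integrable lborel (%t. \<integral>zeta. norm (case (t, zeta) of (t, zeta) => ?p zeta * cis (t \<bullet> zeta) * h t) \<partial>lborel)"
   using h by (simp add: norm_mult)
  show "AE t in lborel. integrable lborel (%zeta. case (t, zeta) of (t, zeta) => ?p zeta * cis (t \<bullet> zeta) * h t)"
  proof (rule AE_I2)
   fix t
   have "integrable lborel (%zeta. h t * (cis (- (zeta \<bullet> - t)) * ?p zeta))" using fi_integrable[OF i, of "- t"] by simp
   then show "integrable lborel (%zeta. case (t, zeta) of (t, zeta) => ?p zeta * cis (t \<bullet> zeta) * h t)"
    by (simp add: mult_ac inner_commute)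
  qed
 qed measurable
 have J1: "integrable lborel J"
  using lborel_pair.integrable_snd[OF prod] unfolding J_def by simp
 have "inner (mb B y) z = Re (LBINT t. cr (apply_bcontfun B) t * ?y t * cnj (?z t))"
  using inner_cl[OF SI_bcf_mult[OF SI_rep[of y], of B] SI_rep[of z]] by (simp add: mb_cl[OF SI_rep, symmetric])
 also have "(LBINT t. cr (apply_bcontfun B) t * ?y t * cnj (?z t)) = (LBINT t. b t * h t)"
  by (rule integral_cong_AE)
    (use SI_measurable[OF b(1)] bB in \<open>auto simp: h_def mult.assoc elim: eventually_mono\<close>)
 also have "\<dots> = (LBINT t. (1 / (2 * pi)\<^sup>2) *\<^sub>R (LBINT zeta. ?p zeta * cis (t \<bullet> zeta) * h t))"
  by (rule Bochner_Integration.integral_cong)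
    (auto simp: b_def fourier_integral_def inner_commute mult.commute[of _ "?p _"])
 also have "\<dots> = (1 / (2 * pi)\<^sup>2) *\<^sub>R (LBINT t. (LBINT zeta. ?p zeta * cis (t \<bullet> zeta) * h t))"
  by simp
 also have "(LBINT t. (LBINT zeta. ?p zeta * cis (t \<bullet> zeta) * h t)) = (LBINT zeta. J zeta)"
  unfolding J_def using lborel_pair.Fubini_integral[OF prod] by simp
 finally have "inner (mb B y) z = 1 / (2 * pi)\<^sup>2 * Re (LBINT zeta. J zeta)" by simp
 also have "Re (LBINT zeta. J zeta) = (LBINT zeta. Re (J zeta))" by (rule integral_Re[OF J1, symmetric])
 finally have 1: "\<bar>inner (mb B y) z\<bar> <= 1 / (2 * pi)\<^sup>2 * (LBINT zeta. \<bar>Re (J zeta)\<bar>)"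
  using integral_norm_bound[of lborel "%zeta. Re (J zeta)"] by (simp add: abs_mult divide_right_mono)
 define K where "K zeta = norm (?p zeta) * (LBINT xi. norm (?Y (xi - zeta)) * norm (?Z xi))" for zeta
 have Yt: "SI (%xi. ?Y (xi - zeta))" for zeta using SI_translate[OF SI_rep[of "FT y"], of "- zeta"] by simp
 have tr: "transl (- zeta) (FT y) = cl (%xi. ?Y (xi - zeta))" for zeta by (simp add: transl_def)
 have ReJ: "\<bar>Re (J zeta)\<bar> <= K zeta / (2 * pi)\<^sup>2" for zeta
 proof -
  have m: "mdom (%t. ?p zeta * cis (t \<bullet> zeta)) y" by (rule mdom_bounded[of _ "norm (?p zeta)"]) (auto simp: norm_mult)
  have "Re (J zeta) = inner (mul (%t. ?p zeta * cis (t \<bullet> zeta)) y) (cl ?z)"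
   unfolding mul_def using inner_cl[OF m[unfolded mdom_def] SI_rep[of z]] by (simp add: J_def h_def mult.assoc)
  also have "\<dots> = inner (mul (%_. ?p zeta) (cl (%xi. ?Y (xi - zeta)))) (cl ?Z) / (2 * pi)\<^sup>2"
   unfolding inner_via_FT[of "mul _ _"] FT_modulate_cmult tr by simp
  also have "inner (mul (%_. ?p zeta) (cl (%xi. ?Y (xi - zeta)))) (cl ?Z) = Re (LBINT xi. ?p zeta * ?Y (xi - zeta) * cnj (?Z xi))"
   by (subst mul_cl) (auto simp: Yt SI_cmult inner_cl SI_rep simp del: cl_rep)
  finally have "\<bar>Re (J zeta)\<bar> <= norm (LBINT xi. ?p zeta * ?Y (xi - zeta) * cnj (?Z xi)) / (2 * pi)\<^sup>2"
   using abs_Re_le_cmod by (simp add: divide_right_mono)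
  also have "norm (LBINT xi. ?p zeta * ?Y (xi - zeta) * cnj (?Z xi)) <= (LBINT xi. norm (?p zeta * ?Y (xi - zeta) * cnj (?Z xi)))"
   by (rule integral_norm_bound)
  also have "\<dots> = K zeta" unfolding K_def by (simp add: norm_mult mult.assoc)
  finally show ?thesis by (simp add: divide_right_mono)
 qed
 have K0: "0 <= K zeta" for zeta unfolding K_def by (intro mult_nonneg_nonneg integral_nonneg) auto
 have Kb: "K zeta <= norm (?p zeta) * (norm (FT y) * norm (FT z))" for zeta
 proof -
  have n: "norm (cl (%xi. ?Y (xi - zeta))) = norm (FT y)"
   unfolding tr[symmetric] by (simp add: norm_eq_sqrt_inner inner_transl)
  show ?thesis unfolding K_def
   using norm_integral_le_norms[OF Yt[of zeta] SI_rep[of "FT z"]] by (intro mult_left_mono) (simp_all add: norm_mult n)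
 qed
 have Ki: "integrable lborel K"
 proof (rule Bochner_Integration.integrable_bound)
  show "integrable lborel (%zeta. norm (?p zeta) * (norm (FT y) * norm (FT z)))" using i by simp
  show "K \<in> borel_measurable lborel" unfolding K_def[abs_def] by measurable
  show "AE zeta in lborel. norm (K zeta) <= norm (norm (?p zeta) * (norm (FT y) * norm (FT z)))"
   using Kb K0 by (intro AE_I2) (simp add: abs_of_nonneg)
 qed
 have "(LBINT zeta. \<bar>Re (J zeta)\<bar>) <= (LBINT zeta. K zeta / (2 * pi)\<^sup>2)"
  by (rule integral_mono) (use J1 Ki ReJ in auto)
 also have "\<dots> = (LBINT zeta. K zeta) / (2 * pi)\<^sup>2" by simp
 finally have "1 / (2 * pi)\<^sup>2 * (LBINT zeta. \<bar>Re (J zeta)\<bar>) <= 1 / (2 * pi)\<^sup>2 * ((LBINT zeta. K zeta) / (2 * pi)\<^sup>2)"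
  by (rule mult_left_mono) simp
 with 1 show ?thesis unfolding K_def by (simp add: power2_eq_square power4_eq_xxxx)
qed

lemma integrable_prod_convolution:
 assumes a: "integrable lborel a" and u: "SI u" and v: "SI v"
 shows "integrable (lborel \<Otimes>\<^sub>M lborel) (%(zeta, xi). norm (a zeta :: complex) * (norm (u (xi - zeta)) * norm (v xi)))"
  and "(LBINT zeta. \<integral>xi. norm (a zeta) * (norm (u (xi - zeta)) * norm (v xi)) \<partial>lborel)
   <= (LBINT zeta. norm (a zeta)) * (norm (cl u) * norm (cl v))"
proof -
 have [measurable]: "a \<in> borel_measurable borel" "u \<in> borel_measurable borel" "v \<in> borel_measurable borel"
  using a SI_measurable[OF u] SI_measurable[OF v] by auto
 have ut: "SI (%xi. u (xi - zeta))" for zeta using SI_translate[OF u, of "- zeta"] by simp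
 have n: "norm (cl (%xi. u (xi - zeta))) = norm (cl u)" for zeta
  using transl_cl[OF u, of "- zeta"] inner_transl[of "- zeta" "cl u" "cl u"] by (simp add: norm_eq_sqrt_inner)
 have le: "(LBINT xi. norm (a zeta) * (norm (u (xi - zeta)) * norm (v xi))) <= norm (a zeta) * (norm (cl u) * norm (cl v))" for zeta
  using mult_left_mono[OF norm_integral_le_norms[OF ut[of zeta] v], of "norm (a zeta)"] by (simp add: norm_mult n)
 have ge: "0 <= (LBINT xi. norm (a zeta) * (norm (u (xi - zeta)) * norm (v xi)))" for zeta
  by (intro integral_nonneg_AE) auto
 have i1: "integrable lborel (%zeta. \<integral>xi. norm (a zeta) * (norm (u (xi - zeta)) * norm (v xi)) \<partial>lborel)"
 proof (rule Bochner_Integration.integrable_bound)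
  show "integrable lborel (%zeta. norm (a zeta) * (norm (cl u) * norm (cl v)))" using a by simp
  show "(%zeta. \<integral>xi. norm (a zeta) * (norm (u (xi - zeta)) * norm (v xi)) \<partial>lborel) \<in> borel_measurable lborel" by measurable
  show "AE zeta in lborel. norm (LBINT xi. norm (a zeta) * (norm (u (xi - zeta)) * norm (v xi))) <= norm (norm (a zeta) * (norm (cl u) * norm (cl v)))"
   using le ge by (intro AE_I2) (simp only: real_norm_def abs_of_nonneg abs_mult abs_norm_cancel)
 qed
 show "(LBINT zeta. \<integral>xi. norm (a zeta) * (norm (u (xi - zeta)) * norm (v xi)) \<partial>lborel)
   <= (LBINT zeta. norm (a zeta)) * (norm (cl u) * norm (cl v))"
  using integral_mono[OF i1 _ le] a by simp
 show "integrable (lborel \<Otimes>\<^sub>M lborel) (%(zeta, xi). norm (a zeta) * (norm (u (xi - zeta)) * norm (v xi)))"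
 proof (rule lborel_pair.Fubini_integrable)
  show "integrable lborel (%zeta. \<integral>xi. norm (case (zeta, xi) of (zeta, xi) => norm (a zeta) * (norm (u (xi - zeta)) * norm (v xi))) \<partial>lborel)"
   using i1 by (simp add: abs_mult)
  show "AE zeta in lborel. integrable lborel (%xi. case (zeta, xi) of (zeta, xi) => norm (a zeta) * (norm (u (xi - zeta)) * norm (v xi)))"
   using integrable_norm[OF SI_prod_integrable[OF ut v]] by (intro AE_I2) (simp add: norm_mult)
 qed measurable
qed

lemma convolution_swap:
 assumes u: "SI u" and a: "integrable lborel a" and v: "SI v"
 shows "(LBINT zeta. \<integral>xi. norm (u zeta) * (norm (a (xi - zeta)) * norm (v xi)) \<partial>lborel)
   <= (LBINT zeta. norm (a zeta :: complex)) * (norm (cl u) * norm (cl v))"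
  and "integrable (lborel \<Otimes>\<^sub>M lborel) (%(zeta, xi). norm (u zeta) * (norm (a (xi - zeta)) * norm (v xi)))"
proof -
 have [measurable]: "a \<in> borel_measurable borel" "u \<in> borel_measurable borel" "v \<in> borel_measurable borel"
  using a SI_measurable[OF u] SI_measurable[OF v] by auto
 let ?F = "%zeta xi. ennreal (norm (u zeta) * (norm (a (xi - zeta)) * norm (v xi)))"
 let ?G = "%zeta xi. ennreal (norm (a zeta) * (norm (u (xi - zeta)) * norm (v xi)))"
 note P = integrable_prod_convolution[OF a u v]
 have nn: "(\<integral>\<^sup>+zeta. \<integral>\<^sup>+xi. ?F zeta xi \<partial>lborel \<partial>lborel) = (\<integral>\<^sup>+zeta. \<integral>\<^sup>+xi. ?G zeta xi \<partial>lborel \<partial>lborel)"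
 proof -
  have "(\<integral>\<^sup>+zeta. \<integral>\<^sup>+xi. ?F zeta xi \<partial>lborel \<partial>lborel) = (\<integral>\<^sup>+xi. \<integral>\<^sup>+zeta. ?F zeta xi \<partial>lborel \<partial>lborel)"
   by (rule lborel_pair.Fubini') measurable
  also have "\<dots> = (\<integral>\<^sup>+xi. \<integral>\<^sup>+zeta. ?G zeta xi \<partial>lborel \<partial>lborel)"
  proof (rule nn_integral_cong)
   fix xi
   have "(\<integral>\<^sup>+zeta. ?F zeta xi \<partial>lborel) = (\<integral>\<^sup>+zeta. ?F (xi + (- 1) *\<^sub>R zeta) xi \<partial>lborel)"
    by (subst nn_integral_affine[of "%zeta. ?F zeta xi" "-1" xi]) auto
   also have "\<dots> = (\<integral>\<^sup>+zeta. ?G zeta xi \<partial>lborel)" by (simp add: mult_ac)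
   finally show "(\<integral>\<^sup>+zeta. ?F zeta xi \<partial>lborel) = (\<integral>\<^sup>+zeta. ?G zeta xi \<partial>lborel)" .
  qed
  also have "\<dots> = (\<integral>\<^sup>+zeta. \<integral>\<^sup>+xi. ?G zeta xi \<partial>lborel \<partial>lborel)"
   by (rule lborel_pair.Fubini'[symmetric]) measurable
  finally show ?thesis .
 qed
 have nnF: "(\<integral>\<^sup>+z. norm (case z of (zeta, xi) => norm (u zeta) * (norm (a (xi - zeta)) * norm (v xi))) \<partial>(lborel \<Otimes>\<^sub>M lborel))
   = (\<integral>\<^sup>+z. norm (case z of (zeta, xi) => norm (a zeta) * (norm (u (xi - zeta)) * norm (v xi))) \<partial>(lborel \<Otimes>\<^sub>M lborel))"
  by (subst (1 2) lborel.nn_integral_fst[symmetric]) (simp_all add: nn abs_mult)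
 show i: "integrable (lborel \<Otimes>\<^sub>M lborel) (%(zeta, xi). norm (u zeta) * (norm (a (xi - zeta)) * norm (v xi)))"
  using P(1) nnF unfolding integrable_iff_bounded by auto
 have "(\<integral>z. (case z of (zeta, xi) => norm (u zeta) * (norm (a (xi - zeta)) * norm (v xi))) \<partial>(lborel \<Otimes>\<^sub>M lborel))
   = (\<integral>z. (case z of (zeta, xi) => norm (a zeta) * (norm (u (xi - zeta)) * norm (v xi))) \<partial>(lborel \<Otimes>\<^sub>M lborel))"
  using nnF by (subst (1 2) integral_eq_nn_integral) (auto simp: abs_mult case_prod_beta)
 then have "(LBINT zeta. \<integral>xi. norm (u zeta) * (norm (a (xi - zeta)) * norm (v xi)) \<partial>lborel) =
   (LBINT zeta. \<integral>xi. norm (a zeta) * (norm (u (xi - zeta)) * norm (v xi)) \<partial>lborel)"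
  using lborel_pair.integral_fst'[OF i] lborel_pair.integral_fst'[OF P(1)] by simp
 then show "(LBINT zeta. \<integral>xi. norm (u zeta) * (norm (a (xi - zeta)) * norm (v xi)) \<partial>lborel)
   <= (LBINT zeta. norm (a zeta)) * (norm (cl u) * norm (cl v))"
  using P(2) by simp
qed

text \<open>For \<open>r > 1/2\<close> the product of two functions in \<open>H\<^sup>r\<close> of the plane is square integrable:
  of the two weights in the convolution, the smaller one is bounded by the square root of their
  product, and \<open>(1 + |\<xi>|\<^sup>2)\<^sup>-\<^sup>r\<close> is square integrable.\<close>

lemma product_estimate:
 assumes r: "r > 1/2" and s: "s > 1" "inHs s x" and xr: "inHs r x" "inHs r y" and x: "RE x = x"
 shows "\<bar>inner (mb (bc x) y) z\<bar> <= 2 * wtc (2 * r) * Hsn r x * Hsn r y * norm z"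
proof -
 let ?p = "rep (FT x)" and ?Y = "rep (FT y)" and ?Z = "rep (FT z)"
 have i: "integrable lborel ?p" by (rule FT_L1(1)[OF s])
 define P where "P xi = wt r xi * ?p xi" for xi
 define Q where "Q xi = wt r xi * ?Y xi" for xi
 define w where "w = wt (- (2 * r))"
 have P: "SI P" "norm (cl P) = Hsn r x" and Q: "SI Q" "norm (cl Q) = Hsn r y"
  using xr unfolding P_def[abs_def] Q_def[abs_def] mdom_def Hsn_def mul_def by auto
 have w: "SI w" unfolding w_def by (rule SI_wt_neg) (use r in simp)
 have c: "norm (cl w) = wtc (2 * r)" by (simp add: w_def wtc_def)
 have wP: "integrable lborel (%xi. w xi * P xi)" "(LBINT xi. norm (w xi * P xi)) <= wtc (2 * r) * Hsn r x"
  using SI_prod_integrable[OF w P(1)] norm_integral_le_norms[OF w P(1)] by (auto simp: c P)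
 have wQ: "integrable lborel (%xi. w xi * Q xi)" "(LBINT xi. norm (w xi * Q xi)) <= wtc (2 * r) * Hsn r y"
  using SI_prod_integrable[OF w Q(1)] norm_integral_le_norms[OF w Q(1)] by (auto simp: c Q)
 note A = integrable_prod_convolution[OF wP(1) Q(1) SI_rep[of "FT z"]]
 note B = convolution_swap[OF P(1) wQ(1) SI_rep[of "FT z"]]
 note C = integrable_prod_convolution[OF i SI_rep[of "FT y"] SI_rep[of "FT z"]]
 have le: "norm (?p zeta) * (norm (?Y (xi - zeta)) * norm (?Z xi)) \<le>
   norm (w zeta * P zeta) * (norm (Q (xi - zeta)) * norm (?Z xi)) + norm (P zeta) * (norm (w (xi - zeta) * Q (xi - zeta)) * norm (?Z xi))" for zeta xi
 proof -
  have pP: "norm (?p \<eta>) = norm (wt (- r) \<eta>) * norm (P \<eta>)" "norm (?Y \<eta>) = norm (wt (- r) \<eta>) * norm (Q \<eta>)" for \<eta>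
   by (simp_all add: P_def Q_def wt_mult wt_0 flip: norm_mult mult.assoc)
  have ww: "norm (w \<eta>) = (norm (wt (- r) \<eta>))\<^sup>2" for \<eta>
   by (simp add: w_def power2_eq_square wt_mult flip: norm_mult)
  have "norm (wt (- r) zeta) * norm (wt (- r) (xi - zeta)) <= norm (w zeta) + norm (w (xi - zeta))"
  proof -
   have "0 <= norm (wt (- r) zeta) * norm (wt (- r) (xi - zeta))" by simp
   then show ?thesis
    using sum_squares_bound[of "norm (wt (- r) zeta)" "norm (wt (- r) (xi - zeta))"] unfolding ww by linarith
  qed
  then have "(norm (wt (- r) zeta) * norm (wt (- r) (xi - zeta))) * (norm (P zeta) * norm (Q (xi - zeta)) * norm (?Z xi)) \<le>
    (norm (w zeta) + norm (w (xi - zeta))) * (norm (P zeta) * norm (Q (xi - zeta)) * norm (?Z xi))"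
   by (rule mult_right_mono) auto
  then show ?thesis unfolding pP by (simp add: norm_mult algebra_simps)
 qed
 have "(LBINT zeta. norm (?p zeta) * (LBINT xi. norm (?Y (xi - zeta)) * norm (?Z xi))) =
   (\<integral>z. (case z of (zeta, xi) => norm (?p zeta) * (norm (?Y (xi - zeta)) * norm (?Z xi))) \<partial>(lborel \<Otimes>\<^sub>M lborel))"
  using lborel_pair.integral_fst'[OF C(1)] by simp
 also have "\<dots> <= (\<integral>z. (case z of (zeta, xi) => norm (w zeta * P zeta) * (norm (Q (xi - zeta)) * norm (?Z xi))) +
   (case z of (zeta, xi) => norm (P zeta) * (norm (w (xi - zeta) * Q (xi - zeta)) * norm (?Z xi))) \<partial>(lborel \<Otimes>\<^sub>M lborel))"
  by (rule integral_mono[OF C(1) Bochner_Integration.integrable_add[OF A(1) B(2)]]) (use le in auto)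
 also have "\<dots> = (LBINT zeta. \<integral>xi. norm (w zeta * P zeta) * (norm (Q (xi - zeta)) * norm (?Z xi)) \<partial>lborel) +
   (LBINT zeta. \<integral>xi. norm (P zeta) * (norm (w (xi - zeta) * Q (xi - zeta)) * norm (?Z xi)) \<partial>lborel)"
  unfolding Bochner_Integration.integral_add[OF A(1) B(2)]
  using lborel_pair.integral_fst'[OF A(1)] lborel_pair.integral_fst'[OF B(2)] by simp
 also have "\<dots> <= wtc (2 * r) * Hsn r x * (Hsn r y * norm (FT z)) + wtc (2 * r) * Hsn r y * (Hsn r x * norm (FT z))"
  using A(2) B(1) wP(2) wQ(2) unfolding P(2) Q(2) cl_rep
  by (intro add_mono) (erule order_trans, intro mult_right_mono mult_nonneg_nonneg, auto simp: Hsn_def)+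
 also have "\<dots> = (2 * pi) * (2 * wtc (2 * r) * Hsn r x * Hsn r y * norm z)"
  by (simp add: norm_FT algebra_simps)
 finally have est: "(LBINT zeta. norm (?p zeta) * (LBINT xi. norm (?Y (xi - zeta)) * norm (?Z xi))) <= (2 * pi) * (2 * wtc (2 * r) * Hsn r x * Hsn r y * norm z)" .
 have "\<bar>inner (mb (bc x) y) z\<bar> <= 1 / (2 * pi) ^ 4 * ((2 * pi) * (2 * wtc (2 * r) * Hsn r x * Hsn r y * norm z))"
  using inner_product_convolution[OF i x bc_real[OF s x], of y z] mult_left_mono[OF est, of "1 / (2 * pi) ^ 4"] by simp
 also have "\<dots> = (2 * wtc (2 * r) * Hsn r x * Hsn r y * norm z) / (2 * pi) ^ 3"
  by (simp add: power3_eq_cube power4_eq_xxxx)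
 also have "\<dots> <= (2 * wtc (2 * r) * Hsn r x * Hsn r y * norm z) / 1"
 proof (rule divide_left_mono)
  have "1 <= 2 * pi" using pi_gt3 by simp
  then show "1 <= (2 * pi) ^ 3" by (rule one_le_power)
 qed (auto simp: wtc_def Hsn_def)
 finally show ?thesis by simp
qed

section \<open>From distributions to differential equations in the Hilbert space\<close>

lemma smooth_antiderivative:
 fixes K k :: "real => real"
 assumes "smooth k" "!!x. (K has_real_derivative k x) (at x)"
 shows "smooth K" "pderiv_dir 1 K = k"
proof -
 have d: "(K has_derivative (%h. k x * h)) (at x)" for x
  using assms(2)[of x] by (simp add: has_field_derivative_def)
 show 1: "pderiv_dir 1 K = k"
  using pderiv_dir_eq[OF d, of 1] by (auto simp: fun_eq_iff)
 show "smooth K"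
 proof (rule smooth_coinduct[where S="%f. f = K \<or> smooth f"])
  fix f :: "real => real" and v x
  assume f: "f = K \<or> smooth f"
  show "f differentiable (at x)" using f d smooth_differentiable by (auto simp: differentiable_def)
  show "v \<in> Basis ==> pderiv_dir v f = K \<or> smooth (pderiv_dir v f)"
   using f 1 assms(1) smooth_pderiv[of f 1] by auto
 qed simp
qed

lemma pderiv_dir_affine_real:
 fixes f :: "real => real"
 assumes "smooth f" shows "pderiv_dir 1 (%x. f (c + d * x)) x = d * pderiv_dir 1 f (c + d * x)"
 using pderiv_dir_affine[OF assms bounded_linear_mult_right[of d], of 1 c x] by simp

text \<open>The weighted time average of a function over the half line.\<close>

abbreviation tint :: "(real => real) => (real => real) => real" where
 "tint \<l> \<theta> \<equiv> (LINT t:{0..}|lborel. \<l> t * \<theta> t)"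

lemma test_fun_continuous: "test_fun W \<phi> ==> continuous_on S \<phi>"
 using smooth_continuous[OF test_fun_smooth] continuous_on_subset by blast

lemma tint_integrable:
 assumes l: "continuous_on {0..} l" and \<theta>: "test_fun {0<..} (\<theta> :: real => real)"
 shows "set_integrable lborel {0..} (%t. l t * \<theta> t)"
proof -
 obtain R where R: "R > 0" "!!x. norm x >= R ==> \<theta> x = 0" by (rule test_fun_bounded_support[OF \<theta>]) blast
 have "set_integrable lborel {0..R} (%t. l t * \<theta> t)"
  by (rule borel_integrable_compact[OF compact_Icc, unfolded set_integrable_def[symmetric]])
    (intro continuous_intros test_fun_continuous[OF \<theta>] continuous_on_subset[OF l], auto)
 then show ?thesis
  unfolding set_integrable_def
  by (rule Bochner_Integration.integrable_cong[THEN iffD1, rotated -1])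
    (use R in \<open>auto simp: indicator_def\<close>)
qed

lemma tint_add:
 assumes "continuous_on {0..} l" "continuous_on {0..} m" "test_fun {0<..} \<theta>"
 shows "tint (%t. l t + m t) \<theta> = tint l \<theta> + tint m \<theta>"
 using set_integral_add(2)[OF tint_integrable[OF assms(1,3)] tint_integrable[OF assms(2,3)]]
 by (simp add: distrib_right)

lemma tint_cmult: "tint (%t. c * l t) \<theta> = c * tint l \<theta>"
 by (simp add: mult.assoc)

context cutoff begin

definition bump :: "real => real" where "bump t = \<theta> (0 + t *\<^sub>R axis 1 1)"

lemma smooth_bump: "smooth bump"
 unfolding bump_def[abs_def] by (rule smooth_affine[OF smooth_\<theta> bounded_linear_scaleR_left])

lemma bump_support: obtains R where "R > 0" "!!t. \<bar>t\<bar> >= R ==> bump t = 0"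
proof -
 obtain R where R: "R > 0" "!!x. norm x >= R ==> \<theta> x = 0" by (rule test_fun_bounded_support[OF test_\<theta>]) blast
 show thesis by (rule that[OF R(1)]) (auto simp: bump_def intro!: R)
qed

lemma bump_bounded: obtains M where "M > 0" "!!t. \<bar>bump t\<bar> <= M"
 using test_fun_bounded[OF test_\<theta>] unfolding bump_def by metis

text \<open>The antiderivative of a bump; differences of rescaled steps approximate indicators.\<close>

lemma smooth_step:
 obtains K R \<kappa> where "R > 0" "\<kappa> > 0" "smooth K" "pderiv_dir 1 K = bump" "!!x. x <= - R ==> K x = 0" "!!x. x >= R ==> K x = \<kappa>"
  "!!x. 0 <= K x \<and> K x <= \<kappa>" "(LBINT y. bump y) = \<kappa>" "!!t. \<bar>t\<bar> >= R ==> bump t = 0"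
proof -
 obtain R where R: "R > 0" "!!t. \<bar>t\<bar> >= R ==> bump t = 0" by (rule bump_support) blast
 have cont: "isCont bump x" for x using smooth_continuous[OF smooth_bump] by (simp add: continuous_on_eq_continuous_at)
 obtain F where F: "!!x. (F has_vector_derivative bump x) (at x)"
  using einterval_antiderivative[of "-\<infinity>" "\<infinity>" bump] cont by auto
 define K where "K x = F x - F (- R)" for x
 have K: "(K has_real_derivative bump x) (at x)" for x
  using F[of x] unfolding K_def[abs_def] has_real_derivative_iff_has_vector_derivative
  by (auto intro!: derivative_eq_intros)
 have b0: "bump t >= 0" for t by (simp add: bump_def \<theta>_nonneg)
 have mono: "K x <= K y" if "x <= y" for x y
  using DERIV_nonneg_imp_nondecreasing[OF that, of K] K b0 by blast
 have const: "K x = K y" if "x < y" "!!z. x < z ==> z < y ==> bump z = 0" for x y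
 proof (rule DERIV_isconst_end[OF that(1), symmetric])
  show "continuous_on {x..y} K"
   using K by (intro continuous_at_imp_continuous_on ballI) (rule DERIV_isCont)
 qed (use K that(2) in metis)
 define \<kappa> where "\<kappa> = K R"
 have K1: "K x = 0" if "x <= - R" for x
  using const[of x "- R"] R(2) that by (cases "x = - R") (auto simp: K_def)
 have K2: "K x = \<kappa>" if "x >= R" for x
  using const[of R x] R(2) that by (cases "x = R") (auto simp: \<kappa>_def)
 have int: "(LBINT y. bump y) = \<kappa>"
 proof -
  have "(LBINT y. bump y) = (LBINT y. indicator {- R..R} y *\<^sub>R bump y)"
  proof (rule Bochner_Integration.integral_cong[OF refl])
   fix y show "bump y = indicator {- R..R} y *\<^sub>R bump y"
    using R(2)[of y] by (cases "\<bar>y\<bar> <= R") (auto simp: indicator_def)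
  qed
  also have "\<dots> = K R - K (- R)"
  proof (rule integral_FTC_Icc)
   show "(K has_vector_derivative bump x) (at x within {- R..R})" for x
    using K[of x] has_vector_derivative_at_within by (auto simp: has_real_derivative_iff_has_vector_derivative)
   show "continuous_on {- R..R} bump" using cont by (intro continuous_at_imp_continuous_on) auto
  qed (use R in auto)
  finally show ?thesis using K1[of "- R"] by (simp add: \<kappa>_def)
 qed
 have "\<kappa> ~= 0"
 proof
  assume k0: "\<kappa> = 0"
  have "K x = 0" for x
  proof (cases "x <= - R")
   case False
   have "K (- R) <= K x" "K x <= K (max x R)" using False by (auto intro!: mono)
   then show ?thesis using K1[of "- R"] K2[of "max x R"] k0 by simp
  qed (rule K1)
  then have "K = (%_. 0)" by auto
  then have "((%_. 0) has_real_derivative bump 0) (at 0)" using K[of 0] by simp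
  then have "bump 0 = 0" using DERIV_unique[OF _ DERIV_const] by blast
  then show False by (simp add: bump_def \<theta>0)
 qed
 moreover have "\<kappa> >= 0" using mono[of "- R" R] K1[of "- R"] R by (simp add: \<kappa>_def)
 ultimately have "\<kappa> > 0" by simp
 moreover have "0 <= K x \<and> K x <= \<kappa>" for x
  using mono[of "min x (- R)" x] mono[of x "max x R"] K1[of "min x (- R)"] K2[of "max x R"] by simp
 ultimately show thesis
  using that[OF R(1) _ smooth_antiderivative[OF smooth_bump K] K1 K2 _ int R(2)] by blast
qed

text \<open>Averages against rescaled bumps converge to the value at the centre.\<close>

lemma bump_average_tendsto:
 assumes l: "continuous_on {0..} l" and c: "c > 0" and R: "R > 0" "!!t. \<bar>t\<bar> >= R ==> bump t = 0"
  and e: "!!n. e n > 0" "!!n. e n * R <= c / 2" "e \<longlonglongrightarrow> 0"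
 shows "(%n. tint l (%r. bump (- c / e n + 1 / e n * r) / e n)) \<longlonglongrightarrow> l c * (LBINT y. bump y)"
proof -
 define l' where "l' r = indicator {0..} r *\<^sub>R l r" for r
 have lm [measurable]: "l' \<in> borel_measurable borel"
  unfolding l'_def[abs_def] by (rule borel_measurable_continuous_on_indicator[OF _ l]) simp
 have bm [measurable]: "bump \<in> borel_measurable borel" by (rule smooth_measurable[OF smooth_bump])
 obtain M where M: "M > 0" "!!t. \<bar>bump t\<bar> <= M" by (rule bump_bounded) blast
 have "compact (l ` {c/2..3*c/2})"
  using c by (intro compact_continuous_image continuous_on_subset[OF l]) auto
 from compact_imp_bounded[OF this] obtain B where B: "\<forall>r\<in>{c/2..3*c/2}. \<bar>l r\<bar> <= B"
  unfolding bounded_iff by auto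
 have B0: "B >= 0" using B[rule_format, of c] c by auto
 have eq: "tint l (%r. bump (- c / e n + 1 / e n * r) / e n) = (LBINT y. l' (c + e n * y) * bump y)" for n
 proof -
  have "tint l (%r. bump (- c / e n + 1 / e n * r) / e n) = (LBINT r. l' r * (bump (- c / e n + 1 / e n * r) / e n))"
   unfolding set_lebesgue_integral_def l'_def by (simp add: mult.assoc)
  also have "\<dots> = \<bar>e n\<bar> *\<^sub>R (LBINT y. l' (c + e n * y) * (bump (- c / e n + 1 / e n * (c + e n * y)) / e n))"
   by (rule lborel_integral_real_affine) (use e(1)[of n] in simp)
  also have "(%y. l' (c + e n * y) * (bump (- c / e n + 1 / e n * (c + e n * y)) / e n)) = (%y. l' (c + e n * y) * bump y / e n)"
   using e(1)[of n] by (auto simp: fun_eq_iff field_simps)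
  also have "\<bar>e n\<bar> *\<^sub>R (LBINT y. l' (c + e n * y) * bump y / e n) = (LBINT y. l' (c + e n * y) * bump y)"
   using e(1)[of n] by simp
  finally show ?thesis .
 qed
 have in_range: "c + e n * y \<in> {c/2..3*c/2}" if "\<bar>y\<bar> <= R" for n y
 proof -
  have "\<bar>e n * y\<bar> <= e n * R" using that e(1)[of n] by (simp add: abs_mult)
  then show ?thesis using e(2)[of n] by (auto simp: abs_le_iff)
 qed
 have "(%n. \<integral>y. l' (c + e n * y) * bump y \<partial>lborel) \<longlonglongrightarrow> (LBINT y. l c * bump y)"
 proof (rule integral_dominated_convergence[where w="%y. B * M * indicator {- R..R} y"])
  show "AE y in lborel. (%n. l' (c + e n * y) * bump y) \<longlonglongrightarrow> l c * bump y"
  proof (intro AE_I2 tendsto_mult tendsto_const)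
   fix y
   have "isCont l c" using continuous_on_interior[OF l, of c] c by (simp add: interior_Ici[of "c/2"] )
   have t: "(%n. c + e n * y) \<longlonglongrightarrow> c" using e(3) by (auto intro!: tendsto_eq_intros)
   have "(%n. l (c + e n * y)) \<longlonglongrightarrow> l c" by (rule isCont_tendsto_compose[OF \<open>isCont l c\<close> t])
   moreover have "\<forall>\<^sub>F n in sequentially. c + e n * y > 0" using order_tendstoD(1)[OF t c] .
   then have "\<forall>\<^sub>F n in sequentially. l (c + e n * y) = l' (c + e n * y)"
    by eventually_elim (simp add: l'_def)
   ultimately show "(%n. l' (c + e n * y)) \<longlonglongrightarrow> l c" by (rule Lim_transform_eventually)
  qed
  show "AE y in lborel. norm (l' (c + e n * y) * bump y) <= B * M * indicator {- R..R} y" for n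
  proof (rule AE_I2)
   fix y
   show "norm (l' (c + e n * y) * bump y) <= B * M * indicator {- R..R} y"
   proof (cases "\<bar>y\<bar> <= R")
    case True
    then have "\<bar>l' (c + e n * y)\<bar> <= B" using B in_range[OF True, of n] c by (auto simp: l'_def)
    then have "\<bar>l' (c + e n * y)\<bar> * \<bar>bump y\<bar> <= B * M" using M B0 by (intro mult_mono) auto
    moreover have "y \<in> {- R..R}" using True by auto
    ultimately show ?thesis by (simp add: abs_mult)
   qed (use R B0 M in auto)
  qed
  show "integrable lborel (%y. B * M * indicator {- R..R} y :: real)"
   by (intro integrable_mult_right integrable_indicator_bounded) auto
 qed measurable
 then show ?thesis unfolding eq by simp
qed

text \<open>The test functions approximate the indicator of \<open>[s, t]\<close>; their derivatives are rescaled bumps at the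
  two end points.\<close>

lemma weak_derivative_in_time:
 assumes l: "continuous_on {0..} l" and m: "continuous_on {0..} m"
  and weak: "!!\<phi>. test_fun {0<..} \<phi> ==> tint l (pderiv_dir 1 \<phi>) = - tint m \<phi>"
  and s: "0 < s" "s < t"
 shows "l t - l s = integral {s..t} m"
proof -
 obtain K R \<kappa> where K: "R > 0" "\<kappa> > 0" "smooth K" "pderiv_dir 1 K = bump" "!!x. x <= - R ==> K x = 0" "!!x. x >= R ==> K x = \<kappa>"
  "!!x. 0 <= K x \<and> K x <= \<kappa>" "(LBINT y. bump y) = \<kappa>" "!!t. \<bar>t\<bar> >= R ==> bump t = 0"
  by (rule smooth_step) blast
 define e where "e n = hseq n * (s / (2 * R))" for n
 have e0: "e n > 0" for n using s K(1) by (simp add: e_def hseq_def)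
 have eR: "e n * R <= s / 2" for n
  using mult_right_mono[OF hseq(2)[of n], of "s/2"] s K(1) by (simp add: e_def hseq_def)
 have e_lim: "e \<longlonglongrightarrow> 0" unfolding e_def using tendsto_mult[OF hseq(3) tendsto_const, of "s / (2 * R)"] by simp
 define \<phi> where "\<phi> n r = K (- s / e n + 1 / e n * r) + (- 1) * K (- t / e n + 1 / e n * r)" for n r
 have smK: "smooth (%r. K (c + d * r))" for c d by (rule smooth_affine[OF K(3) bounded_linear_mult_right])
 have sm: "smooth (\<phi> n)" for n unfolding \<phi>_def[abs_def] by (intro smooth_add smooth_cmult smK)
 have arg: "- c / e n + 1 / e n * r = (r - c) / e n" for c n r by (simp add: diff_divide_distrib)
 have z1: "\<phi> n r = 0" if "r <= s / 2" for n r
 proof -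
  have "(r - s) / e n <= - R" "(r - t) / e n <= - R"
   using that eR[of n] e0[of n] s by (auto simp: divide_le_eq mult.commute)
  then show ?thesis unfolding \<phi>_def arg by (simp add: K)
 qed
 have z2: "\<phi> n r = 0" if "r >= t + s / 2" for n r
 proof -
  have "(r - s) / e n >= R" "(r - t) / e n >= R"
   using that eR[of n] e0[of n] s by (auto simp: le_divide_eq mult.commute)
  then show ?thesis unfolding \<phi>_def arg by (simp add: K)
 qed
 have sup: "support (\<phi> n) \<subseteq> {s / 2..t + s / 2}" for n
 proof (rule support_subset_closed)
  fix r assume "r \<notin> {s / 2..t + s / 2}"
  then show "\<phi> n r = 0" using z1[of r n] z2[of r n] by force
 qed simp
 have tf: "test_fun {0<..} (\<phi> n)" for n
  unfolding test_fun_def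
 proof (intro conjI sm)
  show "compact (support (\<phi> n))"
   using sup[of n] by (metis compact_Int_closed compact_Icc inf.absorb_iff2 closed_closure support_def)
  show "support (\<phi> n) \<subseteq> {0<..}" using sup[of n] s by fastforce
 qed
 have der: "pderiv_dir 1 (\<phi> n) r = bump (- s / e n + 1 / e n * r) / e n + (- 1) * (bump (- t / e n + 1 / e n * r) / e n)" for n r
  unfolding \<phi>_def[abs_def] pderiv_dir_add[OF smK smooth_cmult[OF smK]]
   pderiv_dir_cmult[OF smooth_differentiable[OF smK]] pderiv_dir_affine_real[OF K(3)] K(4) by simp
 have tb: "test_fun {0<..} (%r. bump (- c / e n + 1 / e n * r) / e n)" if "c >= s" for c n
 proof -
  have sup': "support (%r. 1 / e n * bump (- c / e n + 1 / e n * r)) \<subseteq> {s / 2..c + s / 2}"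
  proof (rule support_subset_closed)
   fix r assume "r \<notin> {s / 2..c + s / 2}"
   then have "r < s / 2 \<or> c + s / 2 < r" by auto
   then have "\<bar>r - c\<bar> >= s / 2" using that s by linarith
   then have "\<bar>(r - c) / e n\<bar> >= R" using eR[of n] e0[of n] by (auto simp: abs_divide le_divide_eq mult.commute)
   then show "1 / e n * bump (- c / e n + 1 / e n * r) = 0" unfolding arg by (simp add: K)
  qed simp
  have "compact (support (%r. 1 / e n * bump (- c / e n + 1 / e n * r)))"
   using sup' by (metis compact_Int_closed compact_Icc inf.absorb_iff2 closed_closure support_def)
  moreover have "smooth (%r. 1 / e n * bump (- c / e n + 1 / e n * r))"
   by (intro smooth_cmult smooth_affine[OF smooth_bump bounded_linear_mult_right])
  moreover have "support (%r. 1 / e n * bump (- c / e n + 1 / e n * r)) \<subseteq> {0<..}" using sup' s by fastforce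
  ultimately show ?thesis by (simp add: test_fun_def)
 qed
 have A: "tint l (pderiv_dir 1 (\<phi> n)) = tint l (%r. bump (- s / e n + 1 / e n * r) / e n) - tint l (%r. bump (- t / e n + 1 / e n * r) / e n)" for n
  unfolding der using set_integral_diff(2)[OF tint_integrable[OF l tb[of s n]] tint_integrable[OF l tb[of t n]]] s
  by (simp add: right_diff_distrib)
 have eRt: "e n * R <= t / 2" for n using eR[of n] s by linarith
 have lim1: "(%n. tint l (pderiv_dir 1 (\<phi> n))) \<longlonglongrightarrow> l s * \<kappa> - l t * \<kappa>"
  unfolding A K(8)[symmetric]
  using s eR eRt by (intro tendsto_diff bump_average_tendsto[OF l _ K(1) K(9) e0 _ e_lim]) auto
 have lim2: "(%n. tint m (\<phi> n)) \<longlonglongrightarrow> (LINT r:{0..}|lborel. m r * (\<kappa> * indicator {s..t} r))"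
  unfolding set_lebesgue_integral_def
 proof (rule integral_dominated_convergence[where w="%r. indicator {s/2..t + s} r *\<^sub>R (\<kappa> * \<bar>m r\<bar>)"])
  have lm: "(%r. indicator {0..} r *\<^sub>R m r) \<in> borel_measurable borel"
   by (rule borel_measurable_continuous_on_indicator[OF _ m]) simp
  show "(%r. indicator {0..} r *\<^sub>R (m r * (\<kappa> * indicator {s..t} r))) \<in> borel_measurable lborel"
   using borel_measurable_times[OF lm, of "%r. \<kappa> * indicator {s..t} r"] by (simp add: mult.assoc)
  show "(%r. indicator {0..} r *\<^sub>R (m r * \<phi> n r)) \<in> borel_measurable lborel" for n
   using borel_measurable_times[OF lm smooth_measurable[OF sm[of n]]] by (simp add: mult.assoc)
  show "integrable lborel (%r. indicator {s/2..t + s} r *\<^sub>R (\<kappa> * \<bar>m r\<bar>))"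
   by (rule borel_integrable_compact[OF compact_Icc]) (use s in \<open>intro continuous_intros continuous_on_subset[OF m], auto\<close>)
  show "AE r in lborel. norm (indicator {0..} r *\<^sub>R (m r * \<phi> n r)) <= indicator {s/2..t + s} r *\<^sub>R (\<kappa> * \<bar>m r\<bar>)" for n
  proof (rule AE_I2)
   fix r
   have "\<bar>\<phi> n r\<bar> <= \<kappa>" unfolding \<phi>_def using K(7)[of "- s / e n + 1 / e n * r"] K(7)[of "- t / e n + 1 / e n * r"] by auto
   then have "\<bar>m r\<bar> * \<bar>\<phi> n r\<bar> <= \<kappa> * \<bar>m r\<bar>" using mult_left_mono[of "\<bar>\<phi> n r\<bar>" \<kappa> "\<bar>m r\<bar>"] by (simp add: mult.commute)
   then show "norm (indicator {0..} r *\<^sub>R (m r * \<phi> n r)) <= indicator {s/2..t + s} r *\<^sub>R (\<kappa> * \<bar>m r\<bar>)"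
    using z1[of r n] z2[of r n] s K(2) by (auto simp: indicator_def abs_mult)
  qed
  have "AE r in lborel. r ~= s" "AE r in lborel. r ~= t" by (rule AE_lborel_singleton)+
  then show "AE r in lborel. (%n. indicator {0..} r *\<^sub>R (m r * \<phi> n r)) \<longlonglongrightarrow> indicator {0..} r *\<^sub>R (m r * (\<kappa> * indicator {s..t} r))"
  proof eventually_elim
   case (elim r)
   have step: "(%n. K (- c / e n + 1 / e n * r)) \<longlonglongrightarrow> (if r > c then \<kappa> else 0)" if "r ~= c" for c
   proof (rule tendsto_eventually)
    have "\<bar>r - c\<bar> > 0" using that by simp
    have "(%n. e n * R) \<longlonglongrightarrow> 0" using tendsto_mult[OF e_lim tendsto_const, of R] by simp
    from order_tendstoD(2)[OF this \<open>\<bar>r - c\<bar> > 0\<close>]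
    show "\<forall>\<^sub>F n in sequentially. K (- c / e n + 1 / e n * r) = (if r > c then \<kappa> else 0)"
    proof eventually_elim
     case (elim n)
     show ?case
     proof (cases "r > c")
      case True
      then have "(r - c) / e n >= R" using elim e0[of n] by (simp add: le_divide_eq mult.commute)
      then show ?thesis unfolding arg using True by (simp add: K)
     next
      case False
      then have "(r - c) / e n <= - R" using elim e0[of n] by (simp add: divide_le_eq mult.commute)
      then show ?thesis unfolding arg using False by (simp add: K)
     qed
    qed
   qed
   have "(%n. \<phi> n r) \<longlonglongrightarrow> (if r > s then \<kappa> else 0) + (- 1) * (if r > t then \<kappa> else 0)"
    unfolding \<phi>_def using elim by (intro tendsto_intros step)
   also have "(if r > s then \<kappa> else 0) + (- 1) * (if r > t then \<kappa> else 0) = \<kappa> * indicator {s..t} r"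
    using elim s by (auto simp: indicator_def)
   finally show ?case by (intro tendsto_intros)
  qed
 qed
 have "(%n. - tint m (\<phi> n)) \<longlonglongrightarrow> l s * \<kappa> - l t * \<kappa>"
  using lim1 unfolding weak[OF tf] .
 from LIMSEQ_unique[OF this tendsto_minus[OF lim2]]
 have "l s * \<kappa> - l t * \<kappa> = - (LINT r:{0..}|lborel. m r * (\<kappa> * indicator {s..t} r))" .
 also have "(LINT r:{0..}|lborel. m r * (\<kappa> * indicator {s..t} r)) = \<kappa> * (LINT r:{s..t}|lborel. m r)"
  unfolding set_lebesgue_integral_def integral_mult_right_zero[symmetric]
  using s by (intro Bochner_Integration.integral_cong refl) (auto simp: indicator_def)
 also have "(LINT r:{s..t}|lborel. m r) = integral {s..t} m"
  by (rule set_borel_integral_eq_integral(2)[OF borel_integrable_compact[OF compact_Icc, unfolded set_integrable_def[symmetric]]])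
    (use s in \<open>auto intro: continuous_on_subset[OF m]\<close>)
 finally have "\<kappa> * (l t - l s) = \<kappa> * integral {s..t} m" by (simp add: algebra_simps)
 then show ?thesis using K(2) by simp
qed

lemma weak_derivative_l2:
 assumes X: "continuous_on {0..} X" and G: "continuous_on {0..} G"
  and weak: "!!\<phi> psi. test_fun {0<..} \<phi> ==> test_fun UNIV psi ==>
    tint (%t. inner (X t) (Lr psi)) (pderiv_dir 1 \<phi>) = - tint (%t. inner (G t) (Lr psi)) \<phi>"
  and real: "!!t. t > 0 ==> RE (X t) = X t" "!!t. t > 0 ==> RE (G t) = G t"
  and s: "0 < s" "s < t"
 shows "X t - X s = integral {s..t} G"
proof -
 have Gi: "G integrable_on {s..t}"
  by (rule integrable_continuous_interval) (use s in \<open>auto intro: continuous_on_subset[OF G]\<close>)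
 have "X t - X s - integral {s..t} G = 0"
 proof (rule test_fun_total)
  have "RE (integral {s..t} G) = integral {s..t} (RE \<circ> G)"
   by (rule integral_linear[OF Gi bounded_linear_RE, symmetric])
  also have "\<dots> = integral {s..t} G" by (rule Henstock_Kurzweil_Integration.integral_cong) (use s real in auto)
  finally show "RE (X t - X s - integral {s..t} G) = X t - X s - integral {s..t} G"
   using real s by (simp add: linear_diff[OF bounded_linear.linear[OF bounded_linear_RE]])
  fix psi assume psi: "test_fun UNIV (psi :: real^2 => real)"
  have "inner (X t) (Lr psi) - inner (X s) (Lr psi) = integral {s..t} (%r. inner (G r) (Lr psi))"
   by (rule weak_derivative_in_time[OF _ _ weak[OF _ psi] s]) (intro continuous_intros X G)+
  also have "\<dots> = inner (integral {s..t} G) (Lr psi)"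
   using integral_linear[OF Gi bounded_linear_inner_left[of "Lr psi"]] by (simp add: o_def)
  finally show "inner (X t - X s - integral {s..t} G) (Lr psi) = 0" by (simp add: inner_diff_left)
 qed
 then show ?thesis by simp
qed

end

lemma integral_increment_has_vector_derivative:
 fixes X G :: "real => 'a::banach"
 assumes G: "continuous_on {0..} G" and inc: "!!s t. 0 < s ==> s < t ==> X t - X s = integral {s..t} G" and t: "t > 0"
 shows "(X has_vector_derivative G t) (at t)"
proof -
 have "((%u. X (t/2) + integral {t/2..u} G) has_vector_derivative 0 + G t) (at t within {t/2..2*t})"
  by (intro has_vector_derivative_add has_vector_derivative_const integral_has_vector_derivative)
    (use t in \<open>auto intro: continuous_on_subset[OF G]\<close>)
 then have "((%u. X (t/2) + integral {t/2..u} G) has_vector_derivative G t) (at t)"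
  using at_within_Icc_at[of "t/2" t "2*t"] t by simp
 then show ?thesis
 proof (rule has_vector_derivative_transform_within_open[of _ _ _ "{t/2<..}"])
  show "X (t / 2) + integral {t / 2..u} G = X u" if "u \<in> {t/2<..}" for u
   using inc[of "t/2" u] t that by (simp add: algebra_simps)
 qed (use t in auto)
qed

section \<open>Strong solutions as curves in the Hilbert space\<close>

subsection \<open>Tensor test functions\<close>

definition tens :: "(real => real) => (real^2 => real) => real \<times> (real^2) => real" where
 "tens \<phi> psi z = \<phi> (0 + fst z) * psi (0 + snd z)"

lemma smooth_tens:
 assumes "smooth \<phi>" "smooth psi" shows "smooth (tens \<phi> psi)"
 unfolding tens_def[abs_def]
 by (rule smooth_mult) (intro smooth_affine assms bounded_linear_fst bounded_linear_snd)+

lemma pderiv_dir_0: "smooth f ==> pderiv_dir 0 f x = 0"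
 unfolding pderiv_dir_def by (rule linear_0[OF linear_frechet_derivative[OF smooth_differentiable]])

lemma pderiv_tens:
 assumes "smooth \<phi>" "smooth psi"
 shows "pderiv_dir (1, 0) (tens \<phi> psi) = tens (pderiv_dir 1 \<phi>) psi"
  and "pderiv_dir (0, v) (tens \<phi> psi) = tens \<phi> (pderiv_dir v psi)"
proof -
 have d: "pderiv_dir w (tens \<phi> psi) z = \<phi> (0 + fst z) * pderiv_dir (snd w) psi (0 + snd z) + pderiv_dir (fst w) \<phi> (0 + fst z) * psi (0 + snd z)" for w z
  unfolding tens_def[abs_def]
  using pderiv_dir_eq[OF has_derivative_mult[OF has_derivative_affine_comp[OF assms(1) bounded_linear_fst, of 0 z] has_derivative_affine_comp[OF assms(2) bounded_linear_snd, of 0 z]], where v=w]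
  by (simp add: pderiv_dir_def)
 show "pderiv_dir (1, 0) (tens \<phi> psi) = tens (pderiv_dir 1 \<phi>) psi"
  by (rule ext) (simp add: d tens_def pderiv_dir_0 assms)
 show "pderiv_dir (0, v) (tens \<phi> psi) = tens \<phi> (pderiv_dir v psi)"
  by (rule ext) (simp add: d tens_def pderiv_dir_0 assms)
qed

lemma test_fun_tens:
 assumes "test_fun {0<..} \<phi>" "test_fun UNIV psi" shows "test_fun spacetime (tens \<phi> psi)"
proof -
 have sub: "support (tens \<phi> psi) \<subseteq> support \<phi> \<times> support psi"
 proof (rule support_subset_closed)
  show "closed (support \<phi> \<times> support psi)" by (intro closed_Times) (simp_all add: support_def)
  fix z assume "z \<notin> support \<phi> \<times> support psi"
  then show "tens \<phi> psi z = 0" using not_support[of _ \<phi>] not_support[of _ psi] by (cases z) (auto simp: tens_def)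
 qed
 have c: "compact (support \<phi> \<times> support psi)" using assms by (intro compact_Times) (auto simp: test_fun_def)
 have "compact (support (tens \<phi> psi))"
  using sub c by (metis compact_Int_closed inf.absorb_iff2 closed_closure support_def)
 moreover have "support (tens \<phi> psi) \<subseteq> spacetime"
  using sub assms by (fastforce simp: test_fun_def spacetime_def)
 ultimately show ?thesis using assms by (simp add: test_fun_def smooth_tens)
qed

lemma distr_of_tens:
 assumes f: "!!t. t >= 0 ==> SI (cr (f t))" "!!t. t >= 0 ==> Lr (f t) = G t" and psi: "test_fun UNIV psi"
 shows "distr_of f (tens \<phi> psi) = tint (%t. inner (G t) (Lr psi)) \<phi>"
 unfolding distr_of_def
proof (rule set_lebesgue_integral_cong, simp, intro allI impI)
 fix t :: real assume "t \<in> {0..}"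
 then have t: "t >= 0" by simp
 have "(LBINT x. f t x * tens \<phi> psi (t, x)) = (LBINT x. (f t x * psi x) * \<phi> t)"
  by (rule Bochner_Integration.integral_cong) (auto simp: tens_def)
 also have "\<dots> = inner (G t) (Lr psi) * \<phi> t"
  using inner_Lr[OF f(1)[OF t] test_fun_SI[OF psi]] f(2)[OF t] by simp
 finally show "(LBINT x. f t x * tens \<phi> psi (t, x)) = inner (G t) (Lr psi) * \<phi> t" .
qed

lemma continuous_AE_eq:
 fixes f g :: "real^2 => real"
 assumes "continuous_on UNIV f" "continuous_on UNIV g" "AE x in lborel. f x = g x"
 shows "f = g"
proof -
 have o: "open {x. f x ~= g x}" by (rule open_Collect_neq[OF assms(1,2)])
 have "{x. f x ~= g x} \<in> null_sets lborel"
  using assms(3) o by (subst AE_iff_null_sets) auto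
 then have "negligible {x. f x ~= g x}"
  by (simp add: negligible_iff_null_sets null_sets_completionI)
 then have "{x. f x ~= g x} = {}" using open_not_negligible[OF o] by blast
 then show ?thesis by auto
qed

text \<open>Partial derivatives commute because their multipliers do.\<close>

lemma mixed_partials:
 assumes psi: "test_fun UNIV (psi :: real^2 => real)"
 shows "pderiv_dir (axis k 1) (pderiv_dir (axis l 1) psi) = pderiv_dir (axis l 1) (pderiv_dir (axis k 1) psi)"
proof -
 let ?D = "%k. pderiv_dir (axis k (1::real)) :: (real^2 => real) => _"
 note T = test_fun_pderiv[OF _ axis_Basis]
 have F: "AE xi in lborel. rep (FT (Lr (?D k (?D l psi)))) xi = dsym k xi * (dsym l xi * rep (FT (Lr psi)) xi)" for k l
  using isD_rep[OF isD_test_fun[OF psi], of l] isD_rep[OF isD_test_fun[OF T[OF psi]], of k l]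
  by eventually_elim simp
 have "AE xi in lborel. rep (FT (Lr (?D k (?D l psi)))) xi = rep (FT (Lr (?D l (?D k psi)))) xi"
  using F[of k l] F[of l k] by eventually_elim (simp add: mult_ac)
 then have "cl (rep (FT (Lr (?D k (?D l psi))))) = cl (rep (FT (Lr (?D l (?D k psi)))))"
  by (intro cl_cong_AE SI_rep)
 then have "Lr (?D k (?D l psi)) = Lr (?D l (?D k psi))" by simp
 then have "AE x in lborel. ?D k (?D l psi) x = ?D l (?D k psi) x"
  using cl_eq_iff[OF test_fun_SI[OF T[OF T[OF psi]]] test_fun_SI[OF T[OF T[OF psi]]], of k l l k] by simp
 then show ?thesis
  by (intro continuous_AE_eq test_fun_continuous[OF T[OF T[OF psi]]])
qed

subsection \<open>Curves in Sobolev spaces\<close>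

text \<open>Continuity is imposed on the weighted transforms, which is the continuity in \<open>H\<^sup>s\<close>.\<close>

definition Hs_curve :: "real => (real => l2) => bool" where
 "Hs_curve s x \<longleftrightarrow> (\<forall>t\<ge>0. inHs s (x t)) \<and> continuous_on {0..} (%t. mul (wt s) (FT (x t)))"

lemma Hsn_diff: "inHs s x ==> inHs s y ==> Hsn s (x - y) = norm (mul (wt s) (FT x) - mul (wt s) (FT y))"
 unfolding Hsn_def by (simp add: FT_diff mul_diff)

lemma Hs_curve_continuous:
 fixes A :: "l2 => 'b::real_normed_vector"
 assumes x: "Hs_curve s x" and A: "!!x y. inHs s x ==> inHs s y ==> A (x - y) = A x - A y"
  "!!x. inHs s x ==> norm (A x) <= C * Hsn s x"
 shows "continuous_on {0..} (%t. A (x t))"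
 unfolding continuous_on_def
proof
 fix t :: real assume t: "t \<in> {0..}"
 show "((%t. A (x t)) \<longlongrightarrow> A (x t)) (at t within {0..})"
 proof (rule LIM_zero_cancel, rule Lim_null_comparison)
  show "\<forall>\<^sub>F r in at t within {0..}. norm (A (x r) - A (x t)) <= C * norm (mul (wt s) (FT (x r)) - mul (wt s) (FT (x t)))"
   unfolding eventually_at_filter
  proof (intro always_eventually allI impI)
   fix r :: real assume "r \<in> {0..}"
   then have h: "inHs s (x r)" "inHs s (x t)" using x t by (auto simp: Hs_curve_def)
   show "norm (A (x r) - A (x t)) <= C * norm (mul (wt s) (FT (x r)) - mul (wt s) (FT (x t)))"
    using A(2)[OF inHs_diff[OF h]] unfolding A(1)[OF h] Hsn_diff[OF h] .
  qed
  have "((%t. mul (wt s) (FT (x t))) \<longlongrightarrow> mul (wt s) (FT (x t))) (at t within {0..})"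
   using x t by (auto simp: Hs_curve_def continuous_on_def)
  from tendsto_mult[OF tendsto_const tendsto_norm[OF tendsto_diff[OF this tendsto_const]], of C "mul (wt s) (FT (x t))"]
  show "((%r. C * norm (mul (wt s) (FT (x r)) - mul (wt s) (FT (x t)))) \<longlongrightarrow> 0) (at t within {0..})" by simp
 qed
qed

lemma norm_le_Hsn: "s >= 0 ==> inHs s x ==> norm x <= 1 * Hsn s x"
proof -
 assume s: "s >= 0" "inHs s x"
 have "norm x * 1 <= norm x * (2 * pi)" by (intro mult_left_mono) (use pi_gt3 in auto)
 also have "\<dots> = Hsn 0 x" by (simp add: Hsn_0)
 also have "\<dots> <= Hsn s x" by (rule inHs_mono[OF s(2,1)])
 finally show ?thesis by simp
qed

lemma Hs_curve_mop:
 assumes "Hs_curve s x" "m \<in> borel_measurable borel" "!!xi. norm (m xi) <= norm (wt s xi)"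
 shows "continuous_on {0..} (%t. mop m (x t))"
 by (rule Hs_curve_continuous[OF assms(1), of _ 1]) (auto simp: mop_diff[OF assms(2,3)] intro: mop_Hs(2)[OF assms(2,3)])

lemma Hs_curve_l2: "s >= 0 ==> Hs_curve s x ==> continuous_on {0..} x"
 by (rule Hs_curve_continuous[of s x "%x. x" 1]) (auto intro: norm_le_Hsn[simplified])

lemma Hs_curve_bc: "s > 1 ==> Hs_curve s x ==> continuous_on {0..} (%t. bc (x t))"
 by (rule Hs_curve_continuous[of s x bc]) (auto intro: bc_diff norm_bc_le)

lemma Hs_curveI:
 assumes f: "!!t. t >= 0 ==> in_Hs s (f t)"
  and lim: "!!t. t >= 0 ==> ((%r. Hs_norm s (%x. f r x - f t x)) \<longlongrightarrow> 0) (at t within {0..})"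
 shows "Hs_curve s (%t. Lr (f t))"
 unfolding Hs_curve_def continuous_on_def
proof (intro conjI allI impI ballI)
 show "inHs s (Lr (f t))" if "t >= 0" for t using f[OF that] by (simp add: in_Hs_iff)
 fix t :: real assume "t \<in> {0..}"
 then have t: "t >= 0" by simp
 show "((%t. mul (wt s) (FT (Lr (f t)))) \<longlongrightarrow> mul (wt s) (FT (Lr (f t)))) (at t within {0..})"
 proof (rule LIM_zero_cancel, rule Lim_null_comparison)
  show "\<forall>\<^sub>F r in at t within {0..}. norm (mul (wt s) (FT (Lr (f r))) - mul (wt s) (FT (Lr (f t)))) <= 2 * pi * Hs_norm s (%x. f r x - f t x)"
   unfolding eventually_at_filter
  proof (intro always_eventually allI impI)
   fix r :: real assume "r \<in> {0..}"
   then have F: "SI (cr (f r))" "inHs s (Lr (f r))" "SI (cr (f t))" "inHs s (Lr (f t))"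
    using f[of r] f[OF t] by (auto simp: in_Hs_iff)
   have d: "Lr (%x. f r x - f t x) = Lr (f r) - Lr (f t)" "SI (cr (%x. f r x - f t x))"
    using cl_diff[OF F(1,3)] SI_diff[OF F(1,3)] by simp_all
   have h: "in_Hs s (%x. f r x - f t x)" unfolding in_Hs_iff d(1) using d(2) inHs_diff[OF F(2,4)] by simp
   have "norm (mul (wt s) (FT (Lr (f r))) - mul (wt s) (FT (Lr (f t)))) = Hsn s (Lr (f r) - Lr (f t))"
    by (rule Hsn_diff[OF F(2,4), symmetric])
   also have "\<dots> = 2 * pi * Hs_norm s (%x. f r x - f t x)" unfolding Hs_norm_eq[OF h] d(1) by simp
   finally show "norm (mul (wt s) (FT (Lr (f r))) - mul (wt s) (FT (Lr (f t)))) <= 2 * pi * Hs_norm s (%x. f r x - f t x)" by simp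
  qed
  show "((%r. 2 * pi * Hs_norm s (%x. f r x - f t x)) \<longlongrightarrow> 0) (at t within {0..})"
   using tendsto_mult[OF tendsto_const lim[OF t], of "2 * pi"] by simp
 qed
qed

lemma pair_Hs_norm_ge:
 "\<bar>Hs_norm s (%x. u x $ j)\<bar> <= pair_Hs_norm s u \<tau>" "\<bar>Hs_norm s (%x. \<tau> x $ i $ j)\<bar> <= pair_Hs_norm s u \<tau>"
proof -
 let ?A = "\<Sum>j\<in>UNIV. (Hs_norm s (%x. u x $ j))\<^sup>2" and ?B = "\<Sum>j\<in>UNIV. \<Sum>k\<in>UNIV. (Hs_norm s (%x. \<tau> x $ j $ k))\<^sup>2"
 have p: "?A >= 0" "?B >= 0" by (intro sum_nonneg zero_le_power2)+
 have "(Hs_norm s (%x. u x $ j))\<^sup>2 <= ?A" by (rule member_le_sum) auto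
 then have "sqrt ((Hs_norm s (%x. u x $ j))\<^sup>2) <= sqrt (?A + ?B)" using p by (intro real_sqrt_le_mono) simp
 then show "\<bar>Hs_norm s (%x. u x $ j)\<bar> <= pair_Hs_norm s u \<tau>" by (simp add: pair_Hs_norm_def)
 have "(Hs_norm s (%x. \<tau> x $ i $ j))\<^sup>2 <= (\<Sum>k\<in>UNIV. (Hs_norm s (%x. \<tau> x $ i $ k))\<^sup>2)" by (rule member_le_sum) auto
 also have "\<dots> <= ?B" by (rule member_le_sum[of i UNIV "%i. \<Sum>k\<in>UNIV. (Hs_norm s (%x. \<tau> x $ i $ k))\<^sup>2"]) (auto intro: sum_nonneg)
 finally have "sqrt ((Hs_norm s (%x. \<tau> x $ i $ j))\<^sup>2) <= sqrt (?A + ?B)" using p by (intro real_sqrt_le_mono) simp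
 then show "\<bar>Hs_norm s (%x. \<tau> x $ i $ j)\<bar> <= pair_Hs_norm s u \<tau>" by (simp add: pair_Hs_norm_def)
qed

lemma continuous_in_Hs_curves:
 assumes c: "continuous_in_Hs s u \<tau>"
 shows "Hs_curve s (%t. Lr (%x. u t x $ j))" "Hs_curve s (%t. Lr (%x. \<tau> t x $ i $ j))"
proof -
 have p: "pair_in_Hs s (u t) (\<tau> t)" "((%r. pair_Hs_norm s (%x. u r x - u t x) (%x. \<tau> r x - \<tau> t x)) \<longlongrightarrow> 0) (at t within {0..})" if "t >= 0" for t
  using c that by (auto simp: continuous_in_Hs_def)
 show "Hs_curve s (%t. Lr (%x. u t x $ j))"
 proof (rule Hs_curveI)
  show "in_Hs s (%x. u t x $ j)" if "t >= 0" for t using p(1)[OF that] by (simp add: pair_in_Hs_def)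
  show "((%r. Hs_norm s (%x. u r x $ j - u t x $ j)) \<longlongrightarrow> 0) (at t within {0..})" if "t >= 0" for t
   by (rule Lim_null_comparison[OF _ p(2)[OF that]])
     (use pair_Hs_norm_ge(1)[of s "%x. u _ x - u t x"] in \<open>auto simp: vector_minus_component\<close>)
 qed
 show "Hs_curve s (%t. Lr (%x. \<tau> t x $ i $ j))"
 proof (rule Hs_curveI)
  show "in_Hs s (%x. \<tau> t x $ i $ j)" if "t >= 0" for t using p(1)[OF that] by (simp add: pair_in_Hs_def)
  show "((%r. Hs_norm s (%x. \<tau> r x $ i $ j - \<tau> t x $ i $ j)) \<longlongrightarrow> 0) (at t within {0..})" if "t >= 0" for t
   by (rule Lim_null_comparison[OF _ p(2)[OF that]])
     (use pair_Hs_norm_ge(2)[of s "%x. \<tau> _ x - \<tau> t x"] in \<open>auto simp: vector_minus_component\<close>)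
 qed
qed

subsection \<open>The projection onto gradients\<close>

definition lsym :: "2 => 2 => real^2 => complex" where
 "lsym j k xi = complex_of_real (xi $ j * xi $ k / (norm xi)\<^sup>2)"

lemma lsym_measurable [measurable]: "lsym j k \<in> borel_measurable borel"
proof -
 have [measurable]: "(%xi::real^2. xi $ i) \<in> borel_measurable borel" for i
  by (intro borel_measurable_continuous_onI continuous_intros)
 show ?thesis unfolding lsym_def[abs_def] by measurable
qed

lemma norm_lsym: "norm (lsym j k xi) <= 1"
proof (cases "xi = 0")
 case False
 have "\<bar>xi $ j\<bar> * \<bar>xi $ k\<bar> <= norm xi * norm xi"
  by (intro mult_mono component_le_norm_cart) auto
 then show ?thesis using False by (simp add: lsym_def norm_divide norm_mult power2_eq_square divide_le_eq)
qed (simp add: lsym_def)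

lemma lsym_mdom [simp]: "mdom (lsym j k) x"
 by (rule mdom_bounded[OF lsym_measurable norm_lsym])

lemma bounded_linear_mop_lsym: "bounded_linear (mop (lsym j k))"
 unfolding mop_def[abs_def]
 by (intro bounded_linear_compose[OF bounded_linear_IFT] bounded_linear_compose[OF bounded_linear_mul[OF lsym_measurable norm_lsym]] bounded_linear_FT)

lemma norm_mop_lsym: "norm (mop (lsym j k) x) <= norm x"
 using norm_mul_le[OF lsym_measurable norm_lsym, of j k "FT x"] unfolding mop_def
 by (simp add: norm_IFT norm_FT field_simps)

text \<open>The projection \<open>\<nabla> \<Delta>\<^sup>-\<^sup>1 div\<close>, a bounded multiplier.\<close>

definition grad_part :: "(2 => l2) => 2 => l2" where
 "grad_part G j = (\<Sum>k\<in>UNIV. RE (mop (lsym j k) (G k)))"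

lemma inner_mul_mul:
 assumes "mdom m x" "mdom n y" "mdom m' x" "mdom n' y"
  and eq: "!!xi. m xi * cnj (n xi) = complex_of_real c * (m' xi * cnj (n' xi))"
 shows "inner (mul m x) (mul n y) = c * inner (mul m' x) (mul n' y)"
proof -
 have "(LBINT xi. m xi * rep x xi * cnj (n xi * rep y xi)) = (LBINT xi. complex_of_real c * (m' xi * rep x xi * cnj (n' xi * rep y xi)))"
 proof (rule Bochner_Integration.integral_cong[OF refl])
  fix xi
  have "m xi * rep x xi * cnj (n xi * rep y xi) = (m xi * cnj (n xi)) * (rep x xi * cnj (rep y xi))" by (simp add: mult_ac)
  also have "\<dots> = complex_of_real c * (m' xi * rep x xi * cnj (n' xi * rep y xi))" unfolding eq by (simp add: mult_ac)
  finally show "m xi * rep x xi * cnj (n xi * rep y xi) = complex_of_real c * (m' xi * rep x xi * cnj (n' xi * rep y xi))" .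
 qed
 then show ?thesis
  unfolding mul_def using assms(1-4) by (simp add: inner_cl mdom_def)
qed

lemma RE_grad_part: "RE (grad_part G j) = grad_part G j"
proof -
 have "RE (RE x) = RE x" for x unfolding RE_def[of x] by (rule RE_Lr[OF SI_Re[OF SI_rep]])
 then show ?thesis unfolding grad_part_def by (simp add: linear_sum[OF bounded_linear.linear[OF bounded_linear_RE]])
qed

lemma continuous_grad_part:
 assumes "!!k. continuous_on S (%t. G t k)" shows "continuous_on S (%t. grad_part (G t) j)"
 unfolding grad_part_def
 by (intro continuous_on_sum bounded_linear.continuous_on[OF bounded_linear_RE] bounded_linear.continuous_on[OF bounded_linear_mop_lsym] assms)

lemma inner_grad_part:
 assumes "RE z = z"
 shows "inner (grad_part G j) z = (\<Sum>k\<in>UNIV. inner (mul (lsym j k) (FT (G k))) (FT z)) / (2 * pi)\<^sup>2"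
 unfolding grad_part_def inner_sum_left inner_RE assms inner_via_FT[of "mop _ _"] by (simp add: mop_def sum_divide_distrib)

lemma UNIV_two: "(\<Sum>k\<in>UNIV. f (k::2)) = f 1 + f 2"
 by (simp add: UNIV_2)

lemma norm_sq_two: "(norm (xi::real^2))\<^sup>2 = (xi $ 1)\<^sup>2 + (xi $ 2)\<^sup>2"
 by (simp add: norm_vec_def L2_set_def UNIV_2)

lemma isD_FT: "isD k x x' ==> FT x' = mul (dsym k) (FT x)" "isD k x x' ==> mdom (dsym k) (FT x)"
 by (auto simp: isD_def)

text \<open>The gradient part is orthogonal to rotated gradients, has the same divergence as the field,
  and its pairing with a field is controlled by the divergence of that field.\<close>

lemma grad_part_curl:
 assumes h: "isD 1 h h1" "isD 2 h h2" and real: "RE h1 = h1" "RE h2 = h2"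
 shows "inner (grad_part G 1) h2 = inner (grad_part G 2) h1"
proof -
 have "inner (mul (lsym 1 k) (FT (G k))) (mul (dsym 2) (FT h)) = 1 * inner (mul (lsym 2 k) (FT (G k))) (mul (dsym 1) (FT h))" for k
  by (rule inner_mul_mul) (use h in \<open>auto simp: isD_FT lsym_def dsym_def\<close>)
 then show ?thesis unfolding inner_grad_part[OF real(1)] inner_grad_part[OF real(2)] isD_FT(1)[OF h(1)] isD_FT(1)[OF h(2)] by simp
qed

lemma mul_one: "mul (%_. 1) x = x" "mdom (%_. 1) x"
 by (simp_all add: mul_def mdom_def SI_rep)

lemma grad_part_div:
 assumes h: "!!j. isD j h (h' j)" and real: "!!j. RE (h' j) = h' j"
 shows "(\<Sum>j\<in>UNIV. inner (grad_part G j) (h' j)) = (\<Sum>j\<in>UNIV. inner (G j) (h' j))"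
proof -
 have zero: "xi $ j = 0" if "xi = 0" for xi :: "real^2" and j using that by simp
 have dm: "mdom (dsym k) (FT h)" for k using isD_FT(2)[OF h[of k]] .
 define q where "q k xi = dsym k xi * (if xi = 0 then 0 else 1)" for k xi
 have mq: "mdom (%xi. complex_of_real (xi $ j * xi $ l / (norm xi)\<^sup>2)) (FT x)" for j l x
  using lsym_mdom[of j l "FT x"] unfolding lsym_def[abs_def] .
 have "inner (mul (lsym 1 k) (FT (G k))) (mul (dsym 1) (FT h)) + inner (mul (lsym 2 k) (FT (G k))) (mul (dsym 2) (FT h))
   = inner (FT (G k)) (mul (dsym k) (FT h))" for k
 proof -
  have a: "inner (mul (lsym j k) (FT (G k))) (mul (dsym j) (FT h)) = 1 * inner (mul (lsym j j) (FT (G k))) (mul (dsym k) (FT h))" for j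
   by (rule inner_mul_mul) (use dm in \<open>auto simp: lsym_def dsym_def\<close>)
  have b: "mul (lsym 1 1) x + mul (lsym 2 2) x = x" for x
  proof -
   have "mul (lsym 1 1) x + mul (lsym 2 2) x = cl (%xi. lsym 1 1 xi * rep x xi + lsym 2 2 xi * rep x xi)"
    unfolding mul_def by (rule cl_add[symmetric]) (use lsym_mdom in \<open>auto simp: mdom_def\<close>)
   also have "\<dots> = cl (rep x)"
   proof (rule cl_cong_AE)
    show "SI (%xi. lsym 1 1 xi * rep x xi + lsym 2 2 xi * rep x xi)"
     by (rule SI_add) (use lsym_mdom in \<open>auto simp: mdom_def\<close>)
    have "AE xi in lborel. xi ~= (0::real^2)" by (rule AE_lborel_singleton)
    then show "AE xi in lborel. lsym 1 1 xi * rep x xi + lsym 2 2 xi * rep x xi = rep x xi"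
    proof eventually_elim
     case (elim xi)
     have "lsym 1 1 xi + lsym 2 2 xi = complex_of_real (((xi $ 1)\<^sup>2 + (xi $ 2)\<^sup>2) / (norm xi)\<^sup>2)"
      by (simp add: lsym_def power2_eq_square add_divide_distrib)
     also have "\<dots> = 1" unfolding norm_sq_two[symmetric] using elim by simp
     finally show ?case by (simp flip: distrib_right)
    qed
   qed (rule SI_rep)
   finally show ?thesis by simp
  qed
  show ?thesis unfolding a mult_1 inner_add_left[symmetric] b ..
 qed
 note * = this
 have "(\<Sum>j\<in>UNIV. inner (grad_part G j) (h' j)) = (\<Sum>j\<in>UNIV. \<Sum>k\<in>UNIV. inner (mul (lsym j k) (FT (G k))) (mul (dsym j) (FT h))) / (2 * pi)\<^sup>2"
  unfolding inner_grad_part[OF real] isD_FT(1)[OF h] sum_divide_distrib ..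
 also have "\<dots> = (\<Sum>k\<in>UNIV. inner (FT (G k)) (mul (dsym k) (FT h))) / (2 * pi)\<^sup>2"
  using *[of 1] *[of 2] by (simp add: UNIV_two)
 also have "\<dots> = (\<Sum>k\<in>UNIV. inner (G k) (h' k))"
  unfolding inner_via_FT[of "G _"] isD_FT(1)[OF h] sum_divide_distrib ..
 finally show ?thesis .
qed

lemma grad_part_pairing:
 assumes w: "!!j. isD j (w j) (w' j)" "!!j. RE (w j) = w j" and M: "!!k l. isD l (M k l) (M' k l)"
  and G: "!!k. G k = (\<Sum>l\<in>UNIV. M' k l)"
 shows "\<bar>\<Sum>j\<in>UNIV. inner (grad_part G j) (w j)\<bar> <= norm (\<Sum>j\<in>UNIV. w' j) * (\<Sum>k\<in>UNIV. \<Sum>l\<in>UNIV. norm (M k l))"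
proof -
 have lin: "mul (lsym j k) (FT (G k)) = (\<Sum>l\<in>UNIV. mul (lsym j k) (FT (M' k l)))" for j k
  unfolding G FT_sum by (rule linear_sum[OF bounded_linear.linear[OF bounded_linear_mul[OF lsym_measurable norm_lsym]]])
 have mm: "mdom (%xi. lsym j k xi * dsym l xi) (FT (M k l))" "mul (lsym j k) (FT (M' k l)) = mul (%xi. lsym j k xi * dsym l xi) (FT (M k l))" for j k l
 proof -
  have d: "SI (%xi. dsym l xi * rep (FT (M k l)) xi)" using isD_FT(2)[OF M[of l k]] by (simp add: mdom_def)
  have S: "SI (%xi. lsym j k xi * (dsym l xi * rep (FT (M k l)) xi))"
   by (rule SI_bounded_mult[OF d lsym_measurable norm_lsym])
  then show "mdom (%xi. lsym j k xi * dsym l xi) (FT (M k l))" by (simp add: mdom_def mult.assoc)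
  have "mul (lsym j k) (FT (M' k l)) = mul (lsym j k) (cl (%xi. dsym l xi * rep (FT (M k l)) xi))"
   unfolding isD_FT(1)[OF M] by (simp add: mul_def)
  also have "\<dots> = mul (%xi. lsym j k xi * dsym l xi) (FT (M k l))"
   unfolding mul_cl[OF lsym_measurable d S] by (simp add: mul_def mult.assoc)
  finally show "mul (lsym j k) (FT (M' k l)) = mul (%xi. lsym j k xi * dsym l xi) (FT (M k l))" .
 qed
 have "inner (mul (lsym j k) (FT (M' k l))) (FT (w j)) = - inner (mul (lsym k l) (FT (M k l))) (FT (w' j))" for j k l
 proof -
  have "inner (mul (%xi. lsym j k xi * dsym l xi) (FT (M k l))) (mul (%_. 1) (FT (w j))) = (-1) * inner (mul (lsym k l) (FT (M k l))) (mul (dsym j) (FT (w j)))"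
   by (rule inner_mul_mul[OF mm(1) mul_one(2) lsym_mdom isD_FT(2)[OF w(1)]]) (simp add: lsym_def dsym_def mult_ac)
  then show ?thesis unfolding mm(2) isD_FT(1)[OF w(1)] by (simp add: mul_one)
 qed
 then have "(\<Sum>j\<in>UNIV. inner (grad_part G j) (w j)) = (\<Sum>j\<in>UNIV. (\<Sum>k\<in>UNIV. \<Sum>l\<in>UNIV. - inner (mul (lsym k l) (FT (M k l))) (FT (w' j))) / (2 * pi)\<^sup>2)"
  unfolding inner_grad_part[OF w(2)] lin inner_sum_left by simp
 also have "\<dots> = - (\<Sum>k\<in>UNIV. \<Sum>l\<in>UNIV. inner (mop (lsym k l) (M k l)) (\<Sum>j\<in>UNIV. w' j))"
 proof -
  have m: "inner (mop (lsym k l) (M k l)) (w' j) = inner (mul (lsym k l) (FT (M k l))) (FT (w' j)) / (2 * pi)\<^sup>2" for k l j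
   unfolding inner_via_FT[of "mop _ _"] by (simp add: mop_def)
  show ?thesis unfolding inner_sum_right m by (simp add: UNIV_two add_divide_distrib diff_divide_distrib algebra_simps)
 qed
 finally have "\<bar>\<Sum>j\<in>UNIV. inner (grad_part G j) (w j)\<bar> = \<bar>\<Sum>k\<in>UNIV. \<Sum>l\<in>UNIV. inner (mop (lsym k l) (M k l)) (\<Sum>j\<in>UNIV. w' j)\<bar>" by simp
 also have "\<dots> <= (\<Sum>k\<in>UNIV. \<Sum>l\<in>UNIV. norm (M k l) * norm (\<Sum>j\<in>UNIV. w' j))"
 proof (rule order_trans[OF sum_abs sum_mono], rule order_trans[OF sum_abs sum_mono])
  fix k l
  show "\<bar>inner (mop (lsym k l) (M k l)) (\<Sum>j\<in>UNIV. w' j)\<bar> <= norm (M k l) * norm (\<Sum>j\<in>UNIV. w' j)"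
   by (rule order_trans[OF Cauchy_Schwarz_ineq2]) (intro mult_right_mono norm_mop_lsym norm_ge_zero)
 qed
 finally show ?thesis by (simp add: sum_distrib_left sum_distrib_right mult.commute)
qed

lemma grad_part_solenoidal:
 assumes "!!j. isD j (x j) (x' j)" "!!j. RE (x j) = x j" "(\<Sum>j\<in>UNIV. x' j) = 0"
 shows "(\<Sum>j\<in>UNIV. inner (grad_part G j) (x j)) = 0"
proof -
 have ae: "AE xi in lborel. (\<Sum>j\<in>UNIV. dsym j xi * rep (FT (x j)) xi) = 0"
 proof -
  have S: "SI (%xi. dsym j xi * rep (FT (x j)) xi)" for j using isD_FT(2)[OF assms(1)] by (simp add: mdom_def)
  have "0 = FT (\<Sum>j\<in>UNIV. x' j)" using assms(3) by simp
  also have "\<dots> = cl (%xi. \<Sum>j\<in>UNIV. dsym j xi * rep (FT (x j)) xi)"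
   unfolding FT_sum isD_FT(1)[OF assms(1)] mul_def by (rule cl_sum[symmetric]) (rule S)
  finally have "cl (%xi. \<Sum>j\<in>UNIV. dsym j xi * rep (FT (x j)) xi) = cl (%_. 0)" by simp
  moreover have "SI (%xi. \<Sum>j\<in>UNIV. dsym j xi * rep (FT (x j)) xi)" by (rule SI_sum) (rule S)
  ultimately show ?thesis using cl_eq_iff[OF _ SI_zero] by simp
 qed
 have "(\<Sum>j\<in>UNIV. mul (lsym k j) (FT (x j))) = 0" for k
 proof -
  have S: "SI (%xi. lsym k j xi * rep (FT (x j)) xi)" for j using lsym_mdom by (simp add: mdom_def)
  have "(\<Sum>j\<in>UNIV. mul (lsym k j) (FT (x j))) = cl (%xi. \<Sum>j\<in>UNIV. lsym k j xi * rep (FT (x j)) xi)"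
   unfolding mul_def by (rule cl_sum[symmetric]) (rule S)
  also have "\<dots> = cl (%_. 0)"
  proof (rule cl_cong_AE)
   show "AE xi in lborel. (\<Sum>j\<in>UNIV. lsym k j xi * rep (FT (x j)) xi) = 0"
    using ae
   proof eventually_elim
    case (elim xi)
    have "(\<Sum>j\<in>UNIV. lsym k j xi * rep (FT (x j)) xi) = (complex_of_real (xi $ k / (norm xi)\<^sup>2) * (- \<i>)) * (\<Sum>j\<in>UNIV. dsym j xi * rep (FT (x j)) xi)"
     by (simp add: UNIV_two lsym_def dsym_def algebra_simps add_divide_distrib)
    then show ?case using elim by simp
   qed
  qed (rule SI_sum, rule S, rule SI_zero)
  finally show ?thesis by simp
 qed
 note z = this
 have sw: "inner (mul (lsym j k) (FT (G k))) (FT (x j)) = inner (FT (G k)) (mul (lsym k j) (FT (x j)))" for j k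
  using inner_mul_mul[OF lsym_mdom[of j k] mul_one(2)[of "FT (x j)"] mul_one(2)[of "FT (G k)"] lsym_mdom[of k j], of 1]
  by (simp add: mul_one lsym_def mult_ac)
 have "(\<Sum>j\<in>UNIV. inner (grad_part G j) (x j)) = (\<Sum>k\<in>UNIV. inner (FT (G k)) (\<Sum>j\<in>UNIV. mul (lsym k j) (FT (x j)))) / (2 * pi)\<^sup>2"
  unfolding inner_grad_part[OF assms(2)] sw inner_sum_right by (simp add: UNIV_two add_divide_distrib)
 then show ?thesis unfolding z by simp
qed

subsection \<open>The equations satisfied by a strong solution\<close>

lemma mb_product:
 assumes "SI (cr f)" "s > 1" "inHs s (Lr f)" "SI (cr g)"
 shows "SI (cr (%x. f x * g x))" "Lr (%x. f x * g x) = mb (bc (Lr f)) (Lr g)"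
proof -
 have r: "RE (Lr f) = Lr f" using assms(1) by simp
 note b = bc_real[OF assms(2,3) r]
 have ae: "AE x in lborel. cr (apply_bcontfun (bc (Lr f))) x = cr f x"
  using b cl_eq_iff[OF b(2) assms(1)] by simp
 note m = mb_Lr[OF assms(4), of "bc (Lr f)"]
 have [measurable]: "f \<in> borel_measurable borel" "g \<in> borel_measurable borel"
  using assms(1,4) by (auto simp flip: square_integrable_real simp: square_integrable_def)
 have ae': "AE x in lborel. cr (%x. f x * g x) x = cr (%x. apply_bcontfun (bc (Lr f)) x * g x) x"
  using ae by eventually_elim simp
 show S: "SI (cr (%x. f x * g x))"
  by (rule SI_cong_AE[OF _ m(1) ae']) measurable
 show "Lr (%x. f x * g x) = mb (bc (Lr f)) (Lr g)"
  unfolding m(2) by (rule cl_cong_AE[OF S m(1) ae'])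
qed

lemma Lr_add: "SI (cr f) ==> SI (cr g) ==> SI (cr (%x. f x + g x)) \<and> Lr (%x. f x + g x) = Lr f + Lr g"
 using SI_add[of "cr f" "cr g"] cl_add[of "cr f" "cr g"] by simp

lemma Lr_diff: "SI (cr f) ==> SI (cr g) ==> SI (cr (%x. f x - g x)) \<and> Lr (%x. f x - g x) = Lr f - Lr g"
 using SI_diff[of "cr f" "cr g"] cl_diff[of "cr f" "cr g"] by simp

lemma Lr_cmult: "SI (cr f) ==> SI (cr (%x. c * f x)) \<and> Lr (%x. c * f x) = c *\<^sub>R Lr f"
 using SI_scaleR[of "cr f" c] cl_scaleR[of "cr f" c] by (simp add: scaleR_conv_of_real)

lemma Lr_sum: "(!!i. i \<in> I ==> SI (cr (f i))) ==> SI (cr (%x. \<Sum>i\<in>I. f i x)) \<and> Lr (%x. \<Sum>i\<in>I. f i x) = (\<Sum>i\<in>I. Lr (f i))"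
 using SI_sum[of I "%i. cr (f i)"] cl_sum[of I "%i. cr (f i)"] by simp

text \<open>The right hand sides of the system, for a velocity \<open>x\<close> and a stress \<open>T\<close>.\<close>

definition adv :: "(2 => l2) => l2 => l2" where
 "adv x y = (\<Sum>k\<in>UNIV. mb (bc (x k)) (Dk k y))"

definition Qop :: "real => (2 => l2) => (2 => 2 => l2) => 2 => 2 => l2" where
 "Qop b x T i j = (\<Sum>k\<in>UNIV.
   (1/2) *\<^sub>R (mb (bc (T i k)) (Dk j (x k)) - mb (bc (T i k)) (Dk k (x j)))
  - (1/2) *\<^sub>R (mb (bc (T k j)) (Dk k (x i)) - mb (bc (T k j)) (Dk i (x k)))
  - (b/2) *\<^sub>R (mb (bc (T k j)) (Dk k (x i)) + mb (bc (T k j)) (Dk i (x k))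
    + mb (bc (T i k)) (Dk j (x k)) + mb (bc (T i k)) (Dk k (x j))))"

definition Frhs :: "real => real => real => (2 => l2) => (2 => 2 => l2) => 2 => 2 => l2" where
 "Frhs b \<beta> a x T i j = (1/2) *\<^sub>R (Dk j (x i) + Dk i (x j)) - adv x (T i j) - a *\<^sub>R T i j
   - Qop b x T i j - RE (mop (fsym \<beta>) (T i j))"

definition Grhs :: "(2 => l2) => (2 => 2 => l2) => 2 => l2" where
 "Grhs x T j = (\<Sum>k\<in>UNIV. Dk k (T j k)) - adv x (x j)"

locale strong_sol = cutoff +
 fixes b \<beta> s a :: real and u0 \<tau>0 u \<tau>
 assumes \<beta>: "1/2 < \<beta>" "\<beta> < 1" and s: "s > 1 + \<beta>"
  and sol: "strong_solution b \<beta> s a u0 \<tau>0 u \<tau>"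
begin

abbreviation X :: "real => 2 => l2" where "X t j \<equiv> Lr (%x. u t x $ j)"
abbreviation T :: "real => 2 => 2 => l2" where "T t i j \<equiv> Lr (%x. \<tau> t x $ i $ j)"

lemma s1: "s > 1" "s >= 1" "s >= 0" "0 <= \<beta>" "2 * \<beta> <= s"
 using \<beta> s by auto

lemma cHs: "continuous_in_Hs s u \<tau>" using sol by (simp add: strong_solution_def)

lemma SI_X: "t >= 0 ==> SI (cr (%x. u t x $ j))" and SI_T: "t >= 0 ==> SI (cr (%x. \<tau> t x $ i $ j))"
 using cHs by (auto simp: continuous_in_Hs_def pair_in_Hs_def in_Hs_iff)

lemma curve_X: "Hs_curve s (%t. X t j)" and curve_T: "Hs_curve s (%t. T t i j)"
 by (rule continuous_in_Hs_curves[OF cHs])+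

lemma Hs_X: "t >= 0 ==> inHs s (X t j)" and Hs_T: "t >= 0 ==> inHs s (T t i j)"
 using curve_X curve_T by (auto simp: Hs_curve_def)

lemma RE_X: "t >= 0 ==> RE (X t j) = X t j" and RE_T: "t >= 0 ==> RE (T t i j) = T t i j"
 by (simp_all add: SI_X SI_T)

lemma RE_Dk: "inHs s x ==> RE x = x ==> RE (Dk k x) = Dk k x"
 using isD_real[OF isD_Dk[OF s1(2)]] by blast

lemma wd:
 assumes "SI (cr f)" "inHs s (Lr f)"
 shows "SI (cr (weak_deriv k f))" "Lr (weak_deriv k f) = Dk k (Lr f)"
 using weak_deriv_isD[OF assms(1) isD_Dk[OF s1(2) assms(2)]] by auto

lemma continuous_Dk: "Hs_curve s x ==> continuous_on {0..} (%t. Dk k (x t))"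
 by (rule Hs_curve_mop[OF _ dsym_measurable dsym_le_wt[OF s1(2)]])

lemma continuous_fsym: "Hs_curve s x ==> continuous_on {0..} (%t. mop (fsym \<beta>) (x t))"
 by (rule Hs_curve_mop[OF _ fsym_measurable fsym_le_wt[OF s1(4,5)]])

lemma continuous_mb: "Hs_curve s x ==> continuous_on {0..} g ==> continuous_on {0..} (%t. mb (bc (x t)) (g t))"
 by (rule mb.continuous_on) (rule Hs_curve_bc[OF s1(1)])

lemmas curves = curve_X curve_T Hs_curve_l2[OF s1(3) curve_X] Hs_curve_l2[OF s1(3) curve_T]

lemma transport_Lr:
 assumes t: "t >= 0" and f: "SI (cr f)" "inHs s (Lr f)"
 shows "SI (cr (transport (u t) f))" "Lr (transport (u t) f) = adv (X t) (Lr f)"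
proof -
 note p = mb_product[OF SI_X[OF t] s1(1) Hs_X[OF t] wd(1)[OF f]]
 have "transport (u t) f = (%x. \<Sum>k\<in>UNIV. u t x $ k * weak_deriv k f x)" by (simp add: transport_def[abs_def])
 then show "SI (cr (transport (u t) f))" "Lr (transport (u t) f) = adv (X t) (Lr f)"
  using Lr_sum[of UNIV "%k x. u t x $ k * weak_deriv k f x"] p by (simp_all add: adv_def wd(2)[OF f])
qed

lemma grad_Lr:
 assumes t: "t >= 0"
 shows "SI (cr (%x. grad (u t) x $ j $ k))" "Lr (%x. grad (u t) x $ j $ k) = Dk k (X t j)"
 using wd[OF SI_X[OF t] Hs_X[OF t]] by (simp_all add: grad_def)

lemma Q_Lr:
 assumes t: "t >= 0"
 shows "SI (cr (%x. Q_term b (grad (u t) x) (\<tau> t x) $ i $ j)) \<and>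
   Lr (%x. Q_term b (grad (u t) x) (\<tau> t x) $ i $ j) = Qop b (X t) (T t) i j"
proof -
 define g where "g j k x = grad (u t) x $ j $ k" for j k x
 define p where "p i k j l x = \<tau> t x $ i $ k * g j l x" for i k j l x
 have p: "SI (cr (p i k j l)) \<and> Lr (p i k j l) = mb (bc (T t i k)) (Dk l (X t j))" for i k j l
  unfolding p_def[abs_def] g_def using mb_product[OF SI_T[OF t] s1(1) Hs_T[OF t] grad_Lr(1)[OF t]] by (simp add: grad_Lr(2)[OF t])
 have eq: "Q_term b (grad (u t) x) (\<tau> t x) $ i $ j = (\<Sum>k\<in>UNIV.
   (1/2) * (p i k k j x - p i k j k x) - (1/2) * (p k j i k x - p k j k i x)
   - (b/2) * (p k j i k x + p k j k i x + p i k k j x + p i k j k x))" for x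
  by (simp add: Q_term_def matrix_matrix_mult_def skew_part_def sym_part_def transpose_def p_def g_def UNIV_two algebra_simps)
 have "SI (cr (%x. \<Sum>k\<in>UNIV.
   (1/2) * (p i k k j x - p i k j k x) - (1/2) * (p k j i k x - p k j k i x)
   - (b/2) * (p k j i k x + p k j k i x + p i k k j x + p i k j k x))) \<and>
  Lr (%x. \<Sum>k\<in>UNIV.
   (1/2) * (p i k k j x - p i k j k x) - (1/2) * (p k j i k x - p k j k i x)
   - (b/2) * (p k j i k x + p k j k i x + p i k k j x + p i k j k x)) =
  (\<Sum>k\<in>UNIV. (1/2) *\<^sub>R (Lr (p i k k j) - Lr (p i k j k)) - (1/2) *\<^sub>R (Lr (p k j i k) - Lr (p k j k i))
   - (b/2) *\<^sub>R (Lr (p k j i k) + Lr (p k j k i) + Lr (p i k k j) + Lr (p i k j k)))"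
  (is "SI (cr (%x. \<Sum>k\<in>UNIV. ?f k x)) \<and> _ = (\<Sum>k\<in>UNIV. ?g k)")
 proof -
  have "SI (cr (?f k)) \<and> Lr (?f k) = ?g k" for k
   using p by (simp only: Lr_add Lr_diff Lr_cmult conj_absorb simp_thms)
  then show ?thesis using Lr_sum[of UNIV ?f] by simp
 qed
 note A = this
 have pL: "Lr (p i k j l) = mb (bc (T t i k)) (Dk l (X t j))" for i k j l using p by blast
 show ?thesis using A unfolding eq Qop_def pL .
qed

lemma frac_Lr:
 assumes t: "t >= 0"
 shows "SI (cr (frac_laplacian \<beta> (%x. \<tau> t x $ i $ j)))" "Lr (frac_laplacian \<beta> (%x. \<tau> t x $ i $ j)) = RE (mop (fsym \<beta>) (T t i j))"
 by (rule frac_laplacian_mop[OF SI_T[OF t] mop_Hs(1)[OF fsym_measurable fsym_le_wt[OF s1(4,5)] Hs_T[OF t]]])+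

lemma D_Lr:
 assumes t: "t >= 0"
 shows "SI (cr (%x. sym_part (grad (u t) x) $ i $ j)) \<and> Lr (%x. sym_part (grad (u t) x) $ i $ j) = (1/2) *\<^sub>R (Dk j (X t i) + Dk i (X t j))"
proof -
 have eq: "sym_part (grad (u t) x) $ i $ j = (1/2) * (grad (u t) x $ i $ j + grad (u t) x $ j $ i)" for x
  by (simp add: sym_part_def transpose_def)
 note a = Lr_add[OF grad_Lr(1)[OF t, of i j] grad_Lr(1)[OF t, of j i], unfolded grad_Lr(2)[OF t]]
 show ?thesis
  unfolding eq using Lr_cmult[OF conjunct1[OF a], of "1/2"] conjunct2[OF a] by (simp only: simp_thms)
qed

lemma continuous_adv: "Hs_curve s y ==> continuous_on {0..} (%t. adv (X t) (y t))"
 unfolding adv_def by (intro continuous_on_sum continuous_mb curves continuous_Dk)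

lemma continuous_Qop: "continuous_on {0..} (%t. Qop b (X t) (T t) i j)"
 unfolding Qop_def by (intro continuous_intros continuous_mb curves continuous_Dk)

lemma continuous_Frhs: "continuous_on {0..} (%t. Frhs b \<beta> a (X t) (T t) i j)"
 unfolding Frhs_def
 by (intro continuous_intros continuous_Qop continuous_adv curves continuous_Dk bounded_linear.continuous_on[OF bounded_linear_RE] continuous_fsym)

lemma continuous_Grhs: "continuous_on {0..} (%t. Grhs (X t) (T t) j)"
 unfolding Grhs_def by (intro continuous_intros continuous_adv curves continuous_Dk)

lemmas RE_lin = linear_diff[OF bounded_linear.linear[OF bounded_linear_RE]] linear_add[OF bounded_linear.linear[OF bounded_linear_RE]]
 linear_scale[OF bounded_linear.linear[OF bounded_linear_RE]] linear_sum[OF bounded_linear.linear[OF bounded_linear_RE]]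

lemma RE_RE [simp]: "RE (RE x) = RE x"
 unfolding RE_def[of x] by (rule RE_Lr[OF SI_Re[OF SI_rep]])

lemma RE_adv: "t >= 0 ==> inHs s y ==> RE y = y ==> RE (adv (X t) y) = adv (X t) y"
 unfolding adv_def by (simp add: RE_lin RE_mb RE_Dk)

lemma RE_Frhs: "t >= 0 ==> RE (Frhs b \<beta> a (X t) (T t) i j) = Frhs b \<beta> a (X t) (T t) i j"
 unfolding Frhs_def Qop_def by (simp add: RE_lin RE_mb RE_Dk RE_adv Hs_X Hs_T RE_X RE_T del: RE_Lr)

lemma RE_Grhs: "t >= 0 ==> RE (Grhs (X t) (T t) j) = Grhs (X t) (T t) j"
 unfolding Grhs_def by (simp add: RE_lin RE_Dk RE_adv Hs_X Hs_T RE_X RE_T del: RE_Lr)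

lemma stress_increment:
 assumes "0 < r" "r < t"
 shows "T t i j - T r i j = integral {r..t} (%t. Frhs b \<beta> a (X t) (T t) i j)"
proof (rule weak_derivative_l2[OF curves(4) continuous_Frhs _ _ _ assms])
 show "RE (T t i j) = T t i j" "RE (Frhs b \<beta> a (X t) (T t) i j) = Frhs b \<beta> a (X t) (T t) i j" if "t > 0" for t
  using that RE_T[of t] RE_Frhs[of t] by auto
 fix \<phi> :: "real => real" and psi :: "real^2 => real" assume \<phi>: "test_fun {0<..} \<phi>" and psi: "test_fun UNIV psi"
 note sm = test_fun_smooth[OF \<phi>] test_fun_smooth[OF psi]
 have st: "stress_equation b \<beta> a u \<tau>" using sol by (simp add: strong_solution_def)
 have e1: "distr_dt (distr_of (%t x. \<tau> t x $ i $ j)) (tens \<phi> psi) = - tint (%t. inner (T t i j) (Lr psi)) (pderiv_dir 1 \<phi>)"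
  unfolding distr_deriv_def pderiv_tens(1)[OF sm] by (subst distr_of_tens[OF SI_T refl psi]) auto
 have e2: "distr_of (%t. transport (u t) (%x. \<tau> t x $ i $ j)) (tens \<phi> psi) = tint (%t. inner (adv (X t) (T t i j)) (Lr psi)) \<phi>"
  by (rule distr_of_tens[OF _ _ psi]) (use transport_Lr[OF _ SI_T Hs_T] in auto)
 have e3: "distr_of (%t x. \<tau> t x $ i $ j) (tens \<phi> psi) = tint (%t. inner (T t i j) (Lr psi)) \<phi>"
  by (rule distr_of_tens[OF SI_T refl psi]) auto
 have e4: "distr_of (%t x. Q_term b (grad (u t) x) (\<tau> t x) $ i $ j) (tens \<phi> psi) = tint (%t. inner (Qop b (X t) (T t) i j) (Lr psi)) \<phi>"
  by (rule distr_of_tens[OF _ _ psi]) (use Q_Lr in auto)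
 have e5: "distr_of (%t. frac_laplacian \<beta> (%x. \<tau> t x $ i $ j)) (tens \<phi> psi) = tint (%t. inner (RE (mop (fsym \<beta>) (T t i j))) (Lr psi)) \<phi>"
  by (rule distr_of_tens[OF _ _ psi]) (use frac_Lr in auto)
 have e6: "distr_of (%t x. sym_part (grad (u t) x) $ i $ j) (tens \<phi> psi) = tint (%t. inner ((1/2) *\<^sub>R (Dk j (X t i) + Dk i (X t j))) (Lr psi)) \<phi>"
  by (rule distr_of_tens[OF _ _ psi]) (use D_Lr in auto)
 have c: "continuous_on {0..} (%t. inner (adv (X t) (T t i j)) (Lr psi))" "continuous_on {0..} (%t. inner (T t i j) (Lr psi))"
  "continuous_on {0..} (%t. inner (Qop b (X t) (T t) i j) (Lr psi))" "continuous_on {0..} (%t. inner (RE (mop (fsym \<beta>) (T t i j))) (Lr psi))"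
  "continuous_on {0..} (%t. inner ((1/2) *\<^sub>R (Dk j (X t i) + Dk i (X t j))) (Lr psi))"
  by (intro continuous_intros continuous_Qop continuous_adv curves continuous_Dk bounded_linear.continuous_on[OF bounded_linear_RE] continuous_fsym)+
 have i: "inner (Frhs b \<beta> a (X t) (T t) i j) (Lr psi) = inner ((1/2) *\<^sub>R (Dk j (X t i) + Dk i (X t j))) (Lr psi)
   + ((-1) * inner (adv (X t) (T t i j)) (Lr psi) + ((-a) * inner (T t i j) (Lr psi) + ((-1) * inner (Qop b (X t) (T t) i j) (Lr psi) + (-1) * inner (RE (mop (fsym \<beta>) (T t i j))) (Lr psi))))" for t
  unfolding Frhs_def by (simp add: inner_diff_left)
 have "tint (%t. inner (Frhs b \<beta> a (X t) (T t) i j) (Lr psi)) \<phi> = tint (%t. inner ((1/2) *\<^sub>R (Dk j (X t i) + Dk i (X t j))) (Lr psi)) \<phi>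
   + ((-1) * tint (%t. inner (adv (X t) (T t i j)) (Lr psi)) \<phi> + ((-a) * tint (%t. inner (T t i j) (Lr psi)) \<phi> + ((-1) * tint (%t. inner (Qop b (X t) (T t) i j) (Lr psi)) \<phi> + (-1) * tint (%t. inner (RE (mop (fsym \<beta>) (T t i j))) (Lr psi)) \<phi>)))"
  unfolding i
  by (subst tint_add[OF _ _ \<phi>], (intro continuous_intros c)+, subst tint_add[OF _ _ \<phi>], (intro continuous_intros c)+,
    subst tint_add[OF _ _ \<phi>], (intro continuous_intros c)+, subst tint_add[OF _ _ \<phi>], (intro continuous_intros c)+)
    (simp only: tint_cmult)
 moreover have "- tint (%t. inner (T t i j) (Lr psi)) (pderiv_dir 1 \<phi>) + tint (%t. inner (adv (X t) (T t i j)) (Lr psi)) \<phi>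
   + a * tint (%t. inner (T t i j) (Lr psi)) \<phi> + tint (%t. inner (Qop b (X t) (T t) i j) (Lr psi)) \<phi>
   + tint (%t. inner (RE (mop (fsym \<beta>) (T t i j))) (Lr psi)) \<phi> = tint (%t. inner ((1/2) *\<^sub>R (Dk j (X t i) + Dk i (X t j))) (Lr psi)) \<phi>"
  using st[unfolded stress_equation_def, rule_format, OF test_fun_tens[OF \<phi> psi], of i j] unfolding e1 e2 e3 e4 e5 e6 .
 ultimately show "tint (%t. inner (T t i j) (Lr psi)) (pderiv_dir 1 \<phi>) = - tint (%t. inner (Frhs b \<beta> a (X t) (T t) i j) (Lr psi)) \<phi>"
  by linarith
qed

text \<open>The equation in the sense of distributions gives the increments as integrals of a continuous curve.\<close>

lemma stress_ode: "t > 0 ==> ((%t. T t i j) has_vector_derivative Frhs b \<beta> a (X t) (T t) i j) (at t)"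
 by (rule integral_increment_has_vector_derivative[OF continuous_Frhs stress_increment])

lemma divergence_zero: "t >= 0 ==> (\<Sum>k\<in>UNIV. Dk k (X t k)) = 0"
proof -
 define G where "G t = (\<Sum>k\<in>UNIV. Dk k (X t k))" for t
 have cG: "continuous_on {0..} G" unfolding G_def[abs_def] by (intro continuous_on_sum continuous_Dk curves)
 have inc: "0 - 0 = integral {r..t} G" if "0 < r" "r < t" for r t
 proof (rule weak_derivative_l2[of "%_. 0" G, OF continuous_on_const cG _ _ _ that])
  show "RE 0 = (0::l2)" using linear_0[OF bounded_linear.linear[OF bounded_linear_RE]] .
  show "RE (G t) = G t" if "t > 0" for t
   unfolding G_def using that by (simp add: RE_lin RE_Dk Hs_X RE_X del: RE_Lr)
  fix \<phi> :: "real => real" and psi :: "real^2 => real" assume \<phi>: "test_fun {0<..} \<phi>" and psi: "test_fun UNIV psi"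
  note sm = test_fun_smooth[OF \<phi>] test_fun_smooth[OF psi]
  have in0: "incompressible u" using sol by (simp add: strong_solution_def)
  have e: "distr_dx k (distr_of (%t x. u t x $ k)) (tens \<phi> psi) = tint (%t. inner (Dk k (X t k)) (Lr psi)) \<phi>" for k
  proof -
   have "distr_dx k (distr_of (%t x. u t x $ k)) (tens \<phi> psi) = - tint (%t. inner (X t k) (Lr (pderiv_dir (axis k 1) psi))) \<phi>"
    unfolding distr_deriv_def pderiv_tens(2)[OF sm] by (subst distr_of_tens[OF SI_X refl test_fun_pderiv[OF psi axis_Basis]]) auto
   also have "\<dots> = tint (%t. - inner (X t k) (Lr (pderiv_dir (axis k 1) psi))) \<phi>" using tint_cmult[of "-1"] by simp
   also have "\<dots> = tint (%t. inner (Dk k (X t k)) (Lr psi)) \<phi>"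
    by (rule set_lebesgue_integral_cong) (use isD_ibp[OF isD_Dk[OF s1(2) Hs_X] isD_test_fun[OF psi]] in auto)
   finally show ?thesis .
  qed
  have c: "continuous_on {0..} (%t. inner (Dk k (X t k)) (Lr psi))" for k by (intro continuous_intros continuous_Dk curves)
  have "tint (%t. inner (G t) (Lr psi)) \<phi> = tint (%t. inner (Dk 1 (X t 1)) (Lr psi)) \<phi> + tint (%t. inner (Dk 2 (X t 2)) (Lr psi)) \<phi>"
   unfolding G_def UNIV_two inner_add_left by (rule tint_add[OF c c \<phi>])
  also have "\<dots> = 0"
   using in0[unfolded incompressible_def, rule_format, OF test_fun_tens[OF \<phi> psi]] unfolding e UNIV_two .
  finally show "tint (%t. inner 0 (Lr psi)) (pderiv_dir 1 \<phi>) = - tint (%t. inner (G t) (Lr psi)) \<phi>" by simp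
 qed
 have pos: "G t = 0" if "t > 0" for t
  using vector_derivative_unique_at[OF integral_increment_has_vector_derivative[of G "%_. 0", OF cG inc that] has_vector_derivative_const] by simp
 assume "t >= 0"
 have "G t = 0"
 proof (rule continuous_constant_on_closure[of "{0<..}" G 0])
  show "continuous_on (closure {0<..}) G" using cG by simp
 qed (use pos \<open>t >= 0\<close> in auto)
 then show ?thesis unfolding G_def .
qed

end

subsection \<open>The velocity equation without pressure\<close>

context cutoff begin

text \<open>On the Fourier side the field is orthogonal both to \<open>\<xi>\<close> and to its rotation, hence zero off the
  origin.\<close>

lemma curl_div_free_zero:
 fixes d :: "2 => l2"
 assumes real: "!!j. RE (d j) = d j"
  and curl: "!!h. test_fun UNIV h ==> inner (d 1) (Lr (pderiv_dir (axis 2 1) h)) = inner (d 2) (Lr (pderiv_dir (axis 1 1) h))"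
  and div: "!!h. test_fun UNIV h ==> (\<Sum>j\<in>UNIV. inner (d j) (Lr (pderiv_dir (axis j 1) h))) = 0"
 shows "d j = 0"
proof -
 have r2: "RE (- d 2) = - d 2" using linear_neg[OF bounded_linear.linear[OF bounded_linear_RE]] real by simp
 have "AE xi in lborel. dsym 1 xi * rep (FT (d 1)) xi = dsym 2 xi * rep (FT (- d 2)) xi"
  by (rule test_fun_curl[OF real r2]) (use div in \<open>simp add: UNIV_two add_eq_0_iff\<close>)
 moreover have "AE xi in lborel. rep (FT (0 - d 2)) xi = 0 - rep (FT (d 2)) xi"
  unfolding FT_diff using rep_diff[of "FT 0" "FT (d 2)"] rep_zero
  by (simp add: linear_0[OF bounded_linear.linear[OF bounded_linear_RE]]) (auto simp: FT_diff[of 0 0, simplified] elim: AE_mp)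
 ultimately have ae: "AE xi in lborel. xi $ 1 * rep (FT (d 1)) xi = - (xi $ 2 * rep (FT (d 2)) xi)"
  by eventually_elim (simp add: dsym_def)
 have "AE xi in lborel. dsym 2 xi * rep (FT (d 1)) xi = dsym 1 xi * rep (FT (d 2)) xi"
  by (rule test_fun_curl[OF real real curl])
 moreover have "AE xi in lborel. xi ~= (0::real^2)" by (rule AE_lborel_singleton)
 ultimately have "AE xi in lborel. rep (FT (d j)) xi = 0" for j
  using ae
 proof eventually_elim
  case (elim xi)
  define A B F G where "A = complex_of_real (xi $ 1)" and "B = complex_of_real (xi $ 2)" and "F = rep (FT (d 1)) xi" and "G = rep (FT (d 2)) xi"
  have e: "B * F = A * G" "A * F = - (B * G)" using elim by (simp_all add: dsym_def A_def B_def F_def G_def)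
  have "(A * A + B * B) * F = 0" "(A * A + B * B) * G = 0" using e by algebra+
  moreover have "A * A + B * B ~= 0"
  proof -
   have "A * A + B * B = complex_of_real ((norm xi)\<^sup>2)" unfolding A_def B_def norm_sq_two by (simp add: power2_eq_square)
   then show ?thesis using elim by simp
  qed
  ultimately have "F = 0" "G = 0" by auto
  then show "rep (FT (d j)) xi = 0" using exhaust_2[of j] by (auto simp: F_def G_def)
 qed
 then have "cl (rep (FT (d j))) = cl (%_. 0)" by (intro cl_cong_AE) (auto simp: SI_rep SI_zero)
 then have "FT (d j) = FT 0" using cl_zero FT_diff[of 0 0] by simp
 then show ?thesis unfolding FT_eq_iff .
qed

end

context strong_sol begin

text \<open>The pressure is known only through its values on gradients of test functions.\<close>

lemma pressure_pairing:
 assumes \<phi>: "test_fun {0<..} \<phi>" and psi: "test_fun UNIV psi" and P: "momentum_equation u \<tau> P"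
 shows "P (tens \<phi> (pderiv_dir (axis j 1) psi)) =
  - tint (%t. inner (X t j) (Lr psi)) (pderiv_dir 1 \<phi>) - tint (%t. inner (Grhs (X t) (T t) j) (Lr psi)) \<phi>"
proof -
 note sm = test_fun_smooth[OF \<phi>] test_fun_smooth[OF psi]
 have e1: "distr_dt (distr_of (%t x. u t x $ j)) (tens \<phi> psi) = - tint (%t. inner (X t j) (Lr psi)) (pderiv_dir 1 \<phi>)"
  unfolding distr_deriv_def pderiv_tens(1)[OF sm] by (subst distr_of_tens[OF SI_X refl psi]) auto
 have e2: "distr_of (%t. transport (u t) (%x. u t x $ j)) (tens \<phi> psi) = tint (%t. inner (adv (X t) (X t j)) (Lr psi)) \<phi>"
  by (rule distr_of_tens[OF _ _ psi]) (use transport_Lr[OF _ SI_X Hs_X] in auto)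
 have e3: "distr_dx j P (tens \<phi> psi) = - P (tens \<phi> (pderiv_dir (axis j 1) psi))"
  unfolding distr_deriv_def pderiv_tens(2)[OF sm] ..
 have e4: "distr_dx k (distr_of (%t x. \<tau> t x $ j $ k)) (tens \<phi> psi) = tint (%t. inner (Dk k (T t j k)) (Lr psi)) \<phi>" for k
 proof -
  have "distr_dx k (distr_of (%t x. \<tau> t x $ j $ k)) (tens \<phi> psi) = - tint (%t. inner (T t j k) (Lr (pderiv_dir (axis k 1) psi))) \<phi>"
   unfolding distr_deriv_def pderiv_tens(2)[OF sm] by (subst distr_of_tens[OF SI_T refl test_fun_pderiv[OF psi axis_Basis]]) auto
  also have "\<dots> = tint (%t. - inner (T t j k) (Lr (pderiv_dir (axis k 1) psi))) \<phi>" using tint_cmult[of "-1"] by simp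
  also have "\<dots> = tint (%t. inner (Dk k (T t j k)) (Lr psi)) \<phi>"
   by (rule set_lebesgue_integral_cong) (use isD_ibp[OF isD_Dk[OF s1(2) Hs_T] isD_test_fun[OF psi]] in auto)
  finally show ?thesis .
 qed
 have c: "continuous_on {0..} (%t. inner (Dk k (T t j k)) (Lr psi))" "continuous_on {0..} (%t. inner (adv (X t) (X t j)) (Lr psi))" for k
  by (intro continuous_intros continuous_adv curves continuous_Dk)+
 have i: "inner (Grhs (X t) (T t) j) (Lr psi) = inner (Dk 1 (T t j 1)) (Lr psi) + (inner (Dk 2 (T t j 2)) (Lr psi) + (-1) * inner (adv (X t) (X t j)) (Lr psi))" for t
  unfolding Grhs_def UNIV_two by (simp add: inner_diff_left inner_add_left)
 have "tint (%t. inner (Grhs (X t) (T t) j) (Lr psi)) \<phi> = tint (%t. inner (Dk 1 (T t j 1)) (Lr psi)) \<phi>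
   + (tint (%t. inner (Dk 2 (T t j 2)) (Lr psi)) \<phi> + (-1) * tint (%t. inner (adv (X t) (X t j)) (Lr psi)) \<phi>)"
  unfolding i
  by (subst tint_add[OF _ _ \<phi>], (intro continuous_intros c)+, subst tint_add[OF _ _ \<phi>], (intro continuous_intros c)+)
    (simp only: tint_cmult)
 then show ?thesis
  using P[unfolded momentum_equation_def, rule_format, OF test_fun_tens[OF \<phi> psi], of j] unfolding e1 e2 e3 e4 UNIV_two by linarith
qed

lemma curl_increment:
 assumes h: "test_fun UNIV h" and r: "0 < r" "r < t"
 defines "c \<equiv> %z. inner (z 1) (Lr (pderiv_dir (axis 2 1) h)) - inner (z 2) (Lr (pderiv_dir (axis 1 1) h))"
 shows "c (X t) - c (X r) = integral {r..t} (%t. c (Grhs (X t) (T t)))"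
 unfolding c_def
proof (rule weak_derivative_in_time[OF _ _ _ r])
 let ?h = "%k. pderiv_dir (axis k 1) h"
 note D = test_fun_pderiv[OF h axis_Basis]
 show "continuous_on {0..} (%t. inner (X t 1) (Lr (?h 2)) - inner (X t 2) (Lr (?h 1)))"
  "continuous_on {0..} (%t. inner (Grhs (X t) (T t) 1) (Lr (?h 2)) - inner (Grhs (X t) (T t) 2) (Lr (?h 1)))"
  by (intro continuous_intros curves continuous_Grhs)+
 fix \<phi> :: "real => real" assume \<phi>: "test_fun {0<..} \<phi>"
 obtain P where P: "momentum_equation u \<tau> P" using sol by (auto simp: strong_solution_def)
 have sub: "tint (%t. f t - g t) \<theta> = tint f \<theta> - tint g \<theta>" if "continuous_on {0..} f" "continuous_on {0..} g" "test_fun {0<..} \<theta>" for f g \<theta>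
  using tint_add[OF that(1) continuous_on_minus[OF that(2)] that(3)] tint_cmult[of "-1" g \<theta>] by simp
 have \<phi>': "test_fun {0<..} (pderiv_dir 1 \<phi>)" by (rule test_fun_pderiv[OF \<phi>]) simp
 show "tint (%t. inner (X t 1) (Lr (?h 2)) - inner (X t 2) (Lr (?h 1))) (pderiv_dir 1 \<phi>) =
  - tint (%t. inner (Grhs (X t) (T t) 1) (Lr (?h 2)) - inner (Grhs (X t) (T t) 2) (Lr (?h 1))) \<phi>"
  by (subst sub[OF _ _ \<phi>], (intro continuous_intros curves continuous_Grhs)+, subst sub[OF _ _ \<phi>'], (intro continuous_intros curves continuous_Grhs)+)
    (use pressure_pairing[OF \<phi> D P, of 1 2] pressure_pairing[OF \<phi> D P, of 2 1] mixed_partials[OF h, of 1 2] in simp)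
qed

text \<open>The right hand side is determined by its curl and its divergence. An arbitrary gradient may be
  subtracted before projecting; this is used with the gradient of the isotropic stress.\<close>

lemma velocity_ode:
 assumes q: "Hs_curve s q" "!!t. t >= 0 ==> RE (q t) = q t" and t: "t > 0"
 defines "H \<equiv> %t k. Grhs (X t) (T t) k - Dk k (q t)"
 shows "((%t. X t j) has_vector_derivative H t j - grad_part (H t) j) (at t)"
proof (rule integral_increment_has_vector_derivative[OF _ _ t])
 have Hq: "inHs s (q t)" if "t >= 0" for t using q(1) that by (simp add: Hs_curve_def)
 have cH: "continuous_on {0..} (%t. H t k)" for k unfolding H_def by (intro continuous_intros continuous_Grhs continuous_Dk q)
 let ?V = "%t j. H t j - grad_part (H t) j"
 show cV: "continuous_on {0..} (%t. ?V t j)" for j by (intro continuous_intros cH continuous_grad_part)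
 fix r t :: real assume r: "0 < r" "r < t"
 have sub: "{r..t} \<subseteq> {0..}" using r by auto
 define d where "d j = X t j - X r j - integral {r..t} (%t. ?V t j)" for j
 have iV: "(%t. ?V t j) integrable_on {r..t}" for j
  by (rule integrable_continuous_real[OF continuous_on_subset[OF cV sub]])
 have pull: "A (integral {r..t} (%t. ?V t j)) = integral {r..t} (%t. A (?V t j))" if "bounded_linear A" for A :: "l2 => 'c::banach" and j
  using integral_linear[OF iV that, of j] by (simp add: o_def)
 have bi: "bounded_linear (%x. inner x z)" for z :: l2 by (rule bounded_linear_inner_left)
 have REV: "RE (?V t j) = ?V t j" if "t >= 0" for t j
  unfolding H_def using that by (simp add: RE_lin RE_grad_part RE_Grhs RE_Dk Hq q(2) del: RE_Lr)
 have "d j = 0" for j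
 proof (rule curl_div_free_zero)
  show "RE (d j) = d j" for j
  proof -
   have "integral {r..t} (%t. RE (?V t j)) = integral {r..t} (%t. ?V t j)"
    by (intro Henstock_Kurzweil_Integration.integral_cong REV) (use r in auto)
   then have e: "RE (integral {r..t} (%t. ?V t j)) = integral {r..t} (%t. ?V t j)"
    unfolding pull[OF bounded_linear_RE] .
   have "RE (d j) = RE (X t j) - RE (X r j) - RE (integral {r..t} (%t. ?V t j))" unfolding d_def by (simp only: RE_lin)
   also have "\<dots> = d j" unfolding e d_def using r by (simp add: RE_X del: RE_Lr)
   finally show ?thesis .
  qed
  fix h :: "real^2 => real" assume h: "test_fun UNIV h"
  let ?h = "%k. Lr (pderiv_dir (axis k 1) h)"
  note D = isD_test_fun[OF h]
  have rh: "RE (?h k) = ?h k" for k using test_fun_SI[OF test_fun_pderiv[OF h axis_Basis]] by simp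
  have int: "(%t. inner (?V t j) z) integrable_on {r..t}" for j z
   using integrable_linear[OF iV bi, of z j] by (simp add: o_def)
  have "inner (?V t 1) (?h 2) - inner (?V t 2) (?h 1) = inner (Grhs (X t) (T t) 1) (?h 2) - inner (Grhs (X t) (T t) 2) (?h 1)" if "t >= 0" for t
  proof -
   have "inner (Dk k (q t)) (?h l) = - inner (q t) (Lr (pderiv_dir (axis k 1) (pderiv_dir (axis l 1) h)))" for k l
    by (rule isD_ibp[OF isD_Dk[OF s1(2) Hq[OF that]] isD_test_fun[OF test_fun_pderiv[OF h axis_Basis]]])
   then have "inner (Dk 1 (q t)) (?h 2) = inner (Dk 2 (q t)) (?h 1)" using mixed_partials[OF h, of 1 2] by simp
   then show ?thesis
    using grad_part_curl[OF D D rh rh, of "H t"] by (simp add: inner_diff_left H_def)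
  qed
  then have "integral {r..t} (%t. inner (?V t 1) (?h 2)) - integral {r..t} (%t. inner (?V t 2) (?h 1)) =
    integral {r..t} (%t. inner (Grhs (X t) (T t) 1) (?h 2) - inner (Grhs (X t) (T t) 2) (?h 1))"
   unfolding Henstock_Kurzweil_Integration.integral_diff[OF int int, symmetric] using r
   by (intro Henstock_Kurzweil_Integration.integral_cong) auto
  then show "inner (d 1) (?h 2) = inner (d 2) (?h 1)"
   using curl_increment[OF h r] unfolding d_def inner_diff_left pull[OF bi] by linarith
  have v: "(\<Sum>j\<in>UNIV. inner (?V t j) (?h j)) = 0" for t
   using grad_part_div[OF D rh, of "H t"] by (simp add: inner_diff_left sum_subtractf)
  have x: "(\<Sum>j\<in>UNIV. inner (X t j) (?h j)) = 0" if "t >= 0" for t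
  proof -
   have "inner (X t j) (?h j) = - inner (Dk j (X t j)) (Lr h)" for j
    using isD_ibp[OF isD_Dk[OF s1(2) Hs_X[OF that]] D] by simp
   then show ?thesis using divergence_zero[OF that] by (simp add: sum_negf flip: inner_sum_left)
  qed
  have "inner (d j) (?h j) = inner (X t j) (?h j) - inner (X r j) (?h j) - integral {r..t} (%t. inner (?V t j) (?h j))" for j
   unfolding d_def pull[OF bi, symmetric] by (simp only: inner_diff_left)
  moreover have "(\<Sum>j\<in>UNIV. integral {r..t} (%t. inner (?V t j) (?h j))) = integral {r..t} (%t. \<Sum>j\<in>UNIV. inner (?V t j) (?h j))"
   by (rule Henstock_Kurzweil_Integration.integral_sum[symmetric, OF finite int])
  ultimately show "(\<Sum>j\<in>UNIV. inner (d j) (?h j)) = 0"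
   unfolding v using x[of t] x[of r] r by (simp add: sum_subtractf)
 qed
 then show "X t j - X r j = integral {r..t} (%t. ?V t j)" unfolding d_def by simp
qed

lemma T_symmetric: "t >= 0 ==> T t i j = T t j i"
proof -
 assume t: "t >= 0"
 have "symmetric_tensor (\<tau> t)" using sol t by (simp add: strong_solution_def)
 then have "AE x in lborel. cr (%x. \<tau> t x $ i $ j) x = cr (%x. \<tau> t x $ j $ i) x"
  unfolding symmetric_tensor_def by eventually_elim (simp add: transpose_def vec_eq_iff)
 then show ?thesis by (rule cl_cong_AE[OF SI_T[OF t] SI_T[OF t]])
qed

lemma initial_values:
 shows "SI (cr (%x. u0 x $ j)) ==> X 0 j = Lr (%x. u0 x $ j)" "SI (cr (%x. \<tau>0 x $ i $ j)) ==> T 0 i j = Lr (%x. \<tau>0 x $ i $ j)"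
 using sol unfolding strong_solution_def
 by (auto intro!: cl_cong_AE SI_X SI_T elim: eventually_mono)

end

section \<open>The energy of the difference to an isotropic solution\<close>

subsection \<open>Products and dissipation\<close>

lemma mb_bc_commute:
 assumes "s > 1" "inHs s x" "inHs s y" "RE x = x" "RE y = y"
 shows "mb (bc x) y = mb (bc y) x"
 using mb_swap[OF bc_real(2)[OF assms(1,2,4)] bc_real(2)[OF assms(1,3,5)]]
 by (simp add: bc_real(1)[OF assms(1,2,4)] bc_real(1)[OF assms(1,3,5)])

lemma isD_mb_bc:
 assumes "s > 1" "inHs s x" "inHs s y" "RE x = x" "RE y = y"
 shows "isD k (mb (bc x) y) (mb (bc x) (Dk k y) + mb (bc y) (Dk k x))"
 using isD_mult[OF bc_real(2)[OF assms(1,2,4)] _ bc_real(2)[OF assms(1,3,5)], of k "Dk k x" "Dk k y"]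
  isD_Dk[of s _ k] assms by (simp add: bc_real(1)[OF assms(1,2,4)] bc_real(1)[OF assms(1,3,5)])

lemma adv_rearrange:
 assumes "s > 1" "inHs s x" "inHs s y" "RE x = x" "RE y = y"
 shows "inner (mb (bc x) w) (mb B y) = inner (mb (bc y) w) (mb B x)" "inner (mb (bc x) w) y = inner (mb (bc y) w) x"
proof -
 note c = mb_bc_commute[OF assms]
 show "inner (mb (bc x) w) (mb B y) = inner (mb (bc y) w) (mb B x)"
  unfolding inner_mb mb_commute[of _ B] c ..
 show "inner (mb (bc x) w) y = inner (mb (bc y) w) x" unfolding inner_mb c ..
qed

text \<open>Integration by parts turns \<open>\<integral> y (\<partial>\<^sub>k y) z\<close> into \<open>- 1/2 \<integral> y\<^sup>2 \<partial>\<^sub>k z\<close>.\<close>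

lemma transport_pairing:
 assumes "s > 1" "inHs s y" "RE y = y" "isD k z z'"
 shows "inner (mb (bc y) (Dk k y)) z = - inner (mb (bc y) y) z' / 2"
 using isD_ibp[OF isD_mb_bc[OF assms(1,2,2,3,3), of k] assms(4)] by (simp add: inner_add_left)

lemma Hsn_Dk:
 assumes r: "r >= 0" and x: "inHs (r + 1) x"
 shows "inHs r (Dk k x)" "Hsn r (Dk k x) <= Hsn (r + 1) x"
proof -
 have b: "norm (wt r xi * dsym k xi) <= 1 * norm (wt (r + 1) xi)" for xi
  using norm_component_le_wt[of k xi] unfolding wt_mult[symmetric] norm_mult by (simp add: mult_left_mono)
 note d = mdom_dominated[OF _ x b, simplified]
 have D: "SI (%xi. dsym k xi * rep (FT x) xi)" using mop_Hs(1)[OF dsym_measurable dsym_le_wt x] r by (simp add: mdom_def)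
 have S: "SI (%xi. wt r xi * (dsym k xi * rep (FT x) xi))" using d(1) by (simp add: mdom_def mult.assoc)
 show "inHs r (Dk k x)" "Hsn r (Dk k x) <= Hsn (r + 1) x"
  using d(2) mdom_cl[OF _ D] mul_cl[OF _ D S] S by (simp_all add: Hsn_def mop_def mul_def mult.assoc)
qed

text \<open>Up to a constant, the dissipation controls the missing half derivatives because
  \<open>(1 + \<bar>\<xi>\<bar>\<^sup>2)\<^sup>\<beta> \<le> 2 (1 + \<bar>\<xi>\<bar>\<^sup>2\<^sup>\<beta>)\<close>.\<close>

lemma dissipation:
 assumes \<beta>: "0 < \<beta>" "\<beta> < 1" and y: "inHs (2 * \<beta>) y" "RE y = y"
 shows "(Hsn \<beta> y)\<^sup>2 <= 2 * (2 * pi)\<^sup>2 * ((norm y)\<^sup>2 + inner y (RE (mop (fsym \<beta>) y)))"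
proof -
 let ?F = "FT y"
 define g where "g xi = complex_of_real (norm xi powr \<beta>)" for xi :: "real^2"
 have [measurable]: "g \<in> borel_measurable borel" unfolding g_def[abs_def] by measurable
 have p: "(norm (wt \<beta> xi))\<^sup>2 <= 2 + 2 * (norm (g xi))\<^sup>2" for xi
 proof -
  have "(norm (wt \<beta> xi))\<^sup>2 = (1 + (norm xi)\<^sup>2) powr \<beta>"
   unfolding norm_wt by (simp add: power2_eq_square flip: powr_add)
  also have "\<dots> <= (2 * max 1 ((norm xi)\<^sup>2)) powr \<beta>"
   using \<beta> by (intro powr_mono2) auto
  also have "\<dots> <= 2 * max 1 ((norm xi)\<^sup>2) powr \<beta>"
   using \<beta> powr_mono[of \<beta> 1 2] by (simp add: powr_mult mult_right_mono)
  also have "max 1 ((norm xi)\<^sup>2) powr \<beta> <= 1 + (norm (g xi))\<^sup>2"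
   by (simp add: max_def g_def power2_eq_square powr_mult)
  finally show ?thesis by simp
 qed
 have db: "mdom (wt \<beta>) ?F" using inHs_mono(1)[OF y(1), of \<beta>] \<beta> by auto
 have dg: "mdom g ?F" by (rule mdom_dominated(1)[OF _ db, of g 1]) (use norm_powr_le_wt \<beta> in \<open>auto simp: g_def\<close>)
 have df: "mdom (fsym \<beta>) ?F" using mop_Hs(1)[OF fsym_measurable fsym_le_wt y(1)] \<beta> by simp
 note I = SI_integrable[OF db[unfolded mdom_def]] SI_integrable[OF dg[unfolded mdom_def]] SI_integrable[OF SI_rep[of ?F]]
 have n: "(norm (mul m ?F))\<^sup>2 = (LBINT xi. (norm (m xi * rep ?F xi))\<^sup>2)" if "mdom m ?F" for m
  using that by (simp add: mul_def mdom_def norm_cl_sq)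
 have "(Hsn \<beta> y)\<^sup>2 <= (LBINT xi. 2 * (norm (rep ?F xi))\<^sup>2 + 2 * (norm (g xi * rep ?F xi))\<^sup>2)"
  unfolding Hsn_def n[OF db]
 proof (rule integral_mono)
  show "(norm (wt \<beta> xi * rep ?F xi))\<^sup>2 <= 2 * (norm (rep ?F xi))\<^sup>2 + 2 * (norm (g xi * rep ?F xi))\<^sup>2" for xi
   using mult_right_mono[OF p[of xi] zero_le_power2[of "norm (rep ?F xi)"]] by (simp add: norm_mult power_mult_distrib algebra_simps)
 qed (use I in auto)
 also have "\<dots> = 2 * (norm ?F)\<^sup>2 + 2 * (norm (mul g ?F))\<^sup>2"
  using I n[OF dg] n[of "%_. 1"] by (simp add: mul_one)
 also have "(norm (mul g ?F))\<^sup>2 = inner ?F (mul (fsym \<beta>) ?F)"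
  using inner_mul_mul[OF dg dg mul_one(2) df, of 1] unfolding power2_norm_eq_inner mul_one
  by (simp add: g_def fsym_def flip: of_real_mult powr_add)
 also have "(norm ?F)\<^sup>2 = (2 * pi)\<^sup>2 * (norm y)\<^sup>2"
  using inner_via_FT[of y y] by (simp add: power2_norm_eq_inner)
 also have "inner ?F (mul (fsym \<beta>) ?F) = (2 * pi)\<^sup>2 * inner y (RE (mop (fsym \<beta>) y))"
  using inner_RE[of y "mop (fsym \<beta>) y"] y(2) inner_via_FT[of y "mop (fsym \<beta>) y"] by (simp add: mop_def)
 finally show ?thesis by (simp add: algebra_simps)
qed

subsection \<open>The energy identity and its estimate\<close>

locale energy_state =
 fixes s \<beta> b :: real and x :: "2 => l2" and y :: "2 => 2 => l2" and q :: l2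
 assumes \<beta>: "1/2 < \<beta>" "\<beta> < 1" and s: "s > 1 + \<beta>" and b: "\<bar>b\<bar> <= 1"
  and x: "!!j. inHs s (x j)" "!!j. RE (x j) = x j" and y: "!!i j. inHs s (y i j)" "!!i j. RE (y i j) = y i j"
  and y_sym: "!!i j. y i j = y j i" and div: "(\<Sum>k\<in>UNIV. Dk k (x k)) = 0"
  and q: "inHs s q" "RE q = q" "!!k. inHs s (Dk k q)"
begin

definition w :: l2 where "w = (\<Sum>k\<in>UNIV. mb (bc (Dk k q)) (x k))"

definition H :: "2 => l2" where "H j = (\<Sum>k\<in>UNIV. Dk k (y j k)) - adv x (x j)"

lemma s1: "s > 1" "s >= 1" using s \<beta> by auto

lemma RE_Dq: "RE (Dk k q) = Dk k q" by (rule isD_real[OF isD_Dk[OF s1(2) q(1)] q(2)])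

lemma isD_Sx: "isD k (mb (bc q) (x j)) (mb (bc q) (Dk k (x j)) + mb (bc (Dk k q)) (x j))"
 using isD_mb_bc[OF s1(1) q(1) x(1) q(2) x(2), of k j]
 unfolding mb_bc_commute[OF s1(1) x(1) q(3) x(2) RE_Dq] .

lemma div_Sx: "(\<Sum>k\<in>UNIV. mb (bc q) (Dk k (x k)) + mb (bc (Dk k q)) (x k)) = w"
 using mb.sum_right[of "bc q" "%k. Dk k (x k)" UNIV] unfolding div by (simp add: sum.distrib w_def mb.zero_right)

text \<open>Transport by a divergence free field is skew; with the weight \<open>\<sigma>\<close> only the derivative of the
  weight survives.\<close>

lemma adv_pairing:
 assumes z: "inHs s z" "RE z = z"
 shows "inner (adv x z) z = 0" "inner (adv x z) (mb (bc q) z) = - inner (mb (bc z) z) w / 2"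
proof -
 have "inner (mb (bc (x k)) (Dk k z)) z = - inner (mb (bc z) z) (Dk k (x k)) / 2" for k
  unfolding adv_rearrange(2)[OF s1(1) x(1) z(1) x(2) z(2)] by (rule transport_pairing[OF s1(1) z isD_Dk[OF s1(2) x(1)]])
 then have "inner (adv x z) z = - inner (mb (bc z) z) (\<Sum>k\<in>UNIV. Dk k (x k)) / 2"
  unfolding adv_def by (simp add: inner_sum_left inner_sum_right sum_negf sum_divide_distrib)
 then show "inner (adv x z) z = 0" unfolding div by simp
 have "inner (mb (bc (x k)) (Dk k z)) (mb (bc q) z) = - inner (mb (bc z) z) (mb (bc q) (Dk k (x k)) + mb (bc (Dk k q)) (x k)) / 2" for k
  unfolding adv_rearrange(1)[OF s1(1) x(1) z(1) x(2) z(2)] by (rule transport_pairing[OF s1(1) z isD_Sx])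
 then have "inner (adv x z) (mb (bc q) z) = - inner (mb (bc z) z) (\<Sum>k\<in>UNIV. mb (bc q) (Dk k (x k)) + mb (bc (Dk k q)) (x k)) / 2"
  unfolding adv_def inner_sum_left inner_sum_right by (simp add: sum_negf sum_divide_distrib)
 then show "inner (adv x z) (mb (bc q) z) = - inner (mb (bc z) z) w / 2" unfolding div_Sx .
qed

text \<open>The terms with a derivative of the velocity cancel: \<open>A\<close> and \<open>B\<close> below occur with opposite signs in
  the stress and in the velocity part, because \<open>y\<close> is symmetric.\<close>

lemma energy_identity:
 "(\<Sum>i\<in>UNIV. \<Sum>j\<in>UNIV. inner (y i j) ((1/2) *\<^sub>R (Dk j (x i) + Dk i (x j)) + b *\<^sub>R mb (bc q) (Dk j (x i) + Dk i (x j)) - adv x (y i j)))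
  + (\<Sum>j\<in>UNIV. inner (x j + (2 * b) *\<^sub>R mb (bc q) (x j)) (H j - grad_part H j))
  = - 2 * b * (\<Sum>j\<in>UNIV. \<Sum>k\<in>UNIV. inner (mb (bc (Dk k q)) (x j)) (y j k)) + b * (\<Sum>j\<in>UNIV. inner (mb (bc (x j)) (x j)) w)
   - 2 * b * (\<Sum>j\<in>UNIV. inner (grad_part H j) (mb (bc q) (x j)))"
proof -
 define A where "A i j = inner (y i j) (Dk j (x i))" for i j
 define B where "B i j = inner (y i j) (mb (bc q) (Dk j (x i)))" for i j
 define C where "C j k = inner (mb (bc (Dk k q)) (x j)) (y j k)" for j k
 define h where "h j = inner (grad_part H j) (mb (bc q) (x j))" for j
 have A': "inner (y i j) (Dk i (x j)) = A j i" and B': "inner (y i j) (mb (bc q) (Dk i (x j))) = B j i" for i j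
  unfolding A_def B_def y_sym[of j i] by simp_all
 note D = isD_Dk[OF s1(2)]
 have xD: "inner (x j) (Dk k (y j k)) = - A j k" for j k
  using isD_ibp[OF D[OF y(1)] D[OF x(1)], of k j k j] by (simp add: A_def inner_commute)
 have SD: "inner (mb (bc q) (x j)) (Dk k (y j k)) = - (B j k + C j k)" for j k
  using isD_ibp[OF D[OF y(1)] isD_Sx, of k j k j] by (simp add: B_def C_def inner_commute inner_add_right)
 have gx: "(\<Sum>j\<in>UNIV. inner (x j) (grad_part H j)) = 0"
  using grad_part_solenoidal[OF D[OF x(1)] x(2) div, of H] by (simp add: inner_commute)
 have ay: "inner (y i j) (adv x (y i j)) = 0" and ax: "inner (x j) (adv x (x j)) = 0"
  and aS: "inner (mb (bc q) (x j)) (adv x (x j)) = - inner (mb (bc (x j)) (x j)) w / 2" for i j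
  using adv_pairing(1)[OF y] adv_pairing[OF x] by (simp_all add: inner_commute)
 have e1: "inner (x j + (2 * b) *\<^sub>R mb (bc q) (x j)) (H j - grad_part H j) =
  (\<Sum>k\<in>UNIV. - A j k) - inner (x j) (grad_part H j) + 2 * b * ((\<Sum>k\<in>UNIV. - (B j k + C j k)) + inner (mb (bc (x j)) (x j)) w / 2 - h j)" for j
 proof -
  have "inner (x j) (H j) = (\<Sum>k\<in>UNIV. - A j k)" unfolding H_def by (simp add: inner_diff_right inner_sum_right xD ax)
  moreover have "inner (mb (bc q) (x j)) (H j) = (\<Sum>k\<in>UNIV. - (B j k + C j k)) + inner (mb (bc (x j)) (x j)) w / 2"
   unfolding H_def inner_diff_right inner_sum_right SD aS by simp
  ultimately show ?thesis by (simp add: inner_add_left inner_diff_right h_def inner_commute[of "grad_part H j"] algebra_simps)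
 qed
 have e2: "inner (y i j) ((1/2) *\<^sub>R (Dk j (x i) + Dk i (x j)) + b *\<^sub>R mb (bc q) (Dk j (x i) + Dk i (x j)) - adv x (y i j))
  = (A i j + A j i) / 2 + b * (B i j + B j i)" for i j
  unfolding inner_diff_right inner_add_right mb.add_right inner_scaleR_right ay A' B' by (simp add: A_def B_def)
 show ?thesis
  unfolding e1 e2 C_def[symmetric] h_def[symmetric] using gx unfolding UNIV_two by (simp add: algebra_simps)
qed

lemma adv_q: "adv x q = w"
 unfolding adv_def w_def using mb_bc_commute[OF s1(1) x(1) q(3) x(2) RE_Dq] by simp

lemma inner_Qop_le:
 assumes m: "!!c d k l. \<bar>inner z (mb (bc (y c d)) (Dk k (x l)))\<bar> <= m"
 shows "\<bar>inner z (Qop b x y i j)\<bar> <= 8 * m"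
proof -
 define p where "p c d k l = inner z (mb (bc (y c d)) (Dk k (x l)))" for c d k l
 have m': "p c d k l <= m" "- p c d k l <= m" for c d k l using m[of c d k l] unfolding p_def by linarith+
 have core: "\<bar>(1/2) * (u - v) - (1/2) * (u' - v') - (b/2) * (u' + v' + u + v)\<bar> <= 4 * m"
  if "u <= m" "- u <= m" "v <= m" "- v <= m" "u' <= m" "- u' <= m" "v' <= m" "- v' <= m" for u v u' v'
 proof -
  have Z: "\<bar>u' + v' + u + v\<bar> <= 4 * m" by (rule abs_leI) (use that in linarith)+
  have "\<bar>(b/2) * (u' + v' + u + v)\<bar> = \<bar>b\<bar> * \<bar>u' + v' + u + v\<bar> / 2" by (simp add: abs_mult)
  also have "\<dots> <= 1 * (4 * m) / 2" by (intro mult_mono b Z divide_right_mono) auto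
  finally have e: "\<bar>(b/2) * (u' + v' + u + v)\<bar> <= 2 * m" by simp
  have "\<bar>(1/2) * (u - v) - (1/2) * (u' - v') - e\<bar> <= 4 * m" if "e <= 2 * m" "- e <= 2 * m" for e
   by (rule abs_leI) (use that \<open>u <= m\<close> \<open>- u <= m\<close> \<open>v <= m\<close> \<open>- v <= m\<close> \<open>u' <= m\<close> \<open>- u' <= m\<close> \<open>v' <= m\<close> \<open>- v' <= m\<close> in argo)+
  then show ?thesis using e unfolding abs_le_iff[of "b / 2 * _"] by blast
 qed
 have "\<bar>(1/2) * (p i k j k - p i k k j) - (1/2) * (p k j k i - p k j i k) - (b/2) * (p k j k i + p k j i k + p i k j k + p i k k j)\<bar> <= 4 * m" for k
  by (rule core) (rule m')+
 from this[of 1] this[of 2] show ?thesis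
  unfolding Qop_def by (simp add: inner_sum_right inner_diff_right inner_add_right UNIV_two flip: p_def)
qed

definition size :: real where "size = (\<Sum>i\<in>UNIV. \<Sum>j\<in>UNIV. norm (y i j)) + (\<Sum>j\<in>UNIV. norm (x j))"

definition growth :: "real => real" where "growth K = 1 + 8 * (2 * pi)\<^sup>2 * (8 * wtc (2 * \<beta>) * K)\<^sup>2 + 6 * K + 5 * K\<^sup>2"

lemma norm_le_size: "norm (y i j) <= size" "norm (x j) <= size" "(\<Sum>j\<in>UNIV. norm (x j)) <= size"
 "(\<Sum>i\<in>UNIV. \<Sum>j\<in>UNIV. norm (y i j)) <= size" "0 <= size"
proof -
 have "norm (x j) <= (\<Sum>j\<in>UNIV. norm (x j))" by (rule member_le_sum) auto
 moreover have "norm (y i j) <= (\<Sum>j\<in>UNIV. norm (y i j))" by (rule member_le_sum) auto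
 moreover have "(\<Sum>j\<in>UNIV. norm (y i j)) <= (\<Sum>i\<in>UNIV. \<Sum>j\<in>UNIV. norm (y i j))"
  by (rule member_le_sum[of i UNIV "%i. \<Sum>j\<in>UNIV. norm (y i j)"]) (auto intro: sum_nonneg)
 moreover have "0 <= (\<Sum>j\<in>UNIV. norm (x j))" "0 <= (\<Sum>i\<in>UNIV. \<Sum>j\<in>UNIV. norm (y i j))" by (intro sum_nonneg norm_ge_zero)+
 ultimately show "norm (y i j) <= size" "norm (x j) <= size" "(\<Sum>j\<in>UNIV. norm (x j)) <= size"
  "(\<Sum>i\<in>UNIV. \<Sum>j\<in>UNIV. norm (y i j)) <= size" "0 <= size"
  unfolding size_def by linarith+
qed

text \<open>Each term of \<open>Q\<close> is at most a constant times \<open>\<parallel>y\<parallel>\<^bsub>H^\<beta>\<^esub> \<parallel>\<nabla> x\<parallel>\<^bsub>H^\<beta>\<^esub> \<parallel>y\<parallel>\<close>. The first factor is absorbed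
  by the dissipation, the second is bounded since \<open>s > 1 + \<beta>\<close>.\<close>

lemma quadratic_term_estimate:
 assumes K: "!!j. Hsn s (x j) <= K" "K >= 0"
 shows "- (\<Sum>i\<in>UNIV. \<Sum>j\<in>UNIV. inner (y i j) (Qop b x y i j)) - (\<Sum>i\<in>UNIV. \<Sum>j\<in>UNIV. inner (y i j) (RE (mop (fsym \<beta>) (y i j))))
   <= (1 + 8 * (2 * pi)\<^sup>2 * (8 * wtc (2 * \<beta>) * K)\<^sup>2) * size\<^sup>2"
proof -
 define h where "h i j = Hsn \<beta> (y i j)" for i j
 define d where "d i j = inner (y i j) (RE (mop (fsym \<beta>) (y i j)))" for i j
 define A where "A = (\<Sum>i\<in>UNIV. \<Sum>j\<in>UNIV. h i j)"
 define \<kappa> where "\<kappa> = 8 * (2 * pi)\<^sup>2"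
 have \<kappa>: "\<kappa> > 0" unfolding \<kappa>_def by simp
 have h0: "0 <= h i j" for i j by (simp add: h_def Hsn_def)
 have hA: "h i j <= A" for i j
 proof -
  have "h i j <= (\<Sum>j\<in>UNIV. h i j)" by (rule member_le_sum) (auto simp: h0)
  also have "\<dots> <= A" unfolding A_def by (rule member_le_sum[of i UNIV "%i. \<Sum>j\<in>UNIV. h i j"]) (auto intro: sum_nonneg simp: h0)
  finally show ?thesis .
 qed
 have A0: "0 <= A" using order_trans[OF h0 hA[of 1 1]] .
 let ?c = "2 * wtc (2 * \<beta>) * K"
 have c0: "0 <= wtc (2 * \<beta>)" by (simp add: wtc_def)
 have "\<bar>inner z (mb (bc (y c d)) (Dk k (x l)))\<bar> <= ?c * A * norm z" for z c d k l
 proof -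
  have xr: "inHs (\<beta> + 1) (x l)" by (rule inHs_mono(1)[OF x(1)]) (use s in simp)
  have D: "inHs \<beta> (Dk k (x l))" "Hsn \<beta> (Dk k (x l)) <= K"
   using Hsn_Dk[OF _ xr, of k] inHs_mono(2)[OF x(1)[of l], of "\<beta> + 1"] K(1)[of l] \<beta> s by auto
  have yb: "inHs \<beta> (y c d)" by (rule inHs_mono(1)[OF y(1)]) (use s in simp)
  have "\<bar>inner z (mb (bc (y c d)) (Dk k (x l)))\<bar> <= 2 * wtc (2 * \<beta>) * h c d * Hsn \<beta> (Dk k (x l)) * norm z"
   unfolding h_def inner_commute[of z] by (rule product_estimate[OF \<beta>(1) s1(1) y(1) yb D(1) y(2)])
  also have "\<dots> <= 2 * wtc (2 * \<beta>) * A * K * norm z"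
   using hA[of c d] D(2) h0[of c d] c0 A0 by (intro mult_right_mono mult_mono) (auto simp: Hsn_def)
  finally show ?thesis by (simp add: mult_ac)
 qed
 then have "\<bar>inner z (Qop b x y i j)\<bar> <= 8 * (?c * A * norm z)" for z i j by (rule inner_Qop_le)
 then have "- inner (y i j) (Qop b x y i j) <= 8 * ?c * A * norm (y i j)" for i j
  unfolding abs_le_iff by (simp add: mult.assoc)
 then have "- (\<Sum>i\<in>UNIV. \<Sum>j\<in>UNIV. inner (y i j) (Qop b x y i j)) <= (\<Sum>i\<in>UNIV. \<Sum>j\<in>UNIV. 8 * ?c * A * norm (y i j))"
  unfolding sum_negf[symmetric] by (intro sum_mono)
 also have "\<dots> = 8 * ?c * A * (\<Sum>i\<in>UNIV. \<Sum>j\<in>UNIV. norm (y i j))" by (simp only: sum_distrib_left)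
 also have "\<dots> <= 8 * ?c * A * size" by (intro mult_left_mono norm_le_size mult_nonneg_nonneg) (use c0 A0 K in auto)
 also have "\<dots> <= A\<^sup>2 / \<kappa> + \<kappa> * (8 * wtc (2 * \<beta>) * K)\<^sup>2 * size\<^sup>2"
 proof -
  have "0 <= (A - \<kappa> * (8 * wtc (2 * \<beta>) * K) * size)\<^sup>2 / \<kappa>" using \<kappa> by simp
  also have "\<dots> = A\<^sup>2 / \<kappa> + \<kappa> * (8 * wtc (2 * \<beta>) * K)\<^sup>2 * size\<^sup>2 - 8 * ?c * A * size"
   using \<kappa> by (simp add: field_simps power2_eq_square)
  finally show ?thesis by simp
 qed
 finally have Q: "- (\<Sum>i\<in>UNIV. \<Sum>j\<in>UNIV. inner (y i j) (Qop b x y i j)) <= A\<^sup>2 / \<kappa> + \<kappa> * (8 * wtc (2 * \<beta>) * K)\<^sup>2 * size\<^sup>2" .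
 have four: "(p + q + (r + t))\<^sup>2 <= 4 * (p\<^sup>2 + q\<^sup>2 + (r\<^sup>2 + t\<^sup>2))" for p q r t :: real
  using sum_squares_bound[of p q] sum_squares_bound[of p r] sum_squares_bound[of p t] sum_squares_bound[of q r]
   sum_squares_bound[of q t] sum_squares_bound[of r t] by (simp add: power2_eq_square algebra_simps)
 have "A\<^sup>2 <= 4 * (\<Sum>i\<in>UNIV. \<Sum>j\<in>UNIV. (h i j)\<^sup>2)" unfolding A_def UNIV_two by (rule four)
 also have "(\<Sum>i\<in>UNIV. \<Sum>j\<in>UNIV. (h i j)\<^sup>2) <= (\<Sum>i\<in>UNIV. \<Sum>j\<in>UNIV. 2 * (2 * pi)\<^sup>2 * ((norm (y i j))\<^sup>2 + d i j))"
  unfolding h_def d_def using \<beta> s by (intro sum_mono dissipation y inHs_mono(1)[OF y(1)]) auto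
 also have "\<dots> = 2 * (2 * pi)\<^sup>2 * ((\<Sum>i\<in>UNIV. \<Sum>j\<in>UNIV. (norm (y i j))\<^sup>2) + (\<Sum>i\<in>UNIV. \<Sum>j\<in>UNIV. d i j))"
  by (simp only: sum_distrib_left[symmetric] sum.distrib)
 also have "(\<Sum>i\<in>UNIV. \<Sum>j\<in>UNIV. (norm (y i j))\<^sup>2) <= size\<^sup>2"
 proof -
  have "(\<Sum>i\<in>UNIV. \<Sum>j\<in>UNIV. (norm (y i j))\<^sup>2) <= (\<Sum>i\<in>UNIV. \<Sum>j\<in>UNIV. size * norm (y i j))"
   unfolding power2_eq_square by (intro sum_mono mult_right_mono norm_le_size) simp
  also have "\<dots> = size * (\<Sum>i\<in>UNIV. \<Sum>j\<in>UNIV. norm (y i j))" by (simp only: sum_distrib_left)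
  also have "\<dots> <= size * size" by (intro mult_left_mono norm_le_size)
  finally show ?thesis by (simp add: power2_eq_square)
 qed
 finally have "A\<^sup>2 <= \<kappa> * (size\<^sup>2 + (\<Sum>i\<in>UNIV. \<Sum>j\<in>UNIV. d i j))" by (simp add: \<kappa>_def)
 then have "A\<^sup>2 / \<kappa> <= size\<^sup>2 + (\<Sum>i\<in>UNIV. \<Sum>j\<in>UNIV. d i j)" using \<kappa> by (simp add: divide_le_eq mult.commute)
 with Q show ?thesis unfolding d_def[symmetric] \<kappa>_def[symmetric] by (simp add: algebra_simps)
qed

text \<open>Every remaining term is quadratic in the \<open>L\<^sup>2\<close> size of the difference. For the projection term this
  uses that \<open>H\<close> is the divergence of the tensor \<open>y - x \<otimes> x\<close>, whose derivatives are moved to \<open>\<sigma> x\<close>.\<close>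

lemma energy_estimate:
 assumes K: "!!j. Hsn s (x j) <= K" "!!j. norm (bc (x j)) <= K" "!!k. norm (bc (Dk k q)) <= K" "norm B' <= K" and a: "a >= 0"
 shows "- (\<Sum>i\<in>UNIV. inner (y i i) (adv x q)) - a * (\<Sum>i\<in>UNIV. \<Sum>j\<in>UNIV. (norm (y i j))\<^sup>2)
   - (\<Sum>i\<in>UNIV. \<Sum>j\<in>UNIV. inner (y i j) (Qop b x y i j)) - (\<Sum>i\<in>UNIV. \<Sum>j\<in>UNIV. inner (y i j) (RE (mop (fsym \<beta>) (y i j))))
   - 2 * b * (\<Sum>j\<in>UNIV. \<Sum>k\<in>UNIV. inner (mb (bc (Dk k q)) (x j)) (y j k)) + b * (\<Sum>j\<in>UNIV. inner (mb (bc (x j)) (x j)) w)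
   - 2 * b * (\<Sum>j\<in>UNIV. inner (grad_part H j) (mb (bc q) (x j))) + b * (\<Sum>j\<in>UNIV. inner (mb B' (x j)) (x j))
   <= growth K * size\<^sup>2"
proof -
 have K0: "K >= 0" using K(4) norm_ge_zero order_trans by blast
 note n = norm_le_size
 have bb: "b * z <= \<bar>z\<bar>" "- (b * z) <= \<bar>z\<bar>" for z
  using mult_right_mono[OF b abs_ge_zero[of z]] by (simp_all add: abs_mult[symmetric] abs_le_iff)
 have w: "norm w <= K * size"
 proof -
  have "norm w <= (\<Sum>k\<in>UNIV. K * norm (x k))" unfolding w_def
   by (intro sum_norm_le order_trans[OF norm_mb] mult_right_mono K) simp
  also have "\<dots> <= K * size" unfolding sum_distrib_left[symmetric] by (intro mult_left_mono n K0)
  finally show ?thesis .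
 qed
 have nn: "norm w * m <= K * c * size\<^sup>2" if "m <= c * size" "m >= 0" for m c
  using mult_mono[OF w that(1) mult_nonneg_nonneg[OF K0 n(5)] that(2)] by (simp add: power2_eq_square mult_ac)
 have cs: "- inner v w <= norm w * norm v" for v
  using Cauchy_Schwarz_ineq2[of v w] by (simp add: abs_le_iff mult.commute)
 have t2: "- (\<Sum>i\<in>UNIV. inner (y i i) (adv x q)) <= K * 1 * size\<^sup>2"
 proof -
  have "- (\<Sum>i\<in>UNIV. inner (y i i) (adv x q)) <= (\<Sum>i\<in>UNIV. norm w * norm (y i i))"
   unfolding adv_q sum_negf[symmetric]
   by (intro sum_mono cs)
  also have "\<dots> <= norm w * (\<Sum>i\<in>UNIV. \<Sum>j\<in>UNIV. norm (y i j))"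
   unfolding sum_distrib_left[symmetric] by (intro mult_left_mono sum_mono member_le_sum[of _ UNIV]) auto
  also have "\<dots> <= K * 1 * size\<^sup>2" by (rule nn) (use n in \<open>(intro sum_nonneg norm_ge_zero | simp)+\<close>)
  finally show ?thesis .
 qed
 have t3: "0 <= a * (\<Sum>i\<in>UNIV. \<Sum>j\<in>UNIV. (norm (y i j))\<^sup>2)" using a by (intro mult_nonneg_nonneg sum_nonneg) auto
 have sq: "(\<Sum>j\<in>UNIV. norm (x j) * m j) <= size * (\<Sum>j\<in>UNIV. m j)" if "!!j. m j >= 0" for m
  unfolding sum_distrib_left by (intro sum_mono mult_right_mono n that)
 have t5: "\<bar>\<Sum>j\<in>UNIV. \<Sum>k\<in>UNIV. inner (mb (bc (Dk k q)) (x j)) (y j k)\<bar> <= K * size\<^sup>2"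
 proof -
  have "\<bar>\<Sum>j\<in>UNIV. \<Sum>k\<in>UNIV. inner (mb (bc (Dk k q)) (x j)) (y j k)\<bar> <= (\<Sum>j\<in>UNIV. \<Sum>k\<in>UNIV. K * size * norm (y j k))"
  proof (intro order_trans[OF sum_abs sum_mono] order_trans[OF Cauchy_Schwarz_ineq2 mult_right_mono])
   show "norm (mb (bc (Dk k q)) (x j)) <= K * size" for k j
    by (rule order_trans[OF norm_mb mult_mono]) (use K n K0 in auto)
  qed simp
  also have "\<dots> = K * size * (\<Sum>j\<in>UNIV. \<Sum>k\<in>UNIV. norm (y j k))" by (simp only: sum_distrib_left)
  also have "\<dots> <= K * size * size" by (intro mult_left_mono n mult_nonneg_nonneg K0)
  finally show ?thesis by (simp add: power2_eq_square)
 qed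
 have t6: "\<bar>\<Sum>j\<in>UNIV. inner (mb (bc (x j)) (x j)) w\<bar> <= K * K * size\<^sup>2"
 proof -
  have "\<bar>\<Sum>j\<in>UNIV. inner (mb (bc (x j)) (x j)) w\<bar> <= (\<Sum>j\<in>UNIV. K * norm (x j) * norm w)"
   by (intro order_trans[OF sum_abs sum_mono] order_trans[OF Cauchy_Schwarz_ineq2 mult_right_mono] order_trans[OF norm_mb mult_right_mono] K) auto
  also have "\<dots> = norm w * (K * (\<Sum>j\<in>UNIV. norm (x j)))" by (simp add: sum_distrib_left mult_ac)
  also have "\<dots> <= K * K * size\<^sup>2" by (rule nn) (use n K0 in \<open>auto intro!: mult_left_mono mult_nonneg_nonneg sum_nonneg\<close>)
  finally show ?thesis .
 qed
 have t7: "\<bar>\<Sum>j\<in>UNIV. inner (grad_part H j) (mb (bc q) (x j))\<bar> <= K * (1 + 2 * K) * size\<^sup>2"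
 proof -
  define M where "M k l = y k l - mb (bc (x l)) (x k)" for k l
  define M' where "M' k l = Dk l (y k l) - (mb (bc (x l)) (Dk l (x k)) + mb (bc (x k)) (Dk l (x l)))" for k l
  have D: "isD l (M k l) (M' k l)" for k l unfolding M_def M'_def
   by (intro isD_diff isD_Dk[OF s1(2)] isD_mb_bc[OF s1(1)] x y)
  have "(\<Sum>l\<in>UNIV. M' k l) = H k" for k
   using mb.sum_right[of "bc (x k)" "%l. Dk l (x l)" UNIV] unfolding div M'_def H_def adv_def
   by (simp add: sum.distrib sum_subtractf mb.zero_right)
  then have "grad_part H = grad_part (%k. \<Sum>l\<in>UNIV. M' k l)" by simp
  then have "\<bar>\<Sum>j\<in>UNIV. inner (grad_part H j) (mb (bc q) (x j))\<bar> <= norm w * (\<Sum>k\<in>UNIV. \<Sum>l\<in>UNIV. norm (M k l))"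
   using grad_part_pairing[where w="%j. mb (bc q) (x j)" and M=M and M'=M', OF isD_Sx _ D] div_Sx by (simp add: RE_mb x)
  also have "\<dots> <= K * (1 + 2 * K) * size\<^sup>2"
  proof (rule nn)
   have "(\<Sum>k\<in>UNIV. \<Sum>l\<in>UNIV. norm (M k l)) <= (\<Sum>k\<in>UNIV. \<Sum>l\<in>UNIV. norm (y k l) + K * norm (x k))"
    unfolding M_def by (intro sum_mono order_trans[OF norm_triangle_ineq4 add_left_mono] order_trans[OF norm_mb mult_right_mono] K) simp
   also have "\<dots> = (\<Sum>k\<in>UNIV. \<Sum>l\<in>UNIV. norm (y k l)) + 2 * K * (\<Sum>k\<in>UNIV. norm (x k))"
    by (simp add: sum.distrib sum_distrib_left mult.assoc)
   also have "\<dots> <= size + 2 * K * size" by (intro add_mono mult_left_mono n) (use K0 in auto)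
   finally show "(\<Sum>k\<in>UNIV. \<Sum>l\<in>UNIV. norm (M k l)) <= (1 + 2 * K) * size" by (simp add: algebra_simps)
  qed (intro sum_nonneg norm_ge_zero)
  finally show ?thesis .
 qed
 have t8: "\<bar>\<Sum>j\<in>UNIV. inner (mb B' (x j)) (x j)\<bar> <= K * size\<^sup>2"
 proof -
  have "\<bar>\<Sum>j\<in>UNIV. inner (mb B' (x j)) (x j)\<bar> <= (\<Sum>j\<in>UNIV. K * norm (x j) * size)"
   by (intro order_trans[OF sum_abs sum_mono] order_trans[OF Cauchy_Schwarz_ineq2 mult_mono] order_trans[OF norm_mb mult_right_mono] K n) (use K0 in auto)
  also have "\<dots> = K * size * (\<Sum>j\<in>UNIV. norm (x j))" by (simp add: sum_distrib_left mult_ac)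
  also have "\<dots> <= K * size * size" by (intro mult_left_mono n mult_nonneg_nonneg K0)
  finally show ?thesis by (simp add: power2_eq_square)
 qed
 define G where "G = (1 + 8 * (2 * pi)\<^sup>2 * (8 * wtc (2 * \<beta>) * K)\<^sup>2) * size\<^sup>2"
 have g: "growth K * size\<^sup>2 = G + 6 * (K * size\<^sup>2) + 5 * (K * K * size\<^sup>2)"
  unfolding growth_def G_def distrib_right by (simp add: power2_eq_square[of K])
 have k: "K * (1 + 2 * K) * size\<^sup>2 = K * size\<^sup>2 + 2 * (K * K * size\<^sup>2)" by (simp add: algebra_simps)
 have fin: "- t - u - v - v' - 2 * b * p5 + b * p6 - 2 * b * p7 + b * p8 <= G + 6 * z + 5 * z'"
  if "- t <= z" "0 <= u" "- v - v' <= G" "- (b * p5) <= z" "b * p6 <= z'" "- (b * p7) <= z + 2 * z'" "b * p8 <= z" for t u v v' p5 p6 p7 p8 z z' G :: real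
  using that by (simp add: mult.assoc)
 show ?thesis
  unfolding g
  by (rule fin) (use t2 t3 quadratic_term_estimate[OF K(1) K0] order_trans[OF bb(2) t5] order_trans[OF bb(1) t6] order_trans[OF bb(2) t7[unfolded k]] order_trans[OF bb(1) t8] in \<open>simp_all only: G_def mult_1_right\<close>)
qed

end

section \<open>Uniqueness\<close>

lemma gronwall_zero:
 fixes E :: "real => real"
 assumes E: "continuous_on {0..\<tau>} E" "!!t. 0 < t ==> t < \<tau> ==> (E has_real_derivative E' t) (at t)"
  "!!t. 0 < t ==> t < \<tau> ==> E' t <= L * E t" and 0: "E 0 = 0" "0 <= \<tau>"
 shows "E \<tau> <= 0"
proof (cases "\<tau> = 0")
 case False
 define F where "F t = E t * exp (- L * t)" for t
 have "F \<tau> <= F 0"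
 proof (rule DERIV_nonpos_imp_decreasing_open[of 0 \<tau> F])
  show "continuous_on {0..\<tau>} F" unfolding F_def by (intro continuous_intros E)
  fix t assume t: "0 < t" "t < \<tau>"
  have "(F has_real_derivative E' t * exp (- L * t) + (exp (- L * t) * (- L)) * E t) (at t)"
   unfolding F_def by (rule DERIV_mult[OF E(2)[OF t]]) (auto intro!: derivative_eq_intros)
  moreover have "E' t * exp (- L * t) + (exp (- L * t) * (- L)) * E t = (E' t - L * E t) * exp (- L * t)"
   by (simp add: algebra_simps)
  moreover have "(E' t - L * E t) * exp (- L * t) <= 0" using E(3)[OF t] by (simp add: mult_nonpos_nonneg)
  ultimately show "\<exists>y. (F has_real_derivative y) (at t) \<and> y <= 0" by metis
 qed (use False 0 in auto)
 then show ?thesis using 0 by (simp add: F_def mult_le_0_iff not_le)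
qed (use 0 in simp)

text \<open>The explicit isotropic stress \<open>q\<close> enters only through bounds on \<open>q\<close>, its gradient and its time
  derivative \<open>B\<close>, and through its linear equation.\<close>

locale comparison = strong_sol +
 fixes q :: "real => l2" and B :: "real => bcf" and M :: real
 assumes ab: "\<bar>b\<bar> <= 1" "a >= 0" and q_curve: "Hs_curve s q"
  and q: "!!t. t >= 0 ==> RE (q t) = q t" "!!t k. t >= 0 ==> inHs s (Dk k (q t))"
   "!!t. t >= 0 ==> norm (bc (q t)) <= 1/4" "!!t k. t >= 0 ==> norm (bc (Dk k (q t))) <= M"
  and B: "!!t. t > 0 ==> norm (B t) <= M" "!!t. t > 0 ==> ((%t. bc (q t)) has_vector_derivative B t) (at t)"
  and q_ode: "!!t. t > 0 ==> (q has_vector_derivative - (a *\<^sub>R q t) - RE (mop (fsym \<beta>) (q t))) (at t)"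
  and init: "!!j. X 0 j = 0" "!!i j. T 0 i j = (if i = j then q 0 else 0)"
begin

definition Q :: "real => 2 => 2 => l2" where "Q t i j = (if i = j then q t else 0)"

definition Y :: "real => 2 => 2 => l2" where "Y t i j = T t i j - Q t i j"

lemma Hs_q: "t >= 0 ==> inHs s (q t)" using q_curve by (simp add: Hs_curve_def)

lemma inHs_zero: "inHs r 0" by (simp add: mul_zero)

lemma RE_0: "RE 0 = 0" by (rule linear_0[OF bounded_linear.linear[OF bounded_linear_RE]])

lemma Hs_Q: "t >= 0 ==> inHs s (Q t i j)" using Hs_q inHs_zero unfolding Q_def by (cases "i = j") simp_all

lemma mop_zero: "m \<in> borel_measurable borel ==> (!!xi. norm (m xi) <= norm (wt s xi)) ==> mop m 0 = 0"
 using mop_diff[OF _ _ inHs_zero[of s] inHs_zero, of m] by simp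

lemma mop_Y:
 assumes "m \<in> borel_measurable borel" "!!xi. norm (m xi) <= norm (wt s xi)" "t >= 0"
 shows "mop m (T t i j) = mop m (Y t i j) + (if i = j then mop m (q t) else 0)"
 using mop_diff[OF assms(1,2) Hs_T[OF assms(3)] Hs_Q[OF assms(3)], of i j i j] mop_zero[OF assms(1,2)]
 by (auto simp: Y_def Q_def)

lemmas mop_Y' = mop_Y[OF dsym_measurable dsym_le_wt[OF s1(2)]] mop_Y[OF fsym_measurable fsym_le_wt[OF s1(4,5)]]

lemma bc_T:
 assumes t: "t >= 0" shows "bc (T t i j) = bc (Y t i j) + (if i = j then bc (q t) else 0)"
 using bc_diff[OF s1(1) Hs_T[OF t] Hs_Q[OF t], of i j i j] bc_diff[OF s1(1) inHs_zero inHs_zero] by (auto simp: Y_def Q_def)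

lemma state: "t >= 0 ==> energy_state s \<beta> b (X t) (Y t) (q t)"
proof (unfold_locales)
 assume t: "t >= 0"
 show "1/2 < \<beta>" "\<beta> < 1" "1 + \<beta> < s" "\<bar>b\<bar> <= 1" using \<beta> s ab by auto
 show "inHs s (X t j)" "RE (X t j) = X t j" "(\<Sum>k\<in>UNIV. Dk k (X t k)) = 0" for j
  using t Hs_X RE_X divergence_zero by auto
 show "inHs s (Y t i j)" for i j unfolding Y_def by (rule inHs_diff[OF Hs_T[OF t] Hs_Q[OF t]])
 show "RE (Y t i j) = Y t i j" for i j
  unfolding Y_def RE_lin RE_T[OF t] Q_def using q(1)[OF t] by (cases "i = j") (simp_all add: RE_0)
 show "Y t i j = Y t j i" for i j by (simp add: Y_def Q_def T_symmetric[OF t, of i j])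
 show "inHs s (q t)" "RE (q t) = q t" "inHs s (Dk k (q t))" for k using t q Hs_q by auto
qed

lemma Qop_T:
 assumes t: "t >= 0"
 shows "Qop b (X t) (T t) i j = Qop b (X t) (Y t) i j - b *\<^sub>R mb (bc (q t)) (Dk j (X t i) + Dk i (X t j))"
 unfolding Qop_def bc_T[OF t] UNIV_two using exhaust_2[of i] exhaust_2[of j]
 by (auto simp: mb.add_left mb.add_right mb.zero_left algebra_simps simp flip: scaleR_add_left)

lemma Y_ode:
 assumes t: "t > 0"
 shows "((%t. Y t i j) has_vector_derivative
  ((1/2) *\<^sub>R (Dk j (X t i) + Dk i (X t j)) + b *\<^sub>R mb (bc (q t)) (Dk j (X t i) + Dk i (X t j)) - adv (X t) (Y t i j))
  - (if i = j then adv (X t) (q t) else 0) - a *\<^sub>R Y t i j - Qop b (X t) (Y t) i j - RE (mop (fsym \<beta>) (Y t i j))) (at t)"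
proof -
 have t0: "t >= 0" using t by simp
 have Qd: "((%t. Q t i j) has_vector_derivative (if i = j then - (a *\<^sub>R q t) - RE (mop (fsym \<beta>) (q t)) else 0)) (at t)"
  unfolding Q_def using q_ode[OF t] by simp
 have adv: "adv (X t) (T t i j) = adv (X t) (Y t i j) + (if i = j then adv (X t) (q t) else 0)"
  unfolding adv_def mop_Y'(1)[OF t0] by (simp add: mb.add_right sum.distrib mb.zero_right)
 have eq: "Frhs b \<beta> a (X t) (T t) i j - (if i = j then - (a *\<^sub>R q t) - RE (mop (fsym \<beta>) (q t)) else 0) =
  ((1/2) *\<^sub>R (Dk j (X t i) + Dk i (X t j)) + b *\<^sub>R mb (bc (q t)) (Dk j (X t i) + Dk i (X t j)) - adv (X t) (Y t i j))
  - (if i = j then adv (X t) (q t) else 0) - a *\<^sub>R Y t i j - Qop b (X t) (Y t) i j - RE (mop (fsym \<beta>) (Y t i j))"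
  unfolding Frhs_def Qop_T[OF t0] adv mop_Y'(2)[OF t0] RE_lin Y_def[of t i j] Q_def by (simp add: algebra_simps RE_lin RE_0)
 have "(%t. Y t i j) = (%t. T t i j - Q t i j)" by (simp only: Y_def)
 then show ?thesis
  unfolding eq[symmetric] by (simp only: has_vector_derivative_diff[OF stress_ode[OF t] Qd])
qed

lemma X_ode:
 assumes t: "t > 0"
 shows "((%t. X t j) has_vector_derivative energy_state.H (X t) (Y t) j - grad_part (energy_state.H (X t) (Y t)) j) (at t)"
proof -
 have "Grhs (X t) (T t) k - Dk k (q t) = energy_state.H (X t) (Y t) k" for k
  unfolding energy_state.H_def[OF state[OF less_imp_le[OF t]]] Grhs_def using t
  by (simp add: mop_Y'(1) sum.distrib)
 then show ?thesis using velocity_ode[OF q_curve q(1) t, of j] by simp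
qed

text \<open>The weight \<open>1 + 2 b \<sigma>\<close> on the velocity cancels the derivative loss in the coupling to the stress.\<close>

definition E :: "real => real" where
 "E t = (\<Sum>i\<in>UNIV. \<Sum>j\<in>UNIV. inner (Y t i j) (Y t i j)) / 2 + (\<Sum>j\<in>UNIV. inner (X t j) (X t j)) / 2
   + b * (\<Sum>j\<in>UNIV. inner (mb (bc (q t)) (X t j)) (X t j))"

lemma continuous_Y: "continuous_on {0..} (%t. Y t i j)"
 unfolding Y_def Q_def by (cases "i = j") (auto intro!: continuous_intros curves Hs_curve_l2[OF s1(3) q_curve])

lemma continuous_E: "continuous_on {0..} E"
 unfolding E_def[abs_def] by (intro continuous_intros continuous_Y curves continuous_mb q_curve) auto

text \<open>The energy is coercive because \<open>|b \<sigma>| \<le> 1/4\<close>.\<close>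

lemma size_le_E: "t >= 0 ==> (energy_state.size (X t) (Y t))\<^sup>2 <= 24 * E t"
proof -
 assume t: "t >= 0"
 have cross: "- ((norm (X t j))\<^sup>2 / 4) <= b * inner (mb (bc (q t)) (X t j)) (X t j)" for j
 proof -
  have "\<bar>b * inner (mb (bc (q t)) (X t j)) (X t j)\<bar> <= 1 * ((1/4 * norm (X t j)) * norm (X t j))"
   unfolding abs_mult
   by (intro mult_mono ab order_trans[OF Cauchy_Schwarz_ineq2 mult_right_mono] order_trans[OF norm_mb mult_right_mono] q(3)[OF t]) auto
  then show ?thesis by (simp add: power2_eq_square abs_le_iff)
 qed
 have six: "(p + p' + (r + r') + (u + u'))\<^sup>2 <= 6 * (p\<^sup>2 + p'\<^sup>2 + (r\<^sup>2 + r'\<^sup>2) + (u\<^sup>2 + u'\<^sup>2))" for p p' r r' u u' :: real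
  using sum_squares_bound[of p p'] sum_squares_bound[of p r] sum_squares_bound[of p r'] sum_squares_bound[of p u] sum_squares_bound[of p u']
   sum_squares_bound[of p' r] sum_squares_bound[of p' r'] sum_squares_bound[of p' u] sum_squares_bound[of p' u']
   sum_squares_bound[of r r'] sum_squares_bound[of r u] sum_squares_bound[of r u'] sum_squares_bound[of r' u] sum_squares_bound[of r' u']
   sum_squares_bound[of u u'] by (simp add: power2_eq_square algebra_simps)
 have "(energy_state.size (X t) (Y t))\<^sup>2 <= 6 * ((\<Sum>i\<in>UNIV. \<Sum>j\<in>UNIV. (norm (Y t i j))\<^sup>2) + (\<Sum>j\<in>UNIV. (norm (X t j))\<^sup>2))"
  unfolding energy_state.size_def[OF state[OF t]] UNIV_two by (rule six)
 moreover have "0 <= (\<Sum>i\<in>UNIV. \<Sum>j\<in>UNIV. (norm (Y t i j))\<^sup>2)" by (intro sum_nonneg zero_le_power2)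
 ultimately show ?thesis
  using cross[of 1] cross[of 2] unfolding E_def power2_norm_eq_inner UNIV_two distrib_left by argo
qed

lemma E_derivative:
 assumes t: "t > 0" and K: "!!j. Hsn s (X t j) <= K" "!!j. norm (bc (X t j)) <= K" "M <= K"
 obtains e where "(E has_real_derivative e) (at t)" "e <= energy_state.growth \<beta> K * (energy_state.size (X t) (Y t))\<^sup>2"
proof -
 interpret es: energy_state s \<beta> b "X t" "Y t" "q t" by (rule state) (use t in simp)
 let ?A = "%i j. (1/2) *\<^sub>R (Dk j (X t i) + Dk i (X t j)) + b *\<^sub>R mb (bc (q t)) (Dk j (X t i) + Dk i (X t j)) - adv (X t) (Y t i j)"
 let ?Y = "%i j. ?A i j - (if i = j then adv (X t) (q t) else 0) - a *\<^sub>R Y t i j - Qop b (X t) (Y t) i j - RE (mop (fsym \<beta>) (Y t i j))"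
 let ?V = "%j. es.H j - grad_part es.H j"
 let ?e = "(\<Sum>i\<in>UNIV. \<Sum>j\<in>UNIV. inner (Y t i j) (?Y i j) + inner (?Y i j) (Y t i j)) / 2 + (\<Sum>j\<in>UNIV. inner (X t j) (?V j) + inner (?V j) (X t j)) / 2
   + b * (\<Sum>j\<in>UNIV. inner (mb (bc (q t)) (X t j)) (?V j) + inner (mb (bc (q t)) (?V j) + mb (B t) (X t j)) (X t j))"
 have dI: "((%t. inner (f t) (g t)) has_real_derivative inner (f t) g' + inner f' (g t)) (at t)"
  if "(f has_vector_derivative f') (at t)" "(g has_vector_derivative g') (at t)" for f g :: "real => l2" and f' g'
  using bounded_bilinear.has_vector_derivative[OF bounded_bilinear_inner that] unfolding has_real_derivative_iff_has_vector_derivative .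
 have dM: "((%t. mb (bc (q t)) (X t j)) has_vector_derivative mb (bc (q t)) (?V j) + mb (B t) (X t j)) (at t)" for j
  by (rule mb.has_vector_derivative[OF B(2)[OF t] X_ode[OF t]])
 have "(E has_real_derivative ?e) (at t)"
  unfolding E_def[abs_def] by (intro DERIV_add DERIV_cdivide DERIV_cmult DERIV_sum dI Y_ode X_ode dM t)
 moreover have "?e <= es.growth K * es.size\<^sup>2"
 proof -
  have e1: "inner (Y t i j) (?Y i j) + inner (?Y i j) (Y t i j) = 2 * inner (Y t i j) (?A i j) - 2 * (if i = j then inner (Y t i j) (adv (X t) (q t)) else 0)
    - 2 * a * (norm (Y t i j))\<^sup>2 - 2 * inner (Y t i j) (Qop b (X t) (Y t) i j) - 2 * inner (Y t i j) (RE (mop (fsym \<beta>) (Y t i j)))" for i j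
   unfolding inner_commute[of "?Y i j"] inner_diff_right[of _ "_ - _"] inner_diff_right[of _ "?A i j"] power2_norm_eq_inner by simp
  have e2: "inner (mb (bc (q t)) (X t j)) (?V j) + inner (mb (bc (q t)) (?V j) + mb (B t) (X t j)) (X t j) =
    2 * inner (mb (bc (q t)) (X t j)) (?V j) + inner (mb (B t) (X t j)) (X t j)" for j
   unfolding inner_add_left inner_mb[of "bc (q t)" "?V j"] by (simp add: inner_commute)
  have e3: "inner (X t j + (2 * b) *\<^sub>R mb (bc (q t)) (X t j)) (?V j) = inner (X t j) (?V j) + 2 * b * inner (mb (bc (q t)) (X t j)) (?V j)" for j
   by (simp add: inner_add_left)
  have "M <= K" "norm (B t) <= K" "norm (bc (Dk k (q t))) <= K" for k
   using K(3) B(1)[OF t] q(4)[of t k] t by (auto intro: order_trans)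
  note est = es.energy_estimate[OF K(1,2) this(3,2) ab(2)]
  have gen: "(\<Sum>i\<in>UNIV. \<Sum>j\<in>UNIV. 2 * A i j - 2 * (if i = j then D i j else 0) - 2 * a * N i j - 2 * Q i j - 2 * R i j) / 2
    + (\<Sum>j\<in>UNIV. V j + V j) / 2 + b * (\<Sum>j\<in>UNIV. 2 * W j + Z j)
   = - (\<Sum>i\<in>UNIV. D i i) - a * (\<Sum>i\<in>UNIV. \<Sum>j\<in>UNIV. N i j) - (\<Sum>i\<in>UNIV. \<Sum>j\<in>UNIV. Q i j) - (\<Sum>i\<in>UNIV. \<Sum>j\<in>UNIV. R i j)
    + ((\<Sum>i\<in>UNIV. \<Sum>j\<in>UNIV. A i j) + (\<Sum>j\<in>UNIV. V j + 2 * b * W j)) + b * (\<Sum>j\<in>UNIV. Z j)"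
   for A D N Q R :: "2 => 2 => real" and V W Z :: "2 => real"
   by (simp add: UNIV_two field_simps)
  have "?e = - (\<Sum>i\<in>UNIV. inner (Y t i i) (adv (X t) (q t))) - a * (\<Sum>i\<in>UNIV. \<Sum>j\<in>UNIV. (norm (Y t i j))\<^sup>2)
    - (\<Sum>i\<in>UNIV. \<Sum>j\<in>UNIV. inner (Y t i j) (Qop b (X t) (Y t) i j)) - (\<Sum>i\<in>UNIV. \<Sum>j\<in>UNIV. inner (Y t i j) (RE (mop (fsym \<beta>) (Y t i j))))
    + ((\<Sum>i\<in>UNIV. \<Sum>j\<in>UNIV. inner (Y t i j) (?A i j)) + (\<Sum>j\<in>UNIV. inner (X t j) (?V j) + 2 * b * inner (mb (bc (q t)) (X t j)) (?V j)))
    + b * (\<Sum>j\<in>UNIV. inner (mb (B t) (X t j)) (X t j))"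
   unfolding e1 e2 inner_commute[of "?V _" "X t _"] by (rule gen)
  then show ?thesis
   using est es.energy_identity unfolding e3 by linarith
 qed
 ultimately show thesis by (rule that)
qed

text \<open>The norms of the velocity are bounded on compact time intervals, so the growth rate of the energy
  is constant there and Gronwall's inequality applies.\<close>

theorem unique: "t >= 0 ==> T t i j = (if i = j then q t else 0)"
proof -
 assume t: "t >= 0"
 have "continuous_on {0..t} (%r. mul (wt s) (FT (X r j)))" for j
  using curve_X[of j] continuous_on_subset[of "{0..}" _ "{0..t}"] by (auto simp: Hs_curve_def)
 note cont = this
 have "\<exists>C. \<forall>r\<in>{0..t}. Hsn s (X r j) <= C" for j
  unfolding Hsn_def by (rule continuous_on_compact_bound[OF compact_Icc cont[of j]]) blast
 then obtain C where C: "!!r j. r \<in> {0..t} ==> Hsn s (X r j) <= C j" by metis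
 define k where "k = wtc s / (2 * pi)\<^sup>2"
 have k: "k >= 0" by (simp add: k_def wtc_def)
 define K where "K = max M (max (max (C 1) (C 2)) (k * max (C 1) (C 2)))"
 have CK: "C j <= max (C 1) (C 2)" for j using exhaust_2[of j] by auto
 have K: "Hsn s (X r j) <= K" "norm (bc (X r j)) <= K" "M <= K" if "r \<in> {0..t}" for r j
 proof -
  have h: "Hsn s (X r j) <= max (C 1) (C 2)" using C[OF that] CK order_trans by blast
  then show "Hsn s (X r j) <= K" "M <= K" unfolding K_def by auto
  have "norm (bc (X r j)) <= k * max (C 1) (C 2)"
   unfolding k_def by (rule order_trans[OF norm_bc_le[OF s1(1) Hs_X] mult_left_mono[OF h]]) (use that in \<open>auto simp: wtc_def\<close>)
  then show "norm (bc (X r j)) <= K" unfolding K_def by auto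
 qed
 have "\<exists>e. (E has_real_derivative e) (at r) \<and> e <= energy_state.growth \<beta> K * (energy_state.size (X r) (Y r))\<^sup>2" if "0 < r" "r < t" for r
 proof -
  have "r \<in> {0..t}" using that by auto
  from E_derivative[OF that(1) K(1)[OF this] K(2)[OF this] K(3)[OF this]] show ?thesis by blast
 qed
 then obtain E' where E': "!!r. 0 < r ==> r < t ==> (E has_real_derivative E' r) (at r)"
   "!!r. 0 < r ==> r < t ==> E' r <= energy_state.growth \<beta> K * (energy_state.size (X r) (Y r))\<^sup>2" by metis
 define L where "L = 24 * \<bar>energy_state.growth \<beta> K\<bar>"
 have "E t <= 0"
 proof (rule gronwall_zero[where E=E and \<tau>=t and L=L and E'=E'])
  show "continuous_on {0..t} E" by (rule continuous_on_subset[OF continuous_E]) auto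
  show "(E has_real_derivative E' r) (at r)" if "0 < r" "r < t" for r using E'(1)[OF that] .
  show "E' r <= L * E r" if r: "0 < r" "r < t" for r
  proof -
   have "E' r <= \<bar>energy_state.growth \<beta> K\<bar> * (energy_state.size (X r) (Y r))\<^sup>2"
    by (rule order_trans[OF E'(2)[OF r] mult_right_mono]) auto
   also have "\<dots> <= \<bar>energy_state.growth \<beta> K\<bar> * (24 * E r)" by (intro mult_left_mono size_le_E) (use r in auto)
   finally show ?thesis by (simp add: L_def)
  qed
  show "E 0 = 0" using init by (simp add: E_def Y_def Q_def mb.zero_right)
 qed (rule t)
 then have "(energy_state.size (X t) (Y t))\<^sup>2 <= 0" using size_le_E[OF t] by linarith
 then have "norm (Y t i j) <= 0" using energy_state.norm_le_size(1)[OF state[OF t], of i j] by simp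
 then show ?thesis by (simp add: Y_def Q_def)
qed

end

section \<open>The explicit isotropic solution\<close>

subsection \<open>Fields with spectrum in the unit disc\<close>

abbreviation disc :: "(real^2) set" where "disc \<equiv> cball 0 1"

text \<open>Symbols are cut off to the unit disc, so that all fields are smooth and all norms are controlled by
  the maximum of the symbol on the disc.\<close>

definition sg :: "(real^2 => real) => real^2 => complex" where
 "sg g xi = complex_of_real (g xi * indicator disc xi)"

definition good :: "(real^2 => real) => bool" where
 "good g \<longleftrightarrow> continuous_on UNIV g \<and> (\<forall>xi. g (- xi) = g xi)"

definition area :: real where "area = measure lborel disc"

definition Kop :: "(real^2 => real) => bcf" where "Kop g = ibc (sg g)"

definition field :: "(real^2 => real) => real^2 => real" where "field g = apply_bcontfun (Kop g)"

lemma good_mult: "good g ==> good h ==> good (%xi. g xi * h xi)" and good_diff: "good g ==> good h ==> good (%xi. g xi - h xi)"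
 and good_const: "good (%_. c)" and good_exp: "good g ==> good (%xi. exp (g xi))" and good_powr: "p > 0 ==> good (%xi. norm xi powr p)"
 and good_add: "good g ==> good h ==> good (%xi. g xi + h xi)"
 by (auto simp: good_def intro!: continuous_intros continuous_on_powr')

lemma good_bounded:
 assumes "good g" obtains C where "C >= 0" "!!xi. xi \<in> disc ==> \<bar>g xi\<bar> <= C"
 using assms continuous_on_compact_bound[OF compact_cball, of 0 1 g] continuous_on_subset[of UNIV g disc] by (auto simp: good_def)

lemma sg_measurable: "good g ==> sg g \<in> borel_measurable borel"
proof -
 assume "good g"
 then have [measurable]: "g \<in> borel_measurable borel" by (intro borel_measurable_continuous_onI) (simp add: good_def)
 have [measurable]: "disc \<in> sets borel" by simp
 show ?thesis unfolding sg_def[abs_def] by measurable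
qed

lemma norm_cl_sg:
 assumes g: "good g" and m: "m >= 0" "!!xi. xi \<in> disc ==> \<bar>g xi\<bar> <= m"
 shows "SI (sg g)" "norm (cl (sg g)) <= m * sqrt area" "integrable lborel (sg g)" "(LBINT xi. norm (sg g xi)) <= m * area"
proof -
 have i: "integrable lborel (%xi. c * indicator disc xi :: real)" for c by (intro integrable_mult_right integrable_indicator_bounded) auto
 have I: "(LBINT xi. c * indicator disc xi) = c * area" for c unfolding area_def by simp
 have b: "(norm (sg g xi))\<^sup>2 <= m\<^sup>2 * indicator disc xi" "norm (sg g xi) <= m * indicator disc xi" for xi
  using m by (auto simp: sg_def indicator_def norm_mult abs_le_square_iff[symmetric])
 have [measurable]: "sg g \<in> borel_measurable lborel" using sg_measurable[OF g] by simp
 show S: "SI (sg g)" by (rule SI_I_bound[OF _ i[of "m\<^sup>2"]]) (use b in auto)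
 show int: "integrable lborel (sg g)" by (rule Bochner_Integration.integrable_bound[OF i[of m]]) (use b(2) m(1) in \<open>auto intro!: AE_I2\<close>)
 have "(norm (cl (sg g)))\<^sup>2 <= m\<^sup>2 * area"
  unfolding norm_cl_sq[OF S] I[symmetric] by (rule integral_mono[OF SI_integrable[OF S] i b(1)])
 then have "norm (cl (sg g)) <= sqrt (m\<^sup>2 * area)" using real_le_rsqrt by blast
 then show "norm (cl (sg g)) <= m * sqrt area" using m by (simp add: real_sqrt_mult)
 show "(LBINT xi. norm (sg g xi)) <= m * area"
  unfolding I[symmetric] by (rule integral_mono[OF integrable_norm[OF int] i b(2)])
qed

lemma sg_basic: "good g ==> SI (sg g) \<and> integrable lborel (sg g)"
 using good_bounded[of g] norm_cl_sg by metis

lemma norm_Kop: "good g ==> m >= 0 ==> (!!xi. xi \<in> disc ==> \<bar>g xi\<bar> <= m) ==> norm (Kop g) <= m * area"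
proof -
 assume g: "good g" and m: "m >= 0" "!!xi. xi \<in> disc ==> \<bar>g xi\<bar> <= m"
 note n = norm_cl_sg[OF g m]
 have "norm (Kop g) <= (m * area) / (2 * pi)\<^sup>2"
  unfolding Kop_def by (rule order_trans[OF norm_ibc_le[OF n(3)] divide_right_mono[OF n(4) zero_le_power2]])
 also have "\<dots> <= (m * area) / 1"
 proof (rule divide_left_mono)
  show "1 <= (2 * pi)\<^sup>2" using pi_gt3 by (intro one_le_power) simp
 qed (use m in \<open>auto simp: area_def\<close>)
 finally show ?thesis by simp
qed

text \<open>The symbol is real and even, hence the field is real and no information is lost.\<close>

lemma Lr_field:
 assumes g: "good g"
 shows "SI (cr (field g))" "Lr (field g) = IFT (cl (sg g))" "FT (Lr (field g)) = cl (sg g)"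
proof -
 note b = conjunct1[OF sg_basic[OF g]] conjunct2[OF sg_basic[OF g]]
 have cn: "cnj (fi (sg g) x) = fi (sg g) x" for x
 proof -
  have "(LBINT y. cis (- ((0 - y) \<bullet> x)) * sg g (0 - y)) = (LBINT y. cis (- (y \<bullet> x)) * sg g y)"
   by (rule integral_reflect[of "%y. cis (- (y \<bullet> x)) * sg g y" 0])
  moreover have "sg g (- y) = sg g y" for y using g by (simp add: sg_def good_def indicator_def)
  ultimately have "fi (sg g) (- x) = fi (sg g) x" unfolding fourier_integral_def by simp
  moreover have "(%y. cnj (sg g y)) = sg g" by (simp add: sg_def fun_eq_iff)
  ultimately show ?thesis using fi_cnj[of "sg g" "- x"] by simp
 qed
 have eq: "cr (field g) = (%x. (1 / (2 * pi)\<^sup>2) *\<^sub>R fi (sg g) (- x))"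
 proof
  fix x
  have "Im (fi (sg g) (- x)) = 0" using cn[of "- x"] by (simp add: complex_eq_iff)
  then show "cr (field g) x = (1 / (2 * pi)\<^sup>2) *\<^sub>R fi (sg g) (- x)"
   unfolding field_def Kop_def ibc_apply[OF b(2)] by (simp add: complex_eq_iff)
 qed
 show "SI (cr (field g))" "Lr (field g) = IFT (cl (sg g))"
  unfolding eq using IFT_integrable[OF b] by auto
 then show "FT (Lr (field g)) = cl (sg g)" by simp
qed

lemma RE_field: "good g ==> RE (Lr (field g)) = Lr (field g)" by (simp add: Lr_field(1))

lemma mul_sg:
 assumes "continuous_on UNIV m" and g: "good g"
 shows "SI (%xi. m xi * sg g xi)" "mdom m (cl (sg g))" "mul m (cl (sg g)) = cl (%xi. m xi * sg g xi)"
proof -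
 note b = conjunct1[OF sg_basic[OF g]] conjunct2[OF sg_basic[OF g]]
 have [measurable]: "m \<in> borel_measurable borel" using assms(1) by (rule borel_measurable_continuous_onI)
 have "band_limited (sg g)" unfolding band_limited_def using b by (auto simp: sg_def indicator_def intro!: exI[of _ 2])
 then show S: "SI (%xi. m xi * sg g xi)" by (rule SI_band_limited_mult[OF b(1) _ assms(1)])
 show "mdom m (cl (sg g))" using mdom_cl[OF _ b(1)] S by simp
 show "mul m (cl (sg g)) = cl (%xi. m xi * sg g xi)" using mul_cl[OF _ b(1) S] by simp
qed

lemma continuous_wt: "continuous_on UNIV (%xi::real^2. (1 + (norm xi)\<^sup>2) powr r)"
 by (intro continuous_intros ballI) (rule one_plus_norm_ge(2)[THEN less_imp_neq, THEN not_sym])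

lemma good_wt: "good (%xi. (1 + (norm xi)\<^sup>2) powr (s / 2))" using continuous_wt by (simp add: good_def)

lemma cr_mult_sg: "(%xi. complex_of_real (h xi) * sg g xi) = sg (%xi. h xi * g xi)"
 by (simp add: sg_def fun_eq_iff)

lemma field_Hs:
 assumes g: "good g"
 shows "inHs s (Lr (field g))" "mul (wt s) (FT (Lr (field g))) = cl (sg (%xi. (1 + (norm xi)\<^sup>2) powr (s / 2) * g xi))"
 using mul_sg[OF _ g, of "wt s"] continuous_wt unfolding Lr_field(3)[OF g] cr_mult_sg[symmetric] wt_def[abs_def]
 by (auto intro!: continuous_intros)

lemma field_mop:
 assumes "good g" "good h" "!!xi. m xi = complex_of_real (h xi)"
 shows "mop m (Lr (field g)) = Lr (field (%xi. h xi * g xi))"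
proof -
 have m: "m = (%xi. complex_of_real (h xi))" using assms(3) by auto
 have c: "continuous_on UNIV m" unfolding m using assms(2) by (auto simp: good_def intro!: continuous_intros)
 show ?thesis
  unfolding mop_def Lr_field(3)[OF assms(1)] mul_sg(3)[OF c assms(1)] Lr_field(2)[OF good_mult[OF assms(2,1)]] unfolding m cr_mult_sg ..
qed

lemma bc_field: "good g ==> bc (Lr (field g)) = Kop g"
proof -
 assume g: "good g"
 note b = conjunct1[OF sg_basic[OF g]] conjunct2[OF sg_basic[OF g]]
 have "integrable lborel (rep (cl (sg g)))"
  by (rule integrable_cong_AE_imp[OF b(2)]) (use SI_measurable[OF SI_rep] rep_cl[OF b(1)] in \<open>auto elim: AE_mp\<close>)
 then show ?thesis
  unfolding bc_def Kop_def Lr_field(3)[OF g] using b(2) rep_cl[OF b(1)] by (rule ibc_cong_AE)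
qed

lemma field_Dk:
 assumes g: "good g" and m: "m >= 0" "!!xi. xi \<in> disc ==> \<bar>g xi\<bar> <= m"
 shows "r >= 0 ==> inHs r (Dk k (Lr (field g)))" "norm (bc (Dk k (Lr (field g)))) <= m * area"
proof -
 show "r >= 0 ==> inHs r (Dk k (Lr (field g)))" by (rule Hsn_Dk(1)[OF _ field_Hs(1)[OF g]])
 define p where "p xi = dsym k xi * sg g xi" for xi
 have cd: "continuous_on UNIV (dsym k)" unfolding dsym_def[abs_def] by (intro continuous_intros)
 note P = mul_sg[OF cd g, folded p_def]
 have le: "norm (p xi) <= norm (sg g xi)" for xi
 proof (cases "xi \<in> disc")
  case True
  then have "norm (dsym k xi) <= 1" using component_le_norm_cart[of xi k] by (simp add: dsym_def norm_mult)
  then show ?thesis by (simp add: p_def norm_mult mult_left_le_one_le)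
 qed (simp add: p_def sg_def)
 note n = norm_cl_sg[OF g m]
 have i: "integrable lborel p" by (rule Bochner_Integration.integrable_bound[OF n(3)]) (use P(1) SI_measurable le in auto)
 have "integrable lborel (rep (cl p))"
  by (rule integrable_cong_AE_imp[OF i]) (use SI_measurable[OF SI_rep] rep_cl[OF P(1)] in \<open>auto elim: AE_mp\<close>)
 then have "bc (Dk k (Lr (field g))) = ibc p"
  unfolding bc_def mop_def Lr_field(3)[OF g] P(3) FT_IFT using i rep_cl[OF P(1)] by (rule ibc_cong_AE)
 also have "norm (ibc p) <= (LBINT xi. norm (p xi)) / (2 * pi)\<^sup>2" by (rule norm_ibc_le[OF i])
 also have "\<dots> <= (LBINT xi. norm (p xi)) / 1"
 proof (rule divide_left_mono)
  show "1 <= (2 * pi)\<^sup>2" using pi_gt3 by (intro one_le_power) simp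
 qed (auto intro: integral_nonneg_AE)
 also have "\<dots> <= (LBINT xi. norm (sg g xi))" using integral_mono[OF integrable_norm[OF i] integrable_norm[OF n(3)] le] by simp
 also have "\<dots> <= m * area" by (rule n)
 finally show "norm (bc (Dk k (Lr (field g)))) <= m * area" .
qed

subsection \<open>Differentiation in time\<close>

lemma exp_remainder: "\<bar>h\<bar> <= 1/2 ==> \<bar>exp (- h) - 1 + h\<bar> <= 2 * h\<^sup>2" for h :: real
proof -
 assume h: "\<bar>h\<bar> <= 1/2"
 have "exp (- h) * exp h = 1" by (simp flip: exp_add)
 moreover have "exp (- h) * (1 + h) <= exp (- h) * exp h" by (intro mult_left_mono) (auto simp: exp_ge_add_one_self)
 ultimately have "exp (- h) * (1 + h) <= 1" by simp
 then have "exp (- h) <= 1 / (1 + h)" using h by (simp add: pos_le_divide_eq abs_le_iff)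
 also have "\<dots> <= 1 - h + 2 * h\<^sup>2"
 proof -
  have "0 <= h\<^sup>2 * (1 + 2 * h)" using h by (intro mult_nonneg_nonneg) (auto simp: abs_le_iff)
  then have "1 <= (1 - h + 2 * h\<^sup>2) * (1 + h)" by (simp add: algebra_simps power2_eq_square)
  then show ?thesis using h by (simp add: pos_divide_le_eq abs_le_iff)
 qed
 finally show ?thesis using exp_ge_add_one_self[of "- h"] by (auto simp: abs_le_iff)
qed

text \<open>A map that is bounded in terms of the maximum of the symbol inherits the time derivative of the
  exponential, by Taylor's formula on the disc.\<close>

lemma exponential_curve:
 fixes F :: "(real^2 => real) => 'b::real_normed_vector"
 assumes F: "!!g h. good g ==> good h ==> F (%xi. g xi - h xi) = F g - F h" "!!c g. good g ==> F (%xi. c * g xi) = c *\<^sub>R F g"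
  and bound: "!!g m. good g ==> m >= 0 ==> (!!xi. xi \<in> disc ==> \<bar>g xi\<bar> <= m) ==> norm (F g) <= m * C"
  and e: "good e" and h: "good h"
 shows "((%t. F (%xi. h xi * exp (- (e xi * t)))) has_vector_derivative F (%xi. (- e xi) * (h xi * exp (- (e xi * t))))) (at t)"
 unfolding has_vector_derivative_def
proof -
 obtain N where N: "N >= 0" "!!xi. xi \<in> disc ==> \<bar>h xi * exp (- (e xi * t))\<bar> <= N"
  using good_bounded[of "%xi. h xi * exp (- (e xi * t))"] good_mult[OF h good_exp[OF good_mult[OF e good_const[of "- t"]]]] by auto
 obtain L where L: "L >= 0" "!!xi. xi \<in> disc ==> \<bar>e xi\<bar> <= L" using good_bounded[OF e] by auto
 let ?g = "%t xi. h xi * exp (- (e xi * t))" and ?g' = "%xi. (- e xi) * (h xi * exp (- (e xi * t)))"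
 have g: "good (?g t)" for t using good_mult[OF h good_exp[OF good_mult[OF e good_const[of "- t"]]]] by simp
 have g': "good ?g'" using good_mult[OF good_mult[OF e good_const[of "-1"]] g[of t]] by simp
 show "((%t. F (?g t)) has_derivative (%r. r *\<^sub>R F ?g')) (at t)"
 proof (rule has_derivativeI_sandwich[where H="%r. (N * (2 * L\<^sup>2) * C) * \<bar>r - t\<bar>" and e="1 / (2 * (L + 1))"])
  show "1 / (2 * (L + 1)) > 0" using L by simp
  show "bounded_linear (%r. r *\<^sub>R F ?g')" by (rule bounded_linear_scaleR_left)
  show "((%r. N * (2 * L\<^sup>2) * C * \<bar>r - t\<bar>) \<longlongrightarrow> 0) (at t)" by (auto intro!: tendsto_eq_intros)
  fix r :: real assume r: "r ~= t" "dist r t < 1 / (2 * (L + 1))"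
  have eq: "F (?g r) - F (?g t) - (r - t) *\<^sub>R F ?g' = F (%xi. (?g r xi - ?g t xi) - (r - t) * ?g' xi)"
   unfolding F(1)[OF good_diff[OF g g] good_mult[OF good_const g']] F(1)[OF g g] F(2)[OF g'] ..
  have "norm (F (%xi. (?g r xi - ?g t xi) - (r - t) * ?g' xi)) <= (N * (2 * (L * \<bar>r - t\<bar>)\<^sup>2)) * C"
  proof (rule bound[OF good_diff[OF good_diff[OF g g] good_mult[OF good_const g']]])
   fix xi :: "real^2" assume xi: "xi \<in> disc"
   have le: "\<bar>e xi * (r - t)\<bar> <= L * \<bar>r - t\<bar>" unfolding abs_mult by (intro mult_right_mono L xi) simp
   also have "\<dots> <= (L + 1) * (1 / (2 * (L + 1)))" using r L by (intro mult_mono) (auto simp: dist_real_def)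
   also have "\<dots> = 1/2" using L by (simp add: field_simps)
   finally have "\<bar>e xi * (r - t)\<bar> <= 1/2" .
   note half = exp_remainder[OF this]
   have "\<bar>e xi * (r - t)\<bar>\<^sup>2 <= (L * \<bar>r - t\<bar>)\<^sup>2" by (rule power_mono[OF le abs_ge_zero])
   then have R: "\<bar>exp (- (e xi * (r - t))) - 1 + e xi * (r - t)\<bar> <= 2 * (L * \<bar>r - t\<bar>)\<^sup>2"
    using half unfolding power2_abs by linarith
   have "(?g r xi - ?g t xi) - (r - t) * ?g' xi = ?g t xi * (exp (- (e xi * (r - t))) - 1 + e xi * (r - t))"
    by (simp add: algebra_simps flip: exp_add)
   then show "\<bar>(?g r xi - ?g t xi) - (r - t) * ?g' xi\<bar> <= N * (2 * (L * \<bar>r - t\<bar>)\<^sup>2)"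
    using mult_mono[OF N(2)[OF xi] R N(1)] by (simp add: abs_mult)
  qed (use N in simp)
  then show "norm (F (?g r) - F (?g t) - (r - t) *\<^sub>R F ?g') / norm (r - t) <= N * (2 * L\<^sup>2) * C * \<bar>r - t\<bar>"
   unfolding eq using r by (simp add: divide_le_eq power2_eq_square mult_ac)
 qed
qed

lemma Kop_linear: "good g ==> good h ==> Kop (%xi. g xi - h xi) = Kop g - Kop h" "good g ==> Kop (%xi. c * g xi) = c *\<^sub>R Kop g"
proof -
 have "sg (%xi. g xi - h xi) = (%xi. sg g xi - sg h xi)" "sg (%xi. c * g xi) = (%xi. c *\<^sub>R sg g xi)" for g h c
  by (auto simp: sg_def fun_eq_iff algebra_simps scaleR_conv_of_real)
 then show "good g ==> good h ==> Kop (%xi. g xi - h xi) = Kop g - Kop h" "good g ==> Kop (%xi. c * g xi) = c *\<^sub>R Kop g"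
  unfolding Kop_def by (simp_all add: ibc_diff ibc_scaleR sg_basic)
qed

lemma cl_sg_linear: "good g ==> good h ==> cl (sg (%xi. g xi - h xi)) = cl (sg g) - cl (sg h)" "good g ==> cl (sg (%xi. c * g xi)) = c *\<^sub>R cl (sg g)"
proof -
 have "sg (%xi. g xi - h xi) = (%xi. sg g xi - sg h xi)" "sg (%xi. c * g xi) = (%xi. c *\<^sub>R sg g xi)" for g h c
  by (auto simp: sg_def fun_eq_iff algebra_simps scaleR_conv_of_real)
 then show "good g ==> good h ==> cl (sg (%xi. g xi - h xi)) = cl (sg g) - cl (sg h)" "good g ==> cl (sg (%xi. c * g xi)) = c *\<^sub>R cl (sg g)"
  by (simp_all add: cl_diff cl_scaleR sg_basic)
qed

lemma field_linear: "good g ==> good h ==> Lr (field (%xi. g xi - h xi)) = Lr (field g) - Lr (field h)" "good g ==> Lr (field (%xi. c * g xi)) = c *\<^sub>R Lr (field g)"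
 by (simp_all add: Lr_field(2) cl_sg_linear good_diff good_mult good_const linear_diff[OF bounded_linear.linear[OF bounded_linear_IFT]]
   linear_scale[OF bounded_linear.linear[OF bounded_linear_IFT]])

subsection \<open>Space-time integrals\<close>

lemma continuous_bcf_curve:
 fixes S :: "real => bcf"
 assumes "continuous_on UNIV S" shows "continuous_on UNIV (%z. apply_bcontfun (S (fst z)) (snd z))"
 unfolding continuous_on_eq_continuous_at[OF open_UNIV]
proof
 fix z :: "real \<times> (real^2)"
 have "continuous_on UNIV (%w::real \<times> (real^2). S (fst w))"
  by (rule continuous_on_compose2[OF assms]) (auto intro!: continuous_intros)
 then have c: "((%w. S (fst w)) \<longlongrightarrow> S (fst z)) (at z)" by (cases z) (auto simp: continuous_on_def)
 have A: "((%w. apply_bcontfun (S (fst w)) (snd w) - apply_bcontfun (S (fst z)) (snd w)) \<longlongrightarrow> 0) (at z)"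
 proof (rule Lim_null_comparison[OF always_eventually])
  show "\<forall>w. norm (apply_bcontfun (S (fst w)) (snd w) - apply_bcontfun (S (fst z)) (snd w)) <= dist (S (fst w)) (S (fst z))"
   using dist_bounded[of "S _" _ "S (fst z)"] by (auto simp: dist_norm)
  show "((%w. dist (S (fst w)) (S (fst z))) \<longlongrightarrow> 0) (at z)" using c by (rule tendsto_dist_iff[THEN iffD1])
 qed
 have "continuous_on UNIV (%w::real \<times> (real^2). apply_bcontfun (S (fst z)) (snd w))"
  by (rule continuous_on_compose2[OF continuous_on_apply_bcontfun[of UNIV]]) (auto intro!: continuous_intros)
 then have "((%w. apply_bcontfun (S (fst z)) (snd w)) \<longlongrightarrow> apply_bcontfun (S (fst z)) (snd z)) (at z)"
  by (cases z) (auto simp: continuous_on_def)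
 with A have "((%w. (apply_bcontfun (S (fst w)) (snd w) - apply_bcontfun (S (fst z)) (snd w)) + apply_bcontfun (S (fst z)) (snd w)) \<longlongrightarrow> 0 + apply_bcontfun (S (fst z)) (snd z)) (at z)"
  by (rule tendsto_add)
 then show "isCont (%z. apply_bcontfun (S (fst z)) (snd z)) z" by (simp add: isCont_def)
qed

lemma bounded_linear_apply_bcontfun: "bounded_linear (%B :: bcf. apply_bcontfun B x)"
 by (rule bounded_linear_intro[of _ 1]) (use norm_bounded[of "_ :: bcf" x] in auto)

lemma spacetime_zero: "test_fun spacetime \<phi> ==> t <= 0 ==> \<phi> (t, x) = 0"
 by (rule not_support) (auto simp: test_fun_def spacetime_def)

text \<open>A curve of bounded continuous functions is jointly continuous, so Fubini's theorem is available.\<close>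

locale bcf_curve =
 fixes S :: "real => bcf" and M :: real
 assumes S: "continuous_on UNIV S" and M: "!!t. t >= 0 ==> norm (S t) <= M"
begin

abbreviation v :: "real \<times> (real^2) => real" where "v z \<equiv> apply_bcontfun (S (fst z)) (snd z)"

lemma v_measurable [measurable]: "v \<in> borel_measurable borel"
 by (rule borel_measurable_continuous_onI[OF continuous_bcf_curve[OF S]])

lemma v_bound: "test_fun spacetime \<phi> ==> \<bar>v z * \<phi> z\<bar> <= M * \<bar>\<phi> z\<bar>"
proof (cases "fst z >= 0")
 case True
 have "\<bar>v z\<bar> <= M" using norm_bounded[of "S (fst z)" "snd z"] M[OF True] by simp
 then show ?thesis by (simp add: abs_mult mult_right_mono)
next
 case False
 assume "test_fun spacetime \<phi>"
 then have "\<phi> (fst z, snd z) = 0" using False by (intro spacetime_zero) auto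
 then show ?thesis by simp
qed

lemma integrable_v:
 assumes \<phi>: "test_fun spacetime \<phi>" shows "integrable lborel (%z. v z * \<phi> z)"
proof (rule Bochner_Integration.integrable_bound)
 show "integrable lborel (%z. M * \<bar>\<phi> z\<bar>)" using test_fun_integrable[OF \<phi>] by (intro integrable_mult_right integrable_abs)
 show "(%z. v z * \<phi> z) \<in> borel_measurable lborel" using smooth_measurable[OF test_fun_smooth[OF \<phi>]] by simp
qed (use v_bound[OF \<phi>] in \<open>auto intro!: AE_I2 order_trans[OF _ abs_ge_self]\<close>)

lemma distr_of_joint:
 assumes \<phi>: "test_fun spacetime \<phi>"
 shows "distr_of (%t. apply_bcontfun (S t)) \<phi> = (LBINT z. v z * \<phi> z)"
proof -
 have "integrable (lborel \<Otimes>\<^sub>M lborel) (%z. v z * \<phi> z)" using integrable_v[OF \<phi>] unfolding lborel_prod .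
 from lborel_pair.integral_fst'[OF this]
 have "(LBINT t. (LBINT x. apply_bcontfun (S t) x * \<phi> (t, x))) = (LBINT z. v z * \<phi> z)"
  unfolding lborel_prod by simp
 moreover have "(%t. indicator {0..} t *\<^sub>R (LBINT x. apply_bcontfun (S t) x * \<phi> (t, x))) = (%t. \<integral>x. apply_bcontfun (S t) x * \<phi> (t, x) \<partial>lborel)"
 proof
  fix t show "indicator {0..} t *\<^sub>R (LBINT x. apply_bcontfun (S t) x * \<phi> (t, x)) = (LBINT x. apply_bcontfun (S t) x * \<phi> (t, x))"
   using spacetime_zero[OF \<phi>, of t] by (cases "t >= 0") auto
 qed
 ultimately show ?thesis unfolding distr_of_def set_lebesgue_integral_def by simp
qed

lemma distribution_v: "distribution spacetime (distr_of (%t. apply_bcontfun (S t)))" (is "distribution _ ?P")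
 unfolding distribution_def
proof (intro conjI allI impI)
 fix \<phi> psi :: "real \<times> (real^2) => real" assume t: "test_fun spacetime \<phi>" "test_fun spacetime psi"
 have "support (%x. \<phi> x + psi x) \<subseteq> support \<phi> \<union> support psi"
  by (rule support_subset_closed) (auto simp: not_support, simp add: support_def closed_Un)
 then have "test_fun spacetime (%x. \<phi> x + psi x)"
  using t compact_Int_closed[OF compact_Un[of "support \<phi>" "support psi"], of "support (%x. \<phi> x + psi x)"]
  by (auto simp: test_fun_def smooth_add Int_absorb1 support_def)
 then show "?P (%x. \<phi> x + psi x) = ?P \<phi> + ?P psi"
  using integrable_v[OF t(1)] integrable_v[OF t(2)] by (simp add: distr_of_joint t distrib_left)
next
 fix c \<phi> assume "test_fun spacetime \<phi>"
 show "?P (%x. c * \<phi> x) = c * ?P \<phi>" unfolding distr_of_def set_lebesgue_integral_def by (simp add: mult.left_commute)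
next
 fix \<phi> psi assume conv: "test_converges spacetime \<phi> psi"
 then have t: "test_fun spacetime (\<phi> n)" "test_fun spacetime psi" for n by (auto simp: test_converges_def)
 obtain K where K: "compact K" "!!n. support (\<phi> n) \<subseteq> K" using conv by (auto simp: test_converges_def)
 have "uniform_limit UNIV (%n. iter_pderiv [] (\<phi> n)) (iter_pderiv [] psi) sequentially"
  using conv unfolding test_converges_def by blast
 then have u: "!!e. e > 0 ==> \<forall>\<^sub>F n in sequentially. \<forall>z. \<bar>\<phi> n z - psi z\<bar> < e" by (simp add: uniform_limit_iff dist_real_def)
 define A where "A = K \<union> support psi"
 have A: "compact A" using K t(2) by (auto simp: A_def test_fun_def)
 then have iA: "integrable lborel (indicator A :: _ => real)" by (intro integrable_indicator_bounded compact_imp_bounded borel_compact)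
 define m where "m = (\<integral>z. indicator A z \<partial>(lborel :: (real \<times> (real^2)) measure)) * \<bar>M\<bar> + 1"
 have m: "m > 0" unfolding m_def by (intro add_nonneg_pos mult_nonneg_nonneg integral_nonneg_AE) auto
 show "(%n. ?P (\<phi> n)) \<longlonglongrightarrow> ?P psi"
 proof (rule tendstoI)
  fix e :: real assume e: "e > 0"
  have "\<forall>\<^sub>F n in sequentially. \<forall>z. \<bar>\<phi> n z - psi z\<bar> < e / m" by (rule u) (use e m in simp)
  then show "\<forall>\<^sub>F n in sequentially. dist (?P (\<phi> n)) (?P psi) < e"
  proof eventually_elim
   case (elim n)
   have "?P (\<phi> n) - ?P psi = (LBINT z. v z * \<phi> n z - v z * psi z)"
    using integrable_v[OF t(1)] integrable_v[OF t(2)] by (simp add: distr_of_joint t)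
   also have "\<bar>\<dots>\<bar> <= (LBINT z. \<bar>M\<bar> * (e / m) * indicator A z)"
   proof (rule order_trans[OF integral_abs_bound integral_mono])
    show "integrable lborel (%z. \<bar>v z * \<phi> n z - v z * psi z\<bar>)"
     by (intro integrable_abs Bochner_Integration.integrable_diff integrable_v t)
    show "integrable lborel (%z. \<bar>M\<bar> * (e / m) * indicator A z)" by (intro integrable_mult_right iA)
    fix z
    show "\<bar>v z * \<phi> n z - v z * psi z\<bar> <= \<bar>M\<bar> * (e / m) * indicator A z"
    proof (cases "z \<in> A \<and> fst z > 0")
     case True
     have "\<bar>v z\<bar> <= \<bar>M\<bar>" using norm_bounded[of "S (fst z)" "snd z"] M[of "fst z"] True by simp
     then have "\<bar>v z\<bar> * \<bar>\<phi> n z - psi z\<bar> <= \<bar>M\<bar> * (e / m)" using elim[rule_format, of z] by (intro mult_mono) auto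
     then show ?thesis using True by (simp add: abs_mult flip: right_diff_distrib)
    next
     case False
     have "\<phi> n z = 0 \<and> psi z = 0"
     proof (cases "z \<in> A")
      case True
      then have "fst z <= 0" using False by simp
      then show ?thesis using spacetime_zero[OF t(1)] spacetime_zero[OF t(2)] by (metis prod.collapse)
     qed (use K(2) not_support in \<open>auto simp: A_def\<close>)
     then show ?thesis using e m by simp
    qed
   qed
   also have "\<dots> = (m - 1) * (e / m)" by (simp add: m_def)
   also have "\<dots> < e" using e m by (simp add: field_simps)
   finally show ?case by (simp add: dist_real_def)
  qed
 qed
qed

text \<open>Integration by parts in time, carried out separately at each point of space.\<close>

lemma distr_dt_curve:
 assumes S': "continuous_on UNIV S'" "!!t. t >= 0 ==> norm (S' t) <= M'" "!!t. (S has_vector_derivative S' t) (at t)"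
  and \<phi>: "test_fun spacetime \<phi>"
 shows "distr_dt (distr_of (%t. apply_bcontfun (S t))) \<phi> = distr_of (%t. apply_bcontfun (S' t)) \<phi>"
proof -
 interpret S': bcf_curve S' M' by unfold_locales (use S' in auto)
 have B: "(1, 0) \<in> (Basis :: (real \<times> (real^2)) set)" by (simp add: Basis_prod_def)
 let ?d = "pderiv_dir (1, 0) \<phi>"
 have d: "test_fun spacetime ?d" by (rule test_fun_pderiv[OF \<phi> B])
 obtain R where R: "R > 0" "!!z. norm z >= R ==> \<phi> z = 0" by (rule test_fun_bounded_support[OF \<phi>]) blast
 obtain R' where R': "R' > 0" "!!z. norm z >= R' ==> ?d z = 0" by (rule test_fun_bounded_support[OF d]) blast
 define r where "r = max R R'"
 let ?f = "%z. v z * ?d z + S'.v z * \<phi> z"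
 have i: "integrable lborel ?f" by (intro Bochner_Integration.integrable_add integrable_v S'.integrable_v \<phi> d)
 have zero: "(LBINT t. ?f (t, x)) = 0" for x
 proof -
  have D: "((%t. v (t, x) * \<phi> (t, x)) has_real_derivative ?f (t, x)) (at t)" for t
  proof -
   have a: "((%t. apply_bcontfun (S t) x) has_real_derivative apply_bcontfun (S' t) x) (at t)"
    using bounded_linear.has_vector_derivative[OF bounded_linear_apply_bcontfun S'(3)[of t], of x]
    unfolding has_real_derivative_iff_has_vector_derivative .
   have b: "((%t. \<phi> ((0, x) + t *\<^sub>R (1, 0))) has_real_derivative ?d ((0, x) + t *\<^sub>R (1, 0))) (at t)"
    by (rule line_derivative[OF test_fun_smooth[OF \<phi>]])
   show ?thesis using DERIV_mult[OF a, of "%t. \<phi> (t, x)" "?d (t, x)"] b by (simp add: mult.commute add.commute)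
  qed
  have out: "?f (t, x) = 0" if "t \<notin> {-r..r}" for t
  proof -
   have "r <= norm (t, x)" using that norm_fst_le[of t x] by auto
   then show ?thesis using R(2)[of "(t, x)"] R'(2)[of "(t, x)"] by (simp add: r_def)
  qed
  have c: "isCont (%t. ?f (t, x)) t" for t
  proof -
   have "continuous_on UNIV ?f"
    by (intro continuous_intros continuous_bcf_curve S S' smooth_continuous test_fun_smooth[OF \<phi>] test_fun_smooth[OF d])
   then have "continuous_on UNIV (%t. ?f (t, x))"
    by (rule continuous_on_compose2) (auto intro!: continuous_intros)
   then show ?thesis by (simp add: continuous_on_eq_continuous_at)
  qed
  have "r <= norm (r, x)" "r <= norm (- r, x)" "r > 0" using norm_fst_le[of r x] norm_fst_le[of "- r" x] R(1) by (auto simp: r_def)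
  then have "\<phi> (r, x) = 0" "\<phi> (- r, x) = 0" using R(2)[of "(r, x)"] R(2)[of "(- r, x)"] by (auto simp: r_def)
  moreover have "(LBINT t. ?f (t, x) * indicator {- r..r} t) = v (r, x) * \<phi> (r, x) - v (- r, x) * \<phi> (- r, x)"
   by (rule integral_FTC_Icc_real[OF _ D c]) (use \<open>r > 0\<close> in simp)
  moreover have "(%t. ?f (t, x) * indicator {- r..r} t) = (%t. ?f (t, x))"
  proof
   fix t show "?f (t, x) * indicator {- r..r} t = ?f (t, x)" using out[of t] by (cases "t \<in> {- r..r}") auto
  qed
  ultimately show ?thesis by simp
 qed
 have "integrable (lborel \<Otimes>\<^sub>M lborel) (%(t, x). ?f (t, x))" using i unfolding lborel_prod by (simp add: case_prod_unfold)
 from lborel_pair.integral_snd[OF this] have "(LBINT z. ?f z) = 0" using zero by (simp add: lborel_prod case_prod_unfold)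
 moreover have "(LBINT z. ?f z) = distr_of (%t. apply_bcontfun (S t)) ?d + distr_of (%t. apply_bcontfun (S' t)) \<phi>"
  unfolding distr_of_joint[OF d] S'.distr_of_joint[OF \<phi>]
  by (rule Bochner_Integration.integral_add[OF integrable_v[OF d] S'.integrable_v[OF \<phi>]])
 ultimately show ?thesis unfolding distr_deriv_def by simp
qed

end

lemma distr_of_cong_AE:
 assumes "!!t. t >= 0 ==> AE x in lborel. f t x = g t x"
  and "!!t. t >= 0 ==> f t \<in> borel_measurable borel" "!!t. t >= 0 ==> g t \<in> borel_measurable borel"
  and \<phi>: "test_fun spacetime \<phi>"
 shows "distr_of f \<phi> = distr_of g \<phi>"
 unfolding distr_of_def
proof (rule set_lebesgue_integral_cong, simp, intro allI impI)
 fix t :: real assume "t \<in> {0..}"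
 then have t: "t >= 0" by simp
 have [measurable]: "\<phi> \<in> borel_measurable borel" by (rule smooth_measurable[OF test_fun_smooth[OF \<phi>]])
 have [measurable]: "f t \<in> borel_measurable borel" "g t \<in> borel_measurable borel" using assms t by auto
 have m: "(%x. \<phi> (t, x)) \<in> borel_measurable borel"
  by (rule borel_measurable_continuous_onI, rule continuous_on_compose2[OF smooth_continuous[OF test_fun_smooth[OF \<phi>]]]) (auto intro!: continuous_intros)
 show "(LBINT x. f t x * \<phi> (t, x)) = (LBINT x. g t x * \<phi> (t, x))"
  by (rule integral_cong_AE) (use assms(1)[OF t] m in \<open>auto elim: eventually_mono\<close>)
qed

lemma Kop_curve:
 assumes "good e" "good h"
 shows "((%t. Kop (%xi. h xi * exp (- (e xi * t)))) has_vector_derivative Kop (%xi. (- e xi) * (h xi * exp (- (e xi * t))))) (at t)"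
proof (rule exponential_curve[where F=Kop and C=area])
 show "Kop (%xi. g xi - h xi) = Kop g - Kop h" if "good g" "good h" for g h by (rule Kop_linear(1)[OF that])
 show "Kop (%xi. c * g xi) = c *\<^sub>R Kop g" if "good g" for c g by (rule Kop_linear(2)[OF that])
 show "norm (Kop g) <= m * area" if "good g" "m >= 0" "!!xi. xi \<in> disc ==> \<bar>g xi\<bar> <= m" for g m by (rule norm_Kop[OF that])
qed (rule assms)+

lemma cl_sg_curve:
 assumes "good e" "good h"
 shows "((%t. cl (sg (%xi. h xi * exp (- (e xi * t))))) has_vector_derivative cl (sg (%xi. (- e xi) * (h xi * exp (- (e xi * t)))))) (at t)"
proof (rule exponential_curve[where F="%g. cl (sg g)" and C="sqrt area"])
 show "cl (sg (%xi. g xi - h xi)) = cl (sg g) - cl (sg h)" if "good g" "good h" for g h by (rule cl_sg_linear(1)[OF that])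
 show "cl (sg (%xi. c * g xi)) = c *\<^sub>R cl (sg g)" if "good g" for c g by (rule cl_sg_linear(2)[OF that])
 show "norm (cl (sg g)) <= m * sqrt area" if "good g" "m >= 0" "!!xi. xi \<in> disc ==> \<bar>g xi\<bar> <= m" for g m by (rule norm_cl_sg(2)[OF that])
qed (rule assms)+

subsection \<open>The explicit solution solves the system\<close>

lemma weak_deriv_zero:
 assumes "cutoff \<theta>"
 shows "SI (cr (weak_deriv k (%x. 0)))" "AE x in lborel. weak_deriv k (%x. 0) x = 0"
proof -
 interpret cutoff \<theta> by fact
 have 0: "SI (cr (%x::real^2. 0))" "Lr (%x. 0) = 0" using SI_zero cl_zero by simp_all
 note w = weak_deriv_isD[OF 0(1), unfolded 0(2), OF isD_zero, of k]
 show "SI (cr (weak_deriv k (%x. 0)))" by (rule w)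
 have "AE x in lborel. cr (weak_deriv k (%x. 0)) x = cr (%x. 0) x"
  using cl_eq_iff[OF w(1) 0(1)] unfolding w(2) 0(2) by simp
 then show "AE x in lborel. weak_deriv k (%x. 0) x = 0" by simp
qed

lemma distr_of_zero: "distr_of (%t x. 0) \<phi> = 0"
 by (simp add: distr_of_def)

locale explicit = cutoff +
 fixes \<beta> b s a \<epsilon> :: real
 assumes \<beta>: "1/2 < \<beta>" "\<beta> < 1" and s: "s > 1 + \<beta>" and a: "0 <= a" "a <= 1" and \<epsilon>: "\<epsilon> > 0"
begin

definition rate :: "real^2 => real" where "rate xi = a + norm xi powr (2 * \<beta>)"

definition amp :: "real => real^2 => real" where "amp t xi = \<epsilon> * exp (- (rate xi * t))"

definition \<sigma> :: "real => real^2 => real" where "\<sigma> t = field (amp t)"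

definition iso :: "real => real^2 => real^2^2" where "iso t x = (\<chi> i j. if i = j then \<sigma> t x else 0)"

lemma good_rate: "good rate"
 unfolding rate_def[abs_def] by (rule good_add[OF good_const good_powr]) (use \<beta> in simp)

lemma good_amp: "good (amp t)"
 unfolding amp_def[abs_def] using good_mult[OF good_const good_exp[OF good_mult[OF good_rate good_const[of "- t"]]]] by simp

lemma good_neg_rate_amp: "good (%xi. - rate xi * amp t xi)"
 using good_mult[OF good_mult[OF good_const[of "-1"] good_rate] good_amp] by simp

lemma rate_bounds: "0 <= rate xi" "xi \<in> disc ==> rate xi <= 2"
proof -
 show "0 <= rate xi" using a by (simp add: rate_def)
 assume "xi \<in> disc"
 then have "norm xi powr (2 * \<beta>) <= 1" using \<beta> powr_mono2[of "2 * \<beta>" "norm xi" 1] by simp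
 then show "rate xi <= 2" using a by (simp add: rate_def)
qed

lemma amp_bound: "t >= 0 ==> \<bar>amp t xi\<bar> <= \<epsilon>"
 using \<epsilon> rate_bounds(1)[of xi] by (simp add: amp_def abs_mult mult_left_le)

lemma rate_amp_bound: "t >= 0 ==> xi \<in> disc ==> \<bar>- rate xi * amp t xi\<bar> <= 2 * \<epsilon>"
 using mult_mono[OF rate_bounds(2) amp_bound, of xi t xi] rate_bounds(1)[of xi] by (simp add: abs_mult)

lemma Kop_amp_derivative: "((%t. Kop (amp t)) has_vector_derivative Kop (%xi. - rate xi * amp t xi)) (at t)"
 unfolding amp_def by (rule Kop_curve[OF good_rate good_const])

lemma continuous_rate_amp: "continuous_on UNIV (%t. Kop (%xi. - rate xi * amp t xi))"
proof -
 have "((%t. Kop (%xi. - rate xi * \<epsilon> * exp (- (rate xi * t)))) has_vector_derivative Kop (%xi. - rate xi * (- rate xi * \<epsilon> * exp (- (rate xi * t))))) (at t)" for t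
  by (rule Kop_curve[OF good_rate]) (use good_mult[OF good_mult[OF good_const[of "-1"] good_rate] good_const[of \<epsilon>]] in simp)
 then have "continuous_on UNIV (%t. Kop (%xi. - rate xi * \<epsilon> * exp (- (rate xi * t))))"
  by (intro continuous_at_imp_continuous_on ballI) (blast dest: has_vector_derivative_continuous)
 then show ?thesis by (simp add: amp_def mult.assoc)
qed

sublocale bcf_curve "%t. Kop (amp t)" "\<epsilon> * area"
proof
 show "continuous_on UNIV (%t. Kop (amp t))"
  using Kop_amp_derivative by (intro continuous_at_imp_continuous_on ballI) (blast dest: has_vector_derivative_continuous)
 show "norm (Kop (amp t)) <= \<epsilon> * area" if "t >= 0" for t by (rule norm_Kop[OF good_amp]) (use \<epsilon> amp_bound[OF that] in auto)
qed

lemma \<sigma>_Hs: "SI (cr (\<sigma> t))" "inHs r (Lr (\<sigma> t))" "in_Hs r (\<sigma> t)"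
 using Lr_field(1)[OF good_amp] field_Hs(1)[OF good_amp] by (auto simp: \<sigma>_def in_Hs_iff)

lemma continuous_\<sigma>: "((%r. Hsn s (Lr (\<sigma> r) - Lr (\<sigma> t))) \<longlongrightarrow> 0) (at t)"
proof -
 let ?w = "%xi::real^2. (1 + (norm xi)\<^sup>2) powr (s / 2)"
 have "((%t. cl (sg (%xi. (?w xi * \<epsilon>) * exp (- (rate xi * t))))) has_vector_derivative cl (sg (%xi. - rate xi * ((?w xi * \<epsilon>) * exp (- (rate xi * t)))))) (at t)"
  by (rule cl_sg_curve[OF good_rate good_mult[OF good_wt good_const]])
 from has_vector_derivative_continuous[OF this] have "((%t. mul (wt s) (FT (Lr (\<sigma> t)))) \<longlongrightarrow> mul (wt s) (FT (Lr (\<sigma> t)))) (at t)"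
  unfolding \<sigma>_def field_Hs(2)[OF good_amp] by (simp add: amp_def isCont_def mult.assoc)
 from tendsto_norm_zero[OF LIM_zero[OF this]] show ?thesis
  by (simp add: Hsn_diff[OF \<sigma>_Hs(2) \<sigma>_Hs(2)])
qed

lemma zero_Hs: "in_Hs s (%x. 0)" "Hs_norm s (%x. 0) = 0"
proof -
 have 0: "SI (cr (%x::real^2. 0))" "Lr (%x. 0) = 0" using SI_zero cl_zero by simp_all
 show z: "in_Hs s (%x. 0)" unfolding in_Hs_iff 0(2) using 0(1) by (simp add: mul_zero)
 show "Hs_norm s (%x. 0) = 0" unfolding Hs_norm_eq[OF z] 0(2) by (simp add: Hsn_def mul_zero)
qed

lemma iso_entry: "(%x. iso t x $ i $ j) = (if i = j then \<sigma> t else (%x. 0))"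
 by (auto simp: iso_def)

lemma iso_in_Hs: "pair_in_Hs s (%x. 0) (iso t)"
 unfolding pair_in_Hs_def iso_entry using \<sigma>_Hs(3) zero_Hs(1) by simp

lemma pair_norm_diagonal: "pair_Hs_norm s (%x. 0) (%x. \<chi> i j. if i = j then f x else 0) = sqrt 2 * \<bar>Hs_norm s f\<bar>"
proof -
 have e: "(%x. (\<chi> i j. if i = j then f x else 0) $ i $ j) = (if i = j then f else (%x. 0))" for i j :: 2
  by auto
 show ?thesis unfolding pair_Hs_norm_def e by (simp add: UNIV_two zero_Hs(2) real_sqrt_mult flip: mult_2)
qed

lemma iso_continuous: "continuous_in_Hs s (%t x. 0) iso"
 unfolding continuous_in_Hs_def
proof (intro allI impI conjI)
 fix t :: real
 show "pair_in_Hs s (%x. 0) (iso t)" by (rule iso_in_Hs)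
 have "pair_Hs_norm s (%x. 0 - 0) (%x. iso r x - iso t x) = sqrt 2 * (Hsn s (Lr (\<sigma> r) - Lr (\<sigma> t)) / (2 * pi))" for r
 proof -
  have e: "(%x. iso r x - iso t x) = (%x. \<chi> i j. if i = j then \<sigma> r x - \<sigma> t x else 0)"
   by (auto simp: iso_def vec_eq_iff fun_eq_iff)
  note d = Lr_diff[OF \<sigma>_Hs(1)[of r] \<sigma>_Hs(1)[of t]]
  have "in_Hs s (%x. \<sigma> r x - \<sigma> t x)" unfolding in_Hs_iff using d inHs_diff[OF \<sigma>_Hs(2) \<sigma>_Hs(2)] by simp
  then show ?thesis unfolding e diff_zero pair_norm_diagonal using d by (simp add: Hs_norm_eq Hsn_def)
 qed
 moreover have "((%r. sqrt 2 * (Hsn s (Lr (\<sigma> r) - Lr (\<sigma> t)) / (2 * pi))) \<longlongrightarrow> sqrt 2 * (0 / (2 * pi))) (at t within {0..})"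
  by (intro tendsto_intros tendsto_within_subset[OF continuous_\<sigma>]) auto
 ultimately show "((%r. pair_Hs_norm s (%x. 0 - 0) (%x. iso r x - iso t x)) \<longlongrightarrow> 0) (at t within {0..})" by simp
qed

lemma frac_\<sigma>: "AE x in lborel. frac_laplacian \<beta> (\<sigma> t) x = field (%xi. norm xi powr (2 * \<beta>) * amp t xi) x"
 and frac_\<sigma>_measurable: "frac_laplacian \<beta> (\<sigma> t) \<in> borel_measurable borel"
proof -
 have gp: "good (%xi. norm xi powr (2 * \<beta>))" by (rule good_powr) (use \<beta> in simp)
 note g = good_mult[OF gp good_amp[of t]]
 have d: "mdom (fsym \<beta>) (FT (Lr (\<sigma> t)))" by (rule mop_Hs(1)[OF fsym_measurable fsym_le_wt \<sigma>_Hs(2)[of s]]) (use \<beta> s in auto)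
 note f = frac_laplacian_mop[OF \<sigma>_Hs(1) d]
 have "Lr (frac_laplacian \<beta> (\<sigma> t)) = Lr (field (%xi. norm xi powr (2 * \<beta>) * amp t xi))"
  unfolding f(2) unfolding \<sigma>_def field_mop[OF good_amp gp fsym_def] RE_field[OF g] ..
 then have "AE x in lborel. cr (frac_laplacian \<beta> (\<sigma> t)) x = cr (field (%xi. norm xi powr (2 * \<beta>) * amp t xi)) x"
  using cl_eq_iff[OF f(1) Lr_field(1)[OF g]] by simp
 then show "AE x in lborel. frac_laplacian \<beta> (\<sigma> t) x = field (%xi. norm xi powr (2 * \<beta>) * amp t xi) x" by simp
 show "frac_laplacian \<beta> (\<sigma> t) \<in> borel_measurable borel"
  using f(1) by (auto simp flip: square_integrable_real simp: square_integrable_def)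
qed

text \<open>The symbol solves an ordinary differential equation at each frequency.\<close>

lemma scalar_equation:
 assumes \<phi>: "test_fun spacetime \<phi>"
 shows "distr_dt (distr_of \<sigma>) \<phi> + a * distr_of \<sigma> \<phi> + distr_of (%t. frac_laplacian \<beta> (\<sigma> t)) \<phi> = 0"
proof -
 let ?g = "%t xi. norm xi powr (2 * \<beta>) * amp t xi"
 have gp: "good (%xi. norm xi powr (2 * \<beta>))" by (rule good_powr) (use \<beta> in simp)
 note gg = good_mult[OF gp good_amp]
 have K: "Kop (?g t) = - Kop (%xi. - rate xi * amp t xi) - a *\<^sub>R Kop (amp t)" for t
 proof -
  have "Kop (?g t) = Kop (%xi. (-1) * (- rate xi * amp t xi) - a * amp t xi)" by (simp add: rate_def algebra_simps)
  also have "\<dots> = (-1) *\<^sub>R Kop (%xi. - rate xi * amp t xi) - a *\<^sub>R Kop (amp t)"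
   by (subst Kop_linear(1)[OF good_mult[OF good_const good_neg_rate_amp] good_mult[OF good_const good_amp]])
     (simp only: Kop_linear(2)[OF good_neg_rate_amp] Kop_linear(2)[OF good_amp])
  finally show ?thesis by simp
 qed
 interpret R: bcf_curve "%t. Kop (%xi. - rate xi * amp t xi)" "2 * \<epsilon> * area"
 proof
  show "norm (Kop (%xi. - rate xi * amp t xi)) <= 2 * \<epsilon> * area" if "t >= 0" for t
   by (rule norm_Kop[OF good_neg_rate_amp]) (use \<epsilon> rate_amp_bound[OF that] in auto)
 qed (rule continuous_rate_amp)
 interpret W: bcf_curve "%t. Kop (?g t)" "\<epsilon> * area"
 proof
  show "continuous_on UNIV (%t. Kop (?g t))" unfolding K by (intro continuous_intros S continuous_rate_amp)
  show "norm (Kop (?g t)) <= \<epsilon> * area" if "t >= 0" for t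
  proof (rule norm_Kop[OF gg])
   show "\<bar>?g t xi\<bar> <= \<epsilon>" if xi: "xi \<in> disc" for xi
   proof -
    have "norm xi powr (2 * \<beta>) <= 1" using \<beta> xi powr_mono2[of "2 * \<beta>" "norm xi" 1] by simp
    then show ?thesis using mult_mono[OF _ amp_bound[OF \<open>t >= 0\<close>, of xi], of "norm xi powr (2 * \<beta>)" 1] by (simp add: abs_mult)
   qed
  qed (use \<epsilon> in simp)
 qed
 have dt: "distr_dt (distr_of \<sigma>) \<phi> = distr_of (%t. apply_bcontfun (Kop (%xi. - rate xi * amp t xi))) \<phi>"
  unfolding \<sigma>_def field_def by (rule distr_dt_curve[OF R.S R.M Kop_amp_derivative \<phi>])
 have fr: "distr_of (%t. frac_laplacian \<beta> (\<sigma> t)) \<phi> = distr_of (%t. apply_bcontfun (Kop (?g t))) \<phi>"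
  by (rule distr_of_cong_AE[OF _ frac_\<sigma>_measurable _ \<phi>]) (use frac_\<sigma> in \<open>simp_all add: field_def\<close>)
 have "W.v z * \<phi> z = - (R.v z * \<phi> z) - a * (v z * \<phi> z)" for z
  unfolding K by (simp add: algebra_simps)
 then have "(LBINT z. W.v z * \<phi> z) = - (LBINT z. R.v z * \<phi> z) - a * (LBINT z. v z * \<phi> z)"
  using integrable_v[OF \<phi>] R.integrable_v[OF \<phi>] by simp
 moreover have "\<sigma> = (%t. apply_bcontfun (Kop (amp t)))" by (simp add: \<sigma>_def field_def fun_eq_iff)
 then have "distr_of \<sigma> \<phi> = (LBINT z. v z * \<phi> z)" using distr_of_joint[OF \<phi>] by simp
 ultimately show ?thesis
  unfolding dt fr R.distr_of_joint[OF \<phi>] W.distr_of_joint[OF \<phi>] by simp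
qed

lemma zero_terms:
 assumes \<phi>: "test_fun spacetime \<phi>"
 shows "distr_of (%t x. Q_term b (grad (%x. 0) x) (iso t x) $ i $ j) \<phi> = 0"
  "distr_of (%t x. sym_part (grad (%x. 0) x) $ i $ j) \<phi> = 0"
  "distr_of (%t. frac_laplacian \<beta> (%x. 0)) \<phi> = 0"
proof -
 have g: "(%x. grad (%x. 0) x $ i $ j) = weak_deriv j (%x. 0)" for i j by (simp add: grad_def)
 note w = weak_deriv_zero[OF cutoff_axioms]
 have [measurable]: "weak_deriv j (%x. 0) \<in> borel_measurable borel" for j
  using w(1) by (auto simp flip: square_integrable_real simp: square_integrable_def)
 have gm [measurable]: "(%x. grad (%x. 0) x $ i $ j) \<in> borel_measurable borel" for i j unfolding g by measurable
 have im [measurable]: "(%x. iso t x $ i $ j) \<in> borel_measurable borel" for t i j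
  unfolding iso_entry using \<sigma>_Hs(1)[of t] by (auto simp flip: square_integrable_real simp: square_integrable_def)
 have ae: "AE x in lborel. grad (%x. 0) x = 0"
 proof -
  have "AE x in lborel. \<forall>j. weak_deriv j (%x. 0) x = 0" using w(2) by (simp add: AE_all_countable)
  then show ?thesis by eventually_elim (simp add: grad_def vec_eq_iff)
 qed
 have "distr_of (%t x. Q_term b (grad (%x. 0) x) (iso t x) $ i $ j) \<phi> = distr_of (%t x. 0) \<phi>"
 proof (rule distr_of_cong_AE[OF _ _ _ \<phi>])
  show "AE x in lborel. Q_term b (grad (%x. 0) x) (iso t x) $ i $ j = 0" for t
   using ae by eventually_elim (simp add: Q_term_def skew_part_def sym_part_def transpose_def matrix_matrix_mult_def vec_eq_iff)
  show "(%x. Q_term b (grad (%x. 0) x) (iso t x) $ i $ j) \<in> borel_measurable borel" for t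
   unfolding Q_term_def skew_part_def sym_part_def transpose_def matrix_matrix_mult_def by (simp add: UNIV_two)
 qed simp
 then show "distr_of (%t x. Q_term b (grad (%x. 0) x) (iso t x) $ i $ j) \<phi> = 0" by (simp add: distr_of_zero)
 have "distr_of (%t x. sym_part (grad (%x. 0) x) $ i $ j) \<phi> = distr_of (%t x. 0) \<phi>"
 proof (rule distr_of_cong_AE[OF _ _ _ \<phi>])
  show "AE x in lborel. sym_part (grad (%x. 0) x) $ i $ j = 0"
   using ae by eventually_elim (simp add: sym_part_def transpose_def)
  show "(%x. sym_part (grad (%x. 0) x) $ i $ j) \<in> borel_measurable borel"
   unfolding sym_part_def transpose_def by simp
 qed simp
 then show "distr_of (%t x. sym_part (grad (%x. 0) x) $ i $ j) \<phi> = 0" by (simp add: distr_of_zero)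
 have 0: "SI (cr (%x::real^2. 0))" "Lr (%x. 0) = 0" using SI_zero cl_zero by simp_all
 note f = frac_laplacian_mop[OF 0(1), unfolded 0(2), of \<beta>]
 have f1: "SI (cr (frac_laplacian \<beta> (%x. 0)))" and f2: "Lr (frac_laplacian \<beta> (%x. 0)) = Lr (%x. 0)"
  using f linear_0[OF bounded_linear.linear[OF bounded_linear_RE]] unfolding 0(2) by (simp_all add: mul_zero mop_def)
 have "AE x in lborel. cr (frac_laplacian \<beta> (%x. 0)) x = cr (%x. 0) x" using cl_eq_iff[OF f1 0(1)] f2 by simp
 moreover have "frac_laplacian \<beta> (%x. 0) \<in> borel_measurable borel"
  using f1 by (auto simp flip: square_integrable_real simp: square_integrable_def)
 ultimately have "distr_of (%t. frac_laplacian \<beta> (%x. 0)) \<phi> = distr_of (%t x. 0) \<phi>"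
  by (intro distr_of_cong_AE[OF _ _ _ \<phi>]) auto
 then show "distr_of (%t. frac_laplacian \<beta> (%x. 0)) \<phi> = 0" by (simp add: distr_of_zero)
qed

theorem explicit_solution: "strong_solution b \<beta> s a (%x. 0) (iso 0) (%t x. 0) iso"
 unfolding strong_solution_def
proof (intro conjI allI impI)
 show "continuous_in_Hs s (%t x. 0) iso" by (rule iso_continuous)
 show "symmetric_tensor (iso t)" for t by (auto simp: symmetric_tensor_def iso_def transpose_def vec_eq_iff)
 have tr: "transport (%x. 0) f = (%x. 0)" for f by (simp add: transport_def fun_eq_iff)
 have d0: "distr_deriv w (distr_of (%t x. 0)) \<phi> = 0" for w \<phi> by (simp add: distr_deriv_def distr_of_zero)
 have entry: "(%t x. iso t x $ i $ j) = (if i = j then \<sigma> else (%t x. 0))" for i j by (auto simp: iso_def fun_eq_iff)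
 show "\<exists>P. distribution spacetime P \<and> momentum_equation (%t x. 0) iso P"
 proof (intro exI conjI)
  show "distribution spacetime (distr_of \<sigma>)" unfolding \<sigma>_def field_def by (rule distribution_v)
  show "momentum_equation (%t x. 0) iso (distr_of \<sigma>)"
   unfolding momentum_equation_def entry
  proof (intro allI impI)
   fix \<phi> j
   show "distr_dt (distr_of (%t x. (0::real^2) $ j)) \<phi> + distr_of (%t. transport (%x. 0) (%x. (0::real^2) $ j)) \<phi> + distr_dx j (distr_of \<sigma>) \<phi> =
    (\<Sum>k\<in>UNIV. distr_dx k (distr_of (if j = k then \<sigma> else (%t x. 0))) \<phi>)"
    using exhaust_2[of j] by (auto simp: tr d0 distr_of_zero UNIV_two)
  qed
 qed
 show "incompressible (%t x. 0)" by (simp add: incompressible_def d0)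
 show "stress_equation b \<beta> a (%t x. 0) iso"
  unfolding stress_equation_def
 proof (intro allI impI)
  fix \<phi> i j assume \<phi>: "test_fun spacetime \<phi>"
  have "distr_dt (distr_of (%t x. iso t x $ i $ j)) \<phi> + a * distr_of (%t x. iso t x $ i $ j) \<phi> + distr_of (%t. frac_laplacian \<beta> (%x. iso t x $ i $ j)) \<phi> = 0"
   unfolding entry unfolding iso_entry using scalar_equation[OF \<phi>] zero_terms(3)[OF \<phi>]
   by (cases "i = j") (simp_all add: d0 distr_of_zero)
  then show "distr_dt (distr_of (%t x. iso t x $ i $ j)) \<phi> + distr_of (%t. transport (%x. 0) (%x. iso t x $ i $ j)) \<phi> + a * distr_of (%t x. iso t x $ i $ j) \<phi>
    + distr_of (%t x. Q_term b (grad (%x. 0) x) (iso t x) $ i $ j) \<phi> + distr_of (%t. frac_laplacian \<beta> (%x. iso t x $ i $ j)) \<phi>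
    = distr_of (%t x. sym_part (grad (%x. 0) x) $ i $ j) \<phi>"
   unfolding tr zero_terms(1,2)[OF \<phi>] by (simp add: distr_of_zero)
 qed
qed simp_all

text \<open>The smallness of \<open>\<epsilon>\<close> makes the weight of the energy positive.\<close>

theorem explicit_unique:
 assumes b: "\<bar>b\<bar> <= 1" and small: "\<epsilon> * area <= 1/4"
  and sol: "strong_solution b \<beta> s a (%x. 0) (iso 0) u \<tau>" and t: "t >= 0"
 shows "SI (cr (%x. \<tau> t x $ i $ j))" "Lr (%x. \<tau> t x $ i $ j) = (if i = j then Lr (\<sigma> t) else 0)"
proof -
 interpret strong_sol \<theta> b \<beta> s a "%x. 0" "iso 0" u \<tau> by unfold_locales (use \<beta> s sol in auto)
 show "SI (cr (%x. \<tau> t x $ i $ j))" by (rule SI_T[OF t])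
 have z: "SI (cr (%x::real^2. 0))" "Lr (%x. 0) = 0" using SI_zero cl_zero by simp_all
 have q_ode: "((%t. Lr (\<sigma> t)) has_vector_derivative - (a *\<^sub>R Lr (\<sigma> t)) - RE (mop (fsym \<beta>) (Lr (\<sigma> t)))) (at t)" for t
 proof -
  have gp: "good (%xi. norm xi powr (2 * \<beta>))" by (rule good_powr) (use \<beta> in simp)
  note g = good_mult[OF gp good_amp[of t]]
  have "((%t. cl (sg (amp t))) has_vector_derivative cl (sg (%xi. - rate xi * amp t xi))) (at t)"
   unfolding amp_def by (rule cl_sg_curve[OF good_rate good_const])
  from bounded_linear.has_vector_derivative[OF bounded_linear_IFT this]
  have "((%t. Lr (\<sigma> t)) has_vector_derivative Lr (field (%xi. - rate xi * amp t xi))) (at t)"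
   unfolding \<sigma>_def Lr_field(2)[OF good_amp] Lr_field(2)[OF good_neg_rate_amp] .
  moreover have "Lr (field (%xi. - rate xi * amp t xi)) = - (a *\<^sub>R Lr (\<sigma> t)) - RE (mop (fsym \<beta>) (Lr (\<sigma> t)))"
  proof -
   have "field (%xi. - rate xi * amp t xi) = field (%xi. (- a) * amp t xi - norm xi powr (2 * \<beta>) * amp t xi)"
    by (simp add: rate_def algebra_simps)
   then show ?thesis
    unfolding \<sigma>_def field_mop[OF good_amp gp fsym_def] RE_field[OF g]
    using field_linear(1)[OF good_mult[OF good_const good_amp] g, of "- a"] field_linear(2)[OF good_amp, of "- a"] by simp
  qed
  ultimately show ?thesis by simp
 qed
 interpret comparison \<theta> b \<beta> s a "%x. 0" "iso 0" u \<tau> "%t. Lr (\<sigma> t)" "%t. Kop (%xi. - rate xi * amp t xi)" "2 * \<epsilon> * area"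
 proof
  have area0: "area >= 0" by (simp add: area_def)
  show "\<bar>b\<bar> <= 1" "0 <= a" using b a by auto
  have "continuous_in_Hs s (%t x. 0) iso" by (rule iso_continuous)
  from continuous_in_Hs_curves(2)[OF this, of 1 1] show "Hs_curve s (%t. Lr (\<sigma> t))" by (simp add: iso_def)
  fix t :: real
  have bcS: "bc (Lr (\<sigma> t)) = Kop (amp t)" for t unfolding \<sigma>_def by (rule bc_field[OF good_amp])
  show "RE (Lr (\<sigma> t)) = Lr (\<sigma> t)" using \<sigma>_Hs(1) by simp
  show "inHs s (Dk k (Lr (\<sigma> t)))" if "t >= 0" for k
   unfolding \<sigma>_def by (rule field_Dk(1)[OF good_amp, of \<epsilon>]) (use amp_bound[OF that] \<epsilon> s \<beta> in auto)
  show "norm (bc (Lr (\<sigma> t))) <= 1/4" if "t >= 0" unfolding bcS using M[OF that] small by simp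
  show "norm (bc (Dk k (Lr (\<sigma> t)))) <= 2 * \<epsilon> * area" if "t >= 0" for k
  proof -
   have "norm (bc (Dk k (Lr (\<sigma> t)))) <= \<epsilon> * area"
    unfolding \<sigma>_def by (rule field_Dk(2)[OF good_amp]) (use amp_bound[OF that] \<epsilon> in auto)
   moreover have "0 <= \<epsilon> * area" using \<epsilon> area0 by simp
   ultimately show ?thesis unfolding mult.assoc by linarith
  qed
  show "norm (Kop (%xi. - rate xi * amp t xi)) <= 2 * \<epsilon> * area" if "t > 0"
   by (rule norm_Kop[OF good_neg_rate_amp]) (use \<epsilon> rate_amp_bound[of t] that in auto)
  show "((%t. bc (Lr (\<sigma> t))) has_vector_derivative Kop (%xi. - rate xi * amp t xi)) (at t)" unfolding bcS by (rule Kop_amp_derivative)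
  show "((%t. Lr (\<sigma> t)) has_vector_derivative - (a *\<^sub>R Lr (\<sigma> t)) - RE (mop (fsym \<beta>) (Lr (\<sigma> t)))) (at t)" by (rule q_ode)
  show "Lr (%x. u 0 x $ j) = 0" for j using initial_values(1)[of j] z by simp
  show "Lr (%x. \<tau> 0 x $ i $ j) = (if i = j then Lr (\<sigma> 0) else 0)" for i j
   using initial_values(2)[of i j] z \<sigma>_Hs(1)[of 0] by (cases "i = j") (simp_all add: iso_def)
 qed
 show "Lr (%x. \<tau> t x $ i $ j) = (if i = j then Lr (\<sigma> t) else 0)" by (rule unique[OF t])
qed

end

section \<open>The lower bound\<close>

lemma area_pos: "area > 0"
 unfolding area_def by (simp add: content_cball)

text \<open>The \<open>L\<^sup>2\<close> norm over a disc of radius \<open>r\<close> grows like \<open>r\<close>; this is the source of the exponent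
  \<open>1/(2\<beta>)\<close>.\<close>

lemma norm_cl_sg_ge:
 assumes g: "good g" and r: "0 <= r" "r <= 1" and m: "m >= 0" "!!xi. norm xi <= r ==> m <= \<bar>g xi\<bar>"
 shows "m * r * sqrt area <= norm (cl (sg g))"
proof -
 note S = conjunct1[OF sg_basic[OF g]]
 have "m\<^sup>2 * measure lborel (cball (0::real^2) r) = (LBINT xi. m\<^sup>2 * indicator (cball (0::real^2) r) xi)" by simp
 also have "\<dots> <= (LBINT xi. (norm (sg g xi))\<^sup>2)"
 proof (rule integral_mono[OF _ SI_integrable[OF S]])
  show "integrable lborel (%xi. m\<^sup>2 * indicator (cball (0::real^2) r) xi)"
   by (intro integrable_mult_right integrable_indicator_bounded) auto
  fix xi :: "real^2"
  show "m\<^sup>2 * indicator (cball 0 r) xi <= (norm (sg g xi))\<^sup>2"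
  proof (cases "xi \<in> cball 0 r")
   case True
   then have "m\<^sup>2 <= \<bar>g xi\<bar>\<^sup>2" using m by (intro power_mono) auto
   then show ?thesis using True r by (simp add: sg_def)
  qed simp
 qed
 also have "\<dots> = (norm (cl (sg g)))\<^sup>2" using norm_cl_sq[OF S] by simp
 also have "measure lborel (cball (0::real^2) r) = r\<^sup>2 * area"
  unfolding area_def using r by (simp add: content_cball)
 finally have "(m * r * sqrt area)\<^sup>2 <= (norm (cl (sg g)))\<^sup>2"
  using area_pos by (simp add: power_mult_distrib)
 then show ?thesis by (rule power2_le_imp_le) simp
qed

text \<open>If the function of time is not measurable, its essential supremum is infinite.\<close>

lemma Linf_L2_norm_ge:
 assumes "0 <= p" "p < q" and c: "!!t. p <= t ==> t <= q ==> c <= L2_norm (f t)"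
 shows "ereal c <= Linf_L2_norm f"
proof (cases "(%t. ereal (L2_norm (f t))) \<in> borel_measurable (restrict_space lborel {0..})")
 case True
 show ?thesis
 proof (rule ccontr)
  assume "\<not> ereal c <= Linf_L2_norm f"
  then have lt: "Linf_L2_norm f < ereal c" by simp
  have "AE t in restrict_space lborel {0..}. ereal (L2_norm (f t)) <= Linf_L2_norm f"
   unfolding Linf_L2_norm_def by (rule esssup_AE)
  then have "AE t in lborel. t \<in> {0..} \<longrightarrow> ereal (L2_norm (f t)) <= Linf_L2_norm f"
   by (subst (asm) AE_restrict_space_iff) auto
  then have "AE t in lborel. t \<notin> {p..q}"
  proof eventually_elim
   case (elim t)
   show ?case
   proof
    assume t: "t \<in> {p..q}"
    have "t \<in> {0..}" using t assms(1) by auto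
    with elim have "ereal (L2_norm (f t)) <= Linf_L2_norm f" by blast
    then have "ereal (L2_norm (f t)) < ereal c" using lt by (rule le_less_trans)
    then show False using c[of t] t by simp
   qed
  qed
  then have "{p..q} \<in> null_sets lborel" by (subst AE_iff_null_sets) auto
  then have "emeasure lborel {p..q} = 0" by (rule null_setsD1)
  then show False using assms(2) by simp
 qed
next
 case False
 then show ?thesis by (simp add: Linf_L2_norm_def esssup_def)
qed

lemma littlewood_paleyD:
 assumes "littlewood_paley \<phi>"
 shows "smooth \<phi>" "0 <= \<phi> xi" "\<phi> xi <= 1" "norm xi > 8/3 ==> \<phi> xi = 0"
  "xi ~= 0 ==> ((%j::int. \<phi> ((2 powr (- real_of_int j)) *\<^sub>R xi)) has_sum 1) UNIV"
proof -
 show "smooth \<phi>" "0 <= \<phi> xi" "\<phi> xi <= 1" "xi ~= 0 ==> ((%j::int. \<phi> ((2 powr (- real_of_int j)) *\<^sub>R xi)) has_sum 1) UNIV"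
  using assms unfolding littlewood_paley_def by blast+
 have "support \<phi> \<subseteq> {xi. 3/4 <= norm xi \<and> norm xi <= 8/3}" using assms unfolding littlewood_paley_def by blast
 then show "norm xi > 8/3 ==> \<phi> xi = 0" by (intro not_support) auto
qed

text \<open>A bounded Fourier transform gives blocks of norm at most a constant times \<open>2\<^sup>j\<close>, because the
  \<open>j\<close>-th annulus has area of order \<open>4\<^sup>j\<close>.\<close>

lemma besov_norm_finite:
 assumes \<phi>: "littlewood_paley \<phi>" and f: "SI (cr f)" and \<epsilon>: "\<epsilon> >= 0" "AE xi in lborel. norm (fourier (cr f) xi) <= \<epsilon>"
 shows "besov_norm \<phi> (-1) f < \<infinity>"
proof -
 let ?F = "fourier (cr f)"
 have F: "SI ?F" by (rule SI_fourier[OF f])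
 note m = smooth_measurable[OF littlewood_paleyD(1)[OF \<phi>]] and b = littlewood_paleyD(2,3)[OF \<phi>] and sup = littlewood_paleyD(4)[OF \<phi>]
 have "2 powr (real_of_int j * -1) * L2_norm (dyadic_block \<phi> j f) <= \<epsilon> * (8/3) * sqrt area" for j
 proof -
  define R where "R = 8/3 * 2 powr real_of_int j"
  define p where "p xi = complex_of_real (\<phi> (2 powr (- real_of_int j) *\<^sub>R xi)) * ?F xi" for xi
  have [measurable]: "(%xi. \<phi> (2 powr (- real_of_int j) *\<^sub>R xi)) \<in> borel_measurable borel"
   using m by measurable
  have p: "SI p" unfolding p_def[abs_def] by (rule SI_bounded_mult[OF F, of _ 1]) (use b in \<open>auto simp: norm_mult\<close>)
  have "(norm (cl p))\<^sup>2 = (LBINT xi. (norm (p xi))\<^sup>2)" by (rule norm_cl_sq[OF p])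
  also have "\<dots> <= (LBINT xi. \<epsilon>\<^sup>2 * indicator (cball (0::real^2) R) xi)"
  proof (rule integral_mono_AE[OF SI_integrable[OF p]])
   show "integrable lborel (%xi. \<epsilon>\<^sup>2 * indicator (cball (0::real^2) R) xi)"
    by (intro integrable_mult_right integrable_indicator_bounded) auto
   show "AE xi in lborel. (norm (p xi))\<^sup>2 <= \<epsilon>\<^sup>2 * indicator (cball 0 R) xi"
    using \<epsilon>(2)
   proof eventually_elim
    case (elim xi)
    show ?case
    proof (cases "xi \<in> cball 0 R")
     case True
     have "norm (p xi) <= 1 * \<epsilon>" unfolding p_def norm_mult using b elim by (intro mult_mono) auto
     then show ?thesis using True \<epsilon>(1) by (simp add: power_mono)
    next
     case False
     then have "norm (2 powr (- real_of_int j) *\<^sub>R xi) > 8/3" by (simp add: R_def powr_minus field_simps)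
     then show ?thesis using sup by (simp add: p_def)
    qed
   qed
  qed
  also have "\<dots> = \<epsilon>\<^sup>2 * (R\<^sup>2 * area)" unfolding area_def by (simp add: content_cball R_def)
  finally have "(norm (cl p))\<^sup>2 <= (\<epsilon> * R * sqrt area)\<^sup>2" using area_pos by (simp add: power_mult_distrib)
  then have n: "norm (cl p) <= \<epsilon> * R * sqrt area"
   by (rule power2_le_imp_le) (use \<epsilon>(1) area_pos in \<open>auto simp: R_def\<close>)
  have "L2_norm (dyadic_block \<phi> j f) = norm (cl p) / (2 * pi)"
   unfolding dyadic_block_def p_def[symmetric] norm_cl[OF cl_inv_fourier(1)[OF p], symmetric] cl_inv_fourier(2)[OF p] by (rule norm_IFT)
  also have "\<dots> <= norm (cl p) / 1" by (rule divide_left_mono) (use pi_gt3 in auto)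
  finally have "L2_norm (dyadic_block \<phi> j f) <= \<epsilon> * R * sqrt area" using n by simp
  then have "2 powr (real_of_int j * -1) * L2_norm (dyadic_block \<phi> j f) <= 2 powr (real_of_int j * -1) * (\<epsilon> * R * sqrt area)"
   by (intro mult_left_mono) auto
  also have "\<dots> = \<epsilon> * (8/3) * sqrt area" by (simp add: R_def powr_minus)
  finally show ?thesis .
 qed
 then have "besov_norm \<phi> (-1) f <= ereal (\<epsilon> * (8/3) * sqrt area)"
  unfolding besov_norm_def by (intro SUP_least) simp
 then show ?thesis by (rule le_less_trans) simp
qed

text \<open>A translate of the Littlewood--Paley function serves as a bump function.\<close>

lemma littlewood_paley_cutoff:
 assumes \<phi>: "littlewood_paley \<phi>" obtains \<theta> where "cutoff \<theta>"
proof -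
 have "\<exists>c. \<phi> c ~= 0"
 proof (rule ccontr)
  assume "\<not> (\<exists>c. \<phi> c ~= 0)"
  then have z: "\<phi> x = 0" for x by simp
  have "((%j::int. \<phi> (2 powr (- real_of_int j) *\<^sub>R axis 1 1)) has_sum 1) UNIV"
   by (rule littlewood_paleyD(5)[OF \<phi>]) (simp add: axis_eq_0_iff)
  then have "((%j::int. 0 :: real) has_sum 1) UNIV" unfolding z .
  moreover have "((%j::int. 0 :: real) has_sum 0) UNIV" by (rule has_sum_0) simp
  ultimately show False using has_sum_unique by fastforce
 qed
 then obtain c where c: "\<phi> c ~= 0" by blast
 define \<theta> where "\<theta> x = 1 / \<phi> c * \<phi> (c + x)" for x
 note sup = littlewood_paleyD(4)[OF \<phi>] and pos = littlewood_paleyD(2)[OF \<phi>]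
 have "cutoff \<theta>"
 proof
  show "smooth \<theta>" unfolding \<theta>_def[abs_def]
   by (intro smooth_cmult smooth_affine[where A="%x. x"] bounded_linear_ident littlewood_paleyD(1)[OF \<phi>])
  have "support \<theta> \<subseteq> cball 0 (norm c + 8/3)"
  proof (rule support_subset_closed)
   fix x :: "real^2" assume "x \<notin> cball 0 (norm c + 8/3)"
   then have "norm (c + x) > 8/3" using norm_triangle_ineq4[of "c + x" c] by simp
   then show "\<theta> x = 0" using sup by (simp add: \<theta>_def)
  qed simp
  then have "bounded (support \<theta>)" using bounded_cball bounded_subset by blast
  then show "compact (support \<theta>)" by (simp add: compact_eq_bounded_closed support_def)
  show "\<theta> 0 = 1" "0 <= \<theta> x" for x using c pos by (auto simp: \<theta>_def)
 qed
 then show thesis by (rule that)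
qed

theorem proposition5p10:
  fixes b \<beta> s :: real and \<phi> :: "real^2 \<Rightarrow> real"
  assumes "b \<in> {-1..1}" and "1/2 < \<beta>" and "\<beta> < 1" and "s > 1 + \<beta>"
    and "littlewood_paley \<phi>"
  shows "\<exists>\<delta>0>0. \<forall>\<delta>. 0 < \<delta> \<and> \<delta> \<le> \<delta>0 \<longrightarrow>
    (\<exists>(u0 :: real^2 \<Rightarrow> real^2) (\<tau>0 :: real^2 \<Rightarrow> real^2^2) (C::real).
       pair_in_Hs s u0 \<tau>0 \<and> pair_in_besov \<phi> (-1) u0 \<tau>0 \<and>
       divergence_free u0 \<and> symmetric_tensor \<tau>0 \<and> pair_Hs_norm s u0 \<tau>0 \<le> \<delta> \<and>
       C > 0 \<and>
       (\<forall>a\<in>{0..1}. \<exists>u \<tau>. strong_solution b \<beta> s a u0 \<tau>0 u \<tau>) \<and>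
       (\<forall>a\<in>{0..1}. \<forall>ua \<tau>a uz \<tau>z.
          strong_solution b \<beta> s a u0 \<tau>0 ua \<tau>a \<longrightarrow>
          strong_solution b \<beta> s 0 u0 \<tau>0 uz \<tau>z \<longrightarrow>
          Linf_L2_norm (\<lambda>t x. trace (\<tau>a t x) - trace (\<tau>z t x))
            \<ge> ereal (C * a powr (1 / (2 * \<beta>)))))"
proof (intro exI[of _ "1::real"] conjI allI impI)
 fix \<delta> :: real assume "0 < \<delta> \<and> \<delta> <= 1"
 then have \<delta>: "\<delta> > 0" by simp
 obtain \<theta> where \<theta>: "cutoff \<theta>" by (rule littlewood_paley_cutoff[OF assms(5)]) blast
 define K where "K = sqrt 2 * 2 powr (s / 2) * sqrt area"
 have K: "K > 0" using area_pos by (simp add: K_def)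
 \<comment> \<open>The first bound is for uniqueness, the second for the size of the data.\<close>
 define \<epsilon> where "\<epsilon> = min (1 / (4 * area)) (\<delta> / K)"
 have \<epsilon>: "\<epsilon> > 0" "\<epsilon> * area <= 1/4" "K * \<epsilon> <= \<delta>"
  using area_pos \<delta> K by (auto simp: \<epsilon>_def min_def field_simps)
 have b: "\<bar>b\<bar> <= 1" using assms(1) by auto
 have ex: "explicit \<theta> \<beta> s a \<epsilon>" if "a \<in> {0..1}" for a
  using \<theta> assms \<epsilon> that by (auto simp: explicit_def explicit_axioms_def)
 interpret Z: explicit \<theta> \<beta> b s 0 \<epsilon> by (rule ex) simp
 let ?C = "2 * (\<epsilon> * exp (-2) * (1 - exp (-1)) * sqrt area / (2 * pi))"
 have amp0: "explicit.amp \<beta> a \<epsilon> 0 = (%_. \<epsilon>)" if "a \<in> {0..1}" for a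
  by (simp add: explicit.amp_def[OF ex[OF that]] fun_eq_iff)
 have iso0: "explicit.iso \<beta> a \<epsilon> 0 = Z.iso 0" if "a \<in> {0..1}" for a
 proof
  have "explicit.amp \<beta> a \<epsilon> 0 = Z.amp 0" using amp0[OF that] amp0[of 0] by simp
  then show "explicit.iso \<beta> a \<epsilon> 0 x = Z.iso 0 x" for x
   by (simp only: explicit.iso_def[OF ex[OF that]] explicit.\<sigma>_def[OF ex[OF that]] Z.iso_def Z.\<sigma>_def)
 qed
 have zero: "SI (cr (%x::real^2. 0))" "Lr (%x. 0) = 0" using SI_zero cl_zero by simp_all
 show "\<exists>u0 \<tau>0 C. pair_in_Hs s u0 \<tau>0 \<and> pair_in_besov \<phi> (-1) u0 \<tau>0 \<and>
    divergence_free u0 \<and> symmetric_tensor \<tau>0 \<and> pair_Hs_norm s u0 \<tau>0 <= \<delta> \<and> C > 0 \<and>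
    (\<forall>a\<in>{0..1}. \<exists>u \<tau>. strong_solution b \<beta> s a u0 \<tau>0 u \<tau>) \<and>
    (\<forall>a\<in>{0..1}. \<forall>ua \<tau>a uz \<tau>z. strong_solution b \<beta> s a u0 \<tau>0 ua \<tau>a \<longrightarrow> strong_solution b \<beta> s 0 u0 \<tau>0 uz \<tau>z \<longrightarrow>
     Linf_L2_norm (%t x. trace (\<tau>a t x) - trace (\<tau>z t x)) >= ereal (C * a powr (1 / (2 * \<beta>))))"
 proof (rule exI[of _ "%x. 0"], rule exI[of _ "Z.iso 0"], rule exI[of _ ?C], intro conjI ballI allI impI)
  show "pair_in_Hs s (%x. 0) (Z.iso 0)" by (rule Z.iso_in_Hs)
  have F0: "AE xi in lborel. norm (fourier (cr (%x. 0)) xi) <= \<epsilon>"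
  proof -
   have "cl (fourier (cr (%x. 0))) = cl (%_. 0)" using FT_cl[OF zero(1)] zero(2) cl_zero by simp
   then have "AE xi in lborel. fourier (cr (%x. 0)) xi = 0" using cl_eq_iff[OF SI_fourier[OF zero(1)] SI_zero] by simp
   then show ?thesis by eventually_elim (use \<epsilon> in simp)
  qed
  have F\<sigma>: "AE xi in lborel. norm (fourier (cr (Z.\<sigma> 0)) xi) <= \<epsilon>"
  proof -
   have "cl (fourier (cr (Z.\<sigma> 0))) = cl (sg (Z.amp 0))"
    using FT_cl[OF Z.\<sigma>_Hs(1)[of 0]] Lr_field(3)[OF Z.good_amp[of 0]] by (simp add: Z.\<sigma>_def)
   then have "AE xi in lborel. fourier (cr (Z.\<sigma> 0)) xi = sg (Z.amp 0) xi"
    using cl_eq_iff[OF SI_fourier[OF Z.\<sigma>_Hs(1)] conjunct1[OF sg_basic[OF Z.good_amp]]] by simp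
   then show ?thesis
    by eventually_elim (use \<epsilon> amp0[of 0] in \<open>auto simp: sg_def indicator_def\<close>)
  qed
  have e0: "(%x. (0::real^2) $ j) = (%x::real^2. 0)" for j by simp
  show "pair_in_besov \<phi> (-1) (%x. 0) (Z.iso 0)"
   unfolding pair_in_besov_def Z.iso_entry e0
   using besov_norm_finite[OF assms(5) zero(1) _ F0] besov_norm_finite[OF assms(5) Z.\<sigma>_Hs(1) _ F\<sigma>] \<epsilon> by auto
  show "divergence_free (%x. 0)" by (simp add: divergence_free_def distr_deriv_def)
  show "symmetric_tensor (Z.iso 0)" by (auto simp: symmetric_tensor_def Z.iso_def transpose_def vec_eq_iff)
  show "pair_Hs_norm s (%x. 0) (Z.iso 0) <= \<delta>"
  proof -
   have "norm (cl (sg (%xi. (1 + (norm xi)\<^sup>2) powr (s / 2) * Z.amp 0 xi))) <= (2 powr (s / 2) * \<epsilon>) * sqrt area"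
   proof (rule norm_cl_sg(2)[OF good_mult[OF good_wt Z.good_amp]])
    fix xi :: "real^2" assume "xi \<in> disc"
    then have "(1 + (norm xi)\<^sup>2) powr (s / 2) <= 2 powr (s / 2)"
     using assms by (intro powr_mono2) (auto simp: power_le_one)
    then show "\<bar>(1 + (norm xi)\<^sup>2) powr (s / 2) * Z.amp 0 xi\<bar> <= 2 powr (s / 2) * \<epsilon>"
     using amp0[of 0] \<epsilon> by (simp add: abs_mult mult_right_mono)
   qed (use \<epsilon> in simp)
   then have "Hsn s (Lr (Z.\<sigma> 0)) <= 2 powr (s / 2) * \<epsilon> * sqrt area"
    unfolding Hsn_def Z.\<sigma>_def field_Hs(2)[OF Z.good_amp] .
   moreover have "\<bar>Hs_norm s (Z.\<sigma> 0)\<bar> <= Hsn s (Lr (Z.\<sigma> 0)) / 1"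
    unfolding Hs_norm_eq[OF Z.\<sigma>_Hs(3)] using pi_gt3 by (simp add: Hsn_def divide_le_eq mult_le_cancel_left1)
   ultimately have "sqrt 2 * \<bar>Hs_norm s (Z.\<sigma> 0)\<bar> <= sqrt 2 * (2 powr (s / 2) * \<epsilon> * sqrt area)" by (intro mult_left_mono) auto
   also have "\<dots> <= \<delta>" using \<epsilon>(3) by (simp add: K_def mult_ac)
   finally show ?thesis using Z.pair_norm_diagonal[of "Z.\<sigma> 0"] by (simp add: Z.iso_def[abs_def])
  qed
  show "?C > 0" using \<epsilon> area_pos by simp
  show "\<exists>u \<tau>. strong_solution b \<beta> s a (%x. 0) (Z.iso 0) u \<tau>" if "a \<in> {0..1}" for a
   using explicit.explicit_solution[OF ex[OF that], of b] unfolding iso0[OF that] by (intro exI)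
  fix a :: real and ua \<tau>a uz \<tau>z
  assume a: "a \<in> {0..1}" and sa: "strong_solution b \<beta> s a (%x. 0) (Z.iso 0) ua \<tau>a" and sz: "strong_solution b \<beta> s 0 (%x. 0) (Z.iso 0) uz \<tau>z"
  let ?f = "%t x. trace (\<tau>a t x) - trace (\<tau>z t x)"
  interpret A: explicit \<theta> \<beta> b s a \<epsilon> by (rule ex[OF a])
  show "ereal (?C * a powr (1 / (2 * \<beta>))) <= Linf_L2_norm ?f"
  proof (cases "a = 0")
   case True
   have "ereal 0 <= Linf_L2_norm ?f" by (rule Linf_L2_norm_ge[of 0 1]) (auto simp: L2_norm_def)
   then show ?thesis using True by simp
  next
   case False
   then have a0: "a > 0" "a <= 1" using a by auto
   define r where "r = a powr (1 / (2 * \<beta>))"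
   have r: "0 <= r" "r <= 1" "r powr (2 * \<beta>) = a"
    using a0 assms powr_mono2[of "1 / (2 * \<beta>)" a 1] by (auto simp: r_def powr_powr)
   show ?thesis
   \<comment> \<open>Here the damping factor has left \<open>1\<close> while the diffusion at frequencies up to \<open>r\<close> is still of order one.\<close>
   proof (rule Linf_L2_norm_ge[of "1 / a" "2 / a"])
    fix t assume t: "1 / a <= t" "t <= 2 / a"
    then have t0: "t >= 0" using a0 by (meson divide_nonneg_pos order_trans zero_le_one)
    have at: "1 <= a * t" "a * t <= 2" using t a0 by (simp_all add: field_simps)
    note ua = A.explicit_unique[OF b \<epsilon>(2) _ t0, unfolded iso0[OF a], OF sa]
    note uz = Z.explicit_unique[OF b \<epsilon>(2) sz t0]
    let ?g = "%xi. A.amp t xi - Z.amp t xi"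
    have L: "SI (cr (?f t)) \<and> Lr (?f t) = (Lr (A.\<sigma> t) + Lr (A.\<sigma> t)) - (Lr (Z.\<sigma> t) + Lr (Z.\<sigma> t))"
    proof -
     have "SI (cr (%x. (\<tau>a t x $ 1 $ 1 + \<tau>a t x $ 2 $ 2) - (\<tau>z t x $ 1 $ 1 + \<tau>z t x $ 2 $ 2))) \<and>
      Lr (%x. (\<tau>a t x $ 1 $ 1 + \<tau>a t x $ 2 $ 2) - (\<tau>z t x $ 1 $ 1 + \<tau>z t x $ 2 $ 2))
       = (Lr (%x. \<tau>a t x $ 1 $ 1) + Lr (%x. \<tau>a t x $ 2 $ 2)) - (Lr (%x. \<tau>z t x $ 1 $ 1) + Lr (%x. \<tau>z t x $ 2 $ 2))"
      using ua(1) uz(1) by (simp only: Lr_add Lr_diff conj_absorb simp_thms)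
     then show ?thesis using ua(2)[of 1 1] ua(2)[of 2 2] uz(2)[of 1 1] uz(2)[of 2 2] by (simp add: trace_def UNIV_two)
    qed
    have "Lr (?f t) = 2 *\<^sub>R Lr (field ?g)"
     using L field_linear(1)[OF A.good_amp Z.good_amp, of t t] by (simp add: A.\<sigma>_def Z.\<sigma>_def scaleR_2)
    then have n: "L2_norm (?f t) = 2 * (norm (cl (sg ?g)) / (2 * pi))"
     using L2_norm_real[OF conjunct1[OF L]] norm_FT[of "Lr (field ?g)"] Lr_field(3)[OF good_diff[OF A.good_amp Z.good_amp], of t t] by simp
    have "(\<epsilon> * exp (-2) * (1 - exp (-1))) * r * sqrt area <= norm (cl (sg ?g))"
    proof (rule norm_cl_sg_ge[OF good_diff[OF A.good_amp Z.good_amp] r(1,2)])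
     show "0 <= \<epsilon> * exp (-2) * (1 - exp (-1))" using \<epsilon> by simp
     fix xi :: "real^2" assume xi: "norm xi <= r"
     have "norm xi powr (2 * \<beta>) <= a" using powr_mono2[OF _ _ xi, of "2 * \<beta>"] assms r(3) by simp
     then have "norm xi powr (2 * \<beta>) * t <= 2" using mult_right_mono[OF _ t0] at(2) by (metis order_trans)
     then have "exp (-2) <= exp (- (norm xi powr (2 * \<beta>) * t))" by simp
     moreover have "1 - exp (-1) <= 1 - exp (- (a * t))" using at(1) by simp
     ultimately have 1: "exp (-2) * (1 - exp (-1)) <= exp (- (norm xi powr (2 * \<beta>) * t)) * (1 - exp (- (a * t)))" (is "?c <= ?W")
      by (intro mult_mono) auto
     have 2: "?g xi = - (\<epsilon> * ?W)"
      by (simp add: A.amp_def Z.amp_def A.rate_def Z.rate_def algebra_simps flip: exp_add)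
     have "0 <= ?c" by simp
     then have "0 <= \<epsilon> * ?W" using 1 \<epsilon>(1) by (meson mult_nonneg_nonneg less_imp_le order_trans)
     then have "\<bar>?g xi\<bar> = \<epsilon> * ?W" unfolding 2 abs_minus_cancel by (rule abs_of_nonneg)
     then show "\<epsilon> * exp (-2) * (1 - exp (-1)) <= \<bar>?g xi\<bar>"
      using mult_left_mono[OF 1, of \<epsilon>] \<epsilon>(1) by (simp only: mult.assoc less_imp_le)
    qed
    then show "?C * a powr (1 / (2 * \<beta>)) <= L2_norm (?f t)"
     unfolding n r_def[symmetric] using pi_gt_zero
     by (simp add: divide_right_mono mult.assoc mult.left_commute[of r] mult.commute[of r])
   qed (use a0 in \<open>auto simp: divide_strict_right_mono\<close>)
  qed
 qed
qed simp

end
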